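(* For $f\in L^2(\Omega)$ let $u\in H^1_0(\Omega)$ be the weak solution of $-\operatorname{div}(a\nabla u)=f$ in $\Omega$, $u=0$ on $\partial\Omega$. For $h>0$ let $N(h)$ be the integer part of $|\Omega|/h^d$ and $\Theta_h:=\operatorname{span}\{\theta_1,\dots,\theta_{N(h)}\}$, where $\theta_k\in H_0^1(\Omega)$ is the weak solution of $-\operatorname{div}(a\nabla\theta_k)=\lambda_k\Psi_k$ in $\Omega$, $\theta_k=0$ on $\partial\Omega$. Then: (1) $$\lim_{h\to0}\ \sup_{f\in L^2(\Omega)}\ \inf_{v\in\Theta_h}\frac{\|u-v\|_{a\text{-flux}}}{h\,\|f\|_{L^2(\Omega)}}=\frac{1}{2\sqrt{\pi}}\Big(\frac{1}{\Gamma(1+\frac d2)}\Big)^{\frac1d}.$$ Furthermore, $\Theta_h$ leads (asymptotically as $h\to0$) to the smallest possible constant on the right-hand side among all subspaces of $H^1_0(\Omega)$ of dimension $N(h)$; that is, for any family $(V_h)_{h>0}$ of subspaces of $H^1_0(\Omega)$ with $\dim V_h=N(h)$, $$\liminf_{h\to0}\ \sup_{f\in L^2(\Omega)}\ \inf_{v\in V_h}\frac{\|u-v\|_{a\text{-flux}}}{h\,\|f\|_{L^2(\Omega)}}\ \ge\ \frac{1}{2\sqrt{\pi}}\Big(\frac{1}{\Gamma(1+\frac d2)}\Big)^{\frac1d}.$$ (2) $$\inf_{V,\ \dim V=N}\ \sup_{f\in L^2(\Omega)}\ \inf_{v\in V}\frac{\|u-v\|_{a\text{-flux}}}{\|f\|_{L^2(\Omega)}}=\frac{1}{2\sqrt\pi}\Big(\frac{|\Omega|}{\Gamma(1+\frac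 d2)\,N}\Big)^{\frac1d}\big(1+\epsilon(N)\big),$$ where the infimum is over all $N$-dimensional subspaces $V$ of $H^1_0(\Omega)$ and $\epsilon(N)\to0$ as $N\to\infty$. (Suprema are over $f\ne0$.)
   Context: $\Omega\subset\mathbb{R}^d$ ($d\ge 2$) is a bounded domain with $C^2$ boundary. The matrix $a=(a_{ij})$ has $a_{ij}\in L^\infty(\Omega)$, is symmetric, and is uniformly elliptic: $\lambda_{\min}(a)|\xi|^2\le\xi^Ta(x)\xi\le\lambda_{\max}(a)|\xi|^2$ for all $\xi\in\mathbb{R}^d$ and (almost) all $x\in\Omega$, with constants $0<\lambda_{\min}(a)\le\lambda_{\max}(a)<\infty$. For $k\in(L^2(\Omega))^d$, $k_{pot}$ is the $L^2$-orthogonal projection of $k$ onto the closure of $\{\nabla g: g\in C_0^\infty(\Omega)\}$ in $(L^2(\Omega))^d$, and $\|\psi\|_{a\text{-flux}}:=\|(a\nabla\psi)_{pot}\|_{(L^2(\Omega))^d}$ for $\psi\in H^1_0(\Omega)$. $(\Psi_k)_{k\ge1}$ are the ($L^2$-orthonormal) eigenfunctions of the Dirichlet Laplacian, $-\Delta\Psi_k=\lambda_k\Psi_k$ in $\Omega$, $\Psi_k=0$ on $\partial\Omega$, with eigenvalues ordered $\lambda_k\le\lambda_{k+1}$ (repeated with multiplicity). $|\Omega|$ is the volume of $\Omega$ and $\Gamma$ is Euler's Gamma function. *)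

theory Defs
  imports "HOL-Analysis.Analysis"
begin

section \<open>Smooth functions and domains\<close>

definition grad :: "(real^'n \<Rightarrow> real) \<Rightarrow> real^'n \<Rightarrow> real^'n" where
  "grad f x = (\<chi> i. frechet_derivative f (at x) (axis i 1))"

primrec Ck :: "nat \<Rightarrow> (real^'n \<Rightarrow> real) \<Rightarrow> bool" where
  "Ck 0 f \<longleftrightarrow> continuous_on UNIV f"
| "Ck (Suc m) f \<longleftrightarrow> f differentiable_on UNIV \<and> (\<forall>i. Ck m (\<lambda>x. grad f x $ i))"

definition test_functions :: "(real^'n) set \<Rightarrow> (real^'n \<Rightarrow> real) set" where
  "test_functions \<Omega> =
    {\<phi>. (\<forall>m. Ck m \<phi>) \<and> compact (closure {x. \<phi> x \<noteq> 0}) \<and> closure {x. \<phi> x \<noteq> 0} \<subseteq> \<Omega>}"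

text \<open>Near each boundary point the set lies strictly on one side of the graph of a \<open>C\<^sup>2\<close>
  function over the hyperplane orthogonal to a unit vector \<open>e\<close>. A function on that hyperplane is
  represented by a function \<open>\<gamma>\<close> on the whole space, evaluated only at points orthogonal to \<open>e\<close>.\<close>

definition C2_boundary :: "(real^'n) set \<Rightarrow> bool" where
  "C2_boundary \<Omega> \<longleftrightarrow>
    (\<forall>p\<in>frontier \<Omega>. \<exists>r>0. \<exists>e \<gamma>. norm e = 1 \<and> Ck 2 \<gamma> \<and>
      \<Omega> \<inter> ball p r = {x \<in> ball p r. x \<bullet> e > \<gamma> (x - (x \<bullet> e) *\<^sub>R e)})"

definition bounded_C2_domain :: "(real^'n) set \<Rightarrow> bool" where
  "bounded_C2_domain \<Omega> \<longleftrightarrow>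
    open \<Omega> \<and> connected \<Omega> \<and> \<Omega> \<noteq> {} \<and> bounded \<Omega> \<and> C2_boundary \<Omega>"

section \<open>Square-integrable functions\<close>

text \<open>Elements of \<open>L\<^sup>2(\<Omega>)\<close> are represented by functions on the whole space, two of which stand
  for the same element iff they agree almost everywhere on \<open>\<Omega>\<close>; values outside \<open>\<Omega>\<close> are
  irrelevant. All function spaces below are closed under this equivalence.\<close>

definition L2 :: "(real^'n) set \<Rightarrow> (real^'n \<Rightarrow> 'b::euclidean_space) set" where
  "L2 \<Omega> = {f \<in> borel_measurable (lebesgue_on \<Omega>). integrable (lebesgue_on \<Omega>) (\<lambda>x. (norm (f x))\<^sup>2)}"

definition L2norm :: "(real^'n) set \<Rightarrow> (real^'n \<Rightarrow> 'b::euclidean_space) \<Rightarrow> real" where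
  "L2norm \<Omega> f = sqrt (LINT x|lebesgue_on \<Omega>. (norm (f x))\<^sup>2)"

definition L2inner ::
    "(real^'n) set \<Rightarrow> (real^'n \<Rightarrow> 'b::euclidean_space) \<Rightarrow> (real^'n \<Rightarrow> 'b) \<Rightarrow> real" where
  "L2inner \<Omega> f g = (LINT x|lebesgue_on \<Omega>. f x \<bullet> g x)"

definition ae_zero :: "(real^'n) set \<Rightarrow> (real^'n \<Rightarrow> real) \<Rightarrow> bool" where
  "ae_zero \<Omega> f \<longleftrightarrow> (AE x in lebesgue_on \<Omega>. f x = 0)"

text \<open>Span, in \<open>L\<^sup>2(\<Omega>)\<close>, of (the classes of) \<open>v 1, \<dots>, v N\<close>, and dimension modulo almost
  everywhere equality.\<close>

definition L2_span :: "(real^'n) set \<Rightarrow> (nat \<Rightarrow> real^'n \<Rightarrow> real) \<Rightarrow> nat \<Rightarrow> (real^'n \<Rightarrow> real) set" where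
  "L2_span \<Omega> v N = {w \<in> L2 \<Omega>. \<exists>c. ae_zero \<Omega> (\<lambda>x. w x - (\<Sum>k=1..N. c k * v k x))}"

definition has_dim :: "(real^'n) set \<Rightarrow> (real^'n \<Rightarrow> real) set \<Rightarrow> nat \<Rightarrow> bool" where
  "has_dim \<Omega> V N \<longleftrightarrow>
    (\<exists>v. (\<forall>k\<in>{1..N}. v k \<in> L2 \<Omega>) \<and>
         (\<forall>c. ae_zero \<Omega> (\<lambda>x. \<Sum>k=1..N. c k * v k x) \<longrightarrow> (\<forall>k\<in>{1..N}. c k = 0)) \<and>
         V = L2_span \<Omega> v N)"

section \<open>Sobolev spaces\<close>

definition is_weak_grad ::
    "(real^'n) set \<Rightarrow> (real^'n \<Rightarrow> real) \<Rightarrow> (real^'n \<Rightarrow> real^'n) \<Rightarrow> bool" where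
  "is_weak_grad \<Omega> u G \<longleftrightarrow> G \<in> L2 \<Omega> \<and>
    (\<forall>\<phi>\<in>test_functions \<Omega>.
      (LINT x|lebesgue_on \<Omega>. u x *\<^sub>R grad \<phi> x) = - (LINT x|lebesgue_on \<Omega>. \<phi> x *\<^sub>R G x))"

text \<open>The chosen weak gradient is unique up to almost everywhere equality on \<open>\<Omega>\<close>.\<close>

definition weak_grad :: "(real^'n) set \<Rightarrow> (real^'n \<Rightarrow> real) \<Rightarrow> real^'n \<Rightarrow> real^'n" where
  "weak_grad \<Omega> u = (SOME G. is_weak_grad \<Omega> u G)"

definition H1 :: "(real^'n) set \<Rightarrow> (real^'n \<Rightarrow> real) set" where
  "H1 \<Omega> = {u \<in> L2 \<Omega>. \<exists>G. is_weak_grad \<Omega> u G}"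

definition H1norm :: "(real^'n) set \<Rightarrow> (real^'n \<Rightarrow> real) \<Rightarrow> real" where
  "H1norm \<Omega> u = sqrt ((L2norm \<Omega> u)\<^sup>2 + (L2norm \<Omega> (weak_grad \<Omega> u))\<^sup>2)"

definition H10 :: "(real^'n) set \<Rightarrow> (real^'n \<Rightarrow> real) set" where
  "H10 \<Omega> = {u \<in> H1 \<Omega>. \<forall>\<epsilon>>0. \<exists>\<phi>\<in>test_functions \<Omega>. H1norm \<Omega> (\<lambda>x. u x - \<phi> x) < \<epsilon>}"

definition H10_subspaces :: "(real^'n) set \<Rightarrow> nat \<Rightarrow> (real^'n \<Rightarrow> real) set set" where
  "H10_subspaces \<Omega> N = {V. V \<subseteq> H10 \<Omega> \<and> has_dim \<Omega> V N}"

section \<open>Elliptic equations\<close>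

definition elliptic_matrix ::
    "(real^'n) set \<Rightarrow> (real^'n \<Rightarrow> real^'n^'n) \<Rightarrow> real \<Rightarrow> real \<Rightarrow> bool" where
  "elliptic_matrix \<Omega> a lmin lmax \<longleftrightarrow>
    (\<forall>i j. (\<lambda>x. a x $ i $ j) \<in> borel_measurable (lebesgue_on \<Omega>) \<and>
           (\<exists>M. AE x in lebesgue_on \<Omega>. \<bar>a x $ i $ j\<bar> \<le> M)) \<and>
    (AE x in lebesgue_on \<Omega>. transpose (a x) = a x) \<and>
    0 < lmin \<and> lmin \<le> lmax \<and>
    (AE x in lebesgue_on \<Omega>. \<forall>\<xi>. lmin * (norm \<xi>)\<^sup>2 \<le> \<xi> \<bullet> (a x *v \<xi>) \<and>
                                 \<xi> \<bullet> (a x *v \<xi>) \<le> lmax * (norm \<xi>)\<^sup>2)"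

definition is_weak_sol ::
    "(real^'n) set \<Rightarrow> (real^'n \<Rightarrow> real^'n^'n) \<Rightarrow> (real^'n \<Rightarrow> real) \<Rightarrow> (real^'n \<Rightarrow> real) \<Rightarrow> bool" where
  "is_weak_sol \<Omega> a f u \<longleftrightarrow> u \<in> H10 \<Omega> \<and>
    (\<forall>\<phi>\<in>H10 \<Omega>. L2inner \<Omega> (\<lambda>x. a x *v weak_grad \<Omega> u x) (weak_grad \<Omega> \<phi>) = L2inner \<Omega> f \<phi>)"

definition weak_sol ::
    "(real^'n) set \<Rightarrow> (real^'n \<Rightarrow> real^'n^'n) \<Rightarrow> (real^'n \<Rightarrow> real) \<Rightarrow> real^'n \<Rightarrow> real" where
  "weak_sol \<Omega> a f = (SOME u. is_weak_sol \<Omega> a f u)"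

definition dirichlet_eigenspace :: "(real^'n) set \<Rightarrow> real \<Rightarrow> (real^'n \<Rightarrow> real) set" where
  "dirichlet_eigenspace \<Omega> \<mu> = {w. is_weak_sol \<Omega> (\<lambda>x. mat 1) (\<lambda>x. \<mu> * w x) w}"

text \<open>Sequences are indexed from 1. The last condition says that every real number occurs among
  the \<open>lam k\<close> exactly as often as its multiplicity as a Dirichlet eigenvalue (zero times if it is
  not an eigenvalue), so no eigenvalue or eigenfunction is omitted.\<close>

definition dirichlet_eigensystem ::
    "(real^'n) set \<Rightarrow> (nat \<Rightarrow> real) \<Rightarrow> (nat \<Rightarrow> real^'n \<Rightarrow> real) \<Rightarrow> bool" where
  "dirichlet_eigensystem \<Omega> lam \<Psi> \<longleftrightarrow>
    (\<forall>k\<ge>1. \<Psi> k \<in> dirichlet_eigenspace \<Omega> (lam k)) \<and>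
    (\<forall>j\<ge>1. \<forall>k\<ge>1. L2inner \<Omega> (\<Psi> j) (\<Psi> k) = (if j = k then 1 else 0)) \<and>
    (\<forall>k\<ge>1. lam k \<le> lam (Suc k)) \<and>
    (\<forall>\<mu>. finite {k. k \<ge> 1 \<and> lam k = \<mu>} \<and>
          has_dim \<Omega> (dirichlet_eigenspace \<Omega> \<mu>) (card {k. k \<ge> 1 \<and> lam k = \<mu>}))"

section \<open>The flux norm\<close>

definition gradient_closure :: "(real^'n) set \<Rightarrow> (real^'n \<Rightarrow> real^'n) set" where
  "gradient_closure \<Omega> =
    {p \<in> L2 \<Omega>. \<forall>\<epsilon>>0. \<exists>g\<in>test_functions \<Omega>. L2norm \<Omega> (\<lambda>x. p x - grad g x) < \<epsilon>}"

definition pot :: "(real^'n) set \<Rightarrow> (real^'n \<Rightarrow> real^'n) \<Rightarrow> real^'n \<Rightarrow> real^'n" where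
  "pot \<Omega> k = (SOME p. p \<in> gradient_closure \<Omega> \<and>
    (\<forall>q\<in>gradient_closure \<Omega>. L2inner \<Omega> (\<lambda>x. k x - p x) q = 0))"

definition flux_norm ::
    "(real^'n) set \<Rightarrow> (real^'n \<Rightarrow> real^'n^'n) \<Rightarrow> (real^'n \<Rightarrow> real) \<Rightarrow> real" where
  "flux_norm \<Omega> a \<psi> = L2norm \<Omega> (pot \<Omega> (\<lambda>x. a x *v weak_grad \<Omega> \<psi> x))"

end

theory Submission
  imports Defs
begin

text \<open>
  The projection in the flux norm reduces everything to the Laplacian: if \<open>-div(a\<nabla>\<psi>) = g\<close>, then
  \<open>(a\<nabla>\<psi>)\<^sub>p\<^sub>o\<^sub>t\<close> is the gradient of the Dirichlet solution of \<open>-\<Delta>w = g\<close>. Hence the width of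
  dimension \<open>N\<close> equals \<open>1 / sqrt \<lambda>\<^bsub>N+1\<^esub>\<close> for every \<open>a\<close>, is attained by the span of
  \<open>\<theta>\<^sub>1, \<dots>, \<theta>\<^sub>N\<close>, and the asymptotics are Weyl's law.

  Weyl's law holds for every bounded open set. Place \<open>\<Omega>\<close> in a cube and expand in Fourier series.
  Parseval gives \<open>\<Lambda>\<parallel>u\<parallel>\<^sup>2 - \<parallel>\<nabla>u\<parallel>\<^sup>2 \<le> \<Sum>(\<Lambda> - |\<xi>|\<^sup>2) |u\<^sub>\<xi>|\<^sup>2\<close> over the finitely many frequencies
  with \<open>|\<xi>|\<^sup>2 < \<Lambda>\<close>. This single inequality yields the Poincare inequality, the compactness needed for
  the min-max principle and, applied to the eigenfunctions, the sharp upper bound (Berezin) for the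
  Riesz means \<open>\<Sum>(\<Lambda> - \<lambda>\<^sub>k)\<^sub>+\<close>. Plane waves multiplied by a smooth cutoff of \<open>\<Omega>\<close> as trial functions
  give the matching lower bound. Both bounds involve only the number of lattice points in a ball, and
  difference quotients of the Riesz means recover the counting function.
\<close>

section \<open>Semi-inner products\<close>

text \<open>The eigenpairs are given, not constructed, and nothing states that they are complete.
  Completeness enters only as the Rayleigh bound on the complement of the first N eigenfunctions,
  which is extracted from the multiplicity condition. The matrix drops out because the flux norm of
  \<psi> is the dual norm of \<phi> \<mapsto> \<open>E \<psi> \<phi>\<close> with respect to the
  Dirichlet norm. For u - v with v in the span of the \<open>\<theta> k\<close> this functional is
  the L2 pairing with f minus a combination of the \<open>\<Psi> k\<close>, in which
  \<open>a\<close> no longer occurs. For an arbitrary subspace, orthogonality has to be taken in the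
  energy form of \<open>a\<close> while the norm stays that of the Laplacian; a count of N
  conditions on N+1 coefficients bridges the two. The constant is the d-th root of the Weyl
  constant: the volume of the unit ball is pi powr (d/2) / Gamma (1 + d/2), and its quotient by (2
  pi)^d has the root 1 / (2 sqrt pi) times the Gamma factor. Since N(h) h^d tends to the volume of
  \<Omega>, the volume cancels in the statement in terms of h.\<close>

lemma homogeneous_system_nontrivial:
  fixes A :: "'j \<Rightarrow> 'i \<Rightarrow> real"
  assumes "finite J" "finite I" "card J < card I"
  shows "\<exists>c. (\<exists>i\<in>I. c i \<noteq> 0) \<and> (\<forall>j\<in>J. (\<Sum>i\<in>I. A j i * c i) = 0)"
  using assms
proof (induction J arbitrary: I A rule: finite_induct)
  case empty
  then obtain i where "i \<in> I" by fastforce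
  then show ?case by (intro exI[of _ "\<lambda>_. 1"]) auto
next
  case (insert j J)
  show ?case
  proof (cases "\<forall>i\<in>I. A j i = 0")
    case True
    have "card J < card I" using insert by simp
    from insert.IH[OF insert.prems(1) this, of A] True show ?thesis by auto
  next
    case False
    then obtain p where p: "p \<in> I" "A j p \<noteq> 0" by blast
    \<comment> \<open>One step of Gaussian elimination: equation \<open>j\<close> with pivot
      \<open>p\<close> removes the unknown \<open>p\<close> from the other equations, and
      \<open>c'\<close> restores its value.\<close>
    define A' where "A' k i = A k i - A k p * A j i / A j p" for k i
    have "card J < card (I - {p})" using insert p by simp
    from insert.IH[OF _ this, of A'] insert.prems obtain c where
      c: "\<exists>i\<in>I - {p}. c i \<noteq> 0" "\<forall>k\<in>J. (\<Sum>i\<in>I - {p}. A' k i * c i) = 0" by blast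
    define s where "s = (\<Sum>i\<in>I - {p}. A j i * c i)"
    define c' where "c' i = (if i = p then - s / A j p else c i)" for i
    have sum: "(\<Sum>i\<in>I. A k i * c' i) = A k p * (- s / A j p) + (\<Sum>i\<in>I - {p}. A k i * c i)" for k
    proof -
      have "(\<Sum>i\<in>I. A k i * c' i) = A k p * c' p + (\<Sum>i\<in>I - {p}. A k i * c' i)"
        using p insert.prems by (simp add: sum.remove)
      also have "(\<Sum>i\<in>I - {p}. A k i * c' i) = (\<Sum>i\<in>I - {p}. A k i * c i)"
        by (rule sum.cong) (auto simp: c'_def)
      finally show ?thesis by (simp add: c'_def)
    qed
    have "(\<Sum>i\<in>I. A j i * c' i) = 0" unfolding sum using p by (simp add: s_def)
    moreover have "(\<Sum>i\<in>I. A k i * c' i) = 0" if "k \<in> J" for k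
    proof -
      have "0 = (\<Sum>i\<in>I - {p}. A' k i * c i)" using c that by simp
      also have "\<dots> = (\<Sum>i\<in>I - {p}. A k i * c i) - A k p / A j p * s"
        by (simp add: A'_def s_def algebra_simps sum_subtractf sum_distrib_left)
      finally show ?thesis unfolding sum by (simp add: mult.commute)
    qed
    moreover have "\<exists>i\<in>I. c' i \<noteq> 0" using c by (auto simp: c'_def)
    ultimately show ?thesis by blast
  qed
qed

text \<open>Functions stand for classes modulo null sets, so none of the forms is definite. The
  Hilbert space arguments therefore run on a carrier of functions with a form that may have a
  kernel. The instances are \<open>L2\<close>, \<open>H10\<close> with the Dirichlet form and with
  the energy form, and \<open>gradient_closure\<close>.\<close>

locale semi_inner =
  fixes S :: "('a \<Rightarrow> 'b::real_vector) set" and B :: "('a \<Rightarrow> 'b) \<Rightarrow> ('a \<Rightarrow> 'b) \<Rightarrow> real"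
  assumes zero_mem: "(\<lambda>x. 0) \<in> S"
    and add_mem: "f \<in> S \<Longrightarrow> g \<in> S \<Longrightarrow> (\<lambda>x. f x + g x) \<in> S"
    and scale_mem: "f \<in> S \<Longrightarrow> (\<lambda>x. c *\<^sub>R f x) \<in> S"
    and B_commute: "f \<in> S \<Longrightarrow> g \<in> S \<Longrightarrow> B f g = B g f"
    and B_add_left: "f \<in> S \<Longrightarrow> g \<in> S \<Longrightarrow> h \<in> S \<Longrightarrow> B (\<lambda>x. f x + g x) h = B f h + B g h"
    and B_scale_left: "f \<in> S \<Longrightarrow> h \<in> S \<Longrightarrow> B (\<lambda>x. c *\<^sub>R f x) h = c * B f h"
    and B_nonneg: "f \<in> S \<Longrightarrow> 0 \<le> B f f"
begin

lemma B_add_right: "f \<in> S \<Longrightarrow> g \<in> S \<Longrightarrow> h \<in> S \<Longrightarrow> B h (\<lambda>x. f x + g x) = B h f + B h g"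
  by (simp add: B_commute[of h] B_add_left add_mem)

lemma B_scale_right: "f \<in> S \<Longrightarrow> h \<in> S \<Longrightarrow> B h (\<lambda>x. c *\<^sub>R f x) = c * B h f"
  by (simp add: B_commute[of h] B_scale_left scale_mem)

lemma diff_mem: "f \<in> S \<Longrightarrow> g \<in> S \<Longrightarrow> (\<lambda>x. f x - g x) \<in> S"
  using add_mem[of f "\<lambda>x. (-1) *\<^sub>R g x"] scale_mem[of g "-1"] by simp

lemma B_diff_left: "f \<in> S \<Longrightarrow> g \<in> S \<Longrightarrow> h \<in> S \<Longrightarrow> B (\<lambda>x. f x - g x) h = B f h - B g h"
  using B_add_left[of f "\<lambda>x. (-1) *\<^sub>R g x" h] scale_mem[of g "-1"] B_scale_left[of g h "-1"] by simp

lemma B_diff_right: "f \<in> S \<Longrightarrow> g \<in> S \<Longrightarrow> h \<in> S \<Longrightarrow> B h (\<lambda>x. f x - g x) = B h f - B h g"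
  by (simp add: B_commute[of h] B_diff_left diff_mem)

lemma B_zero_left: "h \<in> S \<Longrightarrow> B (\<lambda>x. 0) h = 0"
  using B_scale_left[of "\<lambda>x. 0" h 0] zero_mem by simp

lemma lincomb_mem: "(\<And>i. i \<in> I \<Longrightarrow> f i \<in> S) \<Longrightarrow> (\<lambda>x. \<Sum>i\<in>I. c i *\<^sub>R f i x) \<in> S"
proof (induction I rule: infinite_finite_induct)
  case (insert i I)
  then show ?case using add_mem[OF scale_mem[of "f i" "c i"], of "\<lambda>x. \<Sum>i\<in>I. c i *\<^sub>R f i x"] by simp
qed (auto simp: zero_mem)

lemma B_lincomb_left:
  "(\<And>i. i \<in> I \<Longrightarrow> f i \<in> S) \<Longrightarrow> h \<in> S \<Longrightarrow> B (\<lambda>x. \<Sum>i\<in>I. c i *\<^sub>R f i x) h = (\<Sum>i\<in>I. c i * B (f i) h)"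
proof (induction I rule: infinite_finite_induct)
  case (insert i I)
  then show ?case
    using B_add_left[OF scale_mem[of "f i" "c i"] lincomb_mem[of I f c], of h] by (simp add: B_scale_left)
qed (auto simp: B_zero_left)

lemma B_lincomb_right:
  "(\<And>i. i \<in> I \<Longrightarrow> f i \<in> S) \<Longrightarrow> h \<in> S \<Longrightarrow> B h (\<lambda>x. \<Sum>i\<in>I. c i *\<^sub>R f i x) = (\<Sum>i\<in>I. c i * B h (f i))"
  by (simp add: B_commute[of h] lincomb_mem B_lincomb_left)

lemma B_add_scale:
  assumes "f \<in> S" "g \<in> S"
  shows "B (\<lambda>x. f x + t *\<^sub>R g x) (\<lambda>x. f x + t *\<^sub>R g x) = B f f + 2 * t * B f g + t\<^sup>2 * B g g"
  using assms scale_mem[of g t] add_mem[of f "\<lambda>x. t *\<^sub>R g x"]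
  by (simp add: B_add_left B_add_right B_scale_left B_scale_right B_commute[of g f] power2_eq_square algebra_simps)

lemma B_diff_self:
  assumes "f \<in> S" "g \<in> S"
  shows "B (\<lambda>x. f x - g x) (\<lambda>x. f x - g x) = B f f - 2 * B f g + B g g"
  using B_add_scale[OF assms, of "-1"] by simp

lemma B_add_self:
  assumes "f \<in> S" "g \<in> S"
  shows "B (\<lambda>x. f x + g x) (\<lambda>x. f x + g x) = B f f + 2 * B f g + B g g"
  using B_add_scale[OF assms, of 1] by simp

end

text \<open>The discriminant of a non-negative quadratic. Besides Cauchy-Schwarz it yields
  first-order conditions: for \<open>a = 0\<close> the linear coefficient must vanish, and for small
  \<open>a\<close> it must be small.\<close>

lemma quadratic_nonneg_imp:
  fixes a b c :: real
  assumes "\<And>t. 0 \<le> a + 2 * t * b + t\<^sup>2 * c" "0 \<le> c"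
  shows "b\<^sup>2 \<le> a * c"
proof (cases "c = 0")
  case True
  have "b = 0"
  proof (rule ccontr)
    assume "b \<noteq> 0"
    \<comment> \<open>At this point the quadratic, which is linear here, takes the value -1.\<close>
    with assms(1)[of "(- a - 1) / (2 * b)"] True show False by (simp add: field_simps)
  qed
  then show ?thesis using True by simp
next
  case False
  then have "0 < c" using assms by simp
  with assms(1)[of "- b / c"] show ?thesis
    by (simp add: field_simps power2_eq_square)
qed

section \<open>Norms, orthonormal systems and representation of functionals in a semi-inner product
  space\<close>

context semi_inner begin

lemma Cauchy_Schwarz_sq: "f \<in> S \<Longrightarrow> g \<in> S \<Longrightarrow> (B f g)\<^sup>2 \<le> B f f * B g g"
  using B_nonneg[OF add_mem[OF _ scale_mem], of f g]
  by (intro quadratic_nonneg_imp) (auto simp: B_add_scale B_nonneg)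

definition nrm :: "('a \<Rightarrow> 'b) \<Rightarrow> real" where "nrm f = sqrt (B f f)"

lemma nrm_nonneg: "f \<in> S \<Longrightarrow> 0 \<le> nrm f"
  by (simp add: nrm_def B_nonneg)

lemma nrm_sq: "f \<in> S \<Longrightarrow> (nrm f)\<^sup>2 = B f f"
  by (simp add: nrm_def B_nonneg)

lemma Cauchy_Schwarz: "f \<in> S \<Longrightarrow> g \<in> S \<Longrightarrow> \<bar>B f g\<bar> \<le> nrm f * nrm g"
  by (rule power2_le_imp_le)
     (auto simp: nrm_sq power_mult_distrib nrm_nonneg Cauchy_Schwarz_sq)

lemma nrm_triangle:
  assumes "f \<in> S" "g \<in> S" shows "nrm (\<lambda>x. f x + g x) \<le> nrm f + nrm g"
proof (rule power2_le_imp_le)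
  have "B f g \<le> nrm f * nrm g" using Cauchy_Schwarz[OF assms] by simp
  then show "(nrm (\<lambda>x. f x + g x))\<^sup>2 \<le> (nrm f + nrm g)\<^sup>2"
    using assms by (simp add: nrm_sq add_mem B_add_self power2_sum)
qed (use assms in \<open>simp add: nrm_nonneg\<close>)

lemma nrm_scale: "f \<in> S \<Longrightarrow> nrm (\<lambda>x. c *\<^sub>R f x) = \<bar>c\<bar> * nrm f"
proof -
  assume "f \<in> S"
  then have "B (\<lambda>x. c *\<^sub>R f x) (\<lambda>x. c *\<^sub>R f x) = c\<^sup>2 * B f f"
    by (simp add: B_scale_left B_scale_right scale_mem power2_eq_square)
  then show ?thesis by (simp add: nrm_def real_sqrt_mult)
qed

lemma nrm_diff_commute:
  assumes "f \<in> S" "g \<in> S" shows "nrm (\<lambda>x. f x - g x) = nrm (\<lambda>x. g x - f x)"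
  using nrm_scale[OF diff_mem[OF assms], of "-1"] by simp

lemma nrm_triangle3:
  assumes "f \<in> S" "g \<in> S" "h \<in> S"
  shows "nrm (\<lambda>x. f x - h x) \<le> nrm (\<lambda>x. f x - g x) + nrm (\<lambda>x. g x - h x)"
  using nrm_triangle[OF diff_mem[OF assms(1,2)] diff_mem[OF assms(2,3)]] by simp

lemma nrm_reverse_triangle:
  assumes "f \<in> S" "g \<in> S" shows "\<bar>nrm f - nrm g\<bar> \<le> nrm (\<lambda>x. f x - g x)"
  using nrm_triangle[OF diff_mem[OF assms] assms(2)]
    nrm_triangle[OF diff_mem[OF assms(2,1)] assms(1)] nrm_diff_commute[OF assms] by simp

lemma nrm_tendsto:
  assumes "\<And>n. X n \<in> S" "f \<in> S" "(\<lambda>n. nrm (\<lambda>x. X n x - f x)) \<longlonglongrightarrow> 0"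
  shows "(\<lambda>n. nrm (X n)) \<longlonglongrightarrow> nrm f"
proof -
  have "(\<lambda>n. nrm (X n) - nrm f) \<longlonglongrightarrow> 0"
    by (rule Lim_null_comparison[OF _ assms(3)])
       (use nrm_reverse_triangle[OF assms(1,2)] in simp)
  then show ?thesis by (simp add: LIM_zero_iff)
qed

lemma B_tendsto:
  assumes "\<And>n. X n \<in> S" "f \<in> S" "(\<lambda>n. nrm (\<lambda>x. X n x - f x)) \<longlonglongrightarrow> 0" "g \<in> S"
  shows "(\<lambda>n. B (X n) g) \<longlonglongrightarrow> B f g"
proof -
  have "(\<lambda>n. B (X n) g - B f g) \<longlonglongrightarrow> 0"
  proof (rule Lim_null_comparison)
    show "(\<lambda>n. nrm (\<lambda>x. X n x - f x) * nrm g) \<longlonglongrightarrow> 0"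
      using tendsto_mult_right[OF assms(3)] by simp
    show "\<forall>\<^sub>F n in sequentially. norm (B (X n) g - B f g) \<le> nrm (\<lambda>x. X n x - f x) * nrm g"
      using Cauchy_Schwarz[OF diff_mem[OF assms(1,2)] assms(4)] assms by (simp add: B_diff_left)
  qed
  then show ?thesis by (simp add: LIM_zero_iff)
qed

lemma lincomb_diff_orthonormal:
  assumes "finite I" "\<And>i. i \<in> I \<Longrightarrow> e i \<in> S" "f \<in> S"
    "\<And>i j. i \<in> I \<Longrightarrow> j \<in> I \<Longrightarrow> B (e i) (e j) = (if i = j then 1 else 0)" "k \<in> I"
  shows "B (\<lambda>x. f x - (\<Sum>i\<in>I. B f (e i) *\<^sub>R e i x)) (e k) = 0"
proof -
  have "(\<Sum>i\<in>I. B f (e i) * B (e i) (e k)) = (\<Sum>i\<in>I. if i = k then B f (e k) else 0)"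
    using assms by (intro sum.cong) auto
  then show ?thesis using assms
    by (simp add: B_diff_left lincomb_mem B_lincomb_left)
qed

text \<open>The weights \<open>l\<close> let one statement serve two forms: weight 1 for the L2
  product and the eigenvalues as weights for the Dirichlet form.\<close>

lemma lincomb_orthonormal_self:
  assumes "finite I" "\<And>i. i \<in> I \<Longrightarrow> e i \<in> S"
    "\<And>i j. i \<in> I \<Longrightarrow> j \<in> I \<Longrightarrow> B (e i) (e j) = (if i = j then l i else 0)"
  shows "B (\<lambda>x. \<Sum>i\<in>I. c i *\<^sub>R e i x) (\<lambda>x. \<Sum>i\<in>I. d i *\<^sub>R e i x) = (\<Sum>i\<in>I. c i * d i * l i)"
proof -
  have "B (e i) (\<lambda>x. \<Sum>i\<in>I. d i *\<^sub>R e i x) = d i * l i" if "i \<in> I" for i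
  proof -
    have "(\<Sum>j\<in>I. d j * B (e i) (e j)) = (\<Sum>j\<in>I. if j = i then d i * l i else 0)"
      using assms that by (intro sum.cong) auto
    then show ?thesis using assms that by (simp add: B_lincomb_right)
  qed
  then show ?thesis using assms by (simp add: B_lincomb_left lincomb_mem mult.assoc)
qed

lemma Bessel:
  assumes "finite I" "\<And>i. i \<in> I \<Longrightarrow> e i \<in> S" "f \<in> S"
    "\<And>i j. i \<in> I \<Longrightarrow> j \<in> I \<Longrightarrow> B (e i) (e j) = (if i = j then 1 else 0)"
  shows "(\<Sum>i\<in>I. (B f (e i))\<^sup>2) \<le> B f f"
proof -
  let ?p = "\<lambda>x. \<Sum>i\<in>I. B f (e i) *\<^sub>R e i x"
  have p: "?p \<in> S" using assms by (intro lincomb_mem)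
  have "B ?p ?p = (\<Sum>i\<in>I. (B f (e i))\<^sup>2)"
    using lincomb_orthonormal_self[of I e "\<lambda>_. 1"] assms by (simp add: power2_eq_square)
  moreover have "B f ?p = (\<Sum>i\<in>I. (B f (e i))\<^sup>2)"
    using assms by (simp add: B_lincomb_right power2_eq_square)
  ultimately show ?thesis
    using B_nonneg[OF diff_mem[OF assms(3) p]] B_diff_self[OF assms(3) p] by linarith
qed

text \<open>Fourier coefficients are the best ones: the two sides differ by the sum of the squares
  of \<open>c i - B f (e i)\<close>. Any good approximation in the span thus makes Bessel's
  inequality nearly an equality.\<close>

lemma Bessel_defect:
  assumes "finite I" "\<And>i. i \<in> I \<Longrightarrow> e i \<in> S" "f \<in> S"
    "\<And>i j. i \<in> I \<Longrightarrow> j \<in> I \<Longrightarrow> B (e i) (e j) = (if i = j then 1 else 0)"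
  shows "B f f - (\<Sum>i\<in>I. (B f (e i))\<^sup>2)
    \<le> B (\<lambda>x. f x - (\<Sum>i\<in>I. c i *\<^sub>R e i x)) (\<lambda>x. f x - (\<Sum>i\<in>I. c i *\<^sub>R e i x))"
proof -
  let ?p = "\<lambda>x. \<Sum>i\<in>I. c i *\<^sub>R e i x"
  have p: "?p \<in> S" using assms by (intro lincomb_mem)
  have 1: "B ?p ?p = (\<Sum>i\<in>I. c i * c i)"
    using lincomb_orthonormal_self[of I e "\<lambda>_. 1"] assms by simp
  have 2: "B f ?p = (\<Sum>i\<in>I. c i * B f (e i))"
    using assms by (simp add: B_lincomb_right)
  have "0 \<le> (\<Sum>i\<in>I. (c i - B f (e i))\<^sup>2)" by (simp add: sum_nonneg)
  also have "\<dots> = B ?p ?p - 2 * B f ?p + (\<Sum>i\<in>I. (B f (e i))\<^sup>2)"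
    unfolding 1 2 by (simp add: power2_eq_square algebra_simps sum.distrib sum_subtractf sum_distrib_left)
  finally show ?thesis using B_diff_self[OF assms(3) p] by linarith
qed

text \<open>At a near-minimiser \<open>u\<close> of \<open>B u u - 2 l u\<close> the derivative \<open>B u g - l g\<close> is small, uniformly for
  \<open>nrm g \<le> 1\<close>; hence minimising sequences are Cauchy.\<close>

theorem Riesz:
  assumes complete: "\<And>X. (\<And>n. X n \<in> S) \<Longrightarrow>
      (\<And>\<epsilon>. \<epsilon> > 0 \<Longrightarrow> \<exists>N. \<forall>m\<ge>N. \<forall>n\<ge>N. nrm (\<lambda>x. X m x - X n x) < \<epsilon>) \<Longrightarrow>
      \<exists>f\<in>S. (\<lambda>n. nrm (\<lambda>x. X n x - f x)) \<longlonglongrightarrow> 0"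
    and l_add: "\<And>f g. f \<in> S \<Longrightarrow> g \<in> S \<Longrightarrow> l (\<lambda>x. f x + g x) = l f + l g"
    and l_scale: "\<And>c f. f \<in> S \<Longrightarrow> l (\<lambda>x. c *\<^sub>R f x) = c * l f"
    and l_bdd: "\<And>f. f \<in> S \<Longrightarrow> \<bar>l f\<bar> \<le> M * nrm f"
  shows "\<exists>u\<in>S. \<forall>\<phi>\<in>S. B u \<phi> = l \<phi>"
proof -
  \<comment> \<open>The first variation of this functional at \<open>u\<close> in direction
    \<open>g\<close> is twice \<open>B u g - l g\<close>, so its minimiser is the
    representer.\<close>
  define J where "J u = B u u - 2 * l u" for u
  have J_lower: "- M\<^sup>2 \<le> J u" if "u \<in> S" for u
  proof -
    have "0 \<le> (nrm u - M)\<^sup>2" by simp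
    then show ?thesis using l_bdd[OF that] nrm_sq[OF that]
      by (simp add: J_def power2_diff algebra_simps)
  qed
  define m where "m = (INF u\<in>S. J u)"
  have bdd: "bdd_below (J ` S)" using J_lower by (auto intro!: bdd_belowI[where m = "- M\<^sup>2"])
  have m_le: "m \<le> J u" if "u \<in> S" for u
    unfolding m_def using bdd that by (rule cINF_lower)
  have "\<exists>u\<in>S. J u < m + 1 / real (Suc n)" for n
  proof -
    have "m < m + 1 / real (Suc n)" by simp
    then have "\<exists>u\<in>S. J u < m + 1 / real (Suc n)"
      using cINF_less_iff[of S J "m + 1 / real (Suc n)"] bdd zero_mem unfolding m_def by blast
    then show ?thesis .
  qed
  then obtain X where X: "\<And>n. X n \<in> S" "\<And>n. J (X n) < m + 1 / real (Suc n)" by metis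
  have expand: "J (\<lambda>x. f x + t *\<^sub>R g x) = J f + 2 * t * (B f g - l g) + t\<^sup>2 * B g g"
    if "f \<in> S" "g \<in> S" for f g t
    using that by (simp add: J_def B_add_scale l_add l_scale scale_mem algebra_simps)
  have near: "(B (X n) g - l g)\<^sup>2 \<le> (1 / real (Suc n)) * B g g" if g: "g \<in> S" for n g
  proof (rule quadratic_nonneg_imp)
    fix t
    have "m \<le> J (X n) + 2 * t * (B (X n) g - l g) + t\<^sup>2 * B g g"
      using m_le[OF add_mem[OF X(1) scale_mem[OF g], of n t]] unfolding expand[OF X(1) g] .
    then show "0 \<le> 1 / real (Suc n) + 2 * t * (B (X n) g - l g) + t\<^sup>2 * B g g"
      using X(2)[of n] by linarith
  qed (use g B_nonneg in auto)
  have near': "\<bar>B (X n) g - l g\<bar> \<le> sqrt (1 / real (Suc n)) * nrm g" if g: "g \<in> S" for n g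
  proof -
    have "\<bar>B (X n) g - l g\<bar> = sqrt ((B (X n) g - l g)\<^sup>2)" by simp
    also have "\<dots> \<le> sqrt ((1 / real (Suc n)) * B g g)" by (rule real_sqrt_le_mono[OF near[OF g]])
    also have "\<dots> = sqrt (1 / real (Suc n)) * nrm g" unfolding nrm_def by (rule real_sqrt_mult)
    finally show ?thesis .
  qed
  \<comment> \<open>The near-stationarity at \<open>X i\<close> and at \<open>X j\<close> is tested
    with their own difference; the terms with \<open>l\<close> cancel and the square of its norm
    remains.\<close>
  have cauchy: "nrm (\<lambda>x. X i x - X j x) \<le> sqrt (1 / real (Suc i)) + sqrt (1 / real (Suc j))" for i j
  proof -
    let ?d = "\<lambda>x. X i x - X j x"
    have d: "?d \<in> S" using X diff_mem by simp
    have "nrm ?d * nrm ?d = B (X i) ?d - B (X j) ?d"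
      using nrm_sq[OF d] B_diff_left[OF X(1) X(1) d] by (simp add: power2_eq_square)
    also have "\<dots> \<le> (sqrt (1 / real (Suc i)) + sqrt (1 / real (Suc j))) * nrm ?d"
      using near'[OF d, of i] near'[OF d, of j] by (simp only: distrib_right)
    finally have "nrm ?d * nrm ?d \<le> (sqrt (1 / real (Suc i)) + sqrt (1 / real (Suc j))) * nrm ?d" .
    then show ?thesis using nrm_nonneg[OF d]
      by (cases "nrm ?d = 0") (auto simp: mult_le_cancel_right)
  qed
  have lim0: "(\<lambda>n. sqrt (1 / real (Suc n))) \<longlonglongrightarrow> 0"
    using tendsto_real_sqrt[OF LIMSEQ_inverse_real_of_nat] by (simp add: inverse_eq_divide)
  have "\<exists>N. \<forall>i\<ge>N. \<forall>j\<ge>N. nrm (\<lambda>x. X i x - X j x) < \<epsilon>" if "\<epsilon> > 0" for \<epsilon>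
  proof -
    from order_tendstoD(2)[OF lim0, of "\<epsilon>/2"] that obtain N where
      N: "\<And>n. n \<ge> N \<Longrightarrow> sqrt (1 / real (Suc n)) < \<epsilon>/2" unfolding eventually_sequentially by auto
    have "nrm (\<lambda>x. X i x - X j x) < \<epsilon>" if "i \<ge> N" "j \<ge> N" for i j
      using cauchy[of i j] N[OF that(1)] N[OF that(2)] by linarith
    then show ?thesis by blast
  qed
  from complete[OF X(1) this] obtain u where u: "u \<in> S" "(\<lambda>n. nrm (\<lambda>x. X n x - u x)) \<longlonglongrightarrow> 0"
    by blast
  have "B u g = l g" if g: "g \<in> S" for g
  proof (rule LIMSEQ_unique)
    show "(\<lambda>n. B (X n) g) \<longlonglongrightarrow> B u g" by (rule B_tendsto[OF X(1) u g])
    have "(\<lambda>n. B (X n) g - l g) \<longlonglongrightarrow> 0"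
    proof (rule Lim_null_comparison)
      show "\<forall>\<^sub>F n in sequentially. norm (B (X n) g - l g) \<le> sqrt (1 / real (Suc n)) * nrm g"
        using near'[OF g] by simp
      show "(\<lambda>n. sqrt (1 / real (Suc n)) * nrm g) \<longlonglongrightarrow> 0" using tendsto_mult_right[OF lim0] by simp
    qed
    then show "(\<lambda>n. B (X n) g) \<longlonglongrightarrow> l g" by (simp add: LIM_zero_iff)
  qed
  then show ?thesis using u by blast
qed

end

section \<open>The space \<open>L\<^sup>2\<close>\<close>

locale bounded_open =
  fixes \<Omega> :: "(real^'n) set"
  assumes open_\<Omega>: "open \<Omega>" and bounded_\<Omega>: "bounded \<Omega>"
begin

abbreviation M where "M \<equiv> lebesgue_on \<Omega>"

lemma \<Omega>_lmeasurable: "\<Omega> \<in> lmeasurable"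
  using open_\<Omega> bounded_\<Omega> by (simp add: lmeasurable_open)

lemma \<Omega>_sets: "\<Omega> \<in> sets lebesgue"
  using \<Omega>_lmeasurable by (simp add: fmeasurableD)

lemma finite_measure_M: "finite_measure M"
  by (rule finite_measure_lebesgue_on[OF \<Omega>_lmeasurable])

lemma measure_M: "measure M (space M) = measure lebesgue \<Omega>"
  by (simp add: measure_restrict_space \<Omega>_sets)

lemma L2I:
  "f \<in> borel_measurable M \<Longrightarrow> integrable M (\<lambda>x. (norm (f x))\<^sup>2) \<Longrightarrow> f \<in> L2 \<Omega>"
  by (simp add: L2_def)

lemma L2_measurable: "f \<in> L2 \<Omega> \<Longrightarrow> f \<in> borel_measurable M"
  and L2_integrable_sq: "f \<in> L2 \<Omega> \<Longrightarrow> integrable M (\<lambda>x. (norm (f x))\<^sup>2)"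
  by (simp_all add: L2_def)

lemma L2_bound:
  fixes f :: "real^'n \<Rightarrow> 'b::euclidean_space" and g :: "real^'n \<Rightarrow> 'c::euclidean_space"
  assumes "g \<in> L2 \<Omega>" "f \<in> borel_measurable M" "AE x in M. norm (f x) \<le> C * norm (g x)"
  shows "f \<in> L2 \<Omega>"
proof (rule L2I[OF assms(2)], rule Bochner_Integration.integrable_bound)
  show "integrable M (\<lambda>x. C\<^sup>2 * (norm (g x))\<^sup>2)" using L2_integrable_sq[OF assms(1)] by simp
  show "AE x in M. norm ((norm (f x))\<^sup>2) \<le> norm (C\<^sup>2 * (norm (g x))\<^sup>2)"
    using assms(3) by eventually_elim (auto simp flip: power_mult_distrib intro!: power_mono)
qed (use assms(2) in measurable)

lemma L2_bounded:
  fixes f :: "real^'n \<Rightarrow> 'b::euclidean_space"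
  assumes "f \<in> borel_measurable M" "AE x in M. norm (f x) \<le> C"
  shows "f \<in> L2 \<Omega>"
proof (rule L2_bound[OF _ assms(1)])
  interpret finite_measure M by (rule finite_measure_M)
  show "(\<lambda>_. 1::real) \<in> L2 \<Omega>" by (rule L2I) auto
  show "AE x in M. norm (f x) \<le> C * norm (1::real)" using assms(2) by simp
qed

lemma L2_inner_integrable:
  fixes f g :: "real^'n \<Rightarrow> 'b::euclidean_space"
  assumes "f \<in> L2 \<Omega>" "g \<in> L2 \<Omega>"
  shows "integrable M (\<lambda>x. f x \<bullet> g x)"
proof (rule Bochner_Integration.integrable_bound)
  show "integrable M (\<lambda>x. (norm (f x))\<^sup>2 + (norm (g x))\<^sup>2)"
    using assms by (intro Bochner_Integration.integrable_add L2_integrable_sq)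
  show "(\<lambda>x. f x \<bullet> g x) \<in> borel_measurable M"
    using assms[THEN L2_measurable] by (rule borel_measurable_inner)
  have "\<bar>f x \<bullet> g x\<bar> \<le> (norm (f x))\<^sup>2 + (norm (g x))\<^sup>2" for x
  proof -
    have "\<bar>f x \<bullet> g x\<bar> \<le> norm (f x) * norm (g x)" by (rule Cauchy_Schwarz_ineq2)
    moreover have "2 * (norm (f x) * norm (g x)) \<le> (norm (f x))\<^sup>2 + (norm (g x))\<^sup>2"
      using sum_squares_bound[of "norm (f x)" "norm (g x)"] by (simp add: mult.assoc)
    moreover have "0 \<le> norm (f x) * norm (g x)" by simp
    ultimately show ?thesis by linarith
  qed
  then show "AE x in M. norm (f x \<bullet> g x) \<le> norm ((norm (f x))\<^sup>2 + (norm (g x))\<^sup>2)" by simp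
qed

lemma L2_add:
  fixes f g :: "real^'n \<Rightarrow> 'b::euclidean_space"
  assumes "f \<in> L2 \<Omega>" "g \<in> L2 \<Omega>"
  shows "(\<lambda>x. f x + g x) \<in> L2 \<Omega>"
proof (rule L2I)
  have "(norm (f x + g x))\<^sup>2 = (norm (f x))\<^sup>2 + 2 * (f x \<bullet> g x) + (norm (g x))\<^sup>2" for x
    by (simp add: power2_norm_eq_inner inner_add_left inner_add_right inner_commute)
  then show "integrable M (\<lambda>x. (norm (f x + g x))\<^sup>2)"
    using assms L2_inner_integrable[OF assms] by (simp add: L2_integrable_sq)
qed (use assms[THEN L2_measurable] in measurable)

lemma L2_scale:
  fixes f :: "real^'n \<Rightarrow> 'b::euclidean_space"
  assumes "f \<in> L2 \<Omega>"
  shows "(\<lambda>x. c *\<^sub>R f x) \<in> L2 \<Omega>"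
proof (rule L2_bound[OF assms])
  show "(\<lambda>x. c *\<^sub>R f x) \<in> borel_measurable M" using L2_measurable[OF assms] by measurable
  show "AE x in M. norm (c *\<^sub>R f x) \<le> \<bar>c\<bar> * norm (f x)" by simp
qed

sublocale L2: semi_inner "L2 \<Omega> :: (real^'n \<Rightarrow> 'b::euclidean_space) set" "L2inner \<Omega>"
proof
  show "(\<lambda>x. 0) \<in> L2 \<Omega>" by (rule L2_bounded[of _ 0]) auto
  show "L2inner \<Omega> f g = L2inner \<Omega> g f" for f g :: "real^'n \<Rightarrow> 'b"
    by (simp add: L2inner_def inner_commute)
qed (auto simp: L2_add L2_scale L2inner_def inner_add_left L2_inner_integrable)

lemma L2norm_eq: "L2.nrm f = L2norm \<Omega> f"
  by (simp add: L2.nrm_def L2norm_def L2inner_def power2_norm_eq_inner)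

lemma L2norm_cong_AE:
  assumes "f \<in> borel_measurable M" "g \<in> borel_measurable M" "AE x in M. f x = g x"
  shows "L2norm \<Omega> f = L2norm \<Omega> g"
proof -
  have "(LINT x|M. (norm (f x))\<^sup>2) = (LINT x|M. (norm (g x))\<^sup>2)"
    by (rule integral_cong_AE) (use assms in \<open>auto elim!: eventually_mono\<close>)
  then show ?thesis by (simp add: L2norm_def)
qed

lemma L2inner_cong_AE:
  assumes "f \<in> borel_measurable M" "g \<in> borel_measurable M" "f' \<in> borel_measurable M" "g' \<in> borel_measurable M"
    "AE x in M. f x = f' x" "AE x in M. g x = g' x"
  shows "L2inner \<Omega> f g = L2inner \<Omega> f' g'"
  unfolding L2inner_def
proof (rule integral_cong_AE)
  show "AE x in M. f x \<bullet> g x = f' x \<bullet> g' x" using assms(5,6) by eventually_elim simp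
qed (use assms in measurable)

lemma L2_cong_AE:
  fixes f g :: "real^'n \<Rightarrow> 'b::euclidean_space"
  assumes "f \<in> L2 \<Omega>" "g \<in> borel_measurable M" "AE x in M. f x = g x"
  shows "g \<in> L2 \<Omega>"
proof (rule L2_bound[OF assms(1,2), of 1])
  show "AE x in M. norm (g x) \<le> 1 * norm (f x)" using assms(3) by eventually_elim simp
qed

lemma L2_component:
  fixes f :: "real^'n \<Rightarrow> real^'m"
  assumes "f \<in> L2 \<Omega>" shows "(\<lambda>x. f x $ i) \<in> L2 \<Omega>"
proof (rule L2_bound[OF assms, of _ 1])
  show "(\<lambda>x. f x $ i) \<in> borel_measurable M"
    unfolding cart_eq_inner_axis using L2_measurable[OF assms] by measurable
qed (simp add: component_le_norm_cart)

lemma L2_mult_bounded: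
  fixes f :: "real^'n \<Rightarrow> 'b::euclidean_space"
  assumes "f \<in> L2 \<Omega>" "g \<in> borel_measurable M" "AE x in M. \<bar>g x\<bar> \<le> C"
  shows "(\<lambda>x. g x *\<^sub>R f x) \<in> L2 \<Omega>"
proof (rule L2_bound[OF assms(1)])
  show "(\<lambda>x. g x *\<^sub>R f x) \<in> borel_measurable M" using assms(2) L2_measurable[OF assms(1)] by measurable
  show "AE x in M. norm (g x *\<^sub>R f x) \<le> C * norm (f x)"
    using assms(3) by eventually_elim (simp add: mult_right_mono)
qed

lemma L2_one: "(\<lambda>_. 1::real) \<in> L2 \<Omega>"
  by (rule L2_bounded[of _ 1]) auto

lemma L2_integrable:
  fixes f :: "real^'n \<Rightarrow> 'b::euclidean_space"
  assumes "f \<in> L2 \<Omega>" shows "integrable M f"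
proof (rule Bochner_Integration.integrable_bound)
  have "(\<lambda>x. norm (f x)) \<in> L2 \<Omega>"
    by (rule L2_bound[OF assms, of _ 1]) (use L2_measurable[OF assms] in auto)
  from L2_inner_integrable[OF this L2_one] show "integrable M (\<lambda>x. norm (f x))" by simp
qed (use L2_measurable[OF assms] in auto)

lemma L2norm_eq_0_iff:
  fixes f :: "real^'n \<Rightarrow> 'b::euclidean_space"
  assumes "f \<in> L2 \<Omega>"
  shows "L2norm \<Omega> f = 0 \<longleftrightarrow> (AE x in M. f x = 0)"
  using integral_nonneg_eq_0_iff_AE[OF L2_integrable_sq[OF assms]] by (simp add: L2norm_def)

text \<open>Cauchy-Schwarz against the constant 1, which is square-integrable since \<Omega> has
  finite measure.\<close>

lemma L2_integral_norm_le:
  fixes f :: "real^'n \<Rightarrow> 'b::euclidean_space"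
  assumes "f \<in> L2 \<Omega>"
  shows "(LINT x|M. norm (f x)) \<le> sqrt (measure lebesgue \<Omega>) * L2norm \<Omega> f"
proof -
  have n: "(\<lambda>x. norm (f x)) \<in> L2 \<Omega>"
    by (rule L2_bound[OF assms, of _ 1]) (use L2_measurable[OF assms] in auto)
  interpret finite_measure M by (rule finite_measure_M)
  have "L2norm \<Omega> (\<lambda>x. 1::real) = sqrt (measure lebesgue \<Omega>)"
    using measure_M by (simp add: L2norm_def)
  moreover have "L2norm \<Omega> (\<lambda>x. norm (f x)) = L2norm \<Omega> f" by (simp add: L2norm_def)
  ultimately show ?thesis
    using L2.Cauchy_Schwarz[OF n L2_one] unfolding L2norm_eq by (simp add: L2inner_def mult.commute)
qed

text \<open>Riesz--Fischer: a subsequence with geometrically decaying increments converges almost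
  everywhere, and Fatou's lemma bounds the distance to the limit.\<close>

theorem L2_complete:
  fixes X :: "nat \<Rightarrow> real^'n \<Rightarrow> 'b::euclidean_space"
  assumes X: "\<And>n. X n \<in> L2 \<Omega>"
    and cauchy: "\<And>\<epsilon>. \<epsilon> > 0 \<Longrightarrow> \<exists>N. \<forall>m\<ge>N. \<forall>n\<ge>N. L2norm \<Omega> (\<lambda>x. X m x - X n x) < \<epsilon>"
  shows "\<exists>f\<in>L2 \<Omega>. (\<lambda>n. L2norm \<Omega> (\<lambda>x. X n x - f x)) \<longlonglongrightarrow> 0"
proof -
  note [measurable] = L2_measurable[OF X]
  obtain N0 where N0: "\<And>k m n. m \<ge> N0 k \<Longrightarrow> n \<ge> N0 k \<Longrightarrow> L2norm \<Omega> (\<lambda>x. X m x - X n x) < (1/2)^k"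
    using cauchy[of "(1/2)^k" for k] by (metis half_gt_zero_iff zero_less_one zero_less_power)
  have "\<exists>r. \<forall>k. N0 k \<le> r k \<and> r k < r (Suc k)"
  proof (rule dependent_nat_choice)
    show "\<exists>y. N0 (Suc k) \<le> y \<and> x < y" for x k
      by (rule exI[of _ "Suc (max x (N0 (Suc k)))"]) auto
  qed auto
  then obtain r where r: "\<And>k. N0 k \<le> r k" "\<And>k. r k < r (Suc k)" by blast
  have r_mono: "r k \<le> r l" if "k \<le> l" for k l
    by (rule lift_Suc_mono_le[OF _ that]) (use r(2) in \<open>simp add: less_imp_le\<close>)
  have k_le_r: "k \<le> r k" for k by (rule seq_suble) (use r in \<open>simp add: strict_mono_Suc_iff\<close>)
  define g where "g k x = X (r (Suc k)) x - X (r k) x" for k x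
  have g: "g k \<in> L2 \<Omega>" for k unfolding g_def by (rule L2.diff_mem[OF X X])
  have g_norm: "L2norm \<Omega> (g k) \<le> (1/2)^k" for k
  proof -
    have "N0 k \<le> r (Suc k)" using r(1)[of k] r_mono[of k "Suc k"] by linarith
    from N0[OF this r(1)] show ?thesis unfolding g_def by (rule less_imp_le)
  qed
  \<comment> \<open>The integral of the sum of the increments is dominated by a geometric series, so
    the sum is finite almost everywhere.\<close>
  have "AE x in M. summable (\<lambda>k. norm (g k x))"
  proof -
    have "(\<integral>\<^sup>+x. (\<Sum>k. ennreal (norm (g k x))) \<partial>M) = (\<Sum>k. \<integral>\<^sup>+x. ennreal (norm (g k x)) \<partial>M)"
      using L2_measurable[OF g] by (intro nn_integral_suminf) auto
    also have "\<dots> \<le> (\<Sum>k. ennreal (sqrt (measure lebesgue \<Omega>) * (1/2)^k))"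
    proof (intro suminf_le)
      fix k
      have "(\<integral>\<^sup>+x. ennreal (norm (g k x)) \<partial>M) = ennreal (LINT x|M. norm (g k x))"
        using L2_integrable[OF g] by (intro nn_integral_eq_integral) auto
      also have "\<dots> \<le> ennreal (sqrt (measure lebesgue \<Omega>) * (1/2)^k)"
        by (intro ennreal_leI order_trans[OF L2_integral_norm_le[OF g]] mult_left_mono g_norm) simp
      finally show "(\<integral>\<^sup>+x. ennreal (norm (g k x)) \<partial>M) \<le> ennreal (sqrt (measure lebesgue \<Omega>) * (1/2)^k)" .
    qed auto
    also have "\<dots> < \<infinity>"
      by (subst suminf_ennreal2) (auto intro!: summable_mult summable_geometric)
    finally have "(\<integral>\<^sup>+x. (\<Sum>k. ennreal (norm (g k x))) \<partial>M) \<noteq> \<infinity>" by simp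
    then have "AE x in M. (\<Sum>k. ennreal (norm (g k x))) \<noteq> \<infinity>"
      using L2_measurable[OF g] by (intro nn_integral_PInf_AE) auto
    then show ?thesis
      by eventually_elim (auto intro!: summable_suminf_not_top)
  qed
  then have conv: "AE x in M. convergent (\<lambda>k. X (r k) x)"
  proof eventually_elim
    case (elim x)
    have "summable (\<lambda>k. g k x)" by (rule summable_norm_cancel[OF elim])
    then have "convergent (\<lambda>n. \<Sum>k<n. g k x)" by (simp add: summable_iff_convergent)
    moreover have "(\<Sum>k<n. g k x) = X (r n) x - X (r 0) x" for n
      unfolding g_def by (rule sum_lessThan_telescope)
    ultimately have "convergent (\<lambda>n. X (r n) x - X (r 0) x)" by simp
    then show ?case using convergent_diff_const_right_iff by blast
  qed
  define f where "f x = lim (\<lambda>k. X (r k) x)" for x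
  have f_meas [measurable]: "f \<in> borel_measurable M"
    unfolding f_def[abs_def] by (rule borel_measurable_lim_metric) measurable
  have lim: "AE x in M. (\<lambda>k. X (r k) x) \<longlonglongrightarrow> f x"
    using conv by eventually_elim (simp add: f_def convergent_LIMSEQ_iff)
  have key: "(\<integral>\<^sup>+x. ennreal ((norm (X n x - f x))\<^sup>2) \<partial>M) \<le> ennreal (((1/2)^k)\<^sup>2)" if "n \<ge> N0 k" for n k
  proof -
    have "(\<integral>\<^sup>+x. ennreal ((norm (X n x - f x))\<^sup>2) \<partial>M)
        = (\<integral>\<^sup>+x. liminf (\<lambda>j. ennreal ((norm (X n x - X (r j) x))\<^sup>2)) \<partial>M)"
    proof (rule nn_integral_cong_AE)
      show "AE x in M. ennreal ((norm (X n x - f x))\<^sup>2) = liminf (\<lambda>j. ennreal ((norm (X n x - X (r j) x))\<^sup>2))"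
        using lim
      proof eventually_elim
        case (elim x)
        have "(\<lambda>j. ennreal ((norm (X n x - X (r j) x))\<^sup>2)) \<longlonglongrightarrow> ennreal ((norm (X n x - f x))\<^sup>2)"
          by (intro tendsto_intros elim)
        from lim_imp_Liminf[OF sequentially_bot this] show ?case by simp
      qed
    qed
    also have "\<dots> \<le> liminf (\<lambda>j. \<integral>\<^sup>+x. ennreal ((norm (X n x - X (r j) x))\<^sup>2) \<partial>M)"
      by (rule nn_integral_liminf) measurable
    also have "\<dots> \<le> limsup (\<lambda>j. \<integral>\<^sup>+x. ennreal ((norm (X n x - X (r j) x))\<^sup>2) \<partial>M)"
      by (rule Liminf_le_Limsup) simp
    also have "\<dots> \<le> ennreal (((1/2)^k)\<^sup>2)"
    proof (rule Limsup_bounded, rule eventually_sequentiallyI[of "N0 k"])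
      fix j assume "N0 k \<le> j"
      then have j: "N0 k \<le> r j" using k_le_r order_trans by blast
      have d: "(\<lambda>x. X n x - X (r j) x) \<in> L2 \<Omega>" by (rule L2.diff_mem[OF X X])
      have "(\<integral>\<^sup>+x. ennreal ((norm (X n x - X (r j) x))\<^sup>2) \<partial>M) = ennreal (LINT x|M. (norm (X n x - X (r j) x))\<^sup>2)"
        using L2_integrable_sq[OF d] by (intro nn_integral_eq_integral) auto
      also have "(LINT x|M. (norm (X n x - X (r j) x))\<^sup>2) = (L2norm \<Omega> (\<lambda>x. X n x - X (r j) x))\<^sup>2"
        by (simp add: L2norm_def)
      also have "\<dots> \<le> ((1/2)^k)\<^sup>2"
        by (rule power_mono[OF less_imp_le[OF N0[OF that j]]]) (simp add: L2norm_def)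
      finally show "(\<integral>\<^sup>+x. ennreal ((norm (X n x - X (r j) x))\<^sup>2) \<partial>M) \<le> ennreal (((1/2)^k)\<^sup>2)"
        by (simp add: ennreal_leI)
    qed
    finally show ?thesis .
  qed
  have dn: "(\<lambda>x. X n x - f x) \<in> L2 \<Omega>" if "n \<ge> N0 k" for n k
  proof (rule L2I)
    show "integrable M (\<lambda>x. (norm (X n x - f x))\<^sup>2)"
      by (rule integrableI_nonneg) (use key[OF that] in \<open>auto intro: le_less_trans\<close>)
  qed measurable
  \<comment> \<open>Fatou only shows that the difference to a member of the sequence is
    square-integrable; subtracting it from that member gives the limit.\<close>
  have "(\<lambda>x. X (N0 0) x - (X (N0 0) x - f x)) \<in> L2 \<Omega>" by (rule L2.diff_mem[OF X dn[OF order_refl]])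
  then have f: "f \<in> L2 \<Omega>" by simp
  have bound: "L2norm \<Omega> (\<lambda>x. X n x - f x) \<le> (1/2)^k" if "n \<ge> N0 k" for n k
  proof -
    have "ennreal (LINT x|M. (norm (X n x - f x))\<^sup>2) \<le> ennreal (((1/2)^k)\<^sup>2)"
      using key[OF that] L2_integrable_sq[OF dn[OF that]] by (simp add: nn_integral_eq_integral)
    then have "(LINT x|M. (norm (X n x - f x))\<^sup>2) \<le> ((1/2)^k)\<^sup>2" by simp
    then show ?thesis unfolding L2norm_def by (simp add: real_le_lsqrt)
  qed
  have "(\<lambda>n. L2norm \<Omega> (\<lambda>x. X n x - f x)) \<longlonglongrightarrow> 0"
  proof (rule LIMSEQ_I)
    fix e :: real assume "0 < e"
    then obtain k where k: "(1/2::real)^k < e" using real_arch_pow_inv[of e "1/2"] by auto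
    have "norm (L2norm \<Omega> (\<lambda>x. X n x - f x) - 0) < e" if "n \<ge> N0 k" for n
      using bound[OF that] k by (simp add: L2norm_def)
    then show "\<exists>no. \<forall>n\<ge>no. norm (L2norm \<Omega> (\<lambda>x. X n x - f x) - 0) < e" by blast
  qed
  with f show ?thesis by blast
qed

end

section \<open>Smooth functions\<close>

lemma grad_nth_eq: "(f has_derivative D) (at x) \<Longrightarrow> grad f x $ i = D (axis i 1)"
  by (simp add: grad_def frechet_derivative_at[symmetric])

lemma has_derivative_grad:
  fixes f :: "real^'n \<Rightarrow> real"
  assumes "f differentiable (at x)"
  shows "(f has_derivative (\<lambda>h. grad f x \<bullet> h)) (at x)"
proof -
  obtain D where D: "(f has_derivative D) (at x)" using assms by (auto simp: differentiable_def)
  have l: "linear D" using D by (rule has_derivative_linear)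
  have "D h = grad f x \<bullet> h" for h
  proof -
    have "D h = D (\<Sum>i\<in>UNIV. (h $ i) *\<^sub>R axis i 1)"
      using basis_expansion[of h] by (simp add: scalar_mult_eq_scaleR)
    also have "\<dots> = (\<Sum>i\<in>UNIV. h $ i * D (axis i 1))" using l by (simp add: linear_sum linear_scale)
    also have "\<dots> = grad f x \<bullet> h" using grad_nth_eq[OF D] by (simp add: inner_vec_def mult.commute)
    finally show ?thesis .
  qed
  then have "D = (\<lambda>h. grad f x \<bullet> h)" by auto
  with D show ?thesis by simp
qed

lemma gradI: "(f has_derivative (\<lambda>h. G \<bullet> h)) (at x) \<Longrightarrow> grad f x = G"
  by (simp add: vec_eq_iff grad_nth_eq inner_axis)

lemma grad_add:
  assumes "f differentiable (at x)" "g differentiable (at x)"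
  shows "grad (\<lambda>x. f x + g x) x = grad f x + grad g x"
  by (rule gradI) (use has_derivative_add[OF assms[THEN has_derivative_grad]] in \<open>simp add: inner_add_left\<close>)

lemma grad_mult:
  assumes "f differentiable (at x)" "g differentiable (at x)"
  shows "grad (\<lambda>x. f x * g x) x = f x *\<^sub>R grad g x + g x *\<^sub>R grad f x"
  by (rule gradI)
     (use has_derivative_mult[OF assms[THEN has_derivative_grad]] in
       \<open>simp add: inner_add_left algebra_simps\<close>)

lemma grad_const: "grad (\<lambda>x. c) x = 0"
  by (rule gradI) simp

lemma Ck_Suc_differentiable: "Ck (Suc m) f \<Longrightarrow> f differentiable (at x)"
  by (simp add: differentiable_on_def)

lemma Ck_SucD: "Ck (Suc m) f \<Longrightarrow> Ck m f"
proof (induction m arbitrary: f)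
  case 0
  then show ?case by (simp add: differentiable_imp_continuous_on)
next
  case (Suc m)
  then show ?case by simp
qed

lemma Ck_const: "Ck m (\<lambda>x. c)"
  by (induction m arbitrary: c) (auto simp: grad_const)

lemma Ck_add: "Ck m f \<Longrightarrow> Ck m g \<Longrightarrow> Ck m (\<lambda>x. f x + g x)"
proof (induction m arbitrary: f g)
  case 0
  then show ?case by (simp add: continuous_on_add)
next
  case (Suc m)
  have "grad (\<lambda>x. f x + g x) = (\<lambda>x. grad f x + grad g x)"
    using Suc.prems[THEN Ck_Suc_differentiable] by (auto simp: grad_add)
  then show ?case using Suc by (simp add: differentiable_on_add)
qed

lemma Ck_mult: "Ck m f \<Longrightarrow> Ck m g \<Longrightarrow> Ck m (\<lambda>x. f x * g x)"
proof (induction m arbitrary: f g)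
  case 0
  then show ?case by (simp add: continuous_on_mult)
next
  case (Suc m)
  have eq: "grad (\<lambda>x. f x * g x) = (\<lambda>x. f x *\<^sub>R grad g x + g x *\<^sub>R grad f x)"
    using Suc.prems[THEN Ck_Suc_differentiable] by (auto simp: grad_mult)
  have "Ck m (\<lambda>x. f x * grad g x $ i + g x * grad f x $ i)" for i
    using Suc.prems by (intro Ck_add Suc.IH Suc.prems[THEN Ck_SucD]) auto
  moreover have "(\<lambda>x. f x * g x) differentiable_on UNIV"
    using Suc.prems by (simp add: differentiable_on_def)
  ultimately show ?case by (simp add: eq)
qed

lemma Ck_prod: "(\<And>i. i \<in> I \<Longrightarrow> Ck m (f i)) \<Longrightarrow> Ck m (\<lambda>x. \<Prod>i\<in>I. f i x)"
  by (induction I rule: infinite_finite_induct) (auto simp: Ck_const Ck_mult)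

lemma Ck_scale: "Ck m f \<Longrightarrow> Ck m (\<lambda>x. c * f x)"
  by (intro Ck_mult Ck_const)

lemma Ck_diff: "Ck m f \<Longrightarrow> Ck m g \<Longrightarrow> Ck m (\<lambda>x. f x - g x)"
  using Ck_add[OF _ Ck_scale[of m g "-1"], of f] by simp

lemma has_derivative_affine_comp:
  fixes \<xi> :: "real^'n"
  assumes "(g has_real_derivative g') (at (\<xi> \<bullet> x + b))"
  shows "((\<lambda>x. g (\<xi> \<bullet> x + b)) has_derivative (\<lambda>h. (g' *\<^sub>R \<xi>) \<bullet> h)) (at x)"
proof -
  have "((\<lambda>x. \<xi> \<bullet> x + b) has_derivative (\<lambda>h. \<xi> \<bullet> h)) (at x)"
    by (auto intro!: derivative_eq_intros)
  from has_derivative_compose[OF this assms[unfolded has_field_derivative_def]]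
  show ?thesis by simp
qed

lemma grad_affine_comp:
  assumes "(g has_real_derivative g') (at (\<xi> \<bullet> x + b))"
  shows "grad (\<lambda>x. g (\<xi> \<bullet> x + b)) x = g' *\<^sub>R \<xi>"
  by (rule gradI) (rule has_derivative_affine_comp[OF assms])

text \<open>A sequence of functions of one variable in which each is the derivative of its
  predecessor gives smooth ridge functions, since a partial derivative moves one place along the
  sequence. This covers sine, cosine and the flat functions.\<close>

lemma Ck_affine_comp:
  fixes D :: "nat \<Rightarrow> real \<Rightarrow> real" and \<xi> :: "real^'n"
  assumes "\<And>k t. (D k has_real_derivative D (Suc k) t) (at t)"
  shows "Ck m (\<lambda>x. D k (\<xi> \<bullet> x + b))"
proof (induction m arbitrary: k)
  case 0
  have "continuous_on UNIV (D k)" by (rule DERIV_continuous_on) (use assms in auto)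
  then show ?case
    by (auto intro!: continuous_on_compose2[of UNIV "D k"] continuous_intros)
next
  case (Suc m)
  have "Ck m (\<lambda>x. D (Suc k) (\<xi> \<bullet> x + b) * \<xi> $ i)" for i
    by (intro Ck_mult Ck_const Suc)
  moreover have "(\<lambda>x. D k (\<xi> \<bullet> x + b)) differentiable_on UNIV"
    unfolding differentiable_on_def differentiable_def using has_derivative_affine_comp[OF assms] by blast
  ultimately show ?case by (simp add: grad_affine_comp[OF assms])
qed

lemma Ck_cos: "Ck m (\<lambda>x. cos (\<xi> \<bullet> x))"
proof -
  define D where "D k t = cos (t + real k * (pi / 2))" for k :: nat and t
  have "(D k has_real_derivative D (Suc k) t) (at t)" for k t
  proof -
    have "D (Suc k) t = - sin (t + real k * (pi / 2))"
      by (simp add: D_def minus_sin_cos_eq algebra_simps add_divide_distrib)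
    then show ?thesis unfolding D_def[abs_def] by (auto intro!: derivative_eq_intros)
  qed
  from Ck_affine_comp[of D m 0 \<xi> 0, OF this] show ?thesis by (simp add: D_def)
qed

lemma Ck_sin: "Ck m (\<lambda>x. sin (\<xi> \<bullet> x))"
proof -
  define D where "D k t = sin (t + real k * (pi / 2))" for k :: nat and t
  have "(D k has_real_derivative D (Suc k) t) (at t)" for k t
  proof -
    have "D (Suc k) t = sin ((t + real k * (pi / 2)) + pi / 2)"
      by (simp add: D_def algebra_simps add_divide_distrib)
    also have "\<dots> = cos (t + real k * (pi / 2))" by (simp add: sin_add)
    finally have "D (Suc k) t = cos (t + real k * (pi / 2))" .
    then show ?thesis unfolding D_def[abs_def] by (auto intro!: derivative_eq_intros)
  qed
  from Ck_affine_comp[of D m 0 \<xi> 0, OF this] show ?thesis by (simp add: D_def)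
qed

lemma grad_cos: "grad (\<lambda>x. cos (\<xi> \<bullet> x)) x = (- sin (\<xi> \<bullet> x)) *\<^sub>R \<xi>"
  using grad_affine_comp[of cos "- sin (\<xi> \<bullet> x)" \<xi> x 0] by (auto intro!: derivative_eq_intros)

lemma grad_sin: "grad (\<lambda>x. sin (\<xi> \<bullet> x)) x = cos (\<xi> \<bullet> x) *\<^sub>R \<xi>"
  using grad_affine_comp[of sin "cos (\<xi> \<bullet> x)" \<xi> x 0] by (auto intro!: derivative_eq_intros)

text \<open>The polynomial factor makes the family closed under differentiation.\<close>

definition flat :: "real poly \<Rightarrow> real \<Rightarrow> real" where
  "flat p t = (if t > 0 then poly p (1 / t) * exp (- 1 / t) else 0)"

text \<open>In the variable s = 1/t, differentiating p(s) exp(-s) with respect to t multiplies by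
  -s^2 after differentiating in s; the new polynomial factor is s^2 (p - p').\<close>

definition flat_deriv :: "real poly \<Rightarrow> real poly" where
  "flat_deriv p = [:0, 0, 1:] * (p - pderiv p)"

lemma poly_div_exp_tendsto_0: "((\<lambda>x. poly p x / exp x) \<longlongrightarrow> (0::real)) at_top"
proof -
  have "((\<lambda>x. \<Sum>i\<le>degree p. coeff p i * (x ^ i / exp x)) \<longlongrightarrow> (\<Sum>i\<le>degree p. coeff p i * 0)) at_top"
    by (intro tendsto_intros tendsto_power_div_exp_0)
  then show ?thesis by (simp add: poly_altdef sum_divide_distrib)
qed

lemma flat_right_0: "(flat p \<longlongrightarrow> 0) (at_right 0)"
proof -
  have "((\<lambda>t. poly p (inverse t) / exp (inverse t)) \<longlongrightarrow> 0) (at_right 0)"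
    by (rule filterlim_compose[OF poly_div_exp_tendsto_0 filterlim_inverse_at_top_right])
  moreover have "\<forall>\<^sub>F t in at_right 0. poly p (inverse t) / exp (inverse t) = flat p t"
    unfolding eventually_at_right_field
    by (intro exI[of _ 1]) (auto simp: flat_def inverse_eq_divide exp_minus field_simps)
  ultimately show ?thesis by (rule Lim_transform_eventually)
qed

lemma flat_has_derivative: "(flat p has_real_derivative flat (flat_deriv p) t) (at t)"
proof -
  consider "t > 0" | "t < 0" | "t = 0" by linarith
  then show ?thesis
  proof cases
    case 1
    have "((\<lambda>t. poly p (1 / t) * exp (- 1 / t)) has_real_derivative
        poly (pderiv p) (1/t) * (- 1 / t\<^sup>2) * exp (- 1 / t) + poly p (1/t) * (exp (- 1 / t) * (1 / t\<^sup>2))) (at t)"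
      using 1 by (auto intro!: derivative_eq_intros simp: power2_eq_square)
    also have "poly (pderiv p) (1/t) * (- 1 / t\<^sup>2) * exp (- 1 / t) + poly p (1/t) * (exp (- 1 / t) * (1 / t\<^sup>2))
      = flat (flat_deriv p) t"
      using 1 by (simp add: flat_def flat_deriv_def power2_eq_square algebra_simps)
    finally show ?thesis
      by (rule has_field_derivative_transform_within_open[of _ _ _ "{0<..}"]) (use 1 in \<open>auto simp: flat_def\<close>)
  next
    case 2
    have "((\<lambda>t. 0) has_real_derivative flat (flat_deriv p) t) (at t)" using 2 by (simp add: flat_def)
    then show ?thesis
      by (rule has_field_derivative_transform_within_open[of _ _ _ "{..<0}"]) (use 2 in \<open>auto simp: flat_def\<close>)
  next
    case 3
    have "(\<lambda>h. (flat p h - flat p 0) / (h - 0)) \<midarrow>0\<rightarrow> 0"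
    proof (subst filterlim_at_split, rule conjI)
      have "\<forall>\<^sub>F h in at_left 0. (0::real) = (flat p h - flat p 0) / (h - 0)"
        unfolding eventually_at_left_field by (intro exI[of _ "-1"]) (auto simp: flat_def)
      from Lim_transform_eventually[OF tendsto_const this]
      show "((\<lambda>h. (flat p h - flat p 0) / (h - 0)) \<longlongrightarrow> 0) (at_left 0)" .
      \<comment> \<open>Dividing by h multiplies the polynomial by its variable, so the difference
        quotient is again a flat function and tends to 0.\<close>
      have "\<forall>\<^sub>F h in at_right 0. flat ([:0, 1:] * p) h = (flat p h - flat p 0) / (h - 0)"
        unfolding eventually_at_right_field by (intro exI[of _ 1]) (auto simp: flat_def)
      from Lim_transform_eventually[OF flat_right_0 this]
      show "((\<lambda>h. (flat p h - flat p 0) / (h - 0)) \<longlongrightarrow> 0) (at_right 0)" .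
    qed
    then show ?thesis using 3 by (simp add: has_field_derivative_iff flat_def)
  qed
qed

lemma Ck_flat: "Ck m (\<lambda>x. flat p (\<xi> \<bullet> x + b))"
  using Ck_affine_comp[of "\<lambda>k. flat ((flat_deriv ^^ k) p)" m 0 \<xi> b] flat_has_derivative by simp

section \<open>Test functions\<close>

lemma test_functionI:
  assumes "\<And>m. Ck m \<phi>" "compact K" "K \<subseteq> \<Omega>" "\<And>x. x \<notin> K \<Longrightarrow> \<phi> x = 0"
  shows "\<phi> \<in> test_functions \<Omega>"
proof -
  have "closure {x. \<phi> x \<noteq> 0} \<subseteq> K"
    by (rule closure_minimal) (use assms compact_imp_closed in auto)
  moreover have "compact (closure {x. \<phi> x \<noteq> 0})"
    using calculation assms(2) by (metis closed_closure compact_Int_closed inf.absorb_iff2)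
  ultimately show ?thesis using assms by (auto simp: test_functions_def)
qed

lemma test_functionE:
  assumes "\<phi> \<in> test_functions \<Omega>"
  obtains K where "\<And>m. Ck m \<phi>" "compact K" "K \<subseteq> \<Omega>" "\<And>x. x \<notin> K \<Longrightarrow> \<phi> x = 0"
  by (rule that[of "closure {x. \<phi> x \<noteq> 0}"])
     (use assms closure_subset[of "{x. \<phi> x \<noteq> 0}"] in \<open>auto simp: test_functions_def\<close>)

lemma test_function_Ck: "\<phi> \<in> test_functions \<Omega> \<Longrightarrow> Ck m \<phi>"
  by (simp add: test_functions_def)

lemma test_function_differentiable: "\<phi> \<in> test_functions \<Omega> \<Longrightarrow> \<phi> differentiable (at x)"
  using test_function_Ck[of \<phi> \<Omega> 1] Ck_Suc_differentiable[of 0 \<phi>] by simp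

lemma test_function_mult:
  assumes "\<phi> \<in> test_functions \<Omega>" "\<And>m. Ck m \<psi>"
  shows "(\<lambda>x. \<phi> x * \<psi> x) \<in> test_functions \<Omega>"
  using assms(1)
proof (rule test_functionE)
  fix K assume K: "\<And>m. Ck m \<phi>" "compact K" "K \<subseteq> \<Omega>" "\<And>x. x \<notin> K \<Longrightarrow> \<phi> x = 0"
  show ?thesis by (rule test_functionI[OF _ K(2,3)]) (auto simp: K Ck_mult assms)
qed

lemma test_function_add:
  assumes "\<phi> \<in> test_functions \<Omega>" "\<psi> \<in> test_functions \<Omega>"
  shows "(\<lambda>x. \<phi> x + \<psi> x) \<in> test_functions \<Omega>"
  using assms(1)
proof (rule test_functionE)
  fix K assume K: "\<And>m. Ck m \<phi>" "compact K" "K \<subseteq> \<Omega>" "\<And>x. x \<notin> K \<Longrightarrow> \<phi> x = 0"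
  show ?thesis using assms(2)
  proof (rule test_functionE)
    fix L assume L: "\<And>m. Ck m \<psi>" "compact L" "L \<subseteq> \<Omega>" "\<And>x. x \<notin> L \<Longrightarrow> \<psi> x = 0"
    show ?thesis by (rule test_functionI[of _ "K \<union> L"]) (use K L in \<open>auto simp: Ck_add compact_Un\<close>)
  qed
qed

lemma test_function_scale:
  "\<phi> \<in> test_functions \<Omega> \<Longrightarrow> (\<lambda>x. c * \<phi> x) \<in> test_functions \<Omega>"
  using test_function_mult[OF _ Ck_const, of \<phi> \<Omega> c] by (simp add: mult.commute)

lemma test_function_zero: "(\<lambda>x. 0) \<in> test_functions \<Omega>"
  by (rule test_functionI[of _ "{}"]) (auto simp: Ck_const)

lemma continuous_on_grad: "Ck (Suc 0) f \<Longrightarrow> continuous_on UNIV (grad f)"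
  by (simp add: continuous_on_vec_lambda[of UNIV "\<lambda>i x. grad f x $ i", simplified])

lemma grad_outside_support:
  fixes \<phi> :: "real^'n \<Rightarrow> real"
  assumes "compact K" "\<And>x. x \<notin> K \<Longrightarrow> \<phi> x = 0" "x \<notin> K"
  shows "grad \<phi> x = 0"
proof (rule gradI)
  have "((\<lambda>x. 0) has_derivative (\<lambda>h. (0::real^'n) \<bullet> h)) (at x)" by simp
  then show "(\<phi> has_derivative (\<lambda>h. 0 \<bullet> h)) (at x)"
    by (rule has_derivative_transform_within_open[of _ _ _ _ "- K"])
       (use assms compact_imp_closed in auto)
qed

text \<open>\<open>flat 1\<close> has values in [0,1] and tends to 1 at infinity. Stretching the
  distances to the faces by \<open>Suc k\<close> therefore gives convergence to the indicator of the
  open box without any normalisation.\<close>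

definition box_bump :: "real^'n \<Rightarrow> real^'n \<Rightarrow> nat \<Rightarrow> real^'n \<Rightarrow> real" where
  "box_bump a b k x = (\<Prod>i\<in>UNIV. flat 1 (real (Suc k) * (x $ i - a $ i)) * flat 1 (real (Suc k) * (b $ i - x $ i)))"

lemma flat_1_bounds: "0 \<le> flat 1 t" "flat 1 t \<le> 1"
  by (auto simp: flat_def)

lemma box_bump_bounds: "0 \<le> box_bump a b k x" "box_bump a b k x \<le> 1"
  unfolding box_bump_def
  by (auto intro!: prod_nonneg prod_le_1 mult_le_one mult_nonneg_nonneg flat_1_bounds)

lemma box_bump_outside: "x \<notin> box a b \<Longrightarrow> box_bump a b k x = 0"
proof -
  assume "x \<notin> box a b"
  then obtain i where "x $ i \<le> a $ i \<or> b $ i \<le> x $ i" by (auto simp: mem_box_cart not_less)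
  then have "flat 1 (real (Suc k) * (x $ i - a $ i)) * flat 1 (real (Suc k) * (b $ i - x $ i)) = 0"
    by (auto simp: flat_def zero_less_mult_iff)
  then show ?thesis unfolding box_bump_def by (intro prod_zero) auto
qed

lemma box_bump_Ck: "Ck m (box_bump a b k)"
proof -
  have 1: "Ck m (\<lambda>x. flat 1 (real (Suc k) * (x $ i - a $ i)))" for i
    using Ck_flat[of m 1 "real (Suc k) *\<^sub>R axis i 1" "- real (Suc k) * a $ i"]
    by (simp add: inner_axis' algebra_simps)
  have 2: "Ck m (\<lambda>x. flat 1 (real (Suc k) * (b $ i - x $ i)))" for i
    using Ck_flat[of m 1 "- real (Suc k) *\<^sub>R axis i 1" "real (Suc k) * b $ i"]
    by (simp add: inner_axis' algebra_simps)
  show ?thesis unfolding box_bump_def[abs_def] by (intro Ck_prod Ck_mult 1 2)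
qed

lemma flat_1_tendsto:
  assumes "t > 0" shows "(\<lambda>k. flat 1 (real (Suc k) * t)) \<longlonglongrightarrow> 1"
proof -
  have "(\<lambda>k. exp (- (inverse (real (Suc k)) / t))) \<longlonglongrightarrow> exp (- (0 / t))"
    by (intro tendsto_intros LIMSEQ_inverse_real_of_nat) (use assms in auto)
  moreover have "flat 1 (real (Suc k) * t) = exp (- (inverse (real (Suc k)) / t))" for k
  proof -
    have "0 < real (Suc k) * t" using assms by simp
    then have "flat 1 (real (Suc k) * t) = exp (- 1 / (real (Suc k) * t))"
      unfolding flat_def by (simp only: if_True) simp
    then show ?thesis by (simp add: inverse_eq_divide)
  qed
  ultimately show ?thesis by simp
qed

lemma box_bump_tendsto:
  "(\<lambda>k. box_bump a b k x) \<longlonglongrightarrow> indicator (box a b) x"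
proof (cases "x \<in> box a b")
  case True
  have "(\<lambda>k. box_bump a b k x) \<longlonglongrightarrow> (\<Prod>i\<in>(UNIV::'a set). 1 * 1)"
    unfolding box_bump_def
    by (intro tendsto_prod tendsto_mult flat_1_tendsto) (use True in \<open>auto simp: mem_box_cart\<close>)
  then show ?thesis using True by simp
qed (simp add: box_bump_outside)

text \<open>The open boxes cover, while the closed ones inside \<Omega> are the compact sets that
  carry the bumps. Countability comes from the Lindelof property.\<close>

lemma open_countable_boxes:
  fixes \<Omega> :: "(real^'n) set"
  assumes "open \<Omega>"
  shows "\<exists>a b :: nat \<Rightarrow> real^'n. (\<forall>j. cbox (a j) (b j) \<subseteq> \<Omega>) \<and> \<Omega> = (\<Union>j. box (a j) (b j))"
proof -
  define \<F> where "\<F> = {D. \<exists>a b :: real^'n. D = box a b \<and> cbox a b \<subseteq> \<Omega>}"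
  obtain \<D> where \<D>: "\<D> \<subseteq> \<F>" "countable \<D>" "\<Union>\<D> = \<Union>\<F>"
    by (rule Lindelof[of \<F>]) (auto simp: \<F>_def open_box)
  have "x \<in> \<Union>\<F>" if x: "x \<in> \<Omega>" for x
  proof -
    obtain a b where "cbox a b \<subseteq> \<Omega>" "x \<in> box a b"
      by (rule open_contains_cbox[OF assms x])
    then show ?thesis by (auto simp: \<F>_def)
  qed
  moreover have "D \<subseteq> \<Omega>" if "D \<in> \<F>" for D
    using that order_trans[OF box_subset_cbox] unfolding \<F>_def by blast
  ultimately have un: "\<Omega> = \<Union>\<F>" by blast
  \<comment> \<open>An empty box belongs to the family; with it the countable subfamily can be
    indexed by all natural numbers even if it is finite or empty.\<close>
  have "box 1 0 = ({} :: (real^'n) set)" "cbox 1 0 = ({} :: (real^'n) set)"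
    by (auto simp: interval_eq_empty_cart)
  then have "{} \<in> \<F>" unfolding \<F>_def by (metis (mono_tags, lifting) CollectI empty_subsetI)
  define D where "D = from_nat_into (insert {} \<D>)"
  have D: "range D = insert {} \<D>"
    unfolding D_def using \<D>(2) by (intro range_from_nat_into) auto
  then have "\<forall>j. D j \<in> \<F>" using \<D>(1) \<open>{} \<in> \<F>\<close> by (metis insert_subset rangeI subsetD)
  then obtain a b where ab: "\<And>j. D j = box (a j) (b j)" "\<And>j. cbox (a j) (b j) \<subseteq> \<Omega>"
    unfolding \<F>_def by (auto simp: choice_iff)
  have "\<Omega> = (\<Union>j. box (a j) (b j))"
    using un \<D>(3) D ab(1) by auto
  then show ?thesis using ab(2) by blast
qed

text \<open>One minus the product of the complements of the first bumps is a smooth union of boxes: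
  it stays in [0,1], is supported in finitely many closed boxes, and at each point of \<Omega> a
  single factor that tends to 0 forces the product to 0.\<close>

theorem test_function_approx_one:
  fixes \<Omega> :: "(real^'n) set"
  assumes "open \<Omega>"
  shows "\<exists>\<eta> :: nat \<Rightarrow> real^'n \<Rightarrow> real. (\<forall>k. \<eta> k \<in> test_functions \<Omega>) \<and>
    (\<forall>k x. 0 \<le> \<eta> k x \<and> \<eta> k x \<le> 1) \<and> (\<forall>x\<in>\<Omega>. (\<lambda>k. \<eta> k x) \<longlonglongrightarrow> 1)"
proof -
  obtain a b :: "nat \<Rightarrow> real^'n" where
    ab: "\<And>j. cbox (a j) (b j) \<subseteq> \<Omega>" "\<Omega> = (\<Union>j. box (a j) (b j))"
    using open_countable_boxes[OF assms] by blast
  define \<eta> where "\<eta> k x = 1 - (\<Prod>j\<le>k. 1 - box_bump (a j) (b j) k x)" for k x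
  have "\<eta> k \<in> test_functions \<Omega>" for k
  proof (rule test_functionI[of _ "\<Union>j\<le>k. cbox (a j) (b j)"])
    show "Ck m (\<eta> k)" for m unfolding \<eta>_def[abs_def]
      by (intro Ck_diff Ck_const Ck_prod box_bump_Ck)
    show "\<eta> k x = 0" if "x \<notin> (\<Union>j\<le>k. cbox (a j) (b j))" for x
    proof -
      have "box_bump (a j) (b j) k x = 0" if "j \<le> k" for j
        using \<open>x \<notin> _\<close> that box_subset_cbox[of "a j" "b j"] by (intro box_bump_outside) auto
      then show ?thesis by (simp add: \<eta>_def)
    qed
  qed (use ab in auto)
  moreover have bds: "0 \<le> (\<Prod>j\<le>k. 1 - box_bump (a j) (b j) k x)" "(\<Prod>j\<le>k. 1 - box_bump (a j) (b j) k x) \<le> 1" for k x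
    by (auto intro!: prod_nonneg prod_le_1 simp: box_bump_bounds)
  moreover have "(\<lambda>k. \<eta> k x) \<longlonglongrightarrow> 1" if x: "x \<in> \<Omega>" for x
  proof -
    obtain j where j: "x \<in> box (a j) (b j)" using x unfolding ab(2) by blast
    have "(\<lambda>k. 1 - box_bump (a j) (b j) k x) \<longlonglongrightarrow> 1 - 1"
      using box_bump_tendsto[of "a j" "b j" x] j by (intro tendsto_intros) simp
    then have lim: "(\<lambda>k. 1 - box_bump (a j) (b j) k x) \<longlonglongrightarrow> 0" by simp
    have "(\<lambda>k. \<Prod>j\<le>k. 1 - box_bump (a j) (b j) k x) \<longlonglongrightarrow> 0"
    proof (rule tendsto_sandwich[OF _ _ tendsto_const lim])
      have "(\<Prod>i\<le>k. 1 - box_bump (a i) (b i) k x) \<le> 1 - box_bump (a j) (b j) k x" if "j \<le> k" for k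
      proof -
        have "(\<Prod>i\<in>{..k} - {j}. 1 - box_bump (a i) (b i) k x) \<le> 1"
          by (auto intro!: prod_le_1 simp: box_bump_bounds)
        then show ?thesis using that
          by (subst prod.remove[of _ j]) (auto intro!: mult_left_le simp: box_bump_bounds)
      qed
      then show "\<forall>\<^sub>F k in sequentially. (\<Prod>j\<le>k. 1 - box_bump (a j) (b j) k x) \<le> 1 - box_bump (a j) (b j) k x"
        by (rule eventually_sequentiallyI)
    qed (use bds in simp)
    from tendsto_diff[OF tendsto_const[of 1] this] show ?thesis by (simp add: \<eta>_def)
  qed
  ultimately show ?thesis by (intro exI[of _ \<eta>]) (auto simp: \<eta>_def)
qed

section \<open>Integration by parts and weak gradients\<close>

lemma onorm_inner_left_le: "onorm (\<lambda>h. v \<bullet> h) \<le> norm v"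
  by (rule onorm_bound) (auto simp: Cauchy_Schwarz_ineq2 order_trans[OF abs_ge_self])

lemma Lipschitz_of_grad_bound:
  fixes g :: "real^'n \<Rightarrow> real"
  assumes "\<And>x. g differentiable (at x)" "\<And>x. norm (grad g x) \<le> C"
  shows "\<bar>g x - g y\<bar> \<le> C * norm (x - y)"
proof -
  have "norm (g x - g y) \<le> C * norm (x - y)"
  proof (rule differentiable_bound[of UNIV g "\<lambda>x h. grad g x \<bullet> h"])
    show "(g has_derivative (\<lambda>h. grad g x \<bullet> h)) (at x within UNIV)" for x
      using has_derivative_grad[OF assms(1)] by simp
    show "onorm (\<lambda>h. grad g x \<bullet> h) \<le> C" for x
      using onorm_inner_left_le assms(2) order_trans by blast
  qed auto
  then show ?thesis by simp
qed

lemma continuous_compact_support_bounded: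
  fixes g :: "real^'n \<Rightarrow> 'b::real_normed_vector"
  assumes "continuous_on UNIV g" "compact K" "\<And>x. x \<notin> K \<Longrightarrow> g x = 0"
  obtains C where "0 \<le> C" "\<And>x. norm (g x) \<le> C"
proof -
  have "compact (g ` K)" using assms by (intro compact_continuous_image continuous_on_subset[OF assms(1)]) auto
  then obtain C where C: "\<And>y. y \<in> g ` K \<Longrightarrow> norm y \<le> C"
    using compact_imp_bounded[of "g ` K"] unfolding bounded_iff by blast
  show ?thesis
  proof (rule that[of "max 0 C"])
    show "norm (g x) \<le> max 0 C" for x
      using C[of "g x"] assms(3)[of x] by (cases "x \<in> K") auto
  qed simp
qed

lemma integral_translate_diff_zero:
  fixes g :: "real^'n \<Rightarrow> real"
  assumes "integrable lborel g"
  shows "integrable lborel (\<lambda>x. g (c + x))" "(LINT x|lborel. g (c + x) - g x) = 0"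
proof -
  have m: "(+) c \<in> lborel \<rightarrow>\<^sub>M borel" by simp
  have g: "g \<in> borel_measurable borel" using borel_measurable_integrable[OF assms] by simp
  have 1: "integrable (distr lborel borel ((+) c)) g" unfolding lborel_distr_plus by (rule assms)
  then show 2: "integrable lborel (\<lambda>x. g (c + x))" using integrable_distr_eq[OF m g] by simp
  have "integral\<^sup>L lborel g = (LINT x|lborel. g (c + x))"
    using integral_distr[OF m g] unfolding lborel_distr_plus .
  then show "(LINT x|lborel. g (c + x) - g x) = 0" using assms 2 by simp
qed

text \<open>The difference quotients of \<open>g\<close> have integral zero by translation invariance.\<close>

lemma integral_grad_compact_support:
  fixes g :: "real^'n \<Rightarrow> real"
  assumes "Ck 1 g" "compact K" "\<And>x. x \<notin> K \<Longrightarrow> g x = 0"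
  shows "(LINT x|lborel. grad g x $ j) = 0"
proof -
  have diff: "g differentiable (at x)" for x using Ck_Suc_differentiable[of 0 g] assms(1) by simp
  have cont: "continuous_on UNIV g" using Ck_SucD[of 0 g] assms(1) by simp
  have contg: "continuous_on UNIV (grad g)" using continuous_on_grad[of g] assms(1) by simp
  obtain C where C: "0 \<le> C" "\<And>x. norm (grad g x) \<le> C"
    using continuous_compact_support_bounded[OF contg assms(2) grad_outside_support[OF assms(2,3)]] by blast
  obtain R where R: "\<And>x. x \<in> K \<Longrightarrow> norm x \<le> R"
    using compact_imp_bounded[OF assms(2)] by (auto simp: bounded_iff)
  have "(\<lambda>x. indicator K x *\<^sub>R g x) = g" using assms(3) by (auto simp: indicator_def fun_eq_iff)
  then have int: "integrable lborel g"
    using borel_integrable_compact[OF assms(2) continuous_on_subset[OF cont]] by simp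
  define q where "q n x = real (Suc n) * (g (inverse (real (Suc n)) *\<^sub>R axis j 1 + x) - g x)" for n x
  have q0: "(LINT x|lborel. q n x) = 0" for n
    unfolding q_def using integral_translate_diff_zero(2)[OF int] by simp
  have "(\<lambda>n. LINT x|lborel. q n x) \<longlonglongrightarrow> (LINT x|lborel. grad g x $ j)"
  proof (rule integral_dominated_convergence)
    show "(\<lambda>x. grad g x $ j) \<in> borel_measurable lborel"
      using contg by (auto intro!: borel_measurable_continuous_onI continuous_intros)
    show "q n \<in> borel_measurable lborel" for n
    proof -
      have "continuous_on UNIV (q n)" unfolding q_def[abs_def]
        by (intro continuous_intros continuous_on_compose2[OF cont]) auto
      then show ?thesis by (simp add: borel_measurable_continuous_onI)
    qed
    \<comment> \<open>The increments have length at most 1, so all quotients vanish outside this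
      ball; inside it the mean value inequality bounds them by \<open>C\<close>.\<close>
    have "compact (cball (0::real^'n) (R + 1))" by simp
    from borel_integrable_compact[OF this, of "\<lambda>_. C"]
    show "integrable lborel (\<lambda>x. indicator (cball (0::real^'n) (R + 1)) x *\<^sub>R C)" by simp
    show "AE x in lborel. (\<lambda>n. q n x) \<longlonglongrightarrow> grad g x $ j"
    proof (rule AE_I2)
      fix x
      have "((\<lambda>t. g (x + t *\<^sub>R axis j 1)) has_real_derivative grad g x $ j) (at 0)"
      proof -
        have 1: "((\<lambda>t. x + t *\<^sub>R axis j 1) has_derivative (\<lambda>t. t *\<^sub>R axis j 1)) (at 0)"
          by (auto intro!: derivative_eq_intros)
        have 2: "(g has_derivative (\<lambda>h. grad g x \<bullet> h)) (at (x + 0 *\<^sub>R axis j 1))"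
          using has_derivative_grad[OF diff[of x]] by simp
        show ?thesis using has_derivative_compose[OF 1 2]
          by (simp add: has_field_derivative_def inner_axis mult_commute_abs)
      qed
      then have lim: "((\<lambda>t. (g (x + t *\<^sub>R axis j 1) - g x) / t) \<longlongrightarrow> grad g x $ j) (at 0)"
        by (simp add: has_field_derivative_iff)
      have "filterlim (\<lambda>n. inverse (real (Suc n))) (at 0) sequentially"
        by (rule filterlim_atI[OF LIMSEQ_inverse_real_of_nat]) simp
      from filterlim_compose[OF lim this]
      show "(\<lambda>n. q n x) \<longlonglongrightarrow> grad g x $ j"
        by (simp add: q_def divide_inverse add.commute mult.commute)
    qed
    show "AE x in lborel. norm (q n x) \<le> indicator (cball (0::real^'n) (R + 1)) x *\<^sub>R C" for n
    proof (rule AE_I2)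
      fix x
      let ?v = "inverse (real (Suc n)) *\<^sub>R axis j 1 :: real^'n"
      have nv: "norm ?v = inverse (real (Suc n))" by simp
      show "norm (q n x) \<le> indicator (cball 0 (R + 1)) x *\<^sub>R C"
      proof (cases "x \<in> cball 0 (R + 1)")
        case True
        have "\<bar>g (?v + x) - g x\<bar> \<le> C * norm (?v + x - x)"
          by (rule Lipschitz_of_grad_bound[OF diff C(2)])
        then have "real (Suc n) * \<bar>g (?v + x) - g x\<bar> \<le> real (Suc n) * (C * inverse (real (Suc n)))"
          using nv by (intro mult_left_mono) auto
        also have "\<dots> = C" by (simp del: of_nat_Suc)
        finally show ?thesis using True by (simp add: q_def abs_mult)
      next
        case False
        have "inverse (real (Suc n)) \<le> 1" by (simp add: inverse_le_1_iff)
        then have "norm (?v + x) > R"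
          using False nv norm_triangle_ineq2[of x "- ?v"] by (simp add: add.commute)
        then have "g (?v + x) = 0" "g x = 0"
          using R[of x] R[of "?v + x"] assms(3) False by (force, force)
        then show ?thesis using False by (simp add: q_def)
      qed
    qed
  qed
  then show ?thesis using q0 by (simp add: LIMSEQ_const_iff)
qed

section \<open>Weak gradients: integration by parts, uniqueness and closedness\<close>

context bounded_open begin

text \<open>Connects the completed measure on \<Omega>, on which the function spaces live, with the
  Borel measure on the whole space, where translation invariance was used.\<close>

lemma integral_M_eq_lborel:
  fixes f :: "real^'n \<Rightarrow> real"
  assumes "f \<in> borel_measurable borel" "\<And>x. x \<notin> \<Omega> \<Longrightarrow> f x = 0"
  shows "(LINT x|M. f x) = (LINT x|lborel. f x)"
proof -
  have "(LINT x|M. f x) = (LINT x|lebesgue. indicator \<Omega> x *\<^sub>R f x)"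
    using \<Omega>_sets by (intro integral_restrict_space) simp
  also have "(\<lambda>x. indicator \<Omega> x *\<^sub>R f x) = f" using assms(2) by (auto simp: indicator_def fun_eq_iff)
  also have "integral\<^sup>L lebesgue f = integral\<^sup>L lborel f"
    by (rule integral_completion) (use assms(1) in simp)
  finally show ?thesis .
qed

lemma continuous_measurable_M: "continuous_on UNIV f \<Longrightarrow> f \<in> borel_measurable M"
  by (rule continuous_imp_measurable_on_sets_lebesgue[OF continuous_on_subset \<Omega>_sets]) auto

lemma test_L2:
  assumes "\<phi> \<in> test_functions \<Omega>"
  shows "\<phi> \<in> L2 \<Omega>" "grad \<phi> \<in> L2 \<Omega>" "(\<lambda>x. grad \<phi> x $ i) \<in> L2 \<Omega>"
proof -
  obtain K where K: "\<And>m. Ck m \<phi>" "compact K" "\<And>x. x \<notin> K \<Longrightarrow> \<phi> x = 0"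
    using assms by (rule test_functionE) blast
  have c: "continuous_on UNIV \<phi>" using K(1)[of 0] by simp
  have cg: "continuous_on UNIV (grad \<phi>)" by (rule continuous_on_grad[OF K(1)])
  obtain C where "\<And>x. norm (\<phi> x) \<le> C" using continuous_compact_support_bounded[OF c K(2,3)] by blast
  then show "\<phi> \<in> L2 \<Omega>" using L2_bounded[OF continuous_measurable_M[OF c]] by blast
  obtain C where "\<And>x. norm (grad \<phi> x) \<le> C"
    using continuous_compact_support_bounded[OF cg K(2) grad_outside_support[OF K(2,3)]] by blast
  then show "grad \<phi> \<in> L2 \<Omega>" using L2_bounded[OF continuous_measurable_M[OF cg]] by blast
  then show "(\<lambda>x. grad \<phi> x $ i) \<in> L2 \<Omega>" by (rule L2_component)
qed

text \<open>Only the product \<phi>\<psi> has to be compactly supported. With a plane wave for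
  \<psi> this computes the Fourier coefficients of a gradient.\<close>

lemma integration_by_parts:
  assumes "\<phi> \<in> test_functions \<Omega>" "\<And>m. Ck m \<psi>"
  shows "(LINT x|M. \<phi> x * grad \<psi> x $ j) = - (LINT x|M. grad \<phi> x $ j * \<psi> x)"
proof -
  obtain K where K: "\<And>m. Ck m \<phi>" "compact K" "K \<subseteq> \<Omega>" "\<And>x. x \<notin> K \<Longrightarrow> \<phi> x = 0"
    using assms(1) by (rule test_functionE) blast
  have c: "continuous_on UNIV \<phi>" "continuous_on UNIV \<psi>" using K(1)[of 0] assms(2)[of 0] by auto
  have cg: "continuous_on UNIV (\<lambda>x. grad \<phi> x $ j)" "continuous_on UNIV (\<lambda>x. grad \<psi> x $ j)"
    using K(1)[of 1] assms(2)[of 1] by auto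
  have 0: "grad \<phi> x = 0" if "x \<notin> K" for x using grad_outside_support[OF K(2,4) that] by simp
  have i: "integrable M (\<lambda>x. \<phi> x * grad \<psi> x $ j)" "integrable M (\<lambda>x. grad \<phi> x $ j * \<psi> x)"
  proof -
    have "\<phi> x * grad \<psi> x $ j = 0" if "x \<notin> K" for x using K(4)[OF that] by simp
    from continuous_compact_support_bounded[OF continuous_on_mult[OF c(1) cg(2)] K(2) this]
    obtain C where "\<And>x. norm (\<phi> x * grad \<psi> x $ j) \<le> C" by metis
    then show "integrable M (\<lambda>x. \<phi> x * grad \<psi> x $ j)"
      by (intro L2_integrable L2_bounded[of _ C] continuous_measurable_M continuous_on_mult c cg) auto
    have "grad \<phi> x $ j * \<psi> x = 0" if "x \<notin> K" for x using 0[OF that] by simp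
    from continuous_compact_support_bounded[OF continuous_on_mult[OF cg(1) c(2)] K(2) this]
    obtain C where "\<And>x. norm (grad \<phi> x $ j * \<psi> x) \<le> C" by metis
    then show "integrable M (\<lambda>x. grad \<phi> x $ j * \<psi> x)"
      by (intro L2_integrable L2_bounded[of _ C] continuous_measurable_M continuous_on_mult c cg) auto
  qed
  have d: "\<phi> differentiable (at x)" "\<psi> differentiable (at x)" for x
    using Ck_Suc_differentiable[OF K(1)] Ck_Suc_differentiable[OF assms(2)] by auto
  have eq: "grad (\<lambda>x. \<phi> x * \<psi> x) x $ j = \<phi> x * grad \<psi> x $ j + grad \<phi> x $ j * \<psi> x" for x
    using grad_mult[OF d] by simp
  have "(LINT x|M. \<phi> x * grad \<psi> x $ j + grad \<phi> x $ j * \<psi> x)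
      = (LINT x|lborel. \<phi> x * grad \<psi> x $ j + grad \<phi> x $ j * \<psi> x)"
  proof (rule integral_M_eq_lborel)
    show "\<phi> x * grad \<psi> x $ j + grad \<phi> x $ j * \<psi> x = 0" if "x \<notin> \<Omega>" for x
    proof -
      have "x \<notin> K" using that K(3) by blast
      then show ?thesis using K(4) 0 by simp
    qed
  qed (intro borel_measurable_continuous_onI continuous_intros c cg)
  also have "\<dots> = 0"
    using integral_grad_compact_support[of "\<lambda>x. \<phi> x * \<psi> x" K j] K assms(2)
    by (simp add: eq Ck_mult del: Ck.simps One_nat_def)
  finally show ?thesis using i by simp
qed

lemma integral_vec_nth:
  fixes F :: "real^'n \<Rightarrow> real^'m"
  assumes "integrable M F" shows "(LINT x|M. F x) $ i = (LINT x|M. F x $ i)"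
  using integral_bounded_linear[OF bounded_linear_vec_nth assms] by simp

text \<open>Rewrites the vector-valued identity as scalar L2 products, so that bilinearity and
  continuity of the L2 product apply to weak gradients.\<close>

lemma is_weak_grad_iff:
  assumes "u \<in> L2 \<Omega>" "G \<in> L2 \<Omega>"
  shows "is_weak_grad \<Omega> u G \<longleftrightarrow>
    (\<forall>\<phi>\<in>test_functions \<Omega>. \<forall>i. L2inner \<Omega> u (\<lambda>x. grad \<phi> x $ i) = - L2inner \<Omega> \<phi> (\<lambda>x. G x $ i))"
proof -
  have int: "integrable M (\<lambda>x. f x *\<^sub>R F x)" if "f \<in> L2 \<Omega>" "F \<in> L2 \<Omega>" for f and F :: "real^'n \<Rightarrow> real^'n"
  proof -
    have n: "(\<lambda>x. norm (F x)) \<in> L2 \<Omega>"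
      by (rule L2_bound[OF that(2), of _ 1]) (use L2_measurable[OF that(2)] in auto)
    have [measurable]: "f \<in> borel_measurable M" "F \<in> borel_measurable M" using that[THEN L2_measurable] by auto
    show ?thesis
      by (rule Bochner_Integration.integrable_bound[OF L2_inner_integrable[OF that(1) n]]) auto
  qed
  have "(LINT x|M. u x *\<^sub>R grad \<phi> x) = - (LINT x|M. \<phi> x *\<^sub>R G x) \<longleftrightarrow>
     (\<forall>i. L2inner \<Omega> u (\<lambda>x. grad \<phi> x $ i) = - L2inner \<Omega> \<phi> (\<lambda>x. G x $ i))"
    if "\<phi> \<in> test_functions \<Omega>" for \<phi>
    using integral_vec_nth[OF int[OF assms(1) test_L2(2)[OF that]]]
      integral_vec_nth[OF int[OF test_L2(1)[OF that] assms(2)]]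
    by (simp add: vec_eq_iff L2inner_def)
  then show ?thesis using assms by (simp add: is_weak_grad_def)
qed

lemma is_weak_gradD:
  assumes "is_weak_grad \<Omega> u G" "u \<in> L2 \<Omega>" "\<phi> \<in> test_functions \<Omega>"
  shows "L2inner \<Omega> u (\<lambda>x. grad \<phi> x $ i) = - L2inner \<Omega> \<phi> (\<lambda>x. G x $ i)"
  using assms is_weak_grad_iff[OF assms(2)] by (auto simp: is_weak_grad_def)

lemma is_weak_grad_L2: "is_weak_grad \<Omega> u G \<Longrightarrow> G \<in> L2 \<Omega>"
  by (simp add: is_weak_grad_def)

lemma is_weak_grad_test: "\<phi> \<in> test_functions \<Omega> \<Longrightarrow> is_weak_grad \<Omega> \<phi> (grad \<phi>)"
  using integration_by_parts[OF _ test_function_Ck, of \<phi>]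
  by (simp add: is_weak_grad_iff test_L2 L2inner_def mult.commute)

lemma is_weak_grad_add:
  assumes "is_weak_grad \<Omega> u G" "is_weak_grad \<Omega> v H" "u \<in> L2 \<Omega>" "v \<in> L2 \<Omega>"
  shows "is_weak_grad \<Omega> (\<lambda>x. u x + v x) (\<lambda>x. G x + H x)"
proof -
  have GH: "G \<in> L2 \<Omega>" "H \<in> L2 \<Omega>" using assms is_weak_grad_L2 by auto
  show ?thesis
    using assms GH is_weak_gradD[OF assms(1,3)] is_weak_gradD[OF assms(2,4)]
    by (simp add: is_weak_grad_iff L2.add_mem L2.B_add_left L2.B_add_right test_L2 L2_component)
qed

lemma is_weak_grad_scale:
  assumes "is_weak_grad \<Omega> u G" "u \<in> L2 \<Omega>"
  shows "is_weak_grad \<Omega> (\<lambda>x. c * u x) (\<lambda>x. c *\<^sub>R G x)"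
proof -
  have G: "G \<in> L2 \<Omega>" using assms is_weak_grad_L2 by auto
  have "(\<lambda>x. c * u x) \<in> L2 \<Omega>" using L2.scale_mem[OF assms(2), of c] by simp
  then show ?thesis
    using assms G is_weak_gradD[OF assms] L2.B_scale_left[OF assms(2), of _ c]
     L2.B_scale_right[OF L2_component[OF G], of _ c]
    by (simp add: is_weak_grad_iff L2.scale_mem test_L2)
qed

text \<open>Fundamental lemma of the calculus of variations. Cutoffs carry orthogonality over to
  indicators of open sets, outer regularity to indicators of measurable sets, and the sets where
  \<open>g\<close> is positive or negative finish the proof.\<close>

lemma L2_orthogonal_test_AE_zero:
  assumes g: "g \<in> L2 \<Omega>" and orth: "\<And>\<phi>. \<phi> \<in> test_functions \<Omega> \<Longrightarrow> L2inner \<Omega> \<phi> g = 0"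
  shows "AE x in M. g x = (0::real)"
proof -
  have [measurable]: "g \<in> borel_measurable M" by (rule L2_measurable[OF g])
  have ind: "(indicator A :: _ \<Rightarrow> real) \<in> L2 \<Omega>" if "A \<in> sets lebesgue" for A
  proof (rule L2_bounded[of _ 1])
    show "(indicator A :: _ \<Rightarrow> real) \<in> borel_measurable M"
      by (rule measurable_restrict_space1) (use that in simp)
  qed (simp add: indicator_def)
  have opn: "L2inner \<Omega> (indicator U) g = 0" if U: "open U" "U \<subseteq> \<Omega>" for U
  proof -
    obtain \<eta> :: "nat \<Rightarrow> real^'n \<Rightarrow> real" where \<eta>: "\<And>k. \<eta> k \<in> test_functions U"
        "\<And>k x. 0 \<le> \<eta> k x \<and> \<eta> k x \<le> 1" "\<And>x. x \<in> U \<Longrightarrow> (\<lambda>k. \<eta> k x) \<longlonglongrightarrow> 1"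
      using test_function_approx_one[OF U(1)] by blast
    have t: "\<eta> k \<in> test_functions \<Omega>" for k using \<eta>(1) U(2) by (auto simp: test_functions_def)
    have 0: "\<eta> k x = 0" if "x \<notin> U" for k x using \<eta>(1)[of k] by (rule test_functionE) (use that in blast)
    have "(\<lambda>k. LINT x|M. \<eta> k x * g x) \<longlonglongrightarrow> (LINT x|M. indicator U x * g x)"
    proof (rule integral_dominated_convergence[where w = "\<lambda>x. norm (g x)"])
      show "integrable M (\<lambda>x. norm (g x))" using L2_integrable[OF g] by (rule integrable_norm)
      show "(\<lambda>x. indicator U x * g x) \<in> borel_measurable M"
        using U(1) by (intro borel_measurable_times L2_measurable[OF ind] L2_measurable[OF g] sets_completionI_sets) auto
      show "(\<lambda>x. \<eta> k x * g x) \<in> borel_measurable M" for k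
        using L2_measurable[OF test_L2(1)[OF t]] by measurable
      show "AE x in M. (\<lambda>k. \<eta> k x * g x) \<longlonglongrightarrow> indicator U x * g x"
      proof (rule AE_I2)
        fix x
        have "(\<lambda>k. \<eta> k x) \<longlonglongrightarrow> indicator U x" using \<eta>(3) 0 by (cases "x \<in> U") auto
        then show "(\<lambda>k. \<eta> k x * g x) \<longlonglongrightarrow> indicator U x * g x" by (rule tendsto_mult_right)
      qed
      show "AE x in M. norm (\<eta> k x * g x) \<le> norm (g x)" for k
        using \<eta>(2) by (intro AE_I2) (simp add: abs_mult mult_left_le_one_le)
    qed
    moreover have "(LINT x|M. \<eta> k x * g x) = 0" for k using orth[OF t] by (simp add: L2inner_def)
    ultimately show ?thesis by (simp add: L2inner_def LIMSEQ_const_iff)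
  qed
  have all: "L2inner \<Omega> (indicator A) g = 0" if A: "A \<in> sets lebesgue" "A \<subseteq> \<Omega>" for A
  proof -
    have "\<bar>L2inner \<Omega> (indicator A) g\<bar> \<le> \<epsilon> * L2norm \<Omega> g" if "\<epsilon> > 0" for \<epsilon>
    proof -
      obtain T where T: "open T" "A \<subseteq> T" "(T - A) \<in> lmeasurable" "emeasure lebesgue (T - A) < ennreal (\<epsilon>\<^sup>2)"
        by (rule sets_lebesgue_outer_open[OF A(1), of "\<epsilon>\<^sup>2"]) (use \<open>\<epsilon> > 0\<close> in auto)
      define U where "U = T \<inter> \<Omega>"
      have U: "open U" "U \<subseteq> \<Omega>" "A \<subseteq> U" using T A open_\<Omega> by (auto simp: U_def)
      have Us: "U \<in> sets lebesgue" using U(1) by (simp add: borel_open)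
      have D: "U - A \<in> sets lebesgue" using Us A by auto
      have "indicator A x = indicator U x - (indicator (U - A) x :: real)" for x
        using U by (auto simp: indicator_def)
      then have "L2inner \<Omega> (indicator A) g = L2inner \<Omega> (\<lambda>x. indicator U x - indicator (U - A) x) g"
        by (metis (no_types, lifting) ext)
      also have "\<dots> = - L2inner \<Omega> (indicator (U - A)) g"
        using L2.B_diff_left[OF ind[OF Us] ind[OF D] g] opn[OF U(1,2)] by simp
      finally have "\<bar>L2inner \<Omega> (indicator A) g\<bar> \<le> L2norm \<Omega> (\<lambda>x. indicator (U - A) x :: real) * L2norm \<Omega> g"
        using L2.Cauchy_Schwarz[OF ind[OF D] g] unfolding L2norm_eq by simp
      also have "L2norm \<Omega> (\<lambda>x. indicator (U - A) x :: real) \<le> \<epsilon>"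
      proof -
        have "(LINT x|M. (norm (indicator (U - A) x :: real))\<^sup>2) = (LINT x|M. indicator (U - A) x)"
          by (rule Bochner_Integration.integral_cong) (auto simp: indicator_def)
        also have "\<dots> = measure M (U - A)"
          using D U by (simp add: measure_restrict_space \<Omega>_sets Int_absorb2 Diff_subset_conv le_supI2)
        also have "\<dots> = measure lebesgue (U - A)"
          using U by (intro measure_restrict_space) (auto simp: \<Omega>_sets)
        also have "\<dots> \<le> measure lebesgue (T - A)"
          by (rule measure_mono_fmeasurable) (use T D in \<open>auto simp: U_def\<close>)
        also have "\<dots> \<le> \<epsilon>\<^sup>2"
          using T(3,4) by (simp add: emeasure_eq_measure2 ennreal_less_iff)
        finally show ?thesis unfolding L2norm_def using that by (simp add: real_le_lsqrt)
      qed
      finally show ?thesis using L2.nrm_nonneg[OF g] unfolding L2norm_eq by (simp add: mult_right_mono)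
    qed
    note b = this
    have "\<bar>L2inner \<Omega> (indicator A) g\<bar> \<le> 0"
    proof (rule field_le_epsilon)
      fix e :: real assume "0 < e"
      have n: "0 \<le> L2norm \<Omega> g" by (simp add: L2norm_def)
      \<comment> \<open>The added 1 keeps the denominator positive when the norm of \<open>g\<close>
        is 0.\<close>
      have "\<bar>L2inner \<Omega> (indicator A) g\<bar> \<le> e / (L2norm \<Omega> g + 1) * L2norm \<Omega> g"
        using b[of "e / (L2norm \<Omega> g + 1)"] \<open>0 < e\<close> n by simp
      also have "\<dots> \<le> e" using n \<open>0 < e\<close> by (simp add: field_simps)
      finally show "\<bar>L2inner \<Omega> (indicator A) g\<bar> \<le> 0 + e" by simp
    qed
    then show ?thesis by simp
  qed
  define P where "P = {x \<in> \<Omega>. g x > 0}"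
  define Q where "Q = {x \<in> \<Omega>. g x < 0}"
  have sp: "space M = \<Omega>" by simp
  have PQ: "P \<in> sets lebesgue" "Q \<in> sets lebesgue"
  proof -
    have "{x \<in> space M. g x > 0} \<in> sets M" "{x \<in> space M. g x < 0} \<in> sets M" by measurable
    then show "P \<in> sets lebesgue" "Q \<in> sets lebesgue"
      by (auto simp: P_def Q_def sets_restrict_space_iff \<Omega>_sets)
  qed
  have "AE x in M. indicator P x * g x = 0"
    using all[OF PQ(1)] L2_inner_integrable[OF ind[OF PQ(1)] g]
    by (subst integral_nonneg_eq_0_iff_AE[symmetric]) (auto simp: L2inner_def P_def indicator_def)
  moreover have "AE x in M. - (indicator Q x * g x) = 0"
    using all[OF PQ(2)] L2_inner_integrable[OF ind[OF PQ(2)] g]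
    by (subst integral_nonneg_eq_0_iff_AE[symmetric]) (auto simp: L2inner_def Q_def indicator_def)
  ultimately show ?thesis using AE_space
  proof eventually_elim
    case (elim x)
    then show ?case by (cases "g x" "0::real" rule: linorder_cases) (auto simp: P_def Q_def)
  qed
qed

text \<open>Allowing two functions that agree almost everywhere makes this at once uniqueness and
  independence of the representative.\<close>

lemma is_weak_grad_unique:
  assumes "is_weak_grad \<Omega> u G" "is_weak_grad \<Omega> v H" "u \<in> L2 \<Omega>" "v \<in> L2 \<Omega>" "AE x in M. u x = v x"
  shows "AE x in M. G x = H x"
proof -
  have L: "G \<in> L2 \<Omega>" "H \<in> L2 \<Omega>" using assms is_weak_grad_L2 by auto
  have "AE x in M. G x $ i - H x $ i = 0" for i
  proof (rule L2_orthogonal_test_AE_zero)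
    show "(\<lambda>x. G x $ i - H x $ i) \<in> L2 \<Omega>" by (intro L2.diff_mem L2_component L)
    fix \<phi> assume \<phi>: "\<phi> \<in> test_functions \<Omega>"
    have "L2inner \<Omega> u (\<lambda>x. grad \<phi> x $ i) = L2inner \<Omega> v (\<lambda>x. grad \<phi> x $ i)"
      by (rule L2inner_cong_AE) (use assms test_L2[OF \<phi>] L2_measurable in auto)
    then show "L2inner \<Omega> \<phi> (\<lambda>x. G x $ i - H x $ i) = 0"
      using is_weak_gradD[OF assms(1,3) \<phi>, of i] is_weak_gradD[OF assms(2,4) \<phi>, of i]
      by (simp add: L2.B_diff_right L2_component L test_L2[OF \<phi>])
  qed
  then have "AE x in M. \<forall>i\<in>UNIV. G x $ i - H x $ i = 0" by (intro AE_finite_allI) auto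
  then show ?thesis by eventually_elim (simp add: vec_eq_iff)
qed

lemma weak_grad_eqI:
  assumes "is_weak_grad \<Omega> u G" "u \<in> L2 \<Omega>"
  shows "is_weak_grad \<Omega> u (weak_grad \<Omega> u)" "AE x in M. weak_grad \<Omega> u x = G x"
proof -
  show 1: "is_weak_grad \<Omega> u (weak_grad \<Omega> u)" unfolding weak_grad_def by (rule someI[of "is_weak_grad \<Omega> u", OF assms(1)])
  show "AE x in M. weak_grad \<Omega> u x = G x" by (rule is_weak_grad_unique[OF 1 assms(1,2,2)]) simp
qed

text \<open>Both sides of the defining identity are continuous in L2, so the weak gradient is a
  closed operator.\<close>

lemma is_weak_grad_limit:
  assumes "\<And>n. is_weak_grad \<Omega> (X n) (G n)" "\<And>n. X n \<in> L2 \<Omega>" "u \<in> L2 \<Omega>" "H \<in> L2 \<Omega>"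
    "(\<lambda>n. L2norm \<Omega> (\<lambda>x. X n x - u x)) \<longlonglongrightarrow> 0" "(\<lambda>n. L2norm \<Omega> (\<lambda>x. G n x - H x)) \<longlonglongrightarrow> 0"
  shows "is_weak_grad \<Omega> u H"
proof -
  have G: "G n \<in> L2 \<Omega>" for n using assms(1) is_weak_grad_L2 by auto
  have "L2inner \<Omega> u (\<lambda>x. grad \<phi> x $ i) = - L2inner \<Omega> \<phi> (\<lambda>x. H x $ i)" if \<phi>: "\<phi> \<in> test_functions \<Omega>" for \<phi> i
  proof (rule LIMSEQ_unique)
    show "(\<lambda>n. L2inner \<Omega> (X n) (\<lambda>x. grad \<phi> x $ i)) \<longlonglongrightarrow> L2inner \<Omega> u (\<lambda>x. grad \<phi> x $ i)"
      by (rule L2.B_tendsto) (use assms test_L2[OF \<phi>] in \<open>auto simp: L2norm_eq\<close>)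
    have "(\<lambda>n. L2inner \<Omega> (\<lambda>x. G n x $ i) \<phi>) \<longlonglongrightarrow> L2inner \<Omega> (\<lambda>x. H x $ i) \<phi>"
    proof (rule L2.B_tendsto)
      show "(\<lambda>n. L2.nrm (\<lambda>x. G n x $ i - H x $ i)) \<longlonglongrightarrow> 0"
      proof (rule Lim_null_comparison[OF _ assms(6)])
        have "L2norm \<Omega> (\<lambda>x. G n x $ i - H x $ i) \<le> L2norm \<Omega> (\<lambda>x. G n x - H x)" for n
          unfolding L2norm_def
        proof (intro real_sqrt_le_mono integral_mono L2_integrable_sq L2.diff_mem L2_component G assms(4))
          show "(norm (G n x $ i - H x $ i))\<^sup>2 \<le> (norm (G n x - H x))\<^sup>2" for x
            using component_le_norm_cart[of "G n x - H x" i] by (intro power_mono) auto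
        qed
        then show "\<forall>\<^sub>F n in sequentially. norm (L2.nrm (\<lambda>x. G n x $ i - H x $ i)) \<le> L2norm \<Omega> (\<lambda>x. G n x - H x)"
          unfolding L2norm_eq by (simp add: L2norm_def)
      qed
    qed (use assms test_L2[OF \<phi>] G in \<open>auto intro!: L2_component\<close>)
    then have "(\<lambda>n. - L2inner \<Omega> (\<lambda>x. G n x $ i) \<phi>) \<longlonglongrightarrow> - L2inner \<Omega> (\<lambda>x. H x $ i) \<phi>" by (rule tendsto_minus)
    then show "(\<lambda>n. L2inner \<Omega> (X n) (\<lambda>x. grad \<phi> x $ i)) \<longlonglongrightarrow> - L2inner \<Omega> \<phi> (\<lambda>x. H x $ i)"
      using is_weak_gradD[OF assms(1,2) \<phi>, of _ i] L2.B_commute[OF test_L2(1)[OF \<phi>] L2_component, OF G]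
        L2.B_commute[OF test_L2(1)[OF \<phi>] L2_component, OF assms(4)] by simp
  qed
  then show ?thesis using assms by (simp add: is_weak_grad_iff)
qed

end

section \<open>Fourier series on a cube\<close>

text \<open>The frequencies of the waves that are periodic with respect to a cube of side 2 pi /
  \<tau>; a small \<tau> means a large cube and a fine lattice.\<close>

definition lat :: "real \<Rightarrow> (real^'n) set" where
  "lat \<tau> = {\<xi>. \<forall>i. \<exists>m::int. \<xi> $ i = \<tau> * of_int m}"

definition tbox :: "real \<Rightarrow> (real^'n) set" where
  "tbox \<tau> = box (\<chi> i. - (pi / \<tau>)) (\<chi> i. pi / \<tau>)"

lemma mem_tbox: "x \<in> tbox \<tau> \<longleftrightarrow> (\<forall>i. - (pi / \<tau>) < x $ i \<and> x $ i < pi / \<tau>)"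
  by (simp add: tbox_def mem_box_cart)

lemma zero_in_lat: "0 \<in> lat \<tau>"
  by (auto simp: lat_def intro: exI[of _ 0])

lemma lat_add: "\<xi> \<in> lat \<tau> \<Longrightarrow> \<eta> \<in> lat \<tau> \<Longrightarrow> \<xi> + \<eta> \<in> lat \<tau>"
  unfolding lat_def by (auto simp: distrib_left[symmetric]) (metis distrib_left of_int_add)

lemma lat_uminus: "\<xi> \<in> lat \<tau> \<Longrightarrow> - \<xi> \<in> lat \<tau>"
  unfolding lat_def by simp (metis mult_minus_right of_int_minus)

lemma lat_diff: "\<xi> \<in> lat \<tau> \<Longrightarrow> \<eta> \<in> lat \<tau> \<Longrightarrow> \<xi> - \<eta> \<in> lat \<tau>"
  using lat_add[of \<xi> \<tau> "- \<eta>"] lat_uminus[of \<eta> \<tau>] by simp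

lemma lat_axis: "axis i \<tau> \<in> lat \<tau>"
  unfolding lat_def by (auto simp: axis_def intro: exI[of _ 0] exI[of _ 1])

lemma integral_cis_interval:
  assumes "\<tau> > 0"
  shows "(LINT t|lborel. indicator {- (pi / \<tau>)..pi / \<tau>} t *\<^sub>R cis (\<tau> * of_int m * t))
    = (if m = 0 then complex_of_real (2 * pi / \<tau>) else 0)"
proof (cases "m = 0")
  case True
  have "(LINT t|lborel. indicator {- (pi / \<tau>)..pi / \<tau>} t *\<^sub>R (1::complex)) = of_real (pi / \<tau>) - of_real (- (pi / \<tau>))"
    using assms by (intro integral_FTC_atLeastAtMost)
      (auto intro!: derivative_eq_intros continuous_intros simp: has_vector_derivative_def scaleR_conv_of_real)
  then show ?thesis using True by simp
next
  case False
  define c where "c = \<tau> * of_int m"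
  have c: "c \<noteq> 0" using False assms by (simp add: c_def)
  define F where "F t = cis (c * t) / (\<i> * of_real c)" for t
  have "(F has_vector_derivative cis (c * t)) (at t within A)" for t A
  proof -
    have "((\<lambda>z. exp (\<i> * of_real c * z) / (\<i> * of_real c)) has_field_derivative exp (\<i> * of_real c * of_real t)) (at (of_real t))"
      using c by (auto intro!: derivative_eq_intros)
    from has_vector_derivative_at_within[OF has_vector_derivative_real_field[OF this]]
    show ?thesis by (simp add: F_def[abs_def] cis_conv_exp mult.assoc)
  qed
  then have "(LINT t|lborel. indicator {- (pi / \<tau>)..pi / \<tau>} t *\<^sub>R cis (c * t)) = F (pi / \<tau>) - F (- (pi / \<tau>))"
    using assms by (intro integral_FTC_atLeastAtMost) (auto intro!: continuous_intros)
  also have "\<dots> = 0"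
  proof -
    have 1: "c * (pi / \<tau>) = pi * of_int m" "c * (- (pi / \<tau>)) = - (pi * of_int m)"
      using assms by (auto simp: c_def)
    have "cis (pi * of_int m) = cis (- (pi * of_int m))"
      by (simp add: complex_eq_iff)
    then show ?thesis unfolding F_def 1 by simp
  qed
  finally show ?thesis using False by (simp add: c_def)
qed

text \<open>The wave and the indicator of the cube both factor over the coordinates, so the integral
  is a product of one-dimensional ones, and one non-zero component of \<xi> annihilates it.\<close>

lemma integral_cis_tbox:
  fixes \<xi> :: "real^'n"
  assumes "\<tau> > 0" "\<xi> \<in> lat \<tau>"
  shows "(LINT x|lborel. indicator (cbox (\<chi> i. - (pi / \<tau>)) (\<chi> i. pi / \<tau>)) x *\<^sub>R cis (\<xi> \<bullet> x))
    = (if \<xi> = 0 then complex_of_real ((2 * pi / \<tau>) ^ CARD('n)) else 0)"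
proof -
  let ?I = "{- (pi / \<tau>)..pi / \<tau>}"
  let ?C = "cbox (\<chi> i. - (pi / \<tau>)) (\<chi> i. pi / \<tau>) :: (real^'n) set"
  let ?F = "\<lambda>x. indicator ?C x *\<^sub>R cis (\<xi> \<bullet> x)"
  interpret product_sigma_finite "\<lambda>_::real^'n. lborel :: real measure"
    by unfold_locales
  have cont: "continuous_on UNIV (\<lambda>x. cis (\<xi> \<bullet> x))" by (intro continuous_intros)
  have Fm: "?F \<in> borel_measurable borel"
    by (intro borel_measurable_scaleR borel_measurable_indicator borel_measurable_continuous_onI cont) simp
  have sum_b: "(\<Sum>b'\<in>Basis. f b' *\<^sub>R b') \<bullet> b = f b" if "b \<in> Basis" for f and b :: "real^'n"
    using that by (simp add: inner_sum_left inner_Basis if_distrib cong: if_cong)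
  have "integral\<^sup>L lborel ?F = (LINT f|(\<Pi>\<^sub>M b\<in>Basis. lborel). ?F (\<Sum>b\<in>Basis. f b *\<^sub>R b))"
    by (subst lborel_eq, rule integral_distr) (use Fm in auto)
  also have "\<dots> = (LINT f|(\<Pi>\<^sub>M b\<in>(Basis::(real^'n) set). lborel). (\<Prod>b\<in>Basis. indicator ?I (f b) *\<^sub>R cis ((\<xi> \<bullet> b) * f b)))"
  proof (rule Bochner_Integration.integral_cong[OF refl])
    fix f :: "real^'n \<Rightarrow> real"
    let ?x = "\<Sum>b\<in>Basis. f b *\<^sub>R b"
    have mem: "?x \<in> ?C \<longleftrightarrow> (\<forall>b\<in>Basis. f b \<in> ?I)"
    proof -
      have "?x \<in> ?C \<longleftrightarrow> (\<forall>b\<in>Basis. - (pi / \<tau>) \<le> ?x \<bullet> b \<and> ?x \<bullet> b \<le> pi / \<tau>)"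
        by (auto simp: mem_box Basis_vec_def inner_axis)
      then show ?thesis using sum_b by simp
    qed
    have "indicator ?C ?x = (\<Prod>b\<in>(Basis::(real^'n) set). indicator ?I (f b) :: real)"
    proof (cases "?x \<in> ?C")
      case True
      then show ?thesis using mem by (simp add: indicator_def)
    next
      case False
      then obtain b where "b \<in> Basis" "f b \<notin> ?I" using mem by blast
      then have "(\<Prod>b\<in>(Basis::(real^'n) set). indicator ?I (f b) :: real) = 0"
        by (intro prod_zero) (auto simp: indicator_def)
      then show ?thesis using False by simp
    qed
    moreover have "cis (\<xi> \<bullet> ?x) = (\<Prod>b\<in>Basis. cis ((\<xi> \<bullet> b) * f b))"
    proof -
      have "\<xi> \<bullet> ?x = (\<Sum>b\<in>Basis. (\<xi> \<bullet> b) * f b)" by (simp add: inner_sum_right mult.commute)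
      moreover have "cis (sum g A) = (\<Prod>b\<in>A. cis (g b))" for g and A :: "(real^'n) set"
        by (induction A rule: infinite_finite_induct) (auto simp: cis_mult[symmetric])
      ultimately show ?thesis by simp
    qed
    ultimately show "?F ?x = (\<Prod>b\<in>Basis. indicator ?I (f b) *\<^sub>R cis ((\<xi> \<bullet> b) * f b))"
      by (simp add: scaleR_conv_of_real prod.distrib)
  qed
  also have "\<dots> = (\<Prod>b\<in>(Basis::(real^'n) set). LINT t|lborel. indicator ?I t *\<^sub>R cis ((\<xi> \<bullet> b) * t))"
  proof (rule product_integral_prod)
    fix b :: "real^'n"
    show "integrable lborel (\<lambda>t. indicator ?I t *\<^sub>R cis ((\<xi> \<bullet> b) * t))"
      by (rule borel_integrable_compact) (auto intro!: continuous_intros)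
  qed simp
  also have "\<dots> = (\<Prod>b\<in>(Basis::(real^'n) set). if \<xi> \<bullet> b = 0 then complex_of_real (2 * pi / \<tau>) else 0)"
  proof (rule prod.cong[OF refl])
    fix b :: "real^'n" assume "b \<in> Basis"
    then obtain i where "b = axis i 1" by (auto simp: Basis_vec_def)
    then have "\<xi> \<bullet> b = \<xi> $ i" by (simp add: inner_axis)
    then obtain m :: int where m: "\<xi> \<bullet> b = \<tau> * of_int m" using assms(2) by (auto simp: lat_def)
    show "(LINT t|lborel. indicator ?I t *\<^sub>R cis ((\<xi> \<bullet> b) * t)) = (if \<xi> \<bullet> b = 0 then complex_of_real (2 * pi / \<tau>) else 0)"
      unfolding m integral_cis_interval[OF assms(1)] using assms(1) by simp
  qed
  also have "\<dots> = (if \<xi> = 0 then complex_of_real ((2 * pi / \<tau>) ^ CARD('n)) else 0)"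
  proof (cases "\<xi> = 0")
    case False
    then obtain b where "b \<in> Basis" "\<xi> \<bullet> b \<noteq> 0" using euclidean_all_zero_iff by blast
    then have "(\<Prod>b\<in>(Basis::(real^'n) set). if \<xi> \<bullet> b = 0 then complex_of_real (2 * pi / \<tau>) else 0) = 0"
      by (intro prod_zero) auto
    then show ?thesis using False by simp
  qed simp
  finally show ?thesis .
qed

definition trig_poly :: "real \<Rightarrow> (real^'n \<Rightarrow> complex) \<Rightarrow> bool" where
  "trig_poly \<tau> g \<longleftrightarrow> (\<exists>F a. finite F \<and> F \<subseteq> lat \<tau> \<and> (\<forall>x. g x = (\<Sum>\<xi>\<in>F. a \<xi> * cis (\<xi> \<bullet> x))))"

lemma trig_poly_single: "\<xi> \<in> lat \<tau> \<Longrightarrow> trig_poly \<tau> (\<lambda>x. c * cis (\<xi> \<bullet> x))"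
  unfolding trig_poly_def by (intro exI[of _ "{\<xi>}"] exI[of _ "\<lambda>_. c"]) auto

lemma trig_poly_const: "trig_poly \<tau> (\<lambda>x. c)"
  using trig_poly_single[OF zero_in_lat, of \<tau> c] by simp

lemma trig_poly_add:
  assumes "trig_poly \<tau> g" "trig_poly \<tau> h" shows "trig_poly \<tau> (\<lambda>x. g x + h x)"
proof -
  obtain F a where F: "finite F" "F \<subseteq> lat \<tau>" "\<And>x. g x = (\<Sum>\<xi>\<in>F. a \<xi> * cis (\<xi> \<bullet> x))"
    using assms(1) by (auto simp: trig_poly_def)
  obtain G b where G: "finite G" "G \<subseteq> lat \<tau>" "\<And>x. h x = (\<Sum>\<xi>\<in>G. b \<xi> * cis (\<xi> \<bullet> x))"
    using assms(2) by (auto simp: trig_poly_def)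
  define a' where "a' \<xi> = (if \<xi> \<in> F then a \<xi> else 0)" for \<xi>
  define b' where "b' \<xi> = (if \<xi> \<in> G then b \<xi> else 0)" for \<xi>
  have "g x = (\<Sum>\<xi>\<in>F\<union>G. a' \<xi> * cis (\<xi> \<bullet> x))" for x
    unfolding F(3) by (rule sum.mono_neutral_cong_left) (use F G in \<open>auto simp: a'_def\<close>)
  moreover have "h x = (\<Sum>\<xi>\<in>F\<union>G. b' \<xi> * cis (\<xi> \<bullet> x))" for x
    unfolding G(3) by (rule sum.mono_neutral_cong_left) (use F G in \<open>auto simp: b'_def\<close>)
  ultimately have "g x + h x = (\<Sum>\<xi>\<in>F\<union>G. (a' \<xi> + b' \<xi>) * cis (\<xi> \<bullet> x))" for x
    by (simp add: sum.distrib distrib_right)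
  then show ?thesis unfolding trig_poly_def using F G
    by (intro exI[of _ "F \<union> G"] exI[of _ "\<lambda>\<xi>. a' \<xi> + b' \<xi>"]) auto
qed

lemma trig_poly_sum: "(\<And>i. i \<in> I \<Longrightarrow> trig_poly \<tau> (g i)) \<Longrightarrow> trig_poly \<tau> (\<lambda>x. \<Sum>i\<in>I. g i x)"
  by (induction I rule: infinite_finite_induct) (auto simp: trig_poly_const trig_poly_add)

lemma trig_poly_mult:
  assumes "trig_poly \<tau> g" "trig_poly \<tau> h" shows "trig_poly \<tau> (\<lambda>x. g x * h x)"
proof -
  obtain F a where F: "finite F" "F \<subseteq> lat \<tau>" "\<And>x. g x = (\<Sum>\<xi>\<in>F. a \<xi> * cis (\<xi> \<bullet> x))"
    using assms(1) by (auto simp: trig_poly_def)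
  obtain G b where G: "finite G" "G \<subseteq> lat \<tau>" "\<And>x. h x = (\<Sum>\<xi>\<in>G. b \<xi> * cis (\<xi> \<bullet> x))"
    using assms(2) by (auto simp: trig_poly_def)
  have "g x * h x = (\<Sum>\<xi>\<in>F. \<Sum>\<eta>\<in>G. (a \<xi> * b \<eta>) * cis ((\<xi> + \<eta>) \<bullet> x))" for x
    unfolding F(3) G(3) sum_product
    by (intro sum.cong refl) (simp add: inner_add_left cis_mult[symmetric])
  moreover have "trig_poly \<tau> (\<lambda>x. \<Sum>\<xi>\<in>F. \<Sum>\<eta>\<in>G. (a \<xi> * b \<eta>) * cis ((\<xi> + \<eta>) \<bullet> x))"
    by (intro trig_poly_sum trig_poly_single lat_add) (use F G in auto)
  ultimately show ?thesis by simp
qed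

text \<open>The map onto the torus is injective up to identification of boundary points. Functions
  that vanish off the open cube therefore descend to the torus.\<close>

lemma torus_map_eq:
  assumes "\<tau> > 0" "x \<in> cbox (\<chi> i. - (pi / \<tau>)) (\<chi> i. pi / \<tau>)" "y \<in> cbox (\<chi> i. - (pi / \<tau>)) (\<chi> i. pi / \<tau>)"
    "\<And>i. cis (\<tau> * x $ i) = cis (\<tau> * y $ i)"
  shows "x = y \<or> (x \<notin> tbox \<tau> \<and> y \<notin> tbox \<tau>)"
proof -
  have "x $ i = y $ i \<or> (\<bar>x $ i\<bar> = pi / \<tau> \<and> \<bar>y $ i\<bar> = pi / \<tau>)" for i
  proof -
    have "sin (\<tau> * x $ i) = sin (\<tau> * y $ i) \<and> cos (\<tau> * x $ i) = cos (\<tau> * y $ i)"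
      using assms(4)[of i] by (simp add: complex_eq_iff)
    then obtain m :: int where m: "\<tau> * x $ i = \<tau> * y $ i + 2 * pi * of_int m"
      using sin_cos_eq_iff by (metis (no_types, opaque_lifting))
    have b: "\<bar>\<tau> * x $ i\<bar> \<le> pi" "\<bar>\<tau> * y $ i\<bar> \<le> pi"
    proof -
      have "\<bar>\<tau> * z\<bar> \<le> pi" if "- (pi / \<tau>) \<le> z" "z \<le> pi / \<tau>" for z
      proof -
        have "\<bar>z\<bar> \<le> pi / \<tau>" using that by linarith
        then show ?thesis using assms(1) by (simp add: abs_mult field_simps)
      qed
      then show "\<bar>\<tau> * x $ i\<bar> \<le> pi" "\<bar>\<tau> * y $ i\<bar> \<le> pi"
        using assms(2,3) by (auto simp: mem_box_cart)
    qed
    \<comment> \<open>Both angles lie in [-pi, pi], so they differ by at most one full turn, and a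
      full turn occurs only between opposite faces.\<close>
    have "\<bar>2 * pi * of_int m\<bar> \<le> 2 * pi" using m b by linarith
    then have "\<bar>real_of_int m\<bar> \<le> 1" by (simp add: abs_mult)
    then have "m = 0 \<or> m = 1 \<or> m = -1" by linarith
    then consider "m = 0" | "\<tau> * x $ i = pi \<and> \<tau> * y $ i = - pi" | "\<tau> * x $ i = - pi \<and> \<tau> * y $ i = pi"
      using m b by fastforce
    then show ?thesis
    proof cases
      case 1 then show ?thesis using m assms(1) by simp
    next
      case 2
      then have "x $ i = pi / \<tau>" "y $ i = - pi / \<tau>" using assms(1) by (auto simp: field_simps)
      then show ?thesis using assms(1) by simp
    next
      case 3
      then have "x $ i = - pi / \<tau>" "y $ i = pi / \<tau>" using assms(1) by (auto simp: field_simps)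
      then show ?thesis using assms(1) by simp
    qed
  qed
  then show ?thesis
    unfolding vec_eq_iff mem_tbox by (metis abs_less_iff minus_less_iff less_irrefl)
qed

text \<open>Stone--Weierstrass on the torus, realised as the image of the closed cube under
  \<open>x \<mapsto> (cis (\<tau> x\<^sub>i))\<^sub>i\<close>.\<close>

lemma trig_poly_dense:
  fixes \<phi> :: "real^'n \<Rightarrow> real"
  assumes "\<tau> > 0" "continuous_on UNIV \<phi>" "\<And>x. x \<notin> tbox \<tau> \<Longrightarrow> \<phi> x = 0" "\<epsilon> > 0"
  shows "\<exists>g. trig_poly \<tau> g \<and> (\<forall>x\<in>tbox \<tau>. norm (complex_of_real (\<phi> x) - g x) < \<epsilon>)"
proof -
  let ?C = "cbox (\<chi> i. - (pi / \<tau>)) (\<chi> i. pi / \<tau>) :: (real^'n) set"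
  define p :: "real^'n \<Rightarrow> complex^'n" where "p x = (\<chi> i. cis (\<tau> * x $ i))" for x
  define T where "T = p ` ?C"
  have pc: "continuous_on S p" for S unfolding p_def by (intro continuous_intros)
  have T: "compact T" unfolding T_def by (intro compact_continuous_image pc) simp
  \<comment> \<open>The choice of the preimage is harmless: \<open>p\<close> identifies distinct
    points only outside the open cube, where \<phi> vanishes.\<close>
  define \<Phi> where "\<Phi> z = \<phi> (SOME x. x \<in> ?C \<and> p x = z)" for z
  have \<Phi>: "\<Phi> (p x) = \<phi> x" if "x \<in> ?C" for x
  proof -
    define y where "y = (SOME y. y \<in> ?C \<and> p y = p x)"
    have y: "y \<in> ?C \<and> p y = p x" unfolding y_def by (rule someI[of _ x]) (use that in simp)
    then have "cis (\<tau> * x $ i) = cis (\<tau> * y $ i)" for i by (simp add: p_def vec_eq_iff)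
    from torus_map_eq[OF assms(1) that _ this] y have "x = y \<or> \<phi> x = 0 \<and> \<phi> y = 0" using assms(3) by blast
    then show ?thesis unfolding \<Phi>_def y_def[symmetric] by auto
  qed
  \<comment> \<open>The preimage under \<Phi> of a closed set is the image under \<open>p\<close> of
    a compact set, so continuity passes from the cube to the torus.\<close>
  have \<Phi>c: "continuous_on T \<Phi>"
    unfolding continuous_on_closed
  proof (intro allI impI)
    fix U assume U: "closedin (top_of_set (\<Phi> ` T)) U"
    have im: "\<Phi> ` T = \<phi> ` ?C" unfolding T_def image_image using \<Phi> by (rule image_cong[OF refl])
    have "continuous_on ?C \<phi>" using assms(2) by (rule continuous_on_subset) simp
    then have "closedin (top_of_set ?C) (?C \<inter> \<phi> -` U)" using U unfolding im continuous_on_closed by blast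
    then have "compact (?C \<inter> \<phi> -` U)" using closedin_compact[OF compact_cbox] by blast
    then have cl: "closed (p ` (?C \<inter> \<phi> -` U))" by (intro compact_imp_closed compact_continuous_image pc)
    have "p x \<in> T \<inter> \<Phi> -` U" if "x \<in> ?C" "\<phi> x \<in> U" for x
      using that \<Phi>[of x] by (simp add: T_def)
    moreover have "\<phi> x \<in> U" if "x \<in> ?C" "\<Phi> (p x) \<in> U" for x using that \<Phi>[of x] by simp
    ultimately have "p ` (?C \<inter> \<phi> -` U) = T \<inter> \<Phi> -` U" by (auto simp: T_def)
    with cl show "closedin (top_of_set T) (T \<inter> \<Phi> -` U)" by (metis closed_subset inf_le1)
  qed
  \<comment> \<open>The algebra for Stone-Weierstrass consists of real functions on the torus whose
    pullbacks to the cube are trigonometric polynomials.\<close>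
  define P where "P f \<longleftrightarrow> continuous_on T f \<and> trig_poly \<tau> (\<lambda>x. complex_of_real (f (p x)))" for f :: "complex^'n \<Rightarrow> real"
  have cis_coord: "trig_poly \<tau> (\<lambda>x. cis (\<tau> * x $ i))" "trig_poly \<tau> (\<lambda>x. cis (- (\<tau> * x $ i)))" for i
    using trig_poly_single[OF lat_axis[of i \<tau>], where c = 1]
      trig_poly_single[OF lat_uminus[OF lat_axis[of i \<tau>]], where c = 1]
    by (auto simp: inner_axis')
  have re: "P (\<lambda>z. Re (z $ i))" for i
  proof -
    have eq: "complex_of_real (Re (p x $ i)) = (1/2) * (cis (\<tau> * x $ i) + cis (- (\<tau> * x $ i)))" for x
      by (simp add: p_def complex_eq_iff)
    have tp: "trig_poly \<tau> (\<lambda>x. (1/2) * (cis (\<tau> * x $ i) + cis (- (\<tau> * x $ i))))"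
      by (intro trig_poly_mult trig_poly_add trig_poly_const cis_coord)
    show ?thesis unfolding P_def eq using tp by (auto intro!: continuous_intros)
  qed
  have im: "P (\<lambda>z. Im (z $ i))" for i
  proof -
    have eq: "complex_of_real (Im (p x $ i)) = (- \<i>/2) * (cis (\<tau> * x $ i) + (- 1) * cis (- (\<tau> * x $ i)))" for x
      by (simp add: p_def complex_eq_iff)
    have tp: "trig_poly \<tau> (\<lambda>x. (- \<i>/2) * (cis (\<tau> * x $ i) + (- 1) * cis (- (\<tau> * x $ i))))"
      by (intro trig_poly_mult trig_poly_add trig_poly_const cis_coord)
    show ?thesis unfolding P_def eq using tp by (auto intro!: continuous_intros)
  qed
  have "\<exists>f. P f \<and> (\<forall>z\<in>T. \<bar>\<Phi> z - f z\<bar> < \<epsilon>)"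
  proof (rule Stone_Weierstrass_HOL[OF T _ _ _ _ _ \<Phi>c assms(4)])
    show "P (\<lambda>x. c)" for c by (simp add: P_def trig_poly_const)
    show "continuous_on T f" if "P f" for f using that by (simp add: P_def)
    show "P (\<lambda>x. f x + g x)" if "P f \<and> P g" for f g
      using that trig_poly_add[of \<tau> "\<lambda>x. complex_of_real (f (p x))" "\<lambda>x. complex_of_real (g (p x))"]
      by (simp add: P_def continuous_on_add)
    show "P (\<lambda>x. f x * g x)" if "P f \<and> P g" for f g
      using that trig_poly_mult[of \<tau> "\<lambda>x. complex_of_real (f (p x))" "\<lambda>x. complex_of_real (g (p x))"]
      by (simp add: P_def continuous_on_mult)
    show "\<exists>f. P f \<and> f x \<noteq> f y" if xy: "x \<in> T \<and> y \<in> T \<and> x \<noteq> y" for x y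
    proof -
      obtain i where "x $ i \<noteq> y $ i" using xy by (auto simp: vec_eq_iff)
      then have "Re (x $ i) \<noteq> Re (y $ i) \<or> Im (x $ i) \<noteq> Im (y $ i)" by (simp add: complex_eq_iff)
      then show ?thesis using re[of i] im[of i] by blast
    qed
  qed
  then obtain f where f: "P f" "\<And>z. z \<in> T \<Longrightarrow> \<bar>\<Phi> z - f z\<bar> < \<epsilon>" by blast
  have "norm (complex_of_real (\<phi> x) - complex_of_real (f (p x))) < \<epsilon>" if "x \<in> tbox \<tau>" for x
  proof -
    have "x \<in> ?C" using that box_subset_cbox unfolding tbox_def by blast
    then show ?thesis using f(2)[of "p x"] \<Phi>[of x] by (simp add: T_def flip: of_real_diff)
  qed
  then show ?thesis using f(1) unfolding P_def by blast
qed

section \<open>Fourier analysis of functions on \<Omega>, extended by zero to a surrounding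
  cube\<close>

locale boxed_open = bounded_open \<Omega> for \<Omega> :: "(real^'n) set" +
  fixes \<tau> :: real
  assumes \<tau>_pos: "\<tau> > 0" and \<Omega>_tbox: "\<Omega> \<subseteq> tbox \<tau>"
begin

sublocale Q: bounded_open "tbox \<tau> :: (real^'n) set"
  by unfold_locales (simp_all add: tbox_def open_box)

text \<open>\<open>\<kappa>\<close> is the inverse volume of the cube.\<close>

definition \<kappa> :: real where "\<kappa> = (\<tau> / (2 * pi)) ^ CARD('n)"

lemma \<kappa>_pos: "0 < \<kappa>"
  using \<tau>_pos by (simp add: \<kappa>_def)

text \<open>Fourier coefficients without the normalising factor \<open>sqrt \<kappa>\<close>;
  integrating over \<Omega> alone amounts to extension by zero.\<close>

definition tcos :: "(real^'n \<Rightarrow> real) \<Rightarrow> real^'n \<Rightarrow> real" where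
  "tcos f \<xi> = L2inner \<Omega> f (\<lambda>x. cos (\<xi> \<bullet> x))"

definition tsin :: "(real^'n \<Rightarrow> real) \<Rightarrow> real^'n \<Rightarrow> real" where
  "tsin f \<xi> = L2inner \<Omega> f (\<lambda>x. sin (\<xi> \<bullet> x))"

lemma trig_L2: "(\<lambda>x. cos (\<xi> \<bullet> x)) \<in> L2 \<Omega>" "(\<lambda>x. sin (\<xi> \<bullet> x)) \<in> L2 \<Omega>"
  by (rule L2_bounded[of _ 1]; auto intro!: continuous_measurable_M continuous_intros)+

text \<open>Complex functions are treated as functions into a real plane, so each frequency
  contributes two orthonormal elements, the wave and its product with \<i>. The real Bessel
  inequality then applies to complex series.\<close>

definition ebasis :: "(real^'n) \<times> bool \<Rightarrow> real^'n \<Rightarrow> complex" where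
  "ebasis k x = sqrt \<kappa> *\<^sub>R ((if snd k then 1 else \<i>) * cis (fst k \<bullet> x))"

lemma ebasis_L2: "ebasis k \<in> L2 (tbox \<tau>)"
proof (rule Q.L2_bounded)
  show "ebasis k \<in> borel_measurable Q.M"
    unfolding ebasis_def[abs_def] by (intro Q.continuous_measurable_M continuous_intros)
  show "AE x in Q.M. norm (ebasis k x) \<le> sqrt \<kappa>"
    using \<kappa>_pos by (auto simp: ebasis_def norm_mult)
qed

lemma integral_Q_cis:
  assumes "\<xi> \<in> lat \<tau>"
  shows "integrable Q.M (\<lambda>x. cis (\<xi> \<bullet> x))"
    and "(LINT x|Q.M. cis (\<xi> \<bullet> x)) = (if \<xi> = 0 then complex_of_real (1 / \<kappa>) else 0)"
proof -
  let ?C = "cbox (\<chi> i. - (pi / \<tau>)) (\<chi> i. pi / \<tau>) :: (real^'n) set"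
  have cont: "continuous_on UNIV (\<lambda>x. cis (\<xi> \<bullet> x))" by (intro continuous_intros)
  have [measurable]: "(\<lambda>x. cis (\<xi> \<bullet> x)) \<in> borel_measurable borel"
    by (rule borel_measurable_continuous_onI[OF cont])
  have [measurable]: "(tbox \<tau> :: (real^'n) set) \<in> sets borel" by (simp add: tbox_def)
  show "integrable Q.M (\<lambda>x. cis (\<xi> \<bullet> x))"
    by (intro Q.L2_integrable Q.L2_bounded[of _ 1] Q.continuous_measurable_M cont) simp
  have "(LINT x|Q.M. cis (\<xi> \<bullet> x)) = (LINT x|lebesgue. indicator (tbox \<tau>) x *\<^sub>R cis (\<xi> \<bullet> x))"
    using Q.\<Omega>_sets by (intro integral_restrict_space) simp
  also have "\<dots> = (LINT x|lborel. indicator (tbox \<tau>) x *\<^sub>R cis (\<xi> \<bullet> x))"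
    by (rule integral_completion) measurable
  also have "\<dots> = (LINT x|lborel. indicator ?C x *\<^sub>R cis (\<xi> \<bullet> x))"
  proof (rule integral_cong_AE)
    have "AE x in lborel. x \<notin> ?C - tbox \<tau>"
    proof (rule AE_not_in)
      show "?C - tbox \<tau> \<in> null_sets lborel"
        unfolding tbox_def null_sets_def by (simp add: emeasure_Diff emeasure_lborel_cbox_eq emeasure_lborel_box_eq box_subset_cbox)
    qed
    then show "AE x in lborel. indicator (tbox \<tau>) x *\<^sub>R cis (\<xi> \<bullet> x) = indicator ?C x *\<^sub>R cis (\<xi> \<bullet> x)"
    proof eventually_elim
      case (elim x)
      have "tbox \<tau> \<subseteq> ?C" unfolding tbox_def by (rule box_subset_cbox)
      then have "x \<in> tbox \<tau> \<longleftrightarrow> x \<in> ?C" using elim by blast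
      then show ?case by (simp add: indicator_def)
    qed
  qed measurable
  also have "\<dots> = (if \<xi> = 0 then complex_of_real (1 / \<kappa>) else 0)"
    unfolding integral_cis_tbox[OF \<tau>_pos assms] by (simp add: \<kappa>_def power_divide)
  finally show "(LINT x|Q.M. cis (\<xi> \<bullet> x)) = (if \<xi> = 0 then complex_of_real (1 / \<kappa>) else 0)" .
qed

lemma inner_complex_cnj: "z \<bullet> w = Re (z * cnj w)" for z w :: complex
  by (simp add: inner_complex_def)

lemma ebasis_orthonormal:
  assumes "fst k \<in> lat \<tau>" "fst l \<in> lat \<tau>"
  shows "L2inner (tbox \<tau>) (ebasis k) (ebasis l) = (if k = l then 1 else 0)"
proof -
  define c where "c = complex_of_real \<kappa> * ((if snd k then 1 else \<i>) * cnj (if snd l then 1 else \<i>))"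
  have "ebasis k x \<bullet> ebasis l x = Re (c * cis ((fst k - fst l) \<bullet> x))" for x
  proof -
    have "cis (fst k \<bullet> x) * cnj (cis (fst l \<bullet> x)) = cis ((fst k - fst l) \<bullet> x)"
      by (simp add: cis_cnj cis_mult inner_diff_left)
    moreover have "complex_of_real (sqrt \<kappa>) * complex_of_real (sqrt \<kappa>) = complex_of_real \<kappa>"
      using \<kappa>_pos by (simp flip: of_real_mult)
    ultimately show ?thesis
      by (simp add: inner_complex_cnj ebasis_def c_def scaleR_conv_of_real mult.assoc mult.left_commute abs_of_pos[OF \<kappa>_pos])
  qed
  then have "L2inner (tbox \<tau>) (ebasis k) (ebasis l) = (LINT x|Q.M. Re (c * cis ((fst k - fst l) \<bullet> x)))"
    by (simp add: L2inner_def)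
  also have "\<dots> = Re (c * (LINT x|Q.M. cis ((fst k - fst l) \<bullet> x)))"
    using integral_Q_cis(1)[OF lat_diff[OF assms]] by (simp del: times_complex.sel)
  also have "\<dots> = (if k = l then 1 else 0)"
    unfolding integral_Q_cis(2)[OF lat_diff[OF assms]] using \<kappa>_pos
    by (auto simp: c_def prod_eq_iff)
  finally show ?thesis .
qed

text \<open>Values outside \<Omega> carry no meaning, hence the explicit indicator; the complex
  codomain matches that of \<open>ebasis\<close>.\<close>

definition zero_ext :: "(real^'n \<Rightarrow> real) \<Rightarrow> real^'n \<Rightarrow> complex" where
  "zero_ext f x = complex_of_real (indicator \<Omega> x * f x)"

lemma integral_Q_indicator: "(LINT x|Q.M. indicator \<Omega> x * h x) = (LINT x|M. (h x :: real))"
proof -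
  have "(LINT x|Q.M. indicator \<Omega> x * h x) = (LINT x|lebesgue. indicator (tbox \<tau>) x *\<^sub>R (indicator \<Omega> x * h x))"
    using Q.\<Omega>_sets by (intro integral_restrict_space) simp
  also have "\<dots> = (LINT x|lebesgue. indicator \<Omega> x *\<^sub>R h x)"
    using \<Omega>_tbox by (intro Bochner_Integration.integral_cong) (auto simp: indicator_def)
  also have "\<dots> = (LINT x|M. h x)" using \<Omega>_sets by (intro integral_restrict_space[symmetric]) simp
  finally show ?thesis .
qed

lemma zero_ext_L2: assumes "f \<in> L2 \<Omega>" shows "zero_ext f \<in> L2 (tbox \<tau>)"
proof (rule Q.L2I)
  have "(\<lambda>x. indicator \<Omega> x *\<^sub>R f x) \<in> borel_measurable lebesgue"
    using L2_measurable[OF assms] \<Omega>_sets by (subst borel_measurable_restrict_space_iff[symmetric]) auto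
  then have "(\<lambda>x. indicator \<Omega> x *\<^sub>R f x) \<in> borel_measurable Q.M" by (rule measurable_restrict_space1)
  then have "(\<lambda>x. indicator \<Omega> x * f x) \<in> borel_measurable Q.M" by simp
  from borel_measurable_continuous_on[OF continuous_on_of_real_id this]
  show "zero_ext f \<in> borel_measurable Q.M" unfolding zero_ext_def[abs_def] .
  have "integrable lebesgue (\<lambda>x. indicator \<Omega> x *\<^sub>R (norm (f x))\<^sup>2)"
    using L2_integrable_sq[OF assms] \<Omega>_sets by (subst integrable_restrict_space[symmetric]) auto
  then have "integrable lebesgue (\<lambda>x. indicator (tbox \<tau>) x *\<^sub>R (norm (zero_ext f x))\<^sup>2)"
    by (rule Bochner_Integration.integrable_cong[THEN iffD1, rotated 2])
      (use \<Omega>_tbox in \<open>auto simp: zero_ext_def indicator_def\<close>)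
  then show "integrable Q.M (\<lambda>x. (norm (zero_ext f x))\<^sup>2)"
    using Q.\<Omega>_sets by (subst integrable_restrict_space) auto
qed

lemma zero_ext_norm: "L2inner (tbox \<tau>) (zero_ext f) (zero_ext f) = L2inner \<Omega> f f"
proof -
  have "zero_ext f x \<bullet> zero_ext f x = indicator \<Omega> x * (f x * f x)" for x
    by (simp add: zero_ext_def inner_complex_def indicator_def)
  then show ?thesis unfolding L2inner_def using integral_Q_indicator by simp
qed

lemma zero_ext_ebasis:
  "L2inner (tbox \<tau>) (zero_ext f) (ebasis (\<xi>, b)) = sqrt \<kappa> * (if b then tcos f \<xi> else - tsin f \<xi>)"
proof -
  have "zero_ext f x \<bullet> ebasis (\<xi>, b) x = indicator \<Omega> x * (sqrt \<kappa> * (if b then f x * cos (\<xi> \<bullet> x) else - (f x * sin (\<xi> \<bullet> x))))" for x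
    by (simp add: zero_ext_def ebasis_def inner_complex_def)
  then show ?thesis unfolding L2inner_def tcos_def tsin_def
    by (simp add: integral_Q_indicator del: mult_minus_right)
qed

lemma sum_ebasis_sq:
  "(\<Sum>k\<in>F \<times> UNIV. (L2inner (tbox \<tau>) (zero_ext f) (ebasis k))\<^sup>2) = \<kappa> * (\<Sum>\<xi>\<in>F. (tcos f \<xi>)\<^sup>2 + (tsin f \<xi>)\<^sup>2)"
proof -
  have "(\<Sum>k\<in>F \<times> UNIV. (L2inner (tbox \<tau>) (zero_ext f) (ebasis k))\<^sup>2)
      = (\<Sum>\<xi>\<in>F. \<Sum>b\<in>UNIV. (L2inner (tbox \<tau>) (zero_ext f) (ebasis (\<xi>, b)))\<^sup>2)"
    by (simp add: sum.cartesian_product)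
  also have "\<dots> = (\<Sum>\<xi>\<in>F. \<kappa> * ((tcos f \<xi>)\<^sup>2 + (tsin f \<xi>)\<^sup>2))"
    using \<kappa>_pos by (intro sum.cong refl) (simp add: zero_ext_ebasis UNIV_bool power_mult_distrib distrib_left add.commute)
  finally show ?thesis by (simp add: sum_distrib_left)
qed

lemma Bessel_trig:
  assumes "f \<in> L2 \<Omega>" "finite F" "F \<subseteq> lat \<tau>"
  shows "\<kappa> * (\<Sum>\<xi>\<in>F. (tcos f \<xi>)\<^sup>2 + (tsin f \<xi>)\<^sup>2) \<le> L2inner \<Omega> f f"
  using Q.L2.Bessel[of "F \<times> UNIV" ebasis "zero_ext f"] assms
  by (auto simp: ebasis_L2 zero_ext_L2 ebasis_orthonormal subset_iff sum_ebasis_sq zero_ext_norm mem_Times_iff)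

text \<open>A test function vanishes near the boundary of the cube, so it is uniformly close to a
  trigonometric polynomial. By \<open>Bessel_defect\<close> its own Fourier coefficients on the same
  frequencies do at least as well.\<close>

lemma Parseval_test:
  assumes \<phi>: "\<phi> \<in> test_functions \<Omega>" and "\<epsilon> > 0"
  shows "\<exists>F. finite F \<and> F \<subseteq> lat \<tau> \<and>
    L2inner \<Omega> \<phi> \<phi> \<le> \<kappa> * (\<Sum>\<xi>\<in>F. (tcos \<phi> \<xi>)\<^sup>2 + (tsin \<phi> \<xi>)\<^sup>2) + \<epsilon>"
proof -
  obtain K where K: "\<And>m. Ck m \<phi>" "K \<subseteq> \<Omega>" "\<And>x. x \<notin> K \<Longrightarrow> \<phi> x = 0"
    using \<phi> by (rule test_functionE) blast
  have c: "continuous_on UNIV \<phi>" using K(1)[of 0] by simp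
  have 0: "\<phi> x = 0" if "x \<notin> \<Omega>" for x using K that by blast
  define v where "v = measure lebesgue (tbox \<tau> :: (real^'n) set)"
  have v: "0 \<le> v" by (simp add: v_def)
  define \<delta> where "\<delta> = sqrt (\<epsilon> / (v + 1))"
  have \<delta>: "\<delta> > 0" "\<delta>\<^sup>2 * v \<le> \<epsilon>" using v assms(2) by (auto simp: \<delta>_def field_simps)
  obtain g where g: "trig_poly \<tau> g" "\<And>x. x \<in> tbox \<tau> \<Longrightarrow> norm (complex_of_real (\<phi> x) - g x) < \<delta>"
    using trig_poly_dense[OF \<tau>_pos c _ \<delta>(1)] 0 \<Omega>_tbox by blast
  obtain F a where F: "finite F" "F \<subseteq> lat \<tau>" "\<And>x. g x = (\<Sum>\<xi>\<in>F. a \<xi> * cis (\<xi> \<bullet> x))"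
    using g(1) by (auto simp: trig_poly_def)
  \<comment> \<open>Real and imaginary parts of the complex coefficients become real coefficients of
    the two basis elements per frequency.\<close>
  define b where "b k = (if snd k then Re (a (fst k)) else Im (a (fst k))) / sqrt \<kappa>" for k :: "(real^'n) \<times> bool"
  have gb: "g x = (\<Sum>k\<in>F \<times> UNIV. b k *\<^sub>R ebasis k x)" for x
  proof -
    have "(\<Sum>k\<in>F \<times> UNIV. b k *\<^sub>R ebasis k x) = (\<Sum>\<xi>\<in>F. \<Sum>c\<in>UNIV. b (\<xi>, c) *\<^sub>R ebasis (\<xi>, c) x)"
      by (simp add: sum.cartesian_product)
    also have "\<dots> = (\<Sum>\<xi>\<in>F. a \<xi> * cis (\<xi> \<bullet> x))"
    proof (rule sum.cong[OF refl])
      fix \<xi>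
      have "a \<xi> * cis (\<xi> \<bullet> x) = Re (a \<xi>) *\<^sub>R cis (\<xi> \<bullet> x) + Im (a \<xi>) *\<^sub>R (\<i> * cis (\<xi> \<bullet> x))"
        by (simp add: complex_eq_iff)
      then show "(\<Sum>c\<in>UNIV. b (\<xi>, c) *\<^sub>R ebasis (\<xi>, c) x) = a \<xi> * cis (\<xi> \<bullet> x)"
        using \<kappa>_pos by (simp add: UNIV_bool b_def ebasis_def add.commute)
    qed
    finally show ?thesis unfolding F(3) by simp
  qed
  have \<phi>L: "\<phi> \<in> L2 \<Omega>" by (rule test_L2[OF \<phi>])
  have gL: "g \<in> L2 (tbox \<tau>)" unfolding gb[abs_def] by (intro Q.L2.lincomb_mem ebasis_L2)
  let ?d = "\<lambda>x. zero_ext \<phi> x - g x"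
  have dL: "?d \<in> L2 (tbox \<tau>)" by (intro Q.L2.diff_mem zero_ext_L2 \<phi>L gL)
  have "L2inner (tbox \<tau>) (zero_ext \<phi>) (zero_ext \<phi>) - (\<Sum>k\<in>F \<times> UNIV. (L2inner (tbox \<tau>) (zero_ext \<phi>) (ebasis k))\<^sup>2)
      \<le> L2inner (tbox \<tau>) ?d ?d"
    unfolding gb
  proof (rule Q.L2.Bessel_defect)
    show "L2inner (tbox \<tau>) (ebasis k) (ebasis l) = (if k = l then 1 else 0)"
      if "k \<in> F \<times> UNIV" "l \<in> F \<times> UNIV" for k l
      using that F(2) by (intro ebasis_orthonormal) auto
  qed (use F(1) in \<open>auto simp: ebasis_L2 zero_ext_L2 \<phi>L\<close>)
  also have "\<dots> = (LINT x|Q.M. (norm (?d x))\<^sup>2)" by (simp add: L2inner_def power2_norm_eq_inner)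
  also have "\<dots> \<le> (LINT x|Q.M. \<delta>\<^sup>2)"
  proof (rule integral_mono[OF Q.L2_integrable_sq[OF dL]])
    interpret finite_measure Q.M by (rule Q.finite_measure_M)
    show "integrable Q.M (\<lambda>x. \<delta>\<^sup>2)" by simp
    fix x :: "real^'n" assume "x \<in> space Q.M"
    then have x: "x \<in> tbox \<tau>" by simp
    have "zero_ext \<phi> x = complex_of_real (\<phi> x)" using 0[of x] by (cases "x \<in> \<Omega>") (auto simp: zero_ext_def)
    then show "(norm (?d x))\<^sup>2 \<le> \<delta>\<^sup>2" using g(2)[OF x] by (intro power_mono) auto
  qed
  also have "\<dots> = \<delta>\<^sup>2 * v" using Q.measure_M by (simp add: v_def)
  also have "\<dots> \<le> \<epsilon>" by (rule \<delta>)
  finally show ?thesis unfolding sum_ebasis_sq zero_ext_norm using F by (intro exI[of _ F]) auto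
qed

definition low :: "real \<Rightarrow> (real^'n) set" where
  "low \<Lambda> = {\<xi> \<in> lat \<tau>. (norm \<xi>)\<^sup>2 < \<Lambda>}"

lemma finite_low: "finite (low \<Lambda>)"
proof -
  have "low \<Lambda> \<subseteq> (\<lambda>m::'n \<Rightarrow> int. \<chi> i. \<tau> * of_int (m i)) ` {m. \<forall>i. m i \<in> {- \<lceil>sqrt \<bar>\<Lambda>\<bar> / \<tau>\<rceil>..\<lceil>sqrt \<bar>\<Lambda>\<bar> / \<tau>\<rceil>}}"
  proof
    fix \<xi> assume \<xi>: "\<xi> \<in> low \<Lambda>"
    then obtain m :: "'n \<Rightarrow> int" where m: "\<And>i. \<xi> $ i = \<tau> * of_int (m i)"
      unfolding low_def lat_def by (auto simp: choice_iff)
    have "m i \<in> {- \<lceil>sqrt \<bar>\<Lambda>\<bar> / \<tau>\<rceil>..\<lceil>sqrt \<bar>\<Lambda>\<bar> / \<tau>\<rceil>}" for i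
    proof -
      have "\<bar>\<xi> $ i\<bar> \<le> norm \<xi>" by (rule component_le_norm_cart)
      also have "norm \<xi> \<le> sqrt \<bar>\<Lambda>\<bar>" using \<xi> by (intro real_le_rsqrt) (auto simp: low_def)
      finally have "\<bar>real_of_int (m i)\<bar> \<le> sqrt \<bar>\<Lambda>\<bar> / \<tau>" using m \<tau>_pos by (simp add: abs_mult field_simps)
      then have "\<bar>m i\<bar> \<le> \<lceil>sqrt \<bar>\<Lambda>\<bar> / \<tau>\<rceil>" by linarith
      then show ?thesis by (simp add: abs_le_iff)
    qed
    then show "\<xi> \<in> (\<lambda>m::'n \<Rightarrow> int. \<chi> i. \<tau> * of_int (m i)) ` {m. \<forall>i. m i \<in> {- \<lceil>sqrt \<bar>\<Lambda>\<bar> / \<tau>\<rceil>..\<lceil>sqrt \<bar>\<Lambda>\<bar> / \<tau>\<rceil>}}"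
      by (intro image_eqI[of _ _ m]) (auto simp: vec_eq_iff m)
  qed
  moreover have "finite {m::'n \<Rightarrow> int. \<forall>i. m i \<in> {- \<lceil>sqrt \<bar>\<Lambda>\<bar> / \<tau>\<rceil>..\<lceil>sqrt \<bar>\<Lambda>\<bar> / \<tau>\<rceil>}}"
    using finite_PiE[of "UNIV :: 'n set" "\<lambda>_. {- \<lceil>sqrt \<bar>\<Lambda>\<bar> / \<tau>\<rceil>..\<lceil>sqrt \<bar>\<Lambda>\<bar> / \<tau>\<rceil>}"]
    by (simp add: PiE_UNIV_domain Pi_def)
  ultimately show ?thesis by (meson finite_imageI finite_subset)
qed

lemma L2inner_vec:
  fixes G H :: "real^'n \<Rightarrow> real^'n"
  assumes "G \<in> L2 \<Omega>" "H \<in> L2 \<Omega>"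
  shows "L2inner \<Omega> G H = (\<Sum>j\<in>UNIV. L2inner \<Omega> (\<lambda>x. G x $ j) (\<lambda>x. H x $ j))"
  unfolding L2inner_def inner_vec_def
  using L2_inner_integrable[OF L2_component L2_component, OF assms] by (intro Bochner_Integration.integral_sum) simp

lemma trig_coeff_grad:
  assumes "\<phi> \<in> test_functions \<Omega>"
  shows "tcos (\<lambda>x. grad \<phi> x $ j) \<xi> = \<xi> $ j * tsin \<phi> \<xi>" "tsin (\<lambda>x. grad \<phi> x $ j) \<xi> = - \<xi> $ j * tcos \<phi> \<xi>"
proof -
  have 1: "\<phi> x * ((- sin (\<xi> \<bullet> x)) *\<^sub>R \<xi>) $ j = - (\<xi> $ j * (\<phi> x * sin (\<xi> \<bullet> x)))" for x by simp
  have 2: "\<phi> x * (cos (\<xi> \<bullet> x) *\<^sub>R \<xi>) $ j = \<xi> $ j * (\<phi> x * cos (\<xi> \<bullet> x))" for x by simp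
  show "tcos (\<lambda>x. grad \<phi> x $ j) \<xi> = \<xi> $ j * tsin \<phi> \<xi>"
    using integration_by_parts[OF assms, where \<psi> = "\<lambda>x. cos (\<xi> \<bullet> x)" and j = j, OF Ck_cos]
    unfolding grad_cos 1 by (simp add: tcos_def tsin_def L2inner_def)
  show "tsin (\<lambda>x. grad \<phi> x $ j) \<xi> = - \<xi> $ j * tcos \<phi> \<xi>"
    using integration_by_parts[OF assms, where \<psi> = "\<lambda>x. sin (\<xi> \<bullet> x)" and j = j, OF Ck_sin]
    unfolding grad_sin 2 by (simp add: tcos_def tsin_def L2inner_def)
qed

text \<open>Parseval is needed for the function only: the gradient enters with a minus sign, so
  Bessel's inequality for each partial derivative suffices. Frequencies outside
  \<open>low \<Lambda>\<close> have weights that are not positive and are dropped; those inside have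
  positive weights and may be added.\<close>

theorem spectral_bound_test:
  assumes \<phi>: "\<phi> \<in> test_functions \<Omega>" and "0 \<le> \<Lambda>"
  shows "\<Lambda> * L2inner \<Omega> \<phi> \<phi> - L2inner \<Omega> (grad \<phi>) (grad \<phi>)
    \<le> \<kappa> * (\<Sum>\<xi>\<in>low \<Lambda>. (\<Lambda> - (norm \<xi>)\<^sup>2) * ((tcos \<phi> \<xi>)\<^sup>2 + (tsin \<phi> \<xi>)\<^sup>2))" (is "?L \<le> ?R")
proof (rule field_le_epsilon)
  fix e :: real assume e: "0 < e"
  let ?c = "\<lambda>\<xi>. (tcos \<phi> \<xi>)\<^sup>2 + (tsin \<phi> \<xi>)\<^sup>2"
  \<comment> \<open>The Parseval error is later multiplied by \<Lambda>; the 1 covers \<Lambda> =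
    0.\<close>
  have "0 < e / (\<Lambda> + 1)" using e assms(2) by simp
  then obtain F where F: "finite F" "F \<subseteq> lat \<tau>" "L2inner \<Omega> \<phi> \<phi> \<le> \<kappa> * (\<Sum>\<xi>\<in>F. ?c \<xi>) + e / (\<Lambda> + 1)"
    using Parseval_test[OF \<phi>] by blast
  have "\<kappa> * (\<Sum>\<xi>\<in>F. (norm \<xi>)\<^sup>2 * ?c \<xi>) \<le> L2inner \<Omega> (grad \<phi>) (grad \<phi>)"
  proof -
    have "\<kappa> * (\<Sum>\<xi>\<in>F. (norm \<xi>)\<^sup>2 * ?c \<xi>) = (\<Sum>j\<in>UNIV. \<kappa> * (\<Sum>\<xi>\<in>F. (\<xi> $ j)\<^sup>2 * ?c \<xi>))"
      unfolding power2_norm_eq_inner inner_vec_def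
      by (simp add: sum_distrib_left sum_distrib_right power2_eq_square) (rule sum.swap)
    also have "\<dots> = (\<Sum>j\<in>UNIV. \<kappa> * (\<Sum>\<xi>\<in>F. (tcos (\<lambda>x. grad \<phi> x $ j) \<xi>)\<^sup>2 + (tsin (\<lambda>x. grad \<phi> x $ j) \<xi>)\<^sup>2))"
      by (simp add: trig_coeff_grad[OF \<phi>] power_mult_distrib distrib_left add.commute)
    also have "\<dots> \<le> (\<Sum>j\<in>UNIV. L2inner \<Omega> (\<lambda>x. grad \<phi> x $ j) (\<lambda>x. grad \<phi> x $ j))"
      by (intro sum_mono Bessel_trig test_L2[OF \<phi>] F)
    also have "\<dots> = L2inner \<Omega> (grad \<phi>) (grad \<phi>)" by (rule L2inner_vec[symmetric]; rule test_L2[OF \<phi>])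
    finally show ?thesis .
  qed
  moreover have "\<Lambda> * L2inner \<Omega> \<phi> \<phi> \<le> \<Lambda> * (\<kappa> * (\<Sum>\<xi>\<in>F. ?c \<xi>)) + e"
  proof -
    have "\<Lambda> * L2inner \<Omega> \<phi> \<phi> \<le> \<Lambda> * (\<kappa> * (\<Sum>\<xi>\<in>F. ?c \<xi>) + e / (\<Lambda> + 1))"
      using F(3) assms(2) by (rule mult_left_mono)
    moreover have "\<Lambda> * (e / (\<Lambda> + 1)) \<le> e" using e assms(2) by (simp add: field_simps)
    ultimately show ?thesis by (simp add: distrib_left)
  qed
  moreover have "\<Lambda> * (\<kappa> * (\<Sum>\<xi>\<in>F. ?c \<xi>)) - \<kappa> * (\<Sum>\<xi>\<in>F. (norm \<xi>)\<^sup>2 * ?c \<xi>) \<le> ?R"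
  proof -
    have "\<Lambda> * (\<kappa> * (\<Sum>\<xi>\<in>F. ?c \<xi>)) - \<kappa> * (\<Sum>\<xi>\<in>F. (norm \<xi>)\<^sup>2 * ?c \<xi>) = \<kappa> * (\<Sum>\<xi>\<in>F. (\<Lambda> - (norm \<xi>)\<^sup>2) * ?c \<xi>)"
      by (simp add: left_diff_distrib sum_subtractf right_diff_distrib sum_distrib_left mult.left_commute)
    also have "(\<Sum>\<xi>\<in>F. (\<Lambda> - (norm \<xi>)\<^sup>2) * ?c \<xi>) \<le> (\<Sum>\<xi>\<in>low \<Lambda>. (\<Lambda> - (norm \<xi>)\<^sup>2) * ?c \<xi>)"
    proof -
      have "(\<Sum>\<xi>\<in>F. (\<Lambda> - (norm \<xi>)\<^sup>2) * ?c \<xi>) \<le> (\<Sum>\<xi>\<in>F \<inter> low \<Lambda>. (\<Lambda> - (norm \<xi>)\<^sup>2) * ?c \<xi>)"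
      proof -
        have "(\<Sum>\<xi>\<in>F - low \<Lambda>. (\<Lambda> - (norm \<xi>)\<^sup>2) * ?c \<xi>) \<le> 0"
          using F(2) by (intro sum_nonpos mult_nonpos_nonneg) (auto simp: low_def)
        then show ?thesis using sum.Int_Diff[OF F(1), of _ "low \<Lambda>"] by (metis (lifting) add_le_same_cancel1)
      qed
      also have "\<dots> \<le> (\<Sum>\<xi>\<in>low \<Lambda>. (\<Lambda> - (norm \<xi>)\<^sup>2) * ?c \<xi>)"
        by (intro sum_mono2 finite_low mult_nonneg_nonneg) (auto simp: low_def)
      finally show ?thesis .
    qed
    finally show ?thesis using \<kappa>_pos by (simp add: mult_left_mono)
  qed
  ultimately show "?L \<le> ?R + e" by linarith
qed

end

section \<open>The space \<open>H\<^sup>1\<^sub>0\<close>\<close>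

context bounded_open begin

lemma weak_grad_H1:
  assumes "u \<in> H1 \<Omega>"
  shows "u \<in> L2 \<Omega>" "is_weak_grad \<Omega> u (weak_grad \<Omega> u)" "weak_grad \<Omega> u \<in> L2 \<Omega>"
proof -
  obtain G where G: "is_weak_grad \<Omega> u G" and u: "u \<in> L2 \<Omega>" using assms by (auto simp: H1_def)
  show "u \<in> L2 \<Omega>" by (rule u)
  show 1: "is_weak_grad \<Omega> u (weak_grad \<Omega> u)" by (rule weak_grad_eqI[OF G u])
  show "weak_grad \<Omega> u \<in> L2 \<Omega>" by (rule is_weak_grad_L2[OF 1])
qed

lemma H10_H1: "u \<in> H10 \<Omega> \<Longrightarrow> u \<in> H1 \<Omega>"
  by (simp add: H10_def)

lemmas weak_grad_H10 = weak_grad_H1[OF H10_H1]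

lemma L2norm_nonneg: "0 \<le> L2norm \<Omega> f"
  by (simp add: L2norm_def)

lemma L2norm_minus_commute:
  "L2norm \<Omega> (\<lambda>x. f x - g x) = L2norm \<Omega> (\<lambda>x. g x - f x)"
  unfolding L2norm_def by (simp add: norm_minus_commute)

lemma is_weak_grad_diff_test:
  assumes "is_weak_grad \<Omega> u G" "u \<in> L2 \<Omega>" "\<phi> \<in> test_functions \<Omega>"
  shows "is_weak_grad \<Omega> (\<lambda>x. u x - \<phi> x) (\<lambda>x. G x - grad \<phi> x)"
  using is_weak_grad_add[OF assms(1) is_weak_grad_scale[OF is_weak_grad_test[OF assms(3)] test_L2(1)[OF assms(3)], of "-1"]]
    assms(2) L2.scale_mem[OF test_L2(1)[OF assms(3)], of "-1"] by simp

lemma H1norm_diff_test: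
  assumes "is_weak_grad \<Omega> u G" "u \<in> L2 \<Omega>" "\<phi> \<in> test_functions \<Omega>"
  shows "H1norm \<Omega> (\<lambda>x. u x - \<phi> x) = sqrt ((L2norm \<Omega> (\<lambda>x. u x - \<phi> x))\<^sup>2 + (L2norm \<Omega> (\<lambda>x. G x - grad \<phi> x))\<^sup>2)"
proof -
  have w: "is_weak_grad \<Omega> (\<lambda>x. u x - \<phi> x) (\<lambda>x. G x - grad \<phi> x)" by (rule is_weak_grad_diff_test[OF assms])
  have L: "(\<lambda>x. u x - \<phi> x) \<in> L2 \<Omega>" by (intro L2.diff_mem assms test_L2)
  have "L2norm \<Omega> (weak_grad \<Omega> (\<lambda>x. u x - \<phi> x)) = L2norm \<Omega> (\<lambda>x. G x - grad \<phi> x)"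
    by (rule L2norm_cong_AE)
      (use weak_grad_eqI[OF w L] is_weak_grad_L2 w L2_measurable in blast)+
  then show ?thesis by (simp add: H1norm_def)
qed

lemma H10_approx:
  assumes "u \<in> H10 \<Omega>" "0 < \<epsilon>"
  shows "\<exists>\<phi>\<in>test_functions \<Omega>. L2norm \<Omega> (\<lambda>x. u x - \<phi> x) < \<epsilon> \<and> L2norm \<Omega> (\<lambda>x. weak_grad \<Omega> u x - grad \<phi> x) < \<epsilon>"
proof -
  obtain \<phi> where \<phi>: "\<phi> \<in> test_functions \<Omega>" "H1norm \<Omega> (\<lambda>x. u x - \<phi> x) < \<epsilon>"
    using assms by (auto simp: H10_def)
  have eq: "H1norm \<Omega> (\<lambda>x. u x - \<phi> x) = sqrt ((L2norm \<Omega> (\<lambda>x. u x - \<phi> x))\<^sup>2 + (L2norm \<Omega> (\<lambda>x. weak_grad \<Omega> u x - grad \<phi> x))\<^sup>2)"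
    by (rule H1norm_diff_test[OF weak_grad_H10(2,1)[OF assms(1)] \<phi>(1)])
  have "L2norm \<Omega> (\<lambda>x. u x - \<phi> x) \<le> H1norm \<Omega> (\<lambda>x. u x - \<phi> x)"
    "L2norm \<Omega> (\<lambda>x. weak_grad \<Omega> u x - grad \<phi> x) \<le> H1norm \<Omega> (\<lambda>x. u x - \<phi> x)"
    unfolding eq by (simp_all add: real_le_rsqrt)
  then show ?thesis using \<phi> by (intro bexI[of _ \<phi>]) auto
qed

lemma H10_sequence:
  assumes "u \<in> H10 \<Omega>"
  obtains \<phi> where "\<And>n::nat. \<phi> n \<in> test_functions \<Omega>" "(\<lambda>n. L2norm \<Omega> (\<lambda>x. \<phi> n x - u x)) \<longlonglongrightarrow> 0"
    "(\<lambda>n. L2norm \<Omega> (\<lambda>x. grad (\<phi> n) x - weak_grad \<Omega> u x)) \<longlonglongrightarrow> 0"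
proof -
  have "\<forall>n::nat. \<exists>\<phi>. \<phi>\<in>test_functions \<Omega> \<and> L2norm \<Omega> (\<lambda>x. u x - \<phi> x) < inverse (real (Suc n)) \<and> L2norm \<Omega> (\<lambda>x. weak_grad \<Omega> u x - grad \<phi> x) < inverse (real (Suc n))" (is "\<forall>n. ?P n")
  proof
    fix n :: nat
    have "0 < inverse (real (Suc n))" by simp
    from H10_approx[OF assms this] show "?P n" by blast
  qed
  from choice[OF this] obtain \<phi> where \<phi>: "\<And>n::nat. \<phi> n \<in> test_functions \<Omega>"
    "\<And>n. L2norm \<Omega> (\<lambda>x. u x - \<phi> n x) < inverse (real (Suc n))"
    "\<And>n. L2norm \<Omega> (\<lambda>x. weak_grad \<Omega> u x - grad (\<phi> n) x) < inverse (real (Suc n))" by blast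
  note t = test_L2[OF \<phi>(1)] and w = weak_grad_H10[OF assms]
  have c: "L2norm \<Omega> (\<lambda>x. \<phi> n x - u x) = L2norm \<Omega> (\<lambda>x. u x - \<phi> n x)"
    "L2norm \<Omega> (\<lambda>x. grad (\<phi> n) x - weak_grad \<Omega> u x) = L2norm \<Omega> (\<lambda>x. weak_grad \<Omega> u x - grad (\<phi> n) x)" for n
    by (rule L2norm_minus_commute)+
  show ?thesis
  proof (rule that[OF \<phi>(1)])
    show "(\<lambda>n. L2norm \<Omega> (\<lambda>x. \<phi> n x - u x)) \<longlonglongrightarrow> 0"
      by (rule Lim_null_comparison[OF _ LIMSEQ_inverse_real_of_nat])
        (use \<phi>(2) in \<open>auto simp: c L2norm_nonneg intro!: always_eventually less_imp_le\<close>)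
    show "(\<lambda>n. L2norm \<Omega> (\<lambda>x. grad (\<phi> n) x - weak_grad \<Omega> u x)) \<longlonglongrightarrow> 0"
      by (rule Lim_null_comparison[OF _ LIMSEQ_inverse_real_of_nat])
        (use \<phi>(3) in \<open>auto simp: c L2norm_nonneg intro!: always_eventually less_imp_le\<close>)
  qed
qed

text \<open>Strong limits of test functions together with their gradients: one criterion yields
  membership and identifies the weak gradient.\<close>

lemma H10I:
  assumes "u \<in> L2 \<Omega>" "G \<in> L2 \<Omega>" "\<And>n::nat. \<phi> n \<in> test_functions \<Omega>"
    "(\<lambda>n. L2norm \<Omega> (\<lambda>x. \<phi> n x - u x)) \<longlonglongrightarrow> 0" "(\<lambda>n. L2norm \<Omega> (\<lambda>x. grad (\<phi> n) x - G x)) \<longlonglongrightarrow> 0"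
  shows "u \<in> H10 \<Omega>" "is_weak_grad \<Omega> u G" "AE x in M. weak_grad \<Omega> u x = G x"
proof -
  show w: "is_weak_grad \<Omega> u G"
    by (rule is_weak_grad_limit[OF is_weak_grad_test[OF assms(3)] test_L2(1)[OF assms(3)] assms(1,2,4,5)])
  then show "AE x in M. weak_grad \<Omega> u x = G x" using weak_grad_eqI assms(1) by blast
  have "\<exists>\<psi>\<in>test_functions \<Omega>. H1norm \<Omega> (\<lambda>x. u x - \<psi> x) < \<epsilon>" if "\<epsilon> > 0" for \<epsilon>
  proof -
    have "\<forall>\<^sub>F n in sequentially. L2norm \<Omega> (\<lambda>x. \<phi> n x - u x) < \<epsilon> / 2 \<and> L2norm \<Omega> (\<lambda>x. grad (\<phi> n) x - G x) < \<epsilon> / 2"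
      using order_tendstoD(2)[OF assms(4), of "\<epsilon>/2"] order_tendstoD(2)[OF assms(5), of "\<epsilon>/2"] that
      by (simp add: eventually_conj)
    then obtain n where n: "L2norm \<Omega> (\<lambda>x. \<phi> n x - u x) < \<epsilon> / 2" "L2norm \<Omega> (\<lambda>x. grad (\<phi> n) x - G x) < \<epsilon> / 2"
      by (auto simp: eventually_sequentially)
    have c: "L2norm \<Omega> (\<lambda>x. u x - \<phi> n x) = L2norm \<Omega> (\<lambda>x. \<phi> n x - u x)"
      "L2norm \<Omega> (\<lambda>x. G x - grad (\<phi> n) x) = L2norm \<Omega> (\<lambda>x. grad (\<phi> n) x - G x)"
      by (rule L2norm_minus_commute)+
    have "H1norm \<Omega> (\<lambda>x. u x - \<phi> n x) \<le> L2norm \<Omega> (\<lambda>x. u x - \<phi> n x) + L2norm \<Omega> (\<lambda>x. G x - grad (\<phi> n) x)"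
      unfolding H1norm_diff_test[OF w assms(1,3)] by (rule sqrt_sum_squares_le_sum) (auto simp: L2norm_nonneg)
    also have "\<dots> < \<epsilon>" unfolding c using n by linarith
    finally show ?thesis using assms(3) by blast
  qed
  then show "u \<in> H10 \<Omega>" using assms(1) w by (auto simp: H10_def H1_def)
qed

lemma test_H10: "\<phi> \<in> test_functions \<Omega> \<Longrightarrow> \<phi> \<in> H10 \<Omega>"
  using H10I(1)[of \<phi> "grad \<phi>" "\<lambda>_. \<phi>"] by (simp add: test_L2 L2norm_def)

lemma weak_grad_test_AE: "\<phi> \<in> test_functions \<Omega> \<Longrightarrow> AE x in M. weak_grad \<Omega> \<phi> x = grad \<phi> x"
  using weak_grad_eqI(2)[OF is_weak_grad_test test_L2(1)] by blast

lemma H10_cong_AE: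
  assumes "u \<in> H10 \<Omega>" "v \<in> borel_measurable M" "AE x in M. u x = v x"
  shows "v \<in> H10 \<Omega>"
proof -
  obtain \<phi> where \<phi>: "\<And>n::nat. \<phi> n \<in> test_functions \<Omega>" "(\<lambda>n. L2norm \<Omega> (\<lambda>x. \<phi> n x - u x)) \<longlonglongrightarrow> 0"
    "(\<lambda>n. L2norm \<Omega> (\<lambda>x. grad (\<phi> n) x - weak_grad \<Omega> u x)) \<longlonglongrightarrow> 0" using H10_sequence[OF assms(1)] by blast
  note w = weak_grad_H10[OF assms(1)]
  have v: "v \<in> L2 \<Omega>" by (rule L2_cong_AE[OF w(1) assms(2,3)])
  have "L2norm \<Omega> (\<lambda>x. \<phi> n x - v x) = L2norm \<Omega> (\<lambda>x. \<phi> n x - u x)" for n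
  proof (rule L2norm_cong_AE)
    show "(\<lambda>x. \<phi> n x - v x) \<in> borel_measurable M" "(\<lambda>x. \<phi> n x - u x) \<in> borel_measurable M"
      using L2_measurable[OF L2.diff_mem[OF test_L2(1)[OF \<phi>(1)] v]] L2_measurable[OF L2.diff_mem[OF test_L2(1)[OF \<phi>(1)] w(1)]]
      by auto
    show "AE x in M. \<phi> n x - v x = \<phi> n x - u x" using assms(3) by eventually_elim simp
  qed
  then show ?thesis using H10I(1)[OF v w(3) \<phi>(1) _ \<phi>(3)] \<phi>(2) by simp
qed

text \<open>Approximating test functions are combined term by term. The gradient formula holds only
  almost everywhere because \<open>weak_grad\<close> picks a representative separately for each
  function.\<close>

lemma H10_lin:
  assumes u: "u \<in> H10 \<Omega>" and v: "v \<in> H10 \<Omega>"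
  shows "(\<lambda>x. u x + c * v x) \<in> H10 \<Omega>"
    "AE x in M. weak_grad \<Omega> (\<lambda>x. u x + c * v x) x = weak_grad \<Omega> u x + c *\<^sub>R weak_grad \<Omega> v x"
proof -
  obtain \<phi> where \<phi>: "\<And>n::nat. \<phi> n \<in> test_functions \<Omega>" "(\<lambda>n. L2norm \<Omega> (\<lambda>x. \<phi> n x - u x)) \<longlonglongrightarrow> 0"
    "(\<lambda>n. L2norm \<Omega> (\<lambda>x. grad (\<phi> n) x - weak_grad \<Omega> u x)) \<longlonglongrightarrow> 0" using H10_sequence[OF u] by blast
  obtain \<psi> where \<psi>: "\<And>n::nat. \<psi> n \<in> test_functions \<Omega>" "(\<lambda>n. L2norm \<Omega> (\<lambda>x. \<psi> n x - v x)) \<longlonglongrightarrow> 0"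
    "(\<lambda>n. L2norm \<Omega> (\<lambda>x. grad (\<psi> n) x - weak_grad \<Omega> v x)) \<longlonglongrightarrow> 0" using H10_sequence[OF v] by blast
  note wu = weak_grad_H10[OF u] and wv = weak_grad_H10[OF v]
  define \<rho> where "\<rho> n x = \<phi> n x + c * \<psi> n x" for n x
  have \<rho>: "\<rho> n \<in> test_functions \<Omega>" for n
    unfolding \<rho>_def by (intro test_function_add test_function_scale \<phi> \<psi>)
  have gr: "grad (\<rho> n) x = grad (\<phi> n) x + c *\<^sub>R grad (\<psi> n) x" for n x
    unfolding \<rho>_def[abs_def] using test_function_differentiable[OF \<phi>(1)] test_function_differentiable[OF \<psi>(1)]
    by (simp add: grad_add grad_mult grad_const)
  have lim: "(\<lambda>n. L2norm \<Omega> (\<lambda>x. (f n x + c *\<^sub>R g n x) - (F x + c *\<^sub>R G x))) \<longlonglongrightarrow> 0"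
    if "\<And>n. f n \<in> L2 \<Omega>" "\<And>n. g n \<in> L2 \<Omega>" "F \<in> L2 \<Omega>" "G \<in> L2 \<Omega>"
      "(\<lambda>n. L2norm \<Omega> (\<lambda>x. f n x - F x)) \<longlonglongrightarrow> 0" "(\<lambda>n. L2norm \<Omega> (\<lambda>x. g n x - G x)) \<longlonglongrightarrow> 0"
    for f g :: "nat \<Rightarrow> real^'n \<Rightarrow> 'c::euclidean_space" and F G
  proof (rule Lim_null_comparison)
    show "(\<lambda>n. L2norm \<Omega> (\<lambda>x. f n x - F x) + \<bar>c\<bar> * L2norm \<Omega> (\<lambda>x. g n x - G x)) \<longlonglongrightarrow> 0"
      using tendsto_add[OF that(5) tendsto_mult_left[OF that(6), of "\<bar>c\<bar>"]] by simp
    have "L2norm \<Omega> (\<lambda>x. (f n x + c *\<^sub>R g n x) - (F x + c *\<^sub>R G x)) \<le> L2norm \<Omega> (\<lambda>x. f n x - F x) + \<bar>c\<bar> * L2norm \<Omega> (\<lambda>x. g n x - G x)" for n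
      using L2.nrm_triangle[OF L2.diff_mem[OF that(1)[of n] that(3)] L2.scale_mem[OF L2.diff_mem[OF that(2)[of n] that(4)], of c]]
        L2.nrm_scale[OF L2.diff_mem[OF that(2)[of n] that(4)], of c]
      unfolding L2norm_eq by (simp add: algebra_simps)
    then show "\<forall>\<^sub>F n in sequentially. norm (L2norm \<Omega> (\<lambda>x. (f n x + c *\<^sub>R g n x) - (F x + c *\<^sub>R G x)))
        \<le> L2norm \<Omega> (\<lambda>x. f n x - F x) + \<bar>c\<bar> * L2norm \<Omega> (\<lambda>x. g n x - G x)"
      by (simp add: L2norm_nonneg)
  qed
  have mem: "(\<lambda>x. u x + c * v x) \<in> L2 \<Omega>" "(\<lambda>x. weak_grad \<Omega> u x + c *\<^sub>R weak_grad \<Omega> v x) \<in> L2 \<Omega>"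
    using L2.add_mem[OF wu(1) L2.scale_mem[OF wv(1), of c]] L2.add_mem[OF wu(3) L2.scale_mem[OF wv(3), of c]] by auto
  have l1: "(\<lambda>n. L2norm \<Omega> (\<lambda>x. \<rho> n x - (u x + c * v x))) \<longlonglongrightarrow> 0"
    using lim[OF test_L2(1)[OF \<phi>(1)] test_L2(1)[OF \<psi>(1)] wu(1) wv(1) \<phi>(2) \<psi>(2)] by (simp add: \<rho>_def)
  have l2: "(\<lambda>n. L2norm \<Omega> (\<lambda>x. grad (\<rho> n) x - (weak_grad \<Omega> u x + c *\<^sub>R weak_grad \<Omega> v x))) \<longlonglongrightarrow> 0"
    using lim[OF test_L2(2)[OF \<phi>(1)] test_L2(2)[OF \<psi>(1)] wu(3) wv(3) \<phi>(3) \<psi>(3)] by (simp add: gr)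
  show "(\<lambda>x. u x + c * v x) \<in> H10 \<Omega>"
    "AE x in M. weak_grad \<Omega> (\<lambda>x. u x + c * v x) x = weak_grad \<Omega> u x + c *\<^sub>R weak_grad \<Omega> v x"
    using H10I[OF mem \<rho> l1 l2] by auto
qed

lemma zero_H10: "(\<lambda>x. 0) \<in> H10 \<Omega>"
  by (rule test_H10[OF test_function_zero])

lemma weak_grad_zero_AE: "AE x in M. weak_grad \<Omega> (\<lambda>x. 0) x = 0"
  using weak_grad_test_AE[OF test_function_zero] by (simp add: grad_const)

definition D :: "(real^'n \<Rightarrow> real) \<Rightarrow> (real^'n \<Rightarrow> real) \<Rightarrow> real" where
  "D u v = L2inner \<Omega> (weak_grad \<Omega> u) (weak_grad \<Omega> v)"

lemma weak_grad_scale_AE: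
  assumes "u \<in> H10 \<Omega>"
  shows "(\<lambda>x. c * u x) \<in> H10 \<Omega>" "AE x in M. weak_grad \<Omega> (\<lambda>x. c * u x) x = c *\<^sub>R weak_grad \<Omega> u x"
proof -
  show "(\<lambda>x. c * u x) \<in> H10 \<Omega>" using H10_lin(1)[OF zero_H10 assms, of c] by simp
  show "AE x in M. weak_grad \<Omega> (\<lambda>x. c * u x) x = c *\<^sub>R weak_grad \<Omega> u x"
    using H10_lin(2)[OF zero_H10 assms, of c] weak_grad_zero_AE by eventually_elim simp
qed

text \<open>Used with the identity for the Dirichlet form and with multiplication by \<open>a(x)\<close> for the energy
  form of the elliptic operator.\<close>

lemma semi_inner_weak_grad:
  assumes lin: "\<And>F G. F \<in> L2 \<Omega> \<Longrightarrow> G \<in> L2 \<Omega> \<Longrightarrow> A F \<in> L2 \<Omega> \<and> L2inner \<Omega> (A F) G = L2inner \<Omega> (A G) F"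
    and nonneg: "\<And>F. F \<in> L2 \<Omega> \<Longrightarrow> 0 \<le> L2inner \<Omega> (A F) F"
  shows "semi_inner (H10 \<Omega>) (\<lambda>u v. L2inner \<Omega> (A (weak_grad \<Omega> u)) (weak_grad \<Omega> v))"
proof
  show "(\<lambda>x. 0) \<in> H10 \<Omega>" by (rule zero_H10)
  fix f g h :: "real^'n \<Rightarrow> real" and c :: real
  assume f: "f \<in> H10 \<Omega>"
  note wf = weak_grad_H10[OF f]
  show "0 \<le> L2inner \<Omega> (A (weak_grad \<Omega> f)) (weak_grad \<Omega> f)" using nonneg wf by blast
  have sc: "(\<lambda>x. c *\<^sub>R f x) \<in> H10 \<Omega>" and wsc: "AE x in M. weak_grad \<Omega> (\<lambda>x. c *\<^sub>R f x) x = c *\<^sub>R weak_grad \<Omega> f x"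
    using weak_grad_scale_AE[OF f, of c] by auto
  show "(\<lambda>x. c *\<^sub>R f x) \<in> H10 \<Omega>" by (rule sc)
  have right: "L2inner \<Omega> (A F) G = L2inner \<Omega> (A F) G'" if "F \<in> L2 \<Omega>" "G \<in> L2 \<Omega>" "G' \<in> L2 \<Omega>" "AE x in M. G x = G' x" for F G G'
    by (rule L2inner_cong_AE) (use that lin[OF that(1,2)] L2_measurable in auto)
  {
    assume h: "h \<in> H10 \<Omega>"
    note wh = weak_grad_H10[OF h]
    have "L2inner \<Omega> (A (weak_grad \<Omega> (\<lambda>x. c *\<^sub>R f x))) (weak_grad \<Omega> h) = L2inner \<Omega> (A (weak_grad \<Omega> h)) (weak_grad \<Omega> (\<lambda>x. c *\<^sub>R f x))"
      using lin weak_grad_H10[OF sc] wh by blast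
    also have "\<dots> = L2inner \<Omega> (A (weak_grad \<Omega> h)) (\<lambda>x. c *\<^sub>R weak_grad \<Omega> f x)"
      by (rule right[OF wh(3) weak_grad_H10(3)[OF sc] L2.scale_mem[OF wf(3)] wsc])
    also have "\<dots> = c * L2inner \<Omega> (A (weak_grad \<Omega> h)) (weak_grad \<Omega> f)"
      using lin[OF wh(3) wf(3)] wf(3) by (intro L2.B_scale_right) auto
    also have "L2inner \<Omega> (A (weak_grad \<Omega> h)) (weak_grad \<Omega> f) = L2inner \<Omega> (A (weak_grad \<Omega> f)) (weak_grad \<Omega> h)"
      using lin wf wh by blast
    finally show "L2inner \<Omega> (A (weak_grad \<Omega> (\<lambda>x. c *\<^sub>R f x))) (weak_grad \<Omega> h) = c * L2inner \<Omega> (A (weak_grad \<Omega> f)) (weak_grad \<Omega> h)" .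
  }
  assume g: "g \<in> H10 \<Omega>"
  note wg = weak_grad_H10[OF g]
  show "L2inner \<Omega> (A (weak_grad \<Omega> f)) (weak_grad \<Omega> g) = L2inner \<Omega> (A (weak_grad \<Omega> g)) (weak_grad \<Omega> f)"
    using lin wf wg by blast
  have ad: "(\<lambda>x. f x + g x) \<in> H10 \<Omega>" and wad: "AE x in M. weak_grad \<Omega> (\<lambda>x. f x + g x) x = weak_grad \<Omega> f x + weak_grad \<Omega> g x"
    using H10_lin[OF f g, of 1] by auto
  show "(\<lambda>x. f x + g x) \<in> H10 \<Omega>" by (rule ad)
  assume h: "h \<in> H10 \<Omega>"
  note wh = weak_grad_H10[OF h]
  have "L2inner \<Omega> (A (weak_grad \<Omega> (\<lambda>x. f x + g x))) (weak_grad \<Omega> h) = L2inner \<Omega> (A (weak_grad \<Omega> h)) (weak_grad \<Omega> (\<lambda>x. f x + g x))"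
    using lin weak_grad_H10[OF ad] wh by blast
  also have "\<dots> = L2inner \<Omega> (A (weak_grad \<Omega> h)) (\<lambda>x. weak_grad \<Omega> f x + weak_grad \<Omega> g x)"
    by (rule right[OF wh(3) weak_grad_H10(3)[OF ad] L2.add_mem[OF wf(3) wg(3)] wad])
  also have "\<dots> = L2inner \<Omega> (A (weak_grad \<Omega> h)) (weak_grad \<Omega> f) + L2inner \<Omega> (A (weak_grad \<Omega> h)) (weak_grad \<Omega> g)"
    using lin[OF wh(3) wf(3)] wf(3) wg(3) by (intro L2.B_add_right) auto
  also have "\<dots> = L2inner \<Omega> (A (weak_grad \<Omega> f)) (weak_grad \<Omega> h) + L2inner \<Omega> (A (weak_grad \<Omega> g)) (weak_grad \<Omega> h)"
    using lin wf wg wh by metis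
  finally show "L2inner \<Omega> (A (weak_grad \<Omega> (\<lambda>x. f x + g x))) (weak_grad \<Omega> h)
    = L2inner \<Omega> (A (weak_grad \<Omega> f)) (weak_grad \<Omega> h) + L2inner \<Omega> (A (weak_grad \<Omega> g)) (weak_grad \<Omega> h)" .
qed

sublocale H: semi_inner "H10 \<Omega>" D
  unfolding D_def[abs_def]
  by (rule semi_inner_weak_grad[of "\<lambda>F. F"]) (auto simp: L2.B_nonneg L2.B_commute)

lemma weak_grad_diff_AE:
  assumes "u \<in> H10 \<Omega>" "v \<in> H10 \<Omega>"
  shows "AE x in M. weak_grad \<Omega> (\<lambda>x. u x - v x) x = weak_grad \<Omega> u x - weak_grad \<Omega> v x"
  using H10_lin(2)[OF assms, of "-1"] by simp

lemma H_nrm_diff: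
  assumes "u \<in> H10 \<Omega>" "v \<in> H10 \<Omega>"
  shows "H.nrm (\<lambda>x. u x - v x) = L2norm \<Omega> (\<lambda>x. weak_grad \<Omega> u x - weak_grad \<Omega> v x)"
proof -
  have "H.nrm (\<lambda>x. u x - v x) = L2norm \<Omega> (weak_grad \<Omega> (\<lambda>x. u x - v x))"
    by (simp add: H.nrm_def D_def L2.nrm_def[symmetric] L2norm_eq)
  also have "\<dots> = L2norm \<Omega> (\<lambda>x. weak_grad \<Omega> u x - weak_grad \<Omega> v x)"
    by (rule L2norm_cong_AE[OF _ _ weak_grad_diff_AE[OF assms]])
      (intro L2_measurable L2.diff_mem weak_grad_H10 H.diff_mem assms)+
  finally show ?thesis .
qed

lemma D_test: "\<phi> \<in> test_functions \<Omega> \<Longrightarrow> D \<phi> \<phi> = L2inner \<Omega> (grad \<phi>) (grad \<phi>)"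
  unfolding D_def
  by (rule L2inner_cong_AE) (auto simp: weak_grad_test_AE intro!: L2_measurable test_L2 weak_grad_H10 test_H10)

lemma H10_sequence_D:
  assumes "u \<in> H10 \<Omega>"
  obtains \<phi> where "\<And>n::nat. \<phi> n \<in> test_functions \<Omega>" "(\<lambda>n. L2.nrm (\<lambda>x. \<phi> n x - u x)) \<longlonglongrightarrow> 0"
    "(\<lambda>n. H.nrm (\<lambda>x. \<phi> n x - u x)) \<longlonglongrightarrow> 0"
proof -
  obtain \<phi> where \<phi>: "\<And>n::nat. \<phi> n \<in> test_functions \<Omega>" "(\<lambda>n. L2norm \<Omega> (\<lambda>x. \<phi> n x - u x)) \<longlonglongrightarrow> 0"
    "(\<lambda>n. L2norm \<Omega> (\<lambda>x. grad (\<phi> n) x - weak_grad \<Omega> u x)) \<longlonglongrightarrow> 0" using H10_sequence[OF assms] by blast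
  have "H.nrm (\<lambda>x. \<phi> n x - u x) = L2norm \<Omega> (\<lambda>x. grad (\<phi> n) x - weak_grad \<Omega> u x)" for n
    unfolding H_nrm_diff[OF test_H10[OF \<phi>(1)] assms]
  proof (rule L2norm_cong_AE)
    show "AE x in M. weak_grad \<Omega> (\<phi> n) x - weak_grad \<Omega> u x = grad (\<phi> n) x - weak_grad \<Omega> u x"
      using weak_grad_test_AE[OF \<phi>(1)[of n]] by eventually_elim simp
  qed (intro L2_measurable L2.diff_mem weak_grad_H10 test_H10 test_L2 \<phi> assms)+
  then show ?thesis using \<phi> by (intro that[of \<phi>]) (simp_all add: L2norm_eq)
qed

end

section \<open>Spectral inequality, Poincare inequality and completeness of
  \<open>H10\<close>\<close>

context boxed_open begin

text \<open>By density: the right-hand side has finitely many terms, each continuous in L2.\<close>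

theorem spectral_bound:
  assumes u: "u \<in> H10 \<Omega>" and "0 \<le> \<Lambda>"
  shows "\<Lambda> * L2inner \<Omega> u u - D u u
    \<le> \<kappa> * (\<Sum>\<xi>\<in>low \<Lambda>. (\<Lambda> - (norm \<xi>)\<^sup>2) * ((tcos u \<xi>)\<^sup>2 + (tsin u \<xi>)\<^sup>2))"
proof -
  obtain \<phi> where \<phi>: "\<And>n::nat. \<phi> n \<in> test_functions \<Omega>" "(\<lambda>n. L2.nrm (\<lambda>x. \<phi> n x - u x)) \<longlonglongrightarrow> 0"
    "(\<lambda>n. H.nrm (\<lambda>x. \<phi> n x - u x)) \<longlonglongrightarrow> 0" using H10_sequence_D[OF u] by blast
  note uL = weak_grad_H10(1)[OF u] and \<phi>L = test_L2(1)[OF \<phi>(1)] and \<phi>H = test_H10[OF \<phi>(1)]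
  have 1: "(\<lambda>n. L2inner \<Omega> (\<phi> n) (\<phi> n)) \<longlonglongrightarrow> L2inner \<Omega> u u"
    using tendsto_power[OF L2.nrm_tendsto[OF \<phi>L uL \<phi>(2)], of 2] by (simp add: L2.nrm_sq \<phi>L uL)
  have 2: "(\<lambda>n. D (\<phi> n) (\<phi> n)) \<longlonglongrightarrow> D u u"
    using tendsto_power[OF H.nrm_tendsto[OF \<phi>H u \<phi>(3)], of 2] by (simp add: H.nrm_sq \<phi>H u)
  have 3: "(\<lambda>n. tcos (\<phi> n) \<xi>) \<longlonglongrightarrow> tcos u \<xi>" "(\<lambda>n. tsin (\<phi> n) \<xi>) \<longlonglongrightarrow> tsin u \<xi>" for \<xi>
    unfolding tcos_def tsin_def by (rule L2.B_tendsto[OF \<phi>L uL \<phi>(2)]; rule trig_L2)+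
  show ?thesis
  proof (rule LIMSEQ_le)
    show "(\<lambda>n. \<Lambda> * L2inner \<Omega> (\<phi> n) (\<phi> n) - D (\<phi> n) (\<phi> n)) \<longlonglongrightarrow> \<Lambda> * L2inner \<Omega> u u - D u u"
      by (intro tendsto_intros 1 2)
    show "(\<lambda>n. \<kappa> * (\<Sum>\<xi>\<in>low \<Lambda>. (\<Lambda> - (norm \<xi>)\<^sup>2) * ((tcos (\<phi> n) \<xi>)\<^sup>2 + (tsin (\<phi> n) \<xi>)\<^sup>2)))
      \<longlonglongrightarrow> \<kappa> * (\<Sum>\<xi>\<in>low \<Lambda>. (\<Lambda> - (norm \<xi>)\<^sup>2) * ((tcos u \<xi>)\<^sup>2 + (tsin u \<xi>)\<^sup>2))"
      by (intro tendsto_intros 3)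
    show "\<exists>N. \<forall>n\<ge>N. \<Lambda> * L2inner \<Omega> (\<phi> n) (\<phi> n) - D (\<phi> n) (\<phi> n)
      \<le> \<kappa> * (\<Sum>\<xi>\<in>low \<Lambda>. (\<Lambda> - (norm \<xi>)\<^sup>2) * ((tcos (\<phi> n) \<xi>)\<^sup>2 + (tsin (\<phi> n) \<xi>)\<^sup>2))"
      using spectral_bound_test[OF \<phi>(1) assms(2)] by (simp add: D_test \<phi>(1))
  qed
qed

text \<open>Non-zero lattice vectors have length at least \<tau> and \<open>low\<close> is strict,
  so at this level only the constant mode survives. The Poincare inequality is read off
  there.\<close>

lemma low_tau_sq: "low (\<tau>\<^sup>2) = {0}"
proof -
  have "\<xi> = 0" if \<xi>: "\<xi> \<in> low (\<tau>\<^sup>2)" for \<xi>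
  proof -
    have n: "norm \<xi> < \<tau>" using \<xi> \<tau>_pos by (auto simp: low_def intro: power_less_imp_less_base)
    have "\<xi> $ i = 0" for i
    proof -
      obtain m :: int where m: "\<xi> $ i = \<tau> * of_int m" using \<xi> unfolding low_def lat_def by blast
      have "\<tau> * \<bar>real_of_int m\<bar> \<le> norm \<xi>" using component_le_norm_cart[of \<xi> i] \<tau>_pos by (simp add: m abs_mult)
      then have "\<tau> * \<bar>real_of_int m\<bar> < \<tau> * 1" using n by linarith
      then have "\<bar>real_of_int m\<bar> < 1" using mult_less_cancel_left_pos[OF \<tau>_pos] by blast
      then show ?thesis using m by (simp flip: of_int_abs)
    qed
    then show ?thesis by (simp add: vec_eq_iff)
  qed
  moreover have "0 \<in> low (\<tau>\<^sup>2)" using \<tau>_pos by (simp add: low_def zero_in_lat)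
  ultimately show ?thesis by blast
qed

end

locale small_boxed_open = boxed_open \<Omega> \<tau> for \<Omega> :: "(real^'n) set" and \<tau> +
  assumes small: "2 * (\<kappa> * measure lebesgue \<Omega>) \<le> 1"
begin

text \<open>The smallness condition says that the constant mode carries at most half of the norm of \<open>u\<close>.\<close>

lemma Poincare:
  assumes "u \<in> H10 \<Omega>"
  shows "\<tau>\<^sup>2 / 2 * L2inner \<Omega> u u \<le> D u u"
proof -
  note uL = weak_grad_H10(1)[OF assms]
  have one: "L2inner \<Omega> (\<lambda>x. 1 :: real) (\<lambda>x. 1) = measure lebesgue \<Omega>"
  proof -
    interpret finite_measure M by (rule finite_measure_M)
    show ?thesis using measure_M by (simp add: L2inner_def)
  qed
  have "(tcos u 0)\<^sup>2 \<le> L2inner \<Omega> u u * measure lebesgue \<Omega>"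
    using L2.Cauchy_Schwarz_sq[OF uL L2_one] one by (simp add: tcos_def)
  then have "\<kappa> * \<tau>\<^sup>2 * (tcos u 0)\<^sup>2 \<le> \<kappa> * \<tau>\<^sup>2 * (L2inner \<Omega> u u * measure lebesgue \<Omega>)"
    using \<kappa>_pos by (intro mult_left_mono) auto
  also have "\<dots> = \<tau>\<^sup>2 * L2inner \<Omega> u u * (\<kappa> * measure lebesgue \<Omega>)" by (simp add: mult_ac)
  also have "\<dots> \<le> \<tau>\<^sup>2 * L2inner \<Omega> u u * (1 / 2)"
    using small L2.B_nonneg[OF uL] by (intro mult_left_mono) auto
  finally have "\<kappa> * \<tau>\<^sup>2 * (tcos u 0)\<^sup>2 \<le> \<tau>\<^sup>2 * L2inner \<Omega> u u / 2" by simp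
  moreover have "tsin u 0 = 0" by (simp add: tsin_def L2inner_def)
  ultimately show ?thesis using spectral_bound[OF assms, of "\<tau>\<^sup>2"] by (simp add: low_tau_sq mult.assoc)
qed

definition cP :: real where "cP = sqrt 2 / \<tau>"

lemma cP_pos: "0 < cP"
  using \<tau>_pos by (simp add: cP_def)

lemma Poincare_nrm:
  assumes "u \<in> H10 \<Omega>" shows "L2.nrm u \<le> cP * H.nrm u"
proof -
  have "L2inner \<Omega> u u \<le> cP\<^sup>2 * D u u"
    using Poincare[OF assms] \<tau>_pos by (simp add: cP_def power_divide field_simps)
  then have "sqrt (L2inner \<Omega> u u) \<le> sqrt (cP\<^sup>2 * D u u)" by (rule real_sqrt_le_mono)
  then show ?thesis using cP_pos by (simp add: L2.nrm_def H.nrm_def real_sqrt_mult)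
qed

text \<open>The Poincare inequality makes a sequence that is Cauchy for the gradients also Cauchy in
  L2. The two L2 limits are then recognised as a function of \<open>H10\<close> and its weak
  gradient.\<close>

theorem H10_complete:
  assumes X: "\<And>n::nat. X n \<in> H10 \<Omega>"
    and cauchy: "\<And>\<epsilon>. \<epsilon> > 0 \<Longrightarrow> \<exists>N. \<forall>m\<ge>N. \<forall>n\<ge>N. H.nrm (\<lambda>x. X m x - X n x) < \<epsilon>"
  shows "\<exists>u\<in>H10 \<Omega>. (\<lambda>n. H.nrm (\<lambda>x. X n x - u x)) \<longlonglongrightarrow> 0 \<and> (\<lambda>n. L2.nrm (\<lambda>x. X n x - u x)) \<longlonglongrightarrow> 0"
proof -
  note w = weak_grad_H10[OF X]
  have "\<exists>u\<in>L2 \<Omega>. (\<lambda>n. L2norm \<Omega> (\<lambda>x. X n x - u x)) \<longlonglongrightarrow> 0"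
  proof (rule L2_complete[OF w(1)])
    fix \<epsilon> :: real assume "\<epsilon> > 0"
    then obtain N where N: "\<And>m n. m \<ge> N \<Longrightarrow> n \<ge> N \<Longrightarrow> H.nrm (\<lambda>x. X m x - X n x) < \<epsilon> / cP"
      using cauchy[of "\<epsilon> / cP"] cP_pos by auto
    have "L2norm \<Omega> (\<lambda>x. X m x - X n x) < \<epsilon>" if "m \<ge> N" "n \<ge> N" for m n
      using Poincare_nrm[OF H.diff_mem[OF X X], of m n] N[OF that] cP_pos
      by (simp add: L2norm_eq field_simps)
    then show "\<exists>N. \<forall>m\<ge>N. \<forall>n\<ge>N. L2norm \<Omega> (\<lambda>x. X m x - X n x) < \<epsilon>" by blast
  qed
  then obtain u where u: "u \<in> L2 \<Omega>" "(\<lambda>n. L2norm \<Omega> (\<lambda>x. X n x - u x)) \<longlonglongrightarrow> 0" by blast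
  have "\<exists>G\<in>L2 \<Omega>. (\<lambda>n. L2norm \<Omega> (\<lambda>x. weak_grad \<Omega> (X n) x - G x)) \<longlonglongrightarrow> 0"
    by (rule L2_complete[OF w(3)]) (use cauchy in \<open>simp add: H_nrm_diff X\<close>)
  then obtain G where G: "G \<in> L2 \<Omega>" "(\<lambda>n. L2norm \<Omega> (\<lambda>x. weak_grad \<Omega> (X n) x - G x)) \<longlonglongrightarrow> 0" by blast
  \<comment> \<open>Test functions ever closer to the \<open>X n\<close> have the same two limits,
    which is what \<open>H10I\<close> asks for.\<close>
  have "\<forall>n::nat. \<exists>\<phi>. \<phi>\<in>test_functions \<Omega> \<and> L2norm \<Omega> (\<lambda>x. X n x - \<phi> x) < inverse (real (Suc n)) \<and> L2norm \<Omega> (\<lambda>x. weak_grad \<Omega> (X n) x - grad \<phi> x) < inverse (real (Suc n))" (is "\<forall>n. ?P n")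
  proof
    fix n :: nat
    have "0 < inverse (real (Suc n))" by simp
    from H10_approx[OF X this] show "?P n" by blast
  qed
  from choice[OF this] obtain \<phi> where \<phi>: "\<And>n::nat. \<phi> n \<in> test_functions \<Omega>"
    "\<And>n. L2norm \<Omega> (\<lambda>x. X n x - \<phi> n x) < inverse (real (Suc n))"
    "\<And>n. L2norm \<Omega> (\<lambda>x. weak_grad \<Omega> (X n) x - grad (\<phi> n) x) < inverse (real (Suc n))" by blast
  have lim: "(\<lambda>n. L2norm \<Omega> (\<lambda>x. f n x - F x)) \<longlonglongrightarrow> 0"
    if "\<And>n. f n \<in> L2 \<Omega>" "\<And>n. g n \<in> L2 \<Omega>" "F \<in> L2 \<Omega>"
      "\<And>n. L2norm \<Omega> (\<lambda>x. g n x - f n x) < inverse (real (Suc n))" "(\<lambda>n. L2norm \<Omega> (\<lambda>x. g n x - F x)) \<longlonglongrightarrow> 0"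
    for f g :: "nat \<Rightarrow> real^'n \<Rightarrow> 'c::euclidean_space" and F
  proof (rule Lim_null_comparison)
    show "(\<lambda>n. inverse (real (Suc n)) + L2norm \<Omega> (\<lambda>x. g n x - F x)) \<longlonglongrightarrow> 0"
      using tendsto_add[OF LIMSEQ_inverse_real_of_nat that(5)] by simp
    have "L2norm \<Omega> (\<lambda>x. f n x - F x) \<le> inverse (real (Suc n)) + L2norm \<Omega> (\<lambda>x. g n x - F x)" for n
      using L2.nrm_triangle3[OF that(1,2,3), of n n] L2.nrm_diff_commute[OF that(1,2), of n n] that(4)[of n]
      unfolding L2norm_eq by simp
    then show "\<forall>\<^sub>F n in sequentially. norm (L2norm \<Omega> (\<lambda>x. f n x - F x)) \<le> inverse (real (Suc n)) + L2norm \<Omega> (\<lambda>x. g n x - F x)"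
      by (simp add: L2norm_nonneg)
  qed
  have l1: "(\<lambda>n. L2norm \<Omega> (\<lambda>x. \<phi> n x - u x)) \<longlonglongrightarrow> 0"
    by (rule lim[OF test_L2(1)[OF \<phi>(1)] w(1) u(1) \<phi>(2) u(2)])
  have l2: "(\<lambda>n. L2norm \<Omega> (\<lambda>x. grad (\<phi> n) x - G x)) \<longlonglongrightarrow> 0"
    by (rule lim[OF test_L2(2)[OF \<phi>(1)] w(3) G(1) \<phi>(3) G(2)])
  note uH = H10I[OF u(1) G(1) \<phi>(1) l1 l2]
  have "H.nrm (\<lambda>x. X n x - u x) = L2norm \<Omega> (\<lambda>x. weak_grad \<Omega> (X n) x - G x)" for n
    unfolding H_nrm_diff[OF X uH(1)]
  proof (rule L2norm_cong_AE)
    show "AE x in M. weak_grad \<Omega> (X n) x - weak_grad \<Omega> u x = weak_grad \<Omega> (X n) x - G x"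
      using uH(3) by eventually_elim simp
  qed (intro L2_measurable L2.diff_mem w G weak_grad_H10 uH(1))+
  then show ?thesis using G(2) u(2) by (intro bexI[OF _ uH(1)]) (simp add: L2norm_eq)
qed

end

section \<open>Dirichlet eigenvalues\<close>

context bounded_open begin

lemma L2_spanD:
  assumes "w \<in> L2_span \<Omega> v N"
  shows "w \<in> L2 \<Omega>" "\<exists>c. AE x in M. w x = (\<Sum>k=1..N. c k * v k x)"
  using assms by (auto simp: L2_span_def ae_zero_def)

lemma L2_eq_zero_of_AE:
  assumes "f \<in> L2 \<Omega>" "g \<in> L2 \<Omega>" "AE x in M. f x = (0::real)"
  shows "L2inner \<Omega> f g = 0"
  using L2inner_cong_AE[OF L2_measurable[OF assms(1)] L2_measurable[OF assms(2)] _ L2_measurable[OF assms(2)], of "\<lambda>x. 0"]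
    assms(3) L2.B_zero_left[OF assms(2)] by simp

text \<open>With more than N members, a non-trivial combination of them would have vanishing
  coordinates in the spanning family, hence vanish almost everywhere; pairing it with each member
  shows that it is trivial.\<close>

lemma orthonormal_card_le:
  assumes "finite I" "\<And>i. i \<in> I \<Longrightarrow> e i \<in> L2_span \<Omega> v N"
    "\<And>i j. i \<in> I \<Longrightarrow> j \<in> I \<Longrightarrow> L2inner \<Omega> (e i) (e j) = (if i = j then 1 else 0)"
  shows "card I \<le> N"
proof (rule ccontr)
  assume "\<not> card I \<le> N"
  then have lt: "card {1..N} < card I" by simp
  have "\<forall>i\<in>I. \<exists>c. AE x in M. e i x = (\<Sum>k=1..N. c k * v k x)" using L2_spanD(2)[OF assms(2)] by blast
  from bchoice[OF this] obtain A where A: "\<And>i. i \<in> I \<Longrightarrow> AE x in M. e i x = (\<Sum>k=1..N. A i k * v k x)" by blast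
  have "\<exists>c. (\<exists>i\<in>I. c i \<noteq> 0) \<and> (\<forall>k\<in>{1..N}. (\<Sum>i\<in>I. A i k * c i) = 0)"
    by (rule homogeneous_system_nontrivial) (use lt assms(1) in auto)
  then obtain c where c: "\<exists>i\<in>I. c i \<noteq> 0" "\<And>k. k \<in> {1..N} \<Longrightarrow> (\<Sum>i\<in>I. A i k * c i) = 0" by blast
  have L: "e i \<in> L2 \<Omega>" if "i \<in> I" for i using L2_spanD(1)[OF assms(2)[OF that]] .
  let ?s = "\<lambda>x. \<Sum>i\<in>I. c i *\<^sub>R e i x"
  have sL: "?s \<in> L2 \<Omega>" by (rule L2.lincomb_mem[OF L])
  have "AE x in M. \<forall>i\<in>I. e i x = (\<Sum>k=1..N. A i k * v k x)" using A assms(1) by (intro AE_finite_allI) auto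
  then have "AE x in M. ?s x = 0"
  proof eventually_elim
    case (elim x)
    have "?s x = (\<Sum>i\<in>I. c i * (\<Sum>k=1..N. A i k * v k x))" using elim by simp
    also have "\<dots> = (\<Sum>k=1..N. \<Sum>i\<in>I. c i * (A i k * v k x))" by (simp add: sum_distrib_left) (rule sum.swap)
    also have "\<dots> = (\<Sum>k=1..N. (\<Sum>i\<in>I. A i k * c i) * v k x)" by (simp add: sum_distrib_left mult_ac)
    also have "\<dots> = 0" using c(2) by (intro sum.neutral) auto
    finally show ?case .
  qed
  have "c j = 0" if j: "j \<in> I" for j
  proof -
    have "0 = L2inner \<Omega> ?s (e j)" using L2_eq_zero_of_AE[OF sL L[OF j]] \<open>AE x in M. ?s x = 0\<close> by simp
    also have "\<dots> = (\<Sum>i\<in>I. c i * L2inner \<Omega> (e i) (e j))" using L j by (intro L2.B_lincomb_left) auto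
    also have "\<dots> = (\<Sum>i\<in>I. if i = j then c j else 0)" using assms(3) j by (intro sum.cong) auto
    also have "\<dots> = c j" using assms(1) j by simp
    finally show ?thesis by simp
  qed
  then show False using c(1) by blast
qed

end

text \<open>Bolzano-Weierstrass, iterated. As distances are controlled by finitely many Fourier
  coefficients, this takes the place of a compact embedding.\<close>

lemma common_convergent_subsequence:
  fixes f :: "'i \<Rightarrow> nat \<Rightarrow> real"
  assumes "finite I" "\<And>i. i \<in> I \<Longrightarrow> bounded (range (f i))"
  shows "\<exists>r. strict_mono (r :: nat \<Rightarrow> nat) \<and> (\<forall>i\<in>I. convergent (\<lambda>n. f i (r n)))"
  using assms
proof (induction I rule: finite_induct)
  case empty
  then show ?case by (intro exI[of _ id]) (auto simp: strict_mono_def)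
next
  case (insert i I)
  then obtain r where r: "strict_mono (r :: nat \<Rightarrow> nat)" "\<And>i. i \<in> I \<Longrightarrow> convergent (\<lambda>n. f i (r n))" by auto
  have "bounded (range (\<lambda>n. f i (r n)))" using insert.prems[of i] by (rule bounded_subset) auto
  from bounded_imp_convergent_subsequence[OF this]
  obtain l s where s: "strict_mono (s :: nat \<Rightarrow> nat)" "((\<lambda>n. f i (r n)) \<circ> s) \<longlonglongrightarrow> l" by blast
  have "convergent (\<lambda>n. f j (r (s n)))" if "j \<in> insert i I" for j
  proof (cases "j = i")
    case True then show ?thesis using s(2) by (auto simp: convergent_def o_def)
  next
    case False
    then have "convergent (\<lambda>n. f j (r n))" using r that by blast
    then obtain l' where "(\<lambda>n. f j (r n)) \<longlonglongrightarrow> l'" by (auto simp: convergent_def)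
    from LIMSEQ_subseq_LIMSEQ[OF this s(1)] show ?thesis by (auto simp: convergent_def o_def)
  qed
  then show ?case using strict_mono_o[OF r(1) s(1)] by (intro exI[of _ "r \<circ> s"]) (simp add: o_def)
qed

locale eigensystem = small_boxed_open \<Omega> \<tau> for \<Omega> :: "(real^'n) set" and \<tau> +
  fixes lam :: "nat \<Rightarrow> real" and \<Psi> :: "nat \<Rightarrow> real^'n \<Rightarrow> real"
  assumes eigensystem: "dirichlet_eigensystem \<Omega> lam \<Psi>"
begin

lemma mem_dirichlet_eigenspace:
  "w \<in> dirichlet_eigenspace \<Omega> \<mu> \<longleftrightarrow> w \<in> H10 \<Omega> \<and> (\<forall>\<phi>\<in>H10 \<Omega>. D w \<phi> = \<mu> * L2inner \<Omega> w \<phi>)"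
proof -
  have "L2inner \<Omega> (\<lambda>x. \<mu> * w x) \<phi> = \<mu> * L2inner \<Omega> w \<phi>" if "w \<in> H10 \<Omega>" "\<phi> \<in> H10 \<Omega>" for \<phi>
    using L2.B_scale_left[OF weak_grad_H10(1)[OF that(1)] weak_grad_H10(1)[OF that(2)], of \<mu>] by simp
  then show ?thesis by (auto simp: dirichlet_eigenspace_def is_weak_sol_def D_def)
qed

lemma
  assumes "k \<ge> 1"
  shows \<Psi>_H10: "\<Psi> k \<in> H10 \<Omega>" and \<Psi>_L2: "\<Psi> k \<in> L2 \<Omega>"
    and D_\<Psi>: "\<phi> \<in> H10 \<Omega> \<Longrightarrow> D (\<Psi> k) \<phi> = lam k * L2inner \<Omega> (\<Psi> k) \<phi>"
proof -
  have "\<Psi> k \<in> dirichlet_eigenspace \<Omega> (lam k)" using eigensystem assms by (simp add: dirichlet_eigensystem_def)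
  then show "\<Psi> k \<in> H10 \<Omega>" "\<phi> \<in> H10 \<Omega> \<Longrightarrow> D (\<Psi> k) \<phi> = lam k * L2inner \<Omega> (\<Psi> k) \<phi>"
    by (auto simp: mem_dirichlet_eigenspace)
  then show "\<Psi> k \<in> L2 \<Omega>" using weak_grad_H10 by blast
qed

lemma D_\<Psi>_right: "k \<ge> 1 \<Longrightarrow> \<phi> \<in> H10 \<Omega> \<Longrightarrow> D \<phi> (\<Psi> k) = lam k * L2inner \<Omega> \<phi> (\<Psi> k)"
  using D_\<Psi>[of k \<phi>] H.B_commute[of \<phi> "\<Psi> k"] L2.B_commute[of \<phi> "\<Psi> k"] \<Psi>_H10 \<Psi>_L2 weak_grad_H10(1)[of \<phi>] by simp

lemma \<Psi>_orthonormal: "j \<ge> 1 \<Longrightarrow> k \<ge> 1 \<Longrightarrow> L2inner \<Omega> (\<Psi> j) (\<Psi> k) = (if j = k then 1 else 0)"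
  using eigensystem by (simp add: dirichlet_eigensystem_def)

lemma lam_mono:
  assumes "1 \<le> j" "j \<le> k" shows "lam j \<le> lam k"
  using assms(2)
proof (induction k rule: dec_induct)
  case (step k)
  have "lam k \<le> lam (Suc k)" using eigensystem step assms(1) by (simp add: dirichlet_eigensystem_def)
  then show ?case using step.IH by simp
qed simp

lemma lam_pos: "k \<ge> 1 \<Longrightarrow> 0 < lam k"
  using Poincare[OF \<Psi>_H10, of k] D_\<Psi>[of k "\<Psi> k"] \<Psi>_H10[of k] \<Psi>_orthonormal[of k k] \<tau>_pos
  by (simp add: less_le_trans[of 0 "\<tau>\<^sup>2 / 2"])

definition proj :: "nat \<Rightarrow> (real^'n \<Rightarrow> real) \<Rightarrow> real^'n \<Rightarrow> real" where
  "proj N f x = (\<Sum>k=1..N. L2inner \<Omega> f (\<Psi> k) *\<^sub>R \<Psi> k x)"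

lemma proj_H10: "proj N f \<in> H10 \<Omega>" and proj_L2: "proj N f \<in> L2 \<Omega>"
proof -
  show "proj N f \<in> H10 \<Omega>" unfolding proj_def[abs_def] by (rule H.lincomb_mem) (simp add: \<Psi>_H10)
  then show "proj N f \<in> L2 \<Omega>" by (rule weak_grad_H10(1))
qed

lemma diff_proj_orthogonal:
  assumes "f \<in> L2 \<Omega>" "k \<in> {1..N}"
  shows "L2inner \<Omega> (\<lambda>x. f x - proj N f x) (\<Psi> k) = 0"
  unfolding proj_def by (rule L2.lincomb_diff_orthonormal) (use assms in \<open>auto simp: \<Psi>_L2 \<Psi>_orthonormal\<close>)

text \<open>Against an eigenfunction the Dirichlet form is a multiple of the L2 product, so L2
  orthogonality to \<open>\<Psi> k\<close> implies orthogonality in energy.\<close>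

lemma D_orthogonal_proj:
  assumes "w \<in> H10 \<Omega>" "\<And>k. k \<in> {1..N} \<Longrightarrow> L2inner \<Omega> w (\<Psi> k) = 0"
  shows "D w (proj N f) = 0" "L2inner \<Omega> w (proj N f) = 0"
proof -
  have "D w (proj N f) = (\<Sum>k=1..N. L2inner \<Omega> f (\<Psi> k) * D w (\<Psi> k))"
    unfolding proj_def by (rule H.B_lincomb_right) (use assms \<Psi>_H10 in auto)
  also have "\<dots> = 0" using assms by (intro sum.neutral) (auto simp: D_\<Psi>_right)
  finally show "D w (proj N f) = 0" .
  have "L2inner \<Omega> w (proj N f) = (\<Sum>k=1..N. L2inner \<Omega> f (\<Psi> k) * L2inner \<Omega> w (\<Psi> k))"
    unfolding proj_def by (rule L2.B_lincomb_right) (use assms \<Psi>_L2 weak_grad_H10 in auto)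
  also have "\<dots> = 0" using assms by (intro sum.neutral) auto
  finally show "L2inner \<Omega> w (proj N f) = 0" .
qed

text \<open>The minimum of the Rayleigh quotient on the orthogonal complement of \<open>\<Psi>\<^sub>1, \<dots>, \<Psi>\<^sub>N\<close> is
  attained: for a minimising sequence the parallelogram law and the spectral bound control
  distances by finitely many Fourier coefficients. The minimiser is an eigenfunction, and the
  multiplicity condition leaves no room for it below \<open>\<lambda>\<^bsub>N+1\<^esub>\<close>.\<close>

theorem Rayleigh:
  assumes w: "w \<in> H10 \<Omega>" and w_orth: "\<And>k. k \<in> {1..N} \<Longrightarrow> L2inner \<Omega> w (\<Psi> k) = 0"
  shows "lam (Suc N) * L2inner \<Omega> w w \<le> D w w"
proof (rule ccontr)
  assume neg: "\<not> lam (Suc N) * L2inner \<Omega> w w \<le> D w w"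
  define S where "S = {u \<in> H10 \<Omega>. \<forall>k\<in>{1..N}. L2inner \<Omega> u (\<Psi> k) = 0}"
  have SH: "u \<in> H10 \<Omega>" and SL: "u \<in> L2 \<Omega>" and So: "k \<in> {1..N} \<Longrightarrow> L2inner \<Omega> u (\<Psi> k) = 0" if "u \<in> S" for u k
    using that weak_grad_H10(1) by (auto simp: S_def)
  have S_lin: "(\<lambda>x. u x + c *\<^sub>R v x) \<in> S" if "u \<in> S" "v \<in> S" for u v c
    unfolding S_def using that H.add_mem[OF SH[OF that(1)] H.scale_mem[OF SH[OF that(2)], of c]]
    by (auto simp: L2.B_add_left L2.B_scale_left L2.scale_mem SL \<Psi>_L2 So simp del: real_scaleR_def)
  have S_scale: "(\<lambda>x. c *\<^sub>R v x) \<in> S" if "v \<in> S" for v c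
    unfolding S_def using that H.scale_mem[OF SH[OF that], of c] by (auto simp: L2.B_scale_left SL \<Psi>_L2 So simp del: real_scaleR_def)
  define R where "R = {D u u | u. u \<in> S \<and> L2inner \<Omega> u u = 1}"
  define \<mu> where "\<mu> = Inf R"
  have bdd: "bdd_below R" by (rule bdd_belowI[of _ 0]) (auto simp: R_def SH H.B_nonneg)
  have wS: "w \<in> S" using w w_orth by (simp add: S_def)
  have wpos: "0 < L2inner \<Omega> w w"
  proof -
    have "L2inner \<Omega> w w \<noteq> 0" using neg H.B_nonneg[OF w] by auto
    then show ?thesis using L2.B_nonneg[OF SL[OF wS]] by simp
  qed
  have normalise: "D u u / L2inner \<Omega> u u \<in> R" if u: "u \<in> S" "0 < L2inner \<Omega> u u" for u
  proof -
    define c where "c = 1 / sqrt (L2inner \<Omega> u u)"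
    have c2: "c * c * L2inner \<Omega> u u = 1" using u(2) by (simp add: c_def)
    let ?u = "\<lambda>x. c *\<^sub>R u x"
    have "D ?u ?u = c * c * D u u" using SH[OF u(1)] by (simp add: H.B_scale_left H.B_scale_right H.scale_mem del: real_scaleR_def)
    also have "c * c = 1 / L2inner \<Omega> u u" using c2 u(2) by (simp add: field_simps)
    finally have "D ?u ?u = D u u / L2inner \<Omega> u u" by simp
    moreover have "L2inner \<Omega> ?u ?u = 1" using SL[OF u(1)] c2 by (simp add: L2.B_scale_left L2.B_scale_right L2.scale_mem del: real_scaleR_def)
    moreover have "D ?u ?u \<in> R" if "L2inner \<Omega> ?u ?u = 1" unfolding R_def using S_scale[OF u(1), of c] that by blast
    ultimately show ?thesis by simp
  qed
  have \<mu>_le: "\<mu> * L2inner \<Omega> u u \<le> D u u" if u: "u \<in> S" for u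
  proof (cases "L2inner \<Omega> u u = 0")
    case False
    then have p: "0 < L2inner \<Omega> u u" using L2.B_nonneg[OF SL[OF u]] by simp
    have "\<mu> \<le> D u u / L2inner \<Omega> u u" unfolding \<mu>_def by (rule cInf_lower[OF normalise[OF u p] bdd])
    then show ?thesis using p by (simp add: field_simps)
  qed (simp add: H.B_nonneg SH u)
  have R_ne: "R \<noteq> {}" using normalise[OF wS wpos] by blast
  have \<mu>0: "0 \<le> \<mu>" unfolding \<mu>_def by (rule cInf_greatest[OF R_ne]) (auto simp: R_def SH H.B_nonneg)
  have \<mu>_lt: "\<mu> < lam (Suc N)"
  proof -
    have "\<mu> \<le> D w w / L2inner \<Omega> w w" unfolding \<mu>_def by (rule cInf_lower[OF normalise[OF wS wpos] bdd])
    also have "\<dots> < lam (Suc N)" using neg wpos by (simp add: field_simps)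
    finally show ?thesis .
  qed
  have "\<forall>n. \<exists>u. u \<in> S \<and> L2inner \<Omega> u u = 1 \<and> D u u < \<mu> + inverse (real (Suc n))"
  proof
    fix n
    have "Inf R < \<mu> + inverse (real (Suc n))" by (simp add: \<mu>_def)
    from cInf_lessD[OF R_ne this] show "\<exists>u. u \<in> S \<and> L2inner \<Omega> u u = 1 \<and> D u u < \<mu> + inverse (real (Suc n))"
      unfolding R_def by blast
  qed
  from choice[OF this] obtain Y where Y: "\<And>n. Y n \<in> S" "\<And>n. L2inner \<Omega> (Y n) (Y n) = 1"
    "\<And>n. D (Y n) (Y n) < \<mu> + inverse (real (Suc n))" by blast
  \<comment> \<open>The level exceeds \<mu> by 1. The parallelogram law bounds the energy of a
    difference by \<mu> times its squared L2 norm plus small terms, while the spectral bound at this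
    level controls \<mu> + 1 times that squared norm; the surplus can be solved for.\<close>
  define F where "F = low (\<mu> + 1)"
  have bounded_coeff: "bounded (range (\<lambda>n. if b then tcos (Y n) \<xi> else tsin (Y n) \<xi>))" for b \<xi>
  proof (rule boundedI)
    fix y assume "y \<in> range (\<lambda>n. if b then tcos (Y n) \<xi> else tsin (Y n) \<xi>)"
    then obtain n where y: "y = (if b then tcos (Y n) \<xi> else tsin (Y n) \<xi>)" by blast
    have n1: "L2.nrm (Y n) = 1" using Y(2) by (simp add: L2.nrm_def)
    show "norm y \<le> max (L2.nrm (\<lambda>x. cos (\<xi> \<bullet> x))) (L2.nrm (\<lambda>x. sin (\<xi> \<bullet> x)))"
      using L2.Cauchy_Schwarz[OF SL[OF Y(1)] trig_L2(1), of n \<xi>] L2.Cauchy_Schwarz[OF SL[OF Y(1)] trig_L2(2), of n \<xi>]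
      by (auto simp: y tcos_def tsin_def n1)
  qed
  obtain r :: "nat \<Rightarrow> nat" where r: "strict_mono r"
    "\<And>k. k \<in> F \<times> UNIV \<Longrightarrow> convergent (\<lambda>n. if snd k then tcos (Y (r n)) (fst k) else tsin (Y (r n)) (fst k))"
    using common_convergent_subsequence[of "F \<times> (UNIV :: bool set)" "\<lambda>k n. if snd k then tcos (Y n) (fst k) else tsin (Y n) (fst k)"]
      bounded_coeff finite_low F_def by auto
  define X where "X n = Y (r n)" for n
  define \<epsilon> where "\<epsilon> n = inverse (real (Suc n))" for n
  have X: "X n \<in> S" "L2inner \<Omega> (X n) (X n) = 1" "D (X n) (X n) \<le> \<mu> + \<epsilon> n" for n
  proof -
    show "X n \<in> S" "L2inner \<Omega> (X n) (X n) = 1" using Y by (auto simp: X_def)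
    have "n \<le> r n" by (rule seq_suble[OF r(1)])
    then have "inverse (real (Suc (r n))) \<le> inverse (real (Suc n))" by (intro le_imp_inverse_le) auto
    then show "D (X n) (X n) \<le> \<mu> + \<epsilon> n" using Y(3)[of "r n"] unfolding X_def \<epsilon>_def by linarith
  qed
  have XH: "X n \<in> H10 \<Omega>" and XL: "X n \<in> L2 \<Omega>" for n using SH SL X by auto
  have "\<exists>a. \<forall>\<xi>\<in>F. (\<lambda>n. tcos (X n) \<xi>) \<longlonglongrightarrow> a \<xi>" "\<exists>b. \<forall>\<xi>\<in>F. (\<lambda>n. tsin (X n) \<xi>) \<longlonglongrightarrow> b \<xi>"
    using r(2)[of "(\<xi>, True)" for \<xi>] r(2)[of "(\<xi>, False)" for \<xi>]
    by (auto simp: X_def convergent_def intro!: bchoice)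
  then obtain a b where ab: "\<And>\<xi>. \<xi> \<in> F \<Longrightarrow> (\<lambda>n. tcos (X n) \<xi>) \<longlonglongrightarrow> a \<xi>" "\<And>\<xi>. \<xi> \<in> F \<Longrightarrow> (\<lambda>n. tsin (X n) \<xi>) \<longlonglongrightarrow> b \<xi>"
    by blast
  define E where "E n = (\<Sum>\<xi>\<in>F. (tcos (X n) \<xi> - a \<xi>)\<^sup>2 + (tsin (X n) \<xi> - b \<xi>)\<^sup>2)" for n
  have E0: "E \<longlonglongrightarrow> 0"
  proof -
    have "(\<lambda>n. (\<Sum>\<xi>\<in>F. (tcos (X n) \<xi> - a \<xi>)\<^sup>2 + (tsin (X n) \<xi> - b \<xi>)\<^sup>2)) \<longlonglongrightarrow> (\<Sum>\<xi>\<in>F. (a \<xi> - a \<xi>)\<^sup>2 + (b \<xi> - b \<xi>)\<^sup>2)"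
      by (intro tendsto_intros ab)
    then show ?thesis by (simp add: E_def[abs_def])
  qed
  \<comment> \<open>What is left once the L2 norm of the difference has been eliminated from the two
    inequalities, split into one contribution per index.\<close>
  define A where "A n = (1 + \<mu>) * (2 * \<epsilon> n) + 2 * \<mu> * \<kappa> * (\<mu> + 1) * E n" for n
  have \<epsilon>0: "\<epsilon> \<longlonglongrightarrow> 0" unfolding \<epsilon>_def[abs_def] by (rule LIMSEQ_inverse_real_of_nat)
  have A0: "A \<longlonglongrightarrow> 0"
  proof -
    have "(\<lambda>n. (1 + \<mu>) * (2 * \<epsilon> n) + 2 * \<mu> * \<kappa> * (\<mu> + 1) * E n) \<longlonglongrightarrow> (1 + \<mu>) * (2 * 0) + 2 * \<mu> * \<kappa> * (\<mu> + 1) * 0"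
      by (intro tendsto_intros \<epsilon>0 E0)
    then show ?thesis by (simp add: A_def[abs_def])
  qed
  have key: "D (\<lambda>x. X m x - X n x) (\<lambda>x. X m x - X n x) \<le> A m + A n" for m n
  proof -
    let ?d = "\<lambda>x. X m x - X n x" and ?s = "\<lambda>x. X m x + X n x"
    have dH: "?d \<in> H10 \<Omega>" by (intro H.diff_mem XH)
    have sS: "?s \<in> S" using S_lin[OF X(1) X(1), of m 1 n] by simp
    \<comment> \<open>Parallelogram law in both forms. The sum lies in \<open>S\<close>, so its
      energy is at least \<mu> times its squared norm, and little energy is left for the
      difference.\<close>
    have "D ?d ?d + D ?s ?s = 2 * D (X m) (X m) + 2 * D (X n) (X n)"
      using XH by (simp add: H.B_diff_self H.B_add_self)
    moreover have "L2inner \<Omega> ?d ?d + L2inner \<Omega> ?s ?s = 4"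
      using XL X(2) by (simp add: L2.B_diff_self L2.B_add_self)
    then have "\<mu> * L2inner \<Omega> ?s ?s = 4 * \<mu> - \<mu> * L2inner \<Omega> ?d ?d"
    proof -
      assume "L2inner \<Omega> ?d ?d + L2inner \<Omega> ?s ?s = 4"
      then have "L2inner \<Omega> ?s ?s = 4 - L2inner \<Omega> ?d ?d" by linarith
      then show ?thesis by (simp add: right_diff_distrib)
    qed
    ultimately have 1: "D ?d ?d \<le> 2 * \<epsilon> m + 2 * \<epsilon> n + \<mu> * L2inner \<Omega> ?d ?d"
      using \<mu>_le[OF sS] X(3)[of m] X(3)[of n] by linarith
    have coef: "(tcos ?d \<xi>)\<^sup>2 + (tsin ?d \<xi>)\<^sup>2
      \<le> 2 * ((tcos (X m) \<xi> - a \<xi>)\<^sup>2 + (tsin (X m) \<xi> - b \<xi>)\<^sup>2) + 2 * ((tcos (X n) \<xi> - a \<xi>)\<^sup>2 + (tsin (X n) \<xi> - b \<xi>)\<^sup>2)" for \<xi>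
    proof -
      have sq: "(p - q)\<^sup>2 \<le> 2 * (p - z)\<^sup>2 + 2 * (q - z)\<^sup>2" for p q z :: real
      proof -
        have "0 \<le> ((p - z) + (q - z))\<^sup>2" by simp
        then show ?thesis by (simp add: power2_eq_square algebra_simps)
      qed
      have "tcos ?d \<xi> = tcos (X m) \<xi> - tcos (X n) \<xi>" "tsin ?d \<xi> = tsin (X m) \<xi> - tsin (X n) \<xi>"
        unfolding tcos_def tsin_def by (intro L2.B_diff_left XL trig_L2)+
      then show ?thesis using sq[of "tcos (X m) \<xi>" "tcos (X n) \<xi>" "a \<xi>"] sq[of "tsin (X m) \<xi>" "tsin (X n) \<xi>" "b \<xi>"] by simp
    qed
    have "(\<mu> + 1) * L2inner \<Omega> ?d ?d - D ?d ?d \<le> \<kappa> * (\<Sum>\<xi>\<in>F. (\<mu> + 1 - (norm \<xi>)\<^sup>2) * ((tcos ?d \<xi>)\<^sup>2 + (tsin ?d \<xi>)\<^sup>2))"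
      unfolding F_def by (rule spectral_bound[OF dH]) (use \<mu>0 in simp)
    also have "\<dots> \<le> \<kappa> * (\<Sum>\<xi>\<in>F. (\<mu> + 1) * (2 * ((tcos (X m) \<xi> - a \<xi>)\<^sup>2 + (tsin (X m) \<xi> - b \<xi>)\<^sup>2) + 2 * ((tcos (X n) \<xi> - a \<xi>)\<^sup>2 + (tsin (X n) \<xi> - b \<xi>)\<^sup>2)))"
      using \<kappa>_pos \<mu>0 coef by (intro mult_left_mono sum_mono mult_mono) auto
    also have "\<dots> = \<kappa> * (\<mu> + 1) * (2 * E m + 2 * E n)"
      by (simp only: E_def sum_distrib_left[symmetric] sum.distrib mult.assoc)
    finally have 2: "(\<mu> + 1) * L2inner \<Omega> ?d ?d - D ?d ?d \<le> \<kappa> * (\<mu> + 1) * (2 * E m + 2 * E n)" .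
    then have "L2inner \<Omega> ?d ?d \<le> 2 * \<epsilon> m + 2 * \<epsilon> n + \<kappa> * (\<mu> + 1) * (2 * E m + 2 * E n)"
      using 1 by (simp add: distrib_right)
    from mult_left_mono[OF this \<mu>0] 1
    have "D ?d ?d \<le> 2 * \<epsilon> m + 2 * \<epsilon> n + \<mu> * (2 * \<epsilon> m + 2 * \<epsilon> n + \<kappa> * (\<mu> + 1) * (2 * E m + 2 * E n))" by linarith
    also have "\<dots> = A m + A n" by (simp add: A_def algebra_simps)
    finally show ?thesis .
  qed
  have "\<exists>K. \<forall>m\<ge>K. \<forall>n\<ge>K. H.nrm (\<lambda>x. X m x - X n x) < e" if "e > 0" for e
  proof -
    from order_tendstoD(2)[OF A0, of "e\<^sup>2/2"] that obtain K where K: "\<And>n. n \<ge> K \<Longrightarrow> A n < e\<^sup>2/2"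
      by (auto simp: eventually_sequentially)
    have "H.nrm (\<lambda>x. X m x - X n x) < e" if "m \<ge> K" "n \<ge> K" for m n
    proof -
      have "D (\<lambda>x. X m x - X n x) (\<lambda>x. X m x - X n x) < e\<^sup>2" using key[of m n] K[OF that(1)] K[OF that(2)] by linarith
      then show ?thesis unfolding H.nrm_def using \<open>e > 0\<close> by (simp add: real_less_lsqrt H.B_nonneg H.diff_mem XH)
    qed
    then show ?thesis by blast
  qed
  from H10_complete[OF XH this] obtain u where u: "u \<in> H10 \<Omega>" "(\<lambda>n. H.nrm (\<lambda>x. X n x - u x)) \<longlonglongrightarrow> 0" "(\<lambda>n. L2.nrm (\<lambda>x. X n x - u x)) \<longlonglongrightarrow> 0"
    by blast
  have uL: "u \<in> L2 \<Omega>" using weak_grad_H10(1)[OF u(1)] .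
  have u1: "L2inner \<Omega> u u = 1"
  proof -
    have "(\<lambda>n. (L2.nrm (X n))\<^sup>2) \<longlonglongrightarrow> (L2.nrm u)\<^sup>2" by (intro tendsto_power L2.nrm_tendsto[OF XL uL u(3)])
    then show ?thesis by (simp add: L2.nrm_sq XL uL X(2) LIMSEQ_const_iff)
  qed
  have uo: "L2inner \<Omega> u (\<Psi> k) = 0" if k: "k \<in> {1..N}" for k
  proof -
    have "(\<lambda>n. L2inner \<Omega> (X n) (\<Psi> k)) \<longlonglongrightarrow> L2inner \<Omega> u (\<Psi> k)" by (rule L2.B_tendsto[OF XL uL u(3) \<Psi>_L2]) (use k in simp)
    then show ?thesis using So[OF X(1) k] by (simp add: LIMSEQ_const_iff)
  qed
  have uS: "u \<in> S" using u(1) uo by (simp add: S_def)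
  have uD: "D u u = \<mu>"
  proof (rule antisym)
    have 1: "(\<lambda>n. (H.nrm (X n))\<^sup>2) \<longlonglongrightarrow> (H.nrm u)\<^sup>2" by (intro tendsto_power H.nrm_tendsto[OF XH u(1,2)])
    have 2: "(\<lambda>n. \<mu> + \<epsilon> n) \<longlonglongrightarrow> \<mu>" using tendsto_add[OF tendsto_const \<epsilon>0, of \<mu>] by simp
    show "D u u \<le> \<mu>" using LIMSEQ_le[OF 1 2] X(3) by (simp add: H.nrm_sq XH u(1))
    show "\<mu> \<le> D u u" using \<mu>_le[OF uS] u1 by simp
  qed
  \<comment> \<open>The constant term \<open>D u u - \<mu>\<close> of the non-negative quadratic in
    \<open>t\<close> vanishes, hence so does the linear one.\<close>
  have EL_S: "D u \<phi> = \<mu> * L2inner \<Omega> u \<phi>" if \<phi>: "\<phi> \<in> S" for \<phi>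
  proof -
    have "(D u \<phi> - \<mu> * L2inner \<Omega> u \<phi>)\<^sup>2 \<le> 0 * (D \<phi> \<phi> - \<mu> * L2inner \<Omega> \<phi> \<phi>)"
    proof (rule quadratic_nonneg_imp)
      fix t
      have "\<mu> * (L2inner \<Omega> u u + 2 * t * L2inner \<Omega> u \<phi> + t\<^sup>2 * L2inner \<Omega> \<phi> \<phi>) \<le> D u u + 2 * t * D u \<phi> + t\<^sup>2 * D \<phi> \<phi>"
        using \<mu>_le[OF S_lin[OF uS \<phi>, of t]] by (simp only: L2.B_add_scale[OF uL SL[OF \<phi>]] H.B_add_scale[OF u(1) SH[OF \<phi>]])
      then show "0 \<le> 0 + 2 * t * (D u \<phi> - \<mu> * L2inner \<Omega> u \<phi>) + t\<^sup>2 * (D \<phi> \<phi> - \<mu> * L2inner \<Omega> \<phi> \<phi>)"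
        using u1 uD by (simp add: algebra_simps)
    qed (use \<mu>_le[OF \<phi>] in simp)
    then show ?thesis by simp
  qed
  have u_eig: "u \<in> dirichlet_eigenspace \<Omega> \<mu>"
    unfolding mem_dirichlet_eigenspace
  proof (intro conjI ballI u(1))
    fix \<phi> assume \<phi>: "\<phi> \<in> H10 \<Omega>"
    have \<phi>L: "\<phi> \<in> L2 \<Omega>" using weak_grad_H10(1)[OF \<phi>] .
    \<comment> \<open>General \<phi> reduce to \<open>S\<close>, because \<open>u\<close> is
      orthogonal to the projection in both forms.\<close>
    have "(\<lambda>x. \<phi> x - proj N \<phi> x) \<in> S"
      unfolding S_def using H.diff_mem[OF \<phi> proj_H10] diff_proj_orthogonal[OF \<phi>L] by auto
    from EL_S[OF this] show "D u \<phi> = \<mu> * L2inner \<Omega> u \<phi>"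
      using D_orthogonal_proj[OF u(1) uo] by (simp add: H.B_diff_right L2.B_diff_right u(1) uL \<phi> \<phi>L proj_H10 proj_L2)
  qed
  define J where "J = {k. k \<ge> 1 \<and> lam k = \<mu>}"
  have J: "finite J" "has_dim \<Omega> (dirichlet_eigenspace \<Omega> \<mu>) (card J)"
    using eigensystem by (auto simp: dirichlet_eigensystem_def J_def)
  \<comment> \<open>Because \<mu> lies below \<open>lam (Suc N)\<close>, every listed eigenfunction
    for \<mu> is among the first N and thus orthogonal to \<open>u\<close>.\<close>
  have JN: "k \<in> {1..N}" if "k \<in> J" for k
  proof (rule ccontr)
    assume "k \<notin> {1..N}"
    then have "Suc N \<le> k" using that by (auto simp: J_def)
    from lam_mono[OF _ this] show False using \<mu>_lt that by (simp add: J_def)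
  qed
  obtain v where v: "dirichlet_eigenspace \<Omega> \<mu> = L2_span \<Omega> v (card J)" using J(2) by (auto simp: has_dim_def)
  \<comment> \<open>Sequences start at 1, so index 0 is free for the minimiser; the eigenspace would
    then contain one orthonormal function more than its dimension.\<close>
  define e where "e k = (if k = 0 then u else \<Psi> k)" for k :: nat
  have J0: "0 \<notin> J" by (simp add: J_def)
  have "card (insert 0 J) \<le> card J"
  proof (rule orthonormal_card_le)
    show "e i \<in> L2_span \<Omega> v (card J)" if "i \<in> insert 0 J" for i
      unfolding v[symmetric] using that u_eig eigensystem by (auto simp: e_def J_def dirichlet_eigensystem_def)
    show "L2inner \<Omega> (e i) (e j) = (if i = j then 1 else 0)" if "i \<in> insert 0 J" "j \<in> insert 0 J" for i j
    proof -
      have "L2inner \<Omega> (\<Psi> k) u = 0" "L2inner \<Omega> u (\<Psi> k) = 0" "k \<noteq> 0" if "k \<in> J" for k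
        using uo[OF JN[OF that]] L2.B_commute[OF uL \<Psi>_L2, of k] that by (auto simp: J_def)
      moreover have "L2inner \<Omega> (\<Psi> i) (\<Psi> j) = (if i = j then 1 else 0)" if "i \<in> J" "j \<in> J"
        using that by (intro \<Psi>_orthonormal) (auto simp: J_def)
      ultimately show ?thesis using that u1 by (auto simp: e_def)
    qed
  qed (use J in simp)
  then show False using J(1) J0 by simp
qed

end

section \<open>Weyl's law\<close>

context boxed_open begin

definition d\<^sub>n :: real where "d\<^sub>n = real CARD('n)"

text \<open>A coarse bound for the cell diameter through the l1 norm; it shifts radii by a constant,
  which is negligible against sqrt \<Lambda>.\<close>

lemma norm_cell_le:
  fixes x \<xi> :: "real^'n"
  assumes "x \<in> cbox \<xi> (\<xi> + (\<chi> i. \<tau>))"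
  shows "norm (x - \<xi>) \<le> d\<^sub>n * \<tau>"
proof -
  have "norm (x - \<xi>) \<le> (\<Sum>i\<in>UNIV. \<bar>(x - \<xi>) $ i\<bar>)" by (rule norm_le_l1_cart)
  also have "\<dots> \<le> (\<Sum>i\<in>(UNIV :: 'n set). \<tau>)"
  proof (rule sum_mono)
    fix i
    have "\<xi> $ i \<le> x $ i \<and> x $ i \<le> \<xi> $ i + \<tau>" using assms by (simp add: mem_box_cart)
    then show "\<bar>(x - \<xi>) $ i\<bar> \<le> \<tau>" by simp
  qed
  finally show ?thesis by (simp add: d\<^sub>n_def)
qed

lemma measure_cell:
  "measure lborel (cbox \<xi> (\<xi> + (\<chi> i. \<tau>))) = \<tau> ^ CARD('n)"
  "measure lborel (box \<xi> (\<xi> + (\<chi> i. \<tau>))) = \<tau> ^ CARD('n)" for \<xi> :: "real^'n"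
proof -
  show 1: "measure lborel (cbox \<xi> (\<xi> + (\<chi> i. \<tau>))) = \<tau> ^ CARD('n)"
    using \<tau>_pos by (subst content_cbox_cart) (auto simp: interval_eq_empty_cart not_less)
  have "emeasure lborel (box \<xi> (\<xi> + (\<chi> i. \<tau>))) = emeasure lborel (cbox \<xi> (\<xi> + (\<chi> i. \<tau>)))"
    using \<tau>_pos by (simp add: emeasure_lborel_box_eq emeasure_lborel_cbox_eq)
  then show "measure lborel (box \<xi> (\<xi> + (\<chi> i. \<tau>))) = \<tau> ^ CARD('n)" using 1 by (simp add: measure_def)
qed

lemma cells_disjoint:
  "disjoint_family_on (\<lambda>\<xi>. box \<xi> (\<xi> + (\<chi> i. \<tau>))) (low \<Lambda>)"
  unfolding disjoint_family_on_def
proof (intro ballI impI)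
  fix \<xi> \<eta> :: "real^'n" assume \<xi>\<eta>: "\<xi> \<in> low \<Lambda>" "\<eta> \<in> low \<Lambda>" "\<xi> \<noteq> \<eta>"
  show "box \<xi> (\<xi> + (\<chi> i. \<tau>)) \<inter> box \<eta> (\<eta> + (\<chi> i. \<tau>)) = {}"
  proof (rule ccontr)
    assume "\<not> ?thesis"
    then obtain x where x: "x \<in> box \<xi> (\<xi> + (\<chi> i. \<tau>))" "x \<in> box \<eta> (\<eta> + (\<chi> i. \<tau>))" by blast
    have "\<xi> $ i = \<eta> $ i" for i
    proof -
      obtain m l :: int where ml: "\<xi> $ i = \<tau> * of_int m" "\<eta> $ i = \<tau> * of_int l"
        using \<xi>\<eta>(1,2) unfolding low_def lat_def by blast
      have "\<bar>\<xi> $ i - \<eta> $ i\<bar> < \<tau> * 1" using x by (auto simp: mem_box_cart abs_less_iff) (smt (verit))+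
      also have "\<xi> $ i - \<eta> $ i = \<tau> * (of_int (m - l))" by (simp add: ml right_diff_distrib)
      finally have "\<tau> * \<bar>real_of_int (m - l)\<bar> < \<tau> * 1" using \<tau>_pos by (simp add: abs_mult)
      then have "\<bar>real_of_int (m - l)\<bar> < 1" using mult_less_cancel_left_pos[OF \<tau>_pos] by blast
      then have "m = l" by linarith
      then show ?thesis by (simp add: ml)
    qed
    then show False using \<xi>\<eta>(3) by (simp add: vec_eq_iff)
  qed
qed

text \<open>The cells attached to the counted points are disjoint and lie in the ball enlarged by
  the cell diameter.\<close>

lemma lattice_count_upper:
  assumes "0 \<le> \<Lambda>"
  shows "real (card (low \<Lambda>)) * \<tau> ^ CARD('n) \<le> unit_ball_vol d\<^sub>n * (sqrt \<Lambda> + d\<^sub>n * \<tau>) ^ CARD('n)"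
proof -
  have r: "0 \<le> sqrt \<Lambda> + d\<^sub>n * \<tau>" using assms \<tau>_pos by (simp add: d\<^sub>n_def)
  have "real (card (low \<Lambda>)) * \<tau> ^ CARD('n) = (\<Sum>\<xi>\<in>low \<Lambda>. measure lborel (box \<xi> (\<xi> + (\<chi> i. \<tau>))))"
    by (simp add: measure_cell)
  also have "\<dots> = measure lborel (\<Union>\<xi>\<in>low \<Lambda>. box \<xi> (\<xi> + (\<chi> i. \<tau>)))"
    by (rule measure_finite_Union[symmetric])
      (auto simp: finite_low cells_disjoint emeasure_lborel_box_eq)
  also have "\<dots> \<le> measure lborel (cball (0::real^'n) (sqrt \<Lambda> + d\<^sub>n * \<tau>))"
  proof (rule measure_mono_fmeasurable)
    show "(\<Union>\<xi>\<in>low \<Lambda>. box \<xi> (\<xi> + (\<chi> i. \<tau>))) \<subseteq> cball 0 (sqrt \<Lambda> + d\<^sub>n * \<tau>)"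
    proof
      fix x assume "x \<in> (\<Union>\<xi>\<in>low \<Lambda>. box \<xi> (\<xi> + (\<chi> i. \<tau>)))"
      then obtain \<xi> where \<xi>: "\<xi> \<in> low \<Lambda>" "x \<in> box \<xi> (\<xi> + (\<chi> i. \<tau>))" by blast
      have "norm x \<le> norm \<xi> + norm (x - \<xi>)" by (metis add.commute diff_add_cancel norm_triangle_ineq)
      moreover have "norm \<xi> \<le> sqrt \<Lambda>" using \<xi>(1) by (intro real_le_rsqrt) (auto simp: low_def)
      moreover have "norm (x - \<xi>) \<le> d\<^sub>n * \<tau>" using \<xi>(2) box_subset_cbox by (intro norm_cell_le) blast
      ultimately show "x \<in> cball 0 (sqrt \<Lambda> + d\<^sub>n * \<tau>)" by simp
    qed
    show "cball (0::real^'n) (sqrt \<Lambda> + d\<^sub>n * \<tau>) \<in> fmeasurable lborel"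
      using emeasure_lborel_cball_finite by (intro fmeasurableI) auto
  qed (auto intro!: borel_open open_UN)
  also have "\<dots> = unit_ball_vol d\<^sub>n * (sqrt \<Lambda> + d\<^sub>n * \<tau>) ^ CARD('n)"
    using content_cball[OF r, of "0::real^'n"] by (simp add: d\<^sub>n_def)
  finally show ?thesis .
qed

text \<open>Rounding down each coordinate puts a point of the smaller ball into the cell of a
  counted lattice point, so these cells cover that ball.\<close>

lemma lattice_count_lower:
  assumes "d\<^sub>n * \<tau> \<le> sqrt \<Lambda>"
  shows "unit_ball_vol d\<^sub>n * (sqrt \<Lambda> - d\<^sub>n * \<tau>) ^ CARD('n) \<le> real (card (low \<Lambda>)) * \<tau> ^ CARD('n)"
proof -
  have r: "0 \<le> sqrt \<Lambda> - d\<^sub>n * \<tau>" using assms by simp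
  have "unit_ball_vol d\<^sub>n * (sqrt \<Lambda> - d\<^sub>n * \<tau>) ^ CARD('n) = measure lborel (ball (0::real^'n) (sqrt \<Lambda> - d\<^sub>n * \<tau>))"
    using content_ball[OF r, of "0::real^'n"] by (simp add: d\<^sub>n_def)
  also have "\<dots> \<le> measure lborel (\<Union>\<xi>\<in>low \<Lambda>. cbox \<xi> (\<xi> + (\<chi> i. \<tau>)))"
  proof (rule measure_mono_fmeasurable)
    show "ball 0 (sqrt \<Lambda> - d\<^sub>n * \<tau>) \<subseteq> (\<Union>\<xi>\<in>low \<Lambda>. cbox \<xi> (\<xi> + (\<chi> i. \<tau>)))"
    proof
      fix x :: "real^'n" assume x: "x \<in> ball 0 (sqrt \<Lambda> - d\<^sub>n * \<tau>)"
      define \<xi> :: "real^'n" where "\<xi> = (\<chi> i. \<tau> * of_int \<lfloor>x $ i / \<tau>\<rfloor>)"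
      have cell: "x \<in> cbox \<xi> (\<xi> + (\<chi> i. \<tau>))"
        unfolding mem_box_cart
      proof
        fix i
        have "of_int \<lfloor>x $ i / \<tau>\<rfloor> \<le> x $ i / \<tau>" "x $ i / \<tau> \<le> of_int \<lfloor>x $ i / \<tau>\<rfloor> + 1" by linarith+
        from this[THEN mult_left_mono[of _ _ \<tau>]]
        show "\<xi> $ i \<le> x $ i \<and> x $ i \<le> (\<xi> + (\<chi> i. \<tau>)) $ i"
          using \<tau>_pos by (simp add: \<xi>_def distrib_left)
      qed
      have "norm \<xi> \<le> norm x + norm (x - \<xi>)" by (metis norm_minus_commute norm_triangle_sub)
      also have "\<dots> < sqrt \<Lambda>" using x norm_cell_le[OF cell] by simp
      finally have n: "norm \<xi> < sqrt \<Lambda>" .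
      have "(norm \<xi>)\<^sup>2 < \<Lambda>"
      proof -
        have "0 < sqrt \<Lambda>" using n norm_ge_zero[of \<xi>] by linarith
        then have "0 < \<Lambda>" by simp
        have "(norm \<xi>)\<^sup>2 < (sqrt \<Lambda>)\<^sup>2" using n by (intro power_strict_mono) auto
        then show ?thesis using \<open>0 < \<Lambda>\<close> by simp
      qed
      then have "\<xi> \<in> low \<Lambda>" by (auto simp: low_def lat_def \<xi>_def)
      then show "x \<in> (\<Union>\<xi>\<in>low \<Lambda>. cbox \<xi> (\<xi> + (\<chi> i. \<tau>)))" using cell by blast
    qed
    show "(\<Union>\<xi>\<in>low \<Lambda>. cbox \<xi> (\<xi> + (\<chi> i. \<tau>))) \<in> fmeasurable lborel"
      by (intro fmeasurable.finite_UN finite_low) (simp add: fmeasurable_cbox)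
  qed simp
  also have "\<dots> \<le> (\<Sum>\<xi>\<in>low \<Lambda>. measure lborel (cbox \<xi> (\<xi> + (\<chi> i. \<tau>))))"
    by (rule measure_UNION_le) (simp_all add: finite_low)
  also have "\<dots> = real (card (low \<Lambda>)) * \<tau> ^ CARD('n)" by (simp add: measure_cell)
  finally show ?thesis .
qed

definition nlat :: "real \<Rightarrow> real" where
  "nlat \<Lambda> = real (card (low \<Lambda>)) / \<Lambda> powr (d\<^sub>n / 2)"

lemma powr_half_dim: "0 < \<Lambda> \<Longrightarrow> \<Lambda> powr (d\<^sub>n / 2) = sqrt \<Lambda> ^ CARD('n)"
  by (simp add: powr_half_sqrt[symmetric] powr_powr d\<^sub>n_def flip: powr_realpow)

text \<open>After division by sqrt \<Lambda> to the power d, the two counts leave powers of 1 plus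
  or minus a constant over sqrt \<Lambda>.\<close>

lemma nlat_tendsto: "(nlat \<longlongrightarrow> unit_ball_vol d\<^sub>n / \<tau> ^ CARD('n)) at_top"
proof -
  have base: "((\<lambda>\<Lambda>. (1 + c / sqrt \<Lambda>) ^ CARD('n)) \<longlongrightarrow> (1 + 0) ^ CARD('n)) at_top" for c
    by (intro tendsto_intros real_tendsto_divide_at_top[OF tendsto_const] sqrt_at_top)
  have lim: "((\<lambda>\<Lambda>. unit_ball_vol d\<^sub>n * (1 + c / sqrt \<Lambda>) ^ CARD('n) / \<tau> ^ CARD('n)) \<longlongrightarrow> unit_ball_vol d\<^sub>n / \<tau> ^ CARD('n)) at_top" for c
    using tendsto_divide[OF tendsto_mult_left[OF base[of c], of "unit_ball_vol d\<^sub>n"] tendsto_const[of "\<tau> ^ CARD('n)"]] \<tau>_pos by simp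
  have ev: "\<forall>\<^sub>F \<Lambda> in at_top. 0 < \<Lambda> \<and> d\<^sub>n * \<tau> \<le> sqrt \<Lambda>"
  proof (rule eventually_conj)
    show "\<forall>\<^sub>F \<Lambda> in at_top. d\<^sub>n * \<tau> \<le> sqrt \<Lambda>"
      using sqrt_at_top by (auto simp: filterlim_at_top)
  qed (rule eventually_gt_at_top)
  have pull: "(sqrt \<Lambda> + c) ^ CARD('n) = sqrt \<Lambda> ^ CARD('n) * (1 + c / sqrt \<Lambda>) ^ CARD('n)" if "0 < \<Lambda>" for \<Lambda> c
    using that by (simp add: distrib_left flip: power_mult_distrib)
  show ?thesis
  proof (rule tendsto_sandwich[OF _ _ lim[of "- (d\<^sub>n * \<tau>)"] lim[of "d\<^sub>n * \<tau>"]])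
    show "\<forall>\<^sub>F \<Lambda> in at_top. unit_ball_vol d\<^sub>n * (1 + - (d\<^sub>n * \<tau>) / sqrt \<Lambda>) ^ CARD('n) / \<tau> ^ CARD('n) \<le> nlat \<Lambda>"
      using ev
    proof eventually_elim
      case (elim \<Lambda>)
      have "unit_ball_vol d\<^sub>n * (sqrt \<Lambda> ^ CARD('n) * (1 + - (d\<^sub>n * \<tau>) / sqrt \<Lambda>) ^ CARD('n)) \<le> real (card (low \<Lambda>)) * \<tau> ^ CARD('n)"
        using lattice_count_lower[of \<Lambda>] elim pull[of \<Lambda> "- (d\<^sub>n * \<tau>)"] by simp
      then show ?case using elim \<tau>_pos unfolding nlat_def by (simp add: powr_half_dim field_simps)
    qed
    show "\<forall>\<^sub>F \<Lambda> in at_top. nlat \<Lambda> \<le> unit_ball_vol d\<^sub>n * (1 + d\<^sub>n * \<tau> / sqrt \<Lambda>) ^ CARD('n) / \<tau> ^ CARD('n)"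
      using ev
    proof eventually_elim
      case (elim \<Lambda>)
      have "real (card (low \<Lambda>)) * \<tau> ^ CARD('n) \<le> unit_ball_vol d\<^sub>n * (sqrt \<Lambda> ^ CARD('n) * (1 + d\<^sub>n * \<tau> / sqrt \<Lambda>) ^ CARD('n))"
        using lattice_count_upper[of \<Lambda>] elim pull[of \<Lambda> "d\<^sub>n * \<tau>"] by simp
      then show ?case using elim \<tau>_pos unfolding nlat_def by (simp add: powr_half_dim field_simps)
    qed
  qed
qed

text \<open>The first Riesz mean of the Laplacian on the torus, whose eigenvalues are the squared
  lengths of the lattice vectors.\<close>

definition Slat :: "real \<Rightarrow> real" where
  "Slat \<Lambda> = (\<Sum>\<xi>\<in>low \<Lambda>. \<Lambda> - (norm \<xi>)\<^sup>2)"

text \<open>\<open>low \<Lambda>\<close> collects exactly the positive terms. \<open>Slat\<close> is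
  thus a maximum of affine functions of \<Lambda>, hence convex.\<close>

lemma Slat_ge:
  fixes F :: "(real^'n) set"
  assumes "finite F" "F \<subseteq> lat \<tau>" shows "(\<Sum>\<xi>\<in>F. \<Lambda> - (norm \<xi>)\<^sup>2) \<le> Slat \<Lambda>"
proof -
  have "(\<Sum>\<xi>\<in>F. \<Lambda> - (norm \<xi>)\<^sup>2) \<le> (\<Sum>\<xi>\<in>F \<inter> low \<Lambda>. \<Lambda> - (norm \<xi>)\<^sup>2)"
  proof -
    have "(\<Sum>\<xi>\<in>F - low \<Lambda>. \<Lambda> - (norm \<xi>)\<^sup>2) \<le> 0" using assms(2) by (intro sum_nonpos) (auto simp: low_def)
    then show ?thesis using sum.Int_Diff[OF assms(1), of "\<lambda>\<xi>. \<Lambda> - (norm \<xi>)\<^sup>2" "low \<Lambda>"] by linarith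
  qed
  also have "\<dots> \<le> Slat \<Lambda>" unfolding Slat_def by (intro sum_mono2 finite_low) (auto simp: low_def)
  finally show ?thesis .
qed

lemma low_lat: "low \<Lambda> \<subseteq> lat \<tau>"
  by (auto simp: low_def)

text \<open>The supporting line of the convex function at \<Lambda>', with the number of lattice
  points as its slope.\<close>

lemma Slat_diff_le: "Slat \<Lambda>' - Slat \<Lambda> \<le> (\<Lambda>' - \<Lambda>) * real (card (low \<Lambda>'))"
proof -
  have "(\<Sum>\<xi>\<in>low \<Lambda>'. \<Lambda> - (norm \<xi>)\<^sup>2) \<le> Slat \<Lambda>" by (rule Slat_ge[OF finite_low low_lat])
  moreover have "Slat \<Lambda>' - (\<Sum>\<xi>\<in>low \<Lambda>'. \<Lambda> - (norm \<xi>)\<^sup>2) = (\<Lambda>' - \<Lambda>) * real (card (low \<Lambda>'))"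
    unfolding Slat_def sum_subtractf[symmetric] by simp
  ultimately show ?thesis by linarith
qed

lemma Slat_le: "0 \<le> \<Lambda> \<Longrightarrow> Slat \<Lambda> \<le> \<Lambda> * real (card (low \<Lambda>))"
  unfolding Slat_def by (rule order_trans[OF sum_bounded_above[of _ _ \<Lambda>]]) (auto simp: mult.commute)

text \<open>Taking cosine and sine together makes the total independent of the frequency.\<close>

lemma cos_sin_norm:
  assumes "g \<in> L2 \<Omega>"
  shows "L2inner \<Omega> (\<lambda>x. cos (\<xi> \<bullet> x) *\<^sub>R g x) (\<lambda>x. cos (\<xi> \<bullet> x) *\<^sub>R g x)
    + L2inner \<Omega> (\<lambda>x. sin (\<xi> \<bullet> x) *\<^sub>R g x) (\<lambda>x. sin (\<xi> \<bullet> x) *\<^sub>R g x) = L2inner \<Omega> g g"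
proof -
  have L: "(\<lambda>x. cos (\<xi> \<bullet> x) *\<^sub>R g x) \<in> L2 \<Omega>" "(\<lambda>x. sin (\<xi> \<bullet> x) *\<^sub>R g x) \<in> L2 \<Omega>"
    by (rule L2_mult_bounded[OF assms, of _ 1]; auto intro!: continuous_measurable_M continuous_intros)+
  have "(cos (\<xi> \<bullet> x) *\<^sub>R g x) \<bullet> (cos (\<xi> \<bullet> x) *\<^sub>R g x) + (sin (\<xi> \<bullet> x) *\<^sub>R g x) \<bullet> (sin (\<xi> \<bullet> x) *\<^sub>R g x) = g x \<bullet> g x" for x
  proof -
    have "cos (\<xi> \<bullet> x) * cos (\<xi> \<bullet> x) + sin (\<xi> \<bullet> x) * sin (\<xi> \<bullet> x) = 1"
      using sin_cos_squared_add2[of "\<xi> \<bullet> x"] by (simp add: power2_eq_square)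
    then show ?thesis by (simp flip: distrib_right mult.assoc)
  qed
  then show ?thesis
    unfolding L2inner_def
    using Bochner_Integration.integral_add[OF L2_inner_integrable[OF L(1) L(1)] L2_inner_integrable[OF L(2) L(2)]] by simp
qed

lemma one_norm: "L2inner \<Omega> (\<lambda>x. 1 :: real) (\<lambda>x. 1) = measure lebesgue \<Omega>"
proof -
  interpret finite_measure M by (rule finite_measure_M)
  show ?thesis using measure_M by (simp add: L2inner_def)
qed

end

section \<open>Two-sided bounds for the Riesz means of the Dirichlet Laplacian and the counting
  function\<close>

context eigensystem begin

text \<open>After exchanging the sums over k and \<xi>, the inner sum consists of the coefficients
  of one plane wave on \<Omega> with respect to the eigenfunctions, and Bessel bounds it by the
  volume. \<open>K\<close> is arbitrary because finiteness of \<open>below\<close> is deduced from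
  this bound.\<close>

lemma Berezin:
  assumes K: "finite K" "\<And>k. k \<in> K \<Longrightarrow> 1 \<le> k" and "0 \<le> \<Lambda>"
  shows "(\<Sum>k\<in>K. \<Lambda> - lam k) \<le> \<kappa> * measure lebesgue \<Omega> * Slat \<Lambda>"
proof -
  have "(\<Sum>k\<in>K. \<Lambda> - lam k) \<le> (\<Sum>k\<in>K. \<kappa> * (\<Sum>\<xi>\<in>low \<Lambda>. (\<Lambda> - (norm \<xi>)\<^sup>2) * ((tcos (\<Psi> k) \<xi>)\<^sup>2 + (tsin (\<Psi> k) \<xi>)\<^sup>2)))"
  proof (rule sum_mono)
    fix k assume "k \<in> K"
    then have k: "1 \<le> k" using K by blast
    show "\<Lambda> - lam k \<le> \<kappa> * (\<Sum>\<xi>\<in>low \<Lambda>. (\<Lambda> - (norm \<xi>)\<^sup>2) * ((tcos (\<Psi> k) \<xi>)\<^sup>2 + (tsin (\<Psi> k) \<xi>)\<^sup>2))"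
      using spectral_bound[OF \<Psi>_H10[OF k] assms(3)] D_\<Psi>[OF k \<Psi>_H10[OF k]] \<Psi>_orthonormal[OF k k] by simp
  qed
  also have "\<dots> = \<kappa> * (\<Sum>\<xi>\<in>low \<Lambda>. (\<Lambda> - (norm \<xi>)\<^sup>2) * (\<Sum>k\<in>K. (tcos (\<Psi> k) \<xi>)\<^sup>2 + (tsin (\<Psi> k) \<xi>)\<^sup>2))"
    unfolding sum_distrib_left by (rule sum.swap)
  also have "\<dots> \<le> \<kappa> * (\<Sum>\<xi>\<in>low \<Lambda>. (\<Lambda> - (norm \<xi>)\<^sup>2) * measure lebesgue \<Omega>)"
  proof (intro mult_left_mono sum_mono)
    fix \<xi> assume "\<xi> \<in> low \<Lambda>"
    then show "0 \<le> \<Lambda> - (norm \<xi>)\<^sup>2" by (simp add: low_def)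
    have "(\<Sum>k\<in>K. (L2inner \<Omega> g (\<Psi> k))\<^sup>2) \<le> L2inner \<Omega> g g" if "g \<in> L2 \<Omega>" for g
      by (rule L2.Bessel) (use K \<Psi>_L2 \<Psi>_orthonormal that in auto)
    note B = this[OF trig_L2(1)[of \<xi>]] this[OF trig_L2(2)[of \<xi>]]
    have c: "L2inner \<Omega> (\<lambda>x. cos (\<xi> \<bullet> x)) (\<Psi> k) = tcos (\<Psi> k) \<xi>" "L2inner \<Omega> (\<lambda>x. sin (\<xi> \<bullet> x)) (\<Psi> k) = tsin (\<Psi> k) \<xi>" if "k \<in> K" for k
      unfolding tcos_def tsin_def using that K \<Psi>_L2 by (auto intro!: L2.B_commute trig_L2)
    have "(\<Sum>k\<in>K. (tcos (\<Psi> k) \<xi>)\<^sup>2 + (tsin (\<Psi> k) \<xi>)\<^sup>2)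
        \<le> L2inner \<Omega> (\<lambda>x. cos (\<xi> \<bullet> x)) (\<lambda>x. cos (\<xi> \<bullet> x)) + L2inner \<Omega> (\<lambda>x. sin (\<xi> \<bullet> x)) (\<lambda>x. sin (\<xi> \<bullet> x))"
      unfolding sum.distrib using B by (simp add: c cong: sum.cong)
    also have "\<dots> = measure lebesgue \<Omega>" using cos_sin_norm[OF L2_one, of \<xi>] one_norm by simp
    finally show "(\<Sum>k\<in>K. (tcos (\<Psi> k) \<xi>)\<^sup>2 + (tsin (\<Psi> k) \<xi>)\<^sup>2) \<le> measure lebesgue \<Omega>" .
  qed (use \<kappa>_pos in auto)
  also have "\<dots> = \<kappa> * measure lebesgue \<Omega> * Slat \<Lambda>"
    by (simp add: Slat_def sum_distrib_right[symmetric])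
  finally show ?thesis .
qed

definition below :: "real \<Rightarrow> nat set" where
  "below \<Lambda> = {k. 1 \<le> k \<and> lam k < \<Lambda>}"

text \<open>The eigensystem only limits the multiplicity of each single value. That eigenvalues
  cannot accumulate follows from the Berezin bound.\<close>

lemma finite_below: "finite (below \<Lambda>)"
proof (rule ccontr)
  assume inf: "infinite (below \<Lambda>)"
  \<comment> \<open>The level is non-negative, as \<open>Berezin\<close> requires, and exceeds
    \<Lambda> by at least 1, so each eigenvalue below \<Lambda> contributes at least 1.\<close>
  define C where "C = \<kappa> * measure lebesgue \<Omega> * Slat (max \<Lambda> 0 + 1)"
  obtain K where K: "finite K" "card K = nat \<lceil>C\<rceil> + 1" "K \<subseteq> below \<Lambda>"
    using infinite_arbitrarily_large[OF inf] by blast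
  have "real (card K) = (\<Sum>k\<in>K. 1)" by simp
  also have "\<dots> \<le> (\<Sum>k\<in>K. max \<Lambda> 0 + 1 - lam k)" using K(3) by (intro sum_mono) (auto simp: below_def)
  also have "\<dots> \<le> C" unfolding C_def using K by (intro Berezin) (auto simp: below_def)
  finally show False using K(2) by linarith
qed

definition Riesz_mean :: "real \<Rightarrow> real" where
  "Riesz_mean \<Lambda> = (\<Sum>k\<in>below \<Lambda>. \<Lambda> - lam k)"

lemma Riesz_mean_ge:
  assumes "finite K" "\<And>k. k \<in> K \<Longrightarrow> 1 \<le> k"
  shows "(\<Sum>k\<in>K. \<Lambda> - lam k) \<le> Riesz_mean \<Lambda>"
proof -
  have "(\<Sum>k\<in>K. \<Lambda> - lam k) \<le> (\<Sum>k\<in>K \<inter> below \<Lambda>. \<Lambda> - lam k)"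
  proof -
    have "(\<Sum>k\<in>K - below \<Lambda>. \<Lambda> - lam k) \<le> 0" using assms(2) by (intro sum_nonpos) (auto simp: below_def)
    then show ?thesis using sum.Int_Diff[OF assms(1), of "\<lambda>k. \<Lambda> - lam k" "below \<Lambda>"] by linarith
  qed
  also have "\<dots> \<le> Riesz_mean \<Lambda>" unfolding Riesz_mean_def by (intro sum_mono2 finite_below) (auto simp: below_def)
  finally show ?thesis .
qed

text \<open>The supporting line at \<Lambda> of the convex function \<open>Riesz_mean\<close>; its
  slope is the counting function.\<close>

lemma Riesz_mean_diff_ge: "(\<Lambda>' - \<Lambda>) * real (card (below \<Lambda>)) \<le> Riesz_mean \<Lambda>' - Riesz_mean \<Lambda>"
proof -
  have "(\<Sum>k\<in>below \<Lambda>. \<Lambda>' - lam k) \<le> Riesz_mean \<Lambda>'" by (rule Riesz_mean_ge[OF finite_below]) (simp add: below_def)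
  moreover have "(\<Sum>k\<in>below \<Lambda>. \<Lambda>' - lam k) - Riesz_mean \<Lambda> = (\<Lambda>' - \<Lambda>) * real (card (below \<Lambda>))"
    unfolding Riesz_mean_def sum_subtractf[symmetric] by simp
  ultimately show ?thesis by linarith
qed

lemma Riesz_mean_upper: "0 \<le> \<Lambda> \<Longrightarrow> Riesz_mean \<Lambda> \<le> \<kappa> * measure lebesgue \<Omega> * Slat \<Lambda>"
  unfolding Riesz_mean_def by (rule Berezin[OF finite_below]) (auto simp: below_def)

text \<open>Monotonicity makes the set an initial segment, so its cardinality can serve as N in the
  Rayleigh bound at level \<Lambda>.\<close>

lemma below_eq: "below \<Lambda> = {1..card (below \<Lambda>)}" and lam_card_below: "\<Lambda> \<le> lam (Suc (card (below \<Lambda>)))"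
proof -
  define m where "m = card (below \<Lambda>)"
  have sub: "{1..k} \<subseteq> below \<Lambda>" if "k \<in> below \<Lambda>" for k
  proof
    fix j assume "j \<in> {1..k}"
    then show "j \<in> below \<Lambda>" using that lam_mono[of j k] by (auto simp: below_def)
  qed
  have "k \<le> m" if "k \<in> below \<Lambda>" for k
    using card_mono[OF finite_below sub[OF that]] by (simp add: m_def)
  then have "below \<Lambda> \<subseteq> {1..m}" by (auto simp: below_def)
  then have "below \<Lambda> = {1..m}" by (rule card_subset_eq[rotated]) (simp_all add: m_def)
  then show e: "below \<Lambda> = {1..card (below \<Lambda>)}" unfolding m_def .
  have "Suc (card (below \<Lambda>)) \<notin> below \<Lambda>" by (subst e) simp
  then show "\<Lambda> \<le> lam (Suc (card (below \<Lambda>)))" by (simp add: below_def)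
qed

text \<open>The counterpart of \<open>spectral_bound\<close> in the eigenfunctions: the projection
  and the remainder are orthogonal in both forms, and on the remainder the Rayleigh bound makes the
  contribution non-positive.\<close>

lemma variational_upper:
  assumes \<phi>: "\<phi> \<in> H10 \<Omega>"
  shows "\<Lambda> * L2inner \<Omega> \<phi> \<phi> - D \<phi> \<phi> \<le> (\<Sum>k\<in>below \<Lambda>. (\<Lambda> - lam k) * (L2inner \<Omega> \<phi> (\<Psi> k))\<^sup>2)"
proof -
  define m where "m = card (below \<Lambda>)"
  have b: "below \<Lambda> = {1..m}" unfolding m_def by (rule below_eq)
  note \<phi>L = weak_grad_H10(1)[OF \<phi>]
  define r where "r x = \<phi> x - proj m \<phi> x" for x
  have rH: "r \<in> H10 \<Omega>" unfolding r_def[abs_def] by (intro H.diff_mem \<phi> proj_H10)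
  note rL = weak_grad_H10(1)[OF rH]
  have ro: "L2inner \<Omega> r (\<Psi> k) = 0" if "k \<in> {1..m}" for k
    unfolding r_def[abs_def] by (rule diff_proj_orthogonal[OF \<phi>L that])
  have sum: "\<phi> = (\<lambda>x. r x + proj m \<phi> x)" by (simp add: r_def fun_eq_iff)
  have p1: "L2inner \<Omega> (proj m \<phi>) (proj m \<phi>) = (\<Sum>k\<in>{1..m}. (L2inner \<Omega> \<phi> (\<Psi> k))\<^sup>2)"
    unfolding proj_def using L2.lincomb_orthonormal_self[of "{1..m}" \<Psi> "\<lambda>_. 1"]
    by (simp add: \<Psi>_L2 \<Psi>_orthonormal power2_eq_square)
  have p2: "D (proj m \<phi>) (proj m \<phi>) = (\<Sum>k\<in>{1..m}. (L2inner \<Omega> \<phi> (\<Psi> k))\<^sup>2 * lam k)"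
    unfolding proj_def using H.lincomb_orthonormal_self[of "{1..m}" \<Psi> lam]
    by (simp add: \<Psi>_H10 \<Psi>_orthonormal D_\<Psi> power2_eq_square)
  have "L2inner \<Omega> \<phi> \<phi> = L2inner \<Omega> r r + (\<Sum>k\<in>{1..m}. (L2inner \<Omega> \<phi> (\<Psi> k))\<^sup>2)"
    using L2.B_add_self[OF rL proj_L2, of m \<phi>] D_orthogonal_proj(2)[OF rH ro] p1 by (simp flip: sum)
  moreover have "D \<phi> \<phi> = D r r + (\<Sum>k\<in>{1..m}. (L2inner \<Omega> \<phi> (\<Psi> k))\<^sup>2 * lam k)"
    using H.B_add_self[OF rH proj_H10, of m \<phi>] D_orthogonal_proj(1)[OF rH ro] p2 by (simp flip: sum)
  moreover have "\<Lambda> * L2inner \<Omega> r r \<le> D r r"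
  proof -
    have "\<Lambda> * L2inner \<Omega> r r \<le> lam (Suc m) * L2inner \<Omega> r r"
      unfolding m_def using lam_card_below L2.B_nonneg[OF rL] by (rule mult_right_mono)
    also have "\<dots> \<le> D r r" by (rule Rayleigh[OF rH ro])
    finally show ?thesis .
  qed
  ultimately show ?thesis unfolding b
    by (simp add: algebra_simps sum_subtractf sum_distrib_left)
qed

text \<open>The lower bound tests the variational principle with the localised plane waves
  \<open>\<eta> cos(\<xi>\<cdot>x)\<close> and \<open>\<eta> sin(\<xi>\<cdot>x)\<close>; the cross terms in their Dirichlet energies cancel.\<close>

lemma Riesz_mean_lower:
  assumes \<eta>: "\<eta> \<in> test_functions \<Omega>" "\<And>x. 0 \<le> \<eta> x \<and> \<eta> x \<le> 1"
  shows "\<kappa> * (L2inner \<Omega> \<eta> \<eta> * Slat \<Lambda> - L2inner \<Omega> (grad \<eta>) (grad \<eta>) * real (card (low \<Lambda>))) \<le> Riesz_mean \<Lambda>"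
proof -
  define X where "X = L2inner \<Omega> \<eta> \<eta>"
  define Y where "Y = L2inner \<Omega> (grad \<eta>) (grad \<eta>)"
  define c where "c \<xi> x = \<eta> x * cos (\<xi> \<bullet> x)" for \<xi> x
  define s where "s \<xi> x = \<eta> x * sin (\<xi> \<bullet> x)" for \<xi> x
  have ct: "c \<xi> \<in> test_functions \<Omega>" and st: "s \<xi> \<in> test_functions \<Omega>" for \<xi>
    unfolding c_def[abs_def] s_def[abs_def] by (intro test_function_mult \<eta> Ck_cos Ck_sin)+
  note \<eta>L = test_L2(1)[OF \<eta>(1)]
  have norms: "L2inner \<Omega> (c \<xi>) (c \<xi>) + L2inner \<Omega> (s \<xi>) (s \<xi>) = X" for \<xi>
    using cos_sin_norm[OF \<eta>L, of \<xi>] by (simp add: X_def c_def[abs_def] s_def[abs_def] mult.commute)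
  have energies: "D (c \<xi>) (c \<xi>) + D (s \<xi>) (s \<xi>) = Y + (norm \<xi>)\<^sup>2 * X" for \<xi>
  proof -
    have dcos: "(\<lambda>x. cos (\<xi> \<bullet> x)) differentiable (at x)" "(\<lambda>x. sin (\<xi> \<bullet> x)) differentiable (at x)" for x
      using Ck_Suc_differentiable[OF Ck_cos] Ck_Suc_differentiable[OF Ck_sin] by auto
    have gc: "grad (c \<xi>) x = cos (\<xi> \<bullet> x) *\<^sub>R grad \<eta> x - (\<eta> x * sin (\<xi> \<bullet> x)) *\<^sub>R \<xi>" for x
      unfolding c_def[abs_def] grad_mult[OF test_function_differentiable[OF \<eta>(1)] dcos(1)] grad_cos by simp
    have gs: "grad (s \<xi>) x = sin (\<xi> \<bullet> x) *\<^sub>R grad \<eta> x + (\<eta> x * cos (\<xi> \<bullet> x)) *\<^sub>R \<xi>" for x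
      unfolding s_def[abs_def] grad_mult[OF test_function_differentiable[OF \<eta>(1)] dcos(2)] grad_sin by simp
    have pt: "grad (c \<xi>) x \<bullet> grad (c \<xi>) x + grad (s \<xi>) x \<bullet> grad (s \<xi>) x = grad \<eta> x \<bullet> grad \<eta> x + (norm \<xi>)\<^sup>2 * (\<eta> x \<bullet> \<eta> x)" for x
    proof -
      define C where "C = cos (\<xi> \<bullet> x)"
      define T where "T = sin (\<xi> \<bullet> x)"
      have CT: "C * C + T * T = 1" using sin_cos_squared_add2[of "\<xi> \<bullet> x"] by (simp add: power2_eq_square C_def T_def)
      have "grad (c \<xi>) x \<bullet> grad (c \<xi>) x + grad (s \<xi>) x \<bullet> grad (s \<xi>) x
        = (C * C + T * T) * (grad \<eta> x \<bullet> grad \<eta> x) + (C * C + T * T) * (\<eta> x * \<eta> x * (\<xi> \<bullet> \<xi>))"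
      proof -
        have expand: "(p *\<^sub>R v + q *\<^sub>R \<xi>) \<bullet> (p *\<^sub>R v + q *\<^sub>R \<xi>) = p * p * (v \<bullet> v) + 2 * p * q * (v \<bullet> \<xi>) + q * q * (\<xi> \<bullet> \<xi>)" for p q v
          using inner_commute[of \<xi> v] by (simp add: inner_add_left inner_add_right algebra_simps)
        have "grad (c \<xi>) x \<bullet> grad (c \<xi>) x = C * C * (grad \<eta> x \<bullet> grad \<eta> x) - 2 * C * (\<eta> x * T) * (grad \<eta> x \<bullet> \<xi>) + (\<eta> x * T) * (\<eta> x * T) * (\<xi> \<bullet> \<xi>)"
          using expand[of C "grad \<eta> x" "- (\<eta> x * T)"] unfolding gc C_def T_def by simp
        moreover have "grad (s \<xi>) x \<bullet> grad (s \<xi>) x = T * T * (grad \<eta> x \<bullet> grad \<eta> x) + 2 * T * (\<eta> x * C) * (grad \<eta> x \<bullet> \<xi>) + (\<eta> x * C) * (\<eta> x * C) * (\<xi> \<bullet> \<xi>)"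
          using expand[of T "grad \<eta> x" "\<eta> x * C"] unfolding gs C_def T_def by simp
        ultimately show ?thesis by (simp add: algebra_simps)
      qed
      then show ?thesis unfolding CT by (simp add: power2_norm_eq_inner mult.commute)
    qed
    have "D (c \<xi>) (c \<xi>) + D (s \<xi>) (s \<xi>) = (LINT x|M. grad (c \<xi>) x \<bullet> grad (c \<xi>) x + grad (s \<xi>) x \<bullet> grad (s \<xi>) x)"
      unfolding D_test[OF ct] D_test[OF st] unfolding L2inner_def
      using Bochner_Integration.integral_add[OF L2_inner_integrable L2_inner_integrable, OF test_L2(2)[OF ct] test_L2(2)[OF ct] test_L2(2)[OF st] test_L2(2)[OF st]]
      by simp
    also have "\<dots> = Y + (norm \<xi>)\<^sup>2 * X"
      unfolding pt X_def Y_def L2inner_def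
      using L2_inner_integrable[OF test_L2(2)[OF \<eta>(1)] test_L2(2)[OF \<eta>(1)]] L2_inner_integrable[OF \<eta>L \<eta>L] by simp
    finally show ?thesis .
  qed
  have "X * Slat \<Lambda> - Y * real (card (low \<Lambda>)) = (\<Sum>\<xi>\<in>low \<Lambda>. \<Lambda> * X - (Y + (norm \<xi>)\<^sup>2 * X))"
    by (simp add: Slat_def sum_subtractf sum.distrib sum_distrib_left algebra_simps)
  also have "\<dots> = (\<Sum>\<xi>\<in>low \<Lambda>. (\<Lambda> * L2inner \<Omega> (c \<xi>) (c \<xi>) - D (c \<xi>) (c \<xi>)) + (\<Lambda> * L2inner \<Omega> (s \<xi>) (s \<xi>) - D (s \<xi>) (s \<xi>)))"
  proof (intro sum.cong refl)
    fix \<xi>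
    have "\<Lambda> * X = \<Lambda> * L2inner \<Omega> (c \<xi>) (c \<xi>) + \<Lambda> * L2inner \<Omega> (s \<xi>) (s \<xi>)"
      unfolding norms[of \<xi>, symmetric] by (rule distrib_left)
    then show "\<Lambda> * X - (Y + (norm \<xi>)\<^sup>2 * X)
        = (\<Lambda> * L2inner \<Omega> (c \<xi>) (c \<xi>) - D (c \<xi>) (c \<xi>)) + (\<Lambda> * L2inner \<Omega> (s \<xi>) (s \<xi>) - D (s \<xi>) (s \<xi>))"
      using energies[of \<xi>] by linarith
  qed
  also have "\<dots> \<le> (\<Sum>\<xi>\<in>low \<Lambda>. (\<Sum>k\<in>below \<Lambda>. (\<Lambda> - lam k) * (L2inner \<Omega> (c \<xi>) (\<Psi> k))\<^sup>2) + (\<Sum>k\<in>below \<Lambda>. (\<Lambda> - lam k) * (L2inner \<Omega> (s \<xi>) (\<Psi> k))\<^sup>2))"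
    by (intro sum_mono add_mono variational_upper test_H10 ct st)
  also have "\<dots> = (\<Sum>k\<in>below \<Lambda>. (\<Lambda> - lam k) * (\<Sum>\<xi>\<in>low \<Lambda>. (L2inner \<Omega> (c \<xi>) (\<Psi> k))\<^sup>2 + (L2inner \<Omega> (s \<xi>) (\<Psi> k))\<^sup>2))"
    unfolding sum.distrib[symmetric] distrib_left[symmetric] sum_distrib_left by (rule sum.swap)
  also have "\<dots> \<le> (\<Sum>k\<in>below \<Lambda>. (\<Lambda> - lam k) * (1 / \<kappa>))"
  proof (intro sum_mono mult_left_mono)
    fix k assume k: "k \<in> below \<Lambda>"
    then show "0 \<le> \<Lambda> - lam k" by (simp add: below_def)
    have \<Psi>L: "\<Psi> k \<in> L2 \<Omega>" using k by (intro \<Psi>_L2) (simp add: below_def)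
    \<comment> \<open>Products of \<open>\<Psi> k\<close> with the trial functions are Fourier
      coefficients of the cut-off eigenfunction; Bessel in \<xi> bounds their sum by the volume 1 /
      \<kappa> of the cube.\<close>
    define g where "g x = \<eta> x *\<^sub>R \<Psi> k x" for x
    have gL: "g \<in> L2 \<Omega>" unfolding g_def[abs_def]
      by (rule L2_mult_bounded[OF \<Psi>L L2_measurable[OF \<eta>L], of 1]) (use \<eta>(2) in auto)
    have "L2inner \<Omega> (c \<xi>) (\<Psi> k) = tcos g \<xi>" "L2inner \<Omega> (s \<xi>) (\<Psi> k) = tsin g \<xi>" for \<xi>
      unfolding tcos_def tsin_def L2inner_def c_def s_def g_def by (simp_all add: mult_ac)
    then have "\<kappa> * (\<Sum>\<xi>\<in>low \<Lambda>. (L2inner \<Omega> (c \<xi>) (\<Psi> k))\<^sup>2 + (L2inner \<Omega> (s \<xi>) (\<Psi> k))\<^sup>2) \<le> L2inner \<Omega> g g"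
      using Bessel_trig[OF gL finite_low low_lat] by simp
    also have "\<dots> \<le> L2inner \<Omega> (\<Psi> k) (\<Psi> k)"
      unfolding L2inner_def
    proof (rule integral_mono[OF L2_inner_integrable[OF gL gL] L2_inner_integrable[OF \<Psi>L \<Psi>L]])
      fix x
      have "\<eta> x * \<eta> x \<le> 1" using \<eta>(2)[of x] by (intro mult_le_one) auto
      then have "(\<eta> x * \<eta> x) * (\<Psi> k x * \<Psi> k x) \<le> 1 * (\<Psi> k x * \<Psi> k x)" by (intro mult_right_mono) auto
      then show "g x \<bullet> g x \<le> \<Psi> k x \<bullet> \<Psi> k x" by (simp add: g_def mult_ac)
    qed
    also have "\<dots> = 1" using k \<Psi>_orthonormal[of k k] by (simp add: below_def)
    finally show "(\<Sum>\<xi>\<in>low \<Lambda>. (L2inner \<Omega> (c \<xi>) (\<Psi> k))\<^sup>2 + (L2inner \<Omega> (s \<xi>) (\<Psi> k))\<^sup>2) \<le> 1 / \<kappa>"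
      using \<kappa>_pos by (simp add: field_simps)
  qed
  also have "\<dots> = Riesz_mean \<Lambda> / \<kappa>" by (simp add: Riesz_mean_def sum_divide_distrib)
  finally show ?thesis using \<kappa>_pos by (simp add: X_def Y_def field_simps)
qed

definition weyl :: "real \<Rightarrow> real" where
  "weyl \<Lambda> = real (card (below \<Lambda>)) / \<Lambda> powr (d\<^sub>n / 2)"

text \<open>Difference quotients of the Riesz mean over the steps \<open>\<Lambda> \<rightarrow> (1 \<plusminus> \<delta>)\<Lambda>\<close> turn its two bounds
  into bounds for the counting function.\<close>

lemma weyl_bounds:
  assumes \<eta>: "\<eta> \<in> test_functions \<Omega>" "\<And>x. 0 \<le> \<eta> x \<and> \<eta> x \<le> 1"
    and \<delta>: "0 < \<delta>" "\<delta> < 1" and "0 < \<Lambda>"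
  defines "V \<equiv> measure lebesgue \<Omega>" and "X \<equiv> L2inner \<Omega> \<eta> \<eta>" and "Y \<equiv> L2inner \<Omega> (grad \<eta>) (grad \<eta>)"
  defines "err \<equiv> \<kappa> * (V - X) / \<delta> * nlat \<Lambda> + \<kappa> * Y / \<delta> * (nlat \<Lambda> / \<Lambda>)"
  shows "weyl \<Lambda> \<le> \<kappa> * V * ((1 + \<delta>) powr (d\<^sub>n / 2) * nlat ((1 + \<delta>) * \<Lambda>)) + err"
    and "\<kappa> * V * ((1 - \<delta>) powr (d\<^sub>n / 2) * nlat ((1 - \<delta>) * \<Lambda>)) - err \<le> weyl \<Lambda>"
proof -
  define n where "n \<Lambda> = real (card (low \<Lambda>))" for \<Lambda>
  define P where "P = \<Lambda> powr (d\<^sub>n / 2)"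
  have P: "0 < P" using assms by (simp add: P_def)
  have VX: "0 \<le> V - X"
  proof -
    have "X \<le> V"
      unfolding X_def V_def one_norm[symmetric] L2inner_def
    proof (rule integral_mono[OF L2_inner_integrable[OF test_L2(1)[OF \<eta>(1)] test_L2(1)[OF \<eta>(1)]] L2_inner_integrable[OF L2_one L2_one]])
      fix x
      have "\<eta> x * \<eta> x \<le> 1" using \<eta>(2)[of x] by (intro mult_le_one) auto
      then show "\<eta> x \<bullet> \<eta> x \<le> 1 \<bullet> (1::real)" by simp
    qed
    then show ?thesis by simp
  qed
  have lower: "\<kappa> * (X * Slat \<Lambda> - Y * n \<Lambda>) \<le> Riesz_mean \<Lambda>"
    unfolding X_def Y_def n_def by (rule Riesz_mean_lower[OF \<eta>])
  have upper: "Riesz_mean \<Lambda>' \<le> \<kappa> * V * Slat \<Lambda>'" if "0 \<le> \<Lambda>'" for \<Lambda>'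
    unfolding V_def by (rule Riesz_mean_upper[OF that])
  have S: "\<kappa> * (V - X) * Slat \<Lambda> \<le> \<kappa> * (V - X) * (\<Lambda> * n \<Lambda>)"
    unfolding n_def using assms VX \<kappa>_pos by (intro mult_left_mono Slat_le) auto
  \<comment> \<open>Two losses are spread over the step \<delta>\<Lambda>: the mass deficit
    \<open>V - X\<close> of the cutoff, of the order of the main term, and its energy
    \<open>Y\<close>, smaller by a factor \<Lambda>.\<close>
  have err: "err * (\<delta> * \<Lambda> * P) = \<kappa> * (V - X) * (\<Lambda> * n \<Lambda>) + \<kappa> * Y * n \<Lambda>"
    unfolding err_def nlat_def n_def[symmetric] P_def[symmetric] using \<delta> assms(5) P by (simp add: field_simps)
  have \<kappa>V: "0 \<le> \<kappa> * V" using \<kappa>_pos by (simp add: V_def)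
  have pos: "0 < \<delta> * \<Lambda> * P" using \<delta> assms(5) P by simp
  have n_eq: "n (t * \<Lambda>) = t powr (d\<^sub>n / 2) * nlat (t * \<Lambda>) * P" if "0 < t" for t
    using that assms(5) by (simp add: nlat_def n_def P_def powr_mult)
  have weyl: "weyl \<Lambda> * (\<delta> * \<Lambda> * P) = \<delta> * \<Lambda> * real (card (below \<Lambda>))"
    using P by (simp add: weyl_def P_def)
  show "weyl \<Lambda> \<le> \<kappa> * V * ((1 + \<delta>) powr (d\<^sub>n / 2) * nlat ((1 + \<delta>) * \<Lambda>)) + err"
  proof -
    have "\<delta> * \<Lambda> * real (card (below \<Lambda>)) \<le> Riesz_mean ((1 + \<delta>) * \<Lambda>) - Riesz_mean \<Lambda>"
      using Riesz_mean_diff_ge[where \<Lambda>' = "(1 + \<delta>) * \<Lambda>" and \<Lambda> = \<Lambda>] by (simp add: distrib_right)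
    also have "\<dots> \<le> \<kappa> * V * Slat ((1 + \<delta>) * \<Lambda>) - \<kappa> * (X * Slat \<Lambda> - Y * n \<Lambda>)"
      using upper[of "(1 + \<delta>) * \<Lambda>"] lower \<delta> assms(5) by simp
    also have "\<dots> = \<kappa> * V * (Slat ((1 + \<delta>) * \<Lambda>) - Slat \<Lambda>) + \<kappa> * (V - X) * Slat \<Lambda> + \<kappa> * Y * n \<Lambda>"
      by (simp add: algebra_simps)
    also have "\<dots> \<le> \<kappa> * V * (\<delta> * \<Lambda> * n ((1 + \<delta>) * \<Lambda>)) + \<kappa> * (V - X) * (\<Lambda> * n \<Lambda>) + \<kappa> * Y * n \<Lambda>"
    proof -
      have "Slat ((1 + \<delta>) * \<Lambda>) - Slat \<Lambda> \<le> \<delta> * \<Lambda> * n ((1 + \<delta>) * \<Lambda>)"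
        using Slat_diff_le[of "(1 + \<delta>) * \<Lambda>" \<Lambda>] by (simp add: n_def distrib_right)
      from mult_left_mono[OF this \<kappa>V] S show ?thesis by linarith
    qed
    also have "\<dots> = (\<kappa> * V * ((1 + \<delta>) powr (d\<^sub>n / 2) * nlat ((1 + \<delta>) * \<Lambda>)) + err) * (\<delta> * \<Lambda> * P)"
      unfolding distrib_right[of _ err "\<delta> * \<Lambda> * P"] err using n_eq[of "1 + \<delta>"] \<delta> by (simp add: mult_ac)
    finally have "weyl \<Lambda> * (\<delta> * \<Lambda> * P) \<le> (\<kappa> * V * ((1 + \<delta>) powr (d\<^sub>n / 2) * nlat ((1 + \<delta>) * \<Lambda>)) + err) * (\<delta> * \<Lambda> * P)"
      unfolding weyl .
    then show ?thesis using pos by (rule mult_right_le_imp_le)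
  qed
  show "\<kappa> * V * ((1 - \<delta>) powr (d\<^sub>n / 2) * nlat ((1 - \<delta>) * \<Lambda>)) - err \<le> weyl \<Lambda>"
  proof -
    have "(\<kappa> * V * ((1 - \<delta>) powr (d\<^sub>n / 2) * nlat ((1 - \<delta>) * \<Lambda>)) - err) * (\<delta> * \<Lambda> * P)
      = \<kappa> * V * (\<delta> * \<Lambda> * n ((1 - \<delta>) * \<Lambda>)) - (\<kappa> * (V - X) * (\<Lambda> * n \<Lambda>) + \<kappa> * Y * n \<Lambda>)"
      unfolding left_diff_distrib[of _ err "\<delta> * \<Lambda> * P"] err using n_eq[of "1 - \<delta>"] \<delta> by (simp add: mult_ac)
    also have "\<dots> \<le> \<kappa> * V * (Slat \<Lambda> - Slat ((1 - \<delta>) * \<Lambda>)) - (\<kappa> * (V - X) * Slat \<Lambda> + \<kappa> * Y * n \<Lambda>)"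
    proof -
      have "\<delta> * \<Lambda> * n ((1 - \<delta>) * \<Lambda>) \<le> Slat \<Lambda> - Slat ((1 - \<delta>) * \<Lambda>)"
        using Slat_diff_le[of "(1 - \<delta>) * \<Lambda>" \<Lambda>] by (simp add: n_def left_diff_distrib)
      from mult_left_mono[OF this \<kappa>V] S show ?thesis by linarith
    qed
    also have "\<dots> = \<kappa> * (X * Slat \<Lambda> - Y * n \<Lambda>) - \<kappa> * V * Slat ((1 - \<delta>) * \<Lambda>)"
      by (simp add: algebra_simps)
    also have "\<dots> \<le> Riesz_mean \<Lambda> - Riesz_mean ((1 - \<delta>) * \<Lambda>)"
      using upper[of "(1 - \<delta>) * \<Lambda>"] lower \<delta> assms(5) by simp
    also have "\<dots> \<le> \<delta> * \<Lambda> * real (card (below \<Lambda>))"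
      using Riesz_mean_diff_ge[where \<Lambda>' = "(1 - \<delta>) * \<Lambda>" and \<Lambda> = \<Lambda>] by (simp add: left_diff_distrib)
    finally have "(\<kappa> * V * ((1 - \<delta>) powr (d\<^sub>n / 2) * nlat ((1 - \<delta>) * \<Lambda>)) - err) * (\<delta> * \<Lambda> * P) \<le> weyl \<Lambda> * (\<delta> * \<Lambda> * P)"
      unfolding weyl .
    then show ?thesis using pos by (rule mult_right_le_imp_le)
  qed
qed

lemma cutoff_exists:
  assumes "0 < e"
  shows "\<exists>\<eta>\<in>test_functions \<Omega>. (\<forall>x. 0 \<le> \<eta> x \<and> \<eta> x \<le> 1) \<and> measure lebesgue \<Omega> - L2inner \<Omega> \<eta> \<eta> < e"
proof -
  obtain \<eta> :: "nat \<Rightarrow> real^'n \<Rightarrow> real" where \<eta>: "\<And>k. \<eta> k \<in> test_functions \<Omega>"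
    "\<And>k x. 0 \<le> \<eta> k x \<and> \<eta> k x \<le> 1" "\<And>x. x \<in> \<Omega> \<Longrightarrow> (\<lambda>k. \<eta> k x) \<longlonglongrightarrow> 1"
    using test_function_approx_one[OF open_\<Omega>] by blast
  interpret finite_measure M by (rule finite_measure_M)
  have "(\<lambda>k. LINT x|M. \<eta> k x * \<eta> k x) \<longlonglongrightarrow> (LINT x|M. 1 * 1)"
  proof (rule integral_dominated_convergence[where w = "\<lambda>_. 1"])
    show "(\<lambda>x. \<eta> k x * \<eta> k x) \<in> borel_measurable M" for k
      by (intro borel_measurable_times L2_measurable test_L2 \<eta>(1))
    show "AE x in M. (\<lambda>k. \<eta> k x * \<eta> k x) \<longlonglongrightarrow> 1 * 1"
      by (rule AE_I2) (intro tendsto_mult \<eta>(3); simp)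
    show "AE x in M. norm (\<eta> k x * \<eta> k x) \<le> 1" for k
      using \<eta>(2) by (intro AE_I2) (simp add: mult_le_one)
  qed auto
  then have "(\<lambda>k. L2inner \<Omega> (\<eta> k) (\<eta> k)) \<longlonglongrightarrow> measure lebesgue \<Omega>"
    using measure_M by (simp add: L2inner_def)
  from order_tendstoD(1)[OF this, of "measure lebesgue \<Omega> - e"] assms
  obtain k where "measure lebesgue \<Omega> - e < L2inner \<Omega> (\<eta> k) (\<eta> k)" by (auto simp: eventually_sequentially)
  then show ?thesis using \<eta> by (intro bexI[of _ "\<eta> k"]) auto
qed

definition W :: real where
  "W = measure lebesgue \<Omega> * unit_ball_vol d\<^sub>n / (2 * pi) ^ CARD('n)"

text \<open>The side of the cube cancels between \<kappa> and the lattice density.\<close>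

lemma W_eq: "W = \<kappa> * measure lebesgue \<Omega> * (unit_ball_vol d\<^sub>n / \<tau> ^ CARD('n))"
  using \<tau>_pos by (simp add: W_def \<kappa>_def power_divide)

text \<open>\<open>p\<close> stands for the mass deficit of the cutoff, which survives in the limit,
  and \<open>q\<close> for its energy, which does not.\<close>

lemma weyl_error_tendsto:
  defines "V \<equiv> measure lebesgue \<Omega>" and "c \<equiv> unit_ball_vol d\<^sub>n / \<tau> ^ CARD('n)"
  assumes "0 < t"
  shows "((\<lambda>\<Lambda>. \<kappa> * V * (t powr (d\<^sub>n / 2) * nlat (t * \<Lambda>)) + (p * nlat \<Lambda> + q * (nlat \<Lambda> / \<Lambda>)))
    \<longlongrightarrow> W * t powr (d\<^sub>n / 2) + p * c) at_top"
proof -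
  have s: "filterlim (\<lambda>\<Lambda>. t * \<Lambda>) at_top at_top"
    using assms(3) by (intro filterlim_tendsto_pos_mult_at_top[OF tendsto_const]) (auto simp: filterlim_ident)
  have 1: "((\<lambda>\<Lambda>. nlat (t * \<Lambda>)) \<longlongrightarrow> c) at_top" unfolding c_def by (rule filterlim_compose[OF nlat_tendsto s])
  have 2: "(nlat \<longlongrightarrow> c) at_top" unfolding c_def by (rule nlat_tendsto)
  have 3: "((\<lambda>\<Lambda>. nlat \<Lambda> / \<Lambda>) \<longlongrightarrow> 0) at_top" by (rule real_tendsto_divide_at_top[OF 2 filterlim_ident])
  have "((\<lambda>\<Lambda>. \<kappa> * V * (t powr (d\<^sub>n / 2) * nlat (t * \<Lambda>)) + (p * nlat \<Lambda> + q * (nlat \<Lambda> / \<Lambda>)))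
    \<longlongrightarrow> \<kappa> * V * (t powr (d\<^sub>n / 2) * c) + (p * c + q * 0)) at_top"
    by (intro tendsto_intros 1 2 3)
  then show ?thesis unfolding W_eq V_def c_def by (simp add: mult_ac)
qed

lemma powr_near_1:
  assumes "((\<lambda>\<delta>. f \<delta>) \<longlongrightarrow> (1::real)) (at_right 0)"
  shows "((\<lambda>\<delta>::real. W * f \<delta> powr (d\<^sub>n / 2)) \<longlongrightarrow> W) (at_right 0)"
proof -
  have "((\<lambda>\<delta>. W * f \<delta> powr (d\<^sub>n / 2)) \<longlongrightarrow> W * 1 powr (d\<^sub>n / 2)) (at_right 0)"
    by (intro tendsto_intros assms) auto
  then show ?thesis by simp
qed

lemma right_0_witness:
  assumes "\<forall>\<^sub>F \<delta> in at_right (0::real). Q \<delta>"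
  obtains \<delta> where "0 < \<delta>" "\<delta> < 1" "Q \<delta>"
proof -
  have "\<forall>\<^sub>F \<delta> in at_right (0::real). Q \<delta> \<and> 0 < \<delta> \<and> \<delta> < 1"
    using assms by (intro eventually_conj) (auto simp: eventually_at_right_field intro: exI[of _ 1])
  then show ?thesis using that eventually_happens'[of "at_right (0::real)"] by (auto simp: trivial_limit_at_right_real)
qed

text \<open>The order of the choices matters: \<delta> brings the main term close to
  \<open>W\<close>, then the cutoff makes its deficit small relative to \<delta>, and only then
  \<Lambda> grows, which removes the energy of the cutoff however large it is.\<close>

theorem weyl_tendsto: "(weyl \<longlongrightarrow> W) at_top"
proof (rule order_tendstoI)
  define V where "V = measure lebesgue \<Omega>"
  define c where "c = unit_ball_vol d\<^sub>n / \<tau> ^ CARD('n)"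
  have c: "0 \<le> c" using \<tau>_pos by (simp add: c_def d\<^sub>n_def)
  have cut: "\<exists>\<eta>\<in>test_functions \<Omega>. (\<forall>x. 0 \<le> \<eta> x \<and> \<eta> x \<le> 1) \<and> \<kappa> * (V - L2inner \<Omega> \<eta> \<eta>) / \<delta> * c < e"
    if "0 < e" "0 < \<delta>" for e \<delta>
  proof -
    have "0 < e * \<delta> / (\<kappa> * (c + 1))" using that \<kappa>_pos c by simp
    then obtain \<eta> where \<eta>: "\<eta> \<in> test_functions \<Omega>" "\<forall>x. 0 \<le> \<eta> x \<and> \<eta> x \<le> 1" "V - L2inner \<Omega> \<eta> \<eta> < e * \<delta> / (\<kappa> * (c + 1))"
      using cutoff_exists unfolding V_def by blast
    have "\<kappa> * (V - L2inner \<Omega> \<eta> \<eta>) / \<delta> * c \<le> \<kappa> * (e * \<delta> / (\<kappa> * (c + 1))) / \<delta> * c"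
      using \<eta>(3) \<kappa>_pos c that by (intro mult_right_mono divide_right_mono mult_left_mono) auto
    also have "\<dots> = e * (c / (c + 1))" using that \<kappa>_pos by simp
    also have "\<dots> < e * 1" using that c by (intro mult_strict_left_mono) auto
    finally show ?thesis using \<eta> by auto
  qed
  fix a
  {
    assume a: "a < W"
    have "((\<lambda>\<delta>. W * (1 - \<delta>) powr (d\<^sub>n / 2)) \<longlongrightarrow> W) (at_right 0)"
      by (rule powr_near_1) (auto intro!: tendsto_eq_intros)
    from order_tendstoD(1)[OF this a] obtain \<delta> where \<delta>: "0 < \<delta>" "\<delta> < 1" "a < W * (1 - \<delta>) powr (d\<^sub>n / 2)"
      by (rule right_0_witness)
    then have "0 < W * (1 - \<delta>) powr (d\<^sub>n / 2) - a" by simp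
    from cut[OF this \<delta>(1)] obtain \<eta> where \<eta>: "\<eta> \<in> test_functions \<Omega>" "\<And>x. 0 \<le> \<eta> x \<and> \<eta> x \<le> 1"
      "\<kappa> * (V - L2inner \<Omega> \<eta> \<eta>) / \<delta> * c < W * (1 - \<delta>) powr (d\<^sub>n / 2) - a" by blast
    define p where "p = - (\<kappa> * (V - L2inner \<Omega> \<eta> \<eta>) / \<delta>)"
    define q where "q = - (\<kappa> * L2inner \<Omega> (grad \<eta>) (grad \<eta>) / \<delta>)"
    have "a < W * (1 - \<delta>) powr (d\<^sub>n / 2) + p * c" using \<eta>(3) by (simp add: p_def)
    from order_tendstoD(1)[OF weyl_error_tendsto[of "1 - \<delta>" p q, folded c_def] this] \<delta>
    have "\<forall>\<^sub>F \<Lambda> in at_top. a < \<kappa> * V * ((1 - \<delta>) powr (d\<^sub>n / 2) * nlat ((1 - \<delta>) * \<Lambda>)) + (p * nlat \<Lambda> + q * (nlat \<Lambda> / \<Lambda>))"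
      by (simp add: V_def)
    then show "\<forall>\<^sub>F \<Lambda> in at_top. a < weyl \<Lambda>"
      using eventually_gt_at_top[of 0]
    proof eventually_elim
      case (elim \<Lambda>)
      then show ?case using weyl_bounds(2)[OF \<eta>(1,2) \<delta>(1,2), of \<Lambda>] by (simp add: p_def q_def V_def)
    qed
  }
  {
    assume a: "W < a"
    have "((\<lambda>\<delta>. W * (1 + \<delta>) powr (d\<^sub>n / 2)) \<longlongrightarrow> W) (at_right 0)"
      by (rule powr_near_1) (auto intro!: tendsto_eq_intros)
    from order_tendstoD(2)[OF this a] obtain \<delta> where \<delta>: "0 < \<delta>" "\<delta> < 1" "W * (1 + \<delta>) powr (d\<^sub>n / 2) < a"
      by (rule right_0_witness)
    then have "0 < a - W * (1 + \<delta>) powr (d\<^sub>n / 2)" by simp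
    from cut[OF this \<delta>(1)] obtain \<eta> where \<eta>: "\<eta> \<in> test_functions \<Omega>" "\<And>x. 0 \<le> \<eta> x \<and> \<eta> x \<le> 1"
      "\<kappa> * (V - L2inner \<Omega> \<eta> \<eta>) / \<delta> * c < a - W * (1 + \<delta>) powr (d\<^sub>n / 2)" by blast
    define p where "p = \<kappa> * (V - L2inner \<Omega> \<eta> \<eta>) / \<delta>"
    define q where "q = \<kappa> * L2inner \<Omega> (grad \<eta>) (grad \<eta>) / \<delta>"
    have "W * (1 + \<delta>) powr (d\<^sub>n / 2) + p * c < a" using \<eta>(3) by (simp add: p_def)
    from order_tendstoD(2)[OF weyl_error_tendsto[of "1 + \<delta>" p q, folded c_def] this] \<delta>
    have "\<forall>\<^sub>F \<Lambda> in at_top. \<kappa> * V * ((1 + \<delta>) powr (d\<^sub>n / 2) * nlat ((1 + \<delta>) * \<Lambda>)) + (p * nlat \<Lambda> + q * (nlat \<Lambda> / \<Lambda>)) < a"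
      by (simp add: V_def)
    then show "\<forall>\<^sub>F \<Lambda> in at_top. weyl \<Lambda> < a"
      using eventually_gt_at_top[of 0]
    proof eventually_elim
      case (elim \<Lambda>)
      then show ?case using weyl_bounds(1)[OF \<eta>(1,2) \<delta>(1,2), of \<Lambda>] by (simp add: p_def q_def V_def)
    qed
  }
qed

lemma lam_at_top: "filterlim (\<lambda>N. lam (Suc N)) at_top sequentially"
  unfolding filterlim_at_top
proof
  fix Z
  have "Z \<le> lam (Suc N)" if "card (below Z) \<le> N" for N
    using lam_card_below[of Z] lam_mono[of "Suc (card (below Z))" "Suc N"] that by simp
  then show "\<forall>\<^sub>F N in sequentially. Z \<le> lam (Suc N)" by (rule eventually_sequentiallyI)
qed

text \<open>The counting function is strict. At \<open>lam (Suc N)\<close> it is at most N, possibly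
  less because of multiplicity, whereas at any level slightly above it is at least N.\<close>

theorem Weyl_law: "(\<lambda>N. real N / lam (Suc N) powr (d\<^sub>n / 2)) \<longlonglongrightarrow> W"
proof (rule order_tendstoI)
  have pos: "0 < lam (Suc N)" for N by (rule lam_pos) simp
  have lo: "weyl (lam (Suc N)) \<le> real N / lam (Suc N) powr (d\<^sub>n / 2)" for N
  proof -
    have "below (lam (Suc N)) \<subseteq> {1..N}"
    proof
      fix k assume k: "k \<in> below (lam (Suc N))"
      have "\<not> Suc N \<le> k" using k lam_mono[of "Suc N" k] by (auto simp: below_def)
      then show "k \<in> {1..N}" using k by (auto simp: below_def)
    qed
    then have "card (below (lam (Suc N))) \<le> N" using card_mono[of "{1..N}"] by fastforce
    then show ?thesis unfolding weyl_def using pos by (intro divide_right_mono) auto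
  qed
  have hi: "real N / lam (Suc N) powr (d\<^sub>n / 2) \<le> (1 + \<delta>) powr (d\<^sub>n / 2) * weyl ((1 + \<delta>) * lam (Suc N))" if "0 < \<delta>" for N \<delta>
  proof -
    have "{1..N} \<subseteq> below ((1 + \<delta>) * lam (Suc N))"
    proof
      fix k assume k: "k \<in> {1..N}"
      then have "lam k \<le> lam (Suc N)" by (intro lam_mono) auto
      also have "\<dots> < (1 + \<delta>) * lam (Suc N)" using that pos[of N] by simp
      finally show "k \<in> below ((1 + \<delta>) * lam (Suc N))" using k by (simp add: below_def)
    qed
    from card_mono[OF finite_below this] have "real N \<le> real (card (below ((1 + \<delta>) * lam (Suc N))))" by simp
    then have "real N / lam (Suc N) powr (d\<^sub>n / 2) \<le> real (card (below ((1 + \<delta>) * lam (Suc N)))) / lam (Suc N) powr (d\<^sub>n / 2)"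
      by (rule divide_right_mono) simp
    also have "\<dots> = (1 + \<delta>) powr (d\<^sub>n / 2) * weyl ((1 + \<delta>) * lam (Suc N))"
      using that pos[of N] by (simp add: weyl_def powr_mult)
    finally show ?thesis .
  qed
  fix a
  {
    assume "a < W"
    from order_tendstoD(1)[OF filterlim_compose[OF weyl_tendsto lam_at_top] this]
    show "\<forall>\<^sub>F N in sequentially. a < real N / lam (Suc N) powr (d\<^sub>n / 2)"
      by eventually_elim (use lo less_le_trans in blast)
  }
  {
    assume a: "W < a"
    have "((\<lambda>\<delta>. W * (1 + \<delta>) powr (d\<^sub>n / 2)) \<longlongrightarrow> W) (at_right 0)"
      by (rule powr_near_1) (auto intro!: tendsto_eq_intros)
    from order_tendstoD(2)[OF this a] obtain \<delta> where \<delta>: "0 < \<delta>" "\<delta> < 1" "W * (1 + \<delta>) powr (d\<^sub>n / 2) < a"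
      by (rule right_0_witness)
    have "filterlim (\<lambda>N. (1 + \<delta>) * lam (Suc N)) at_top sequentially"
      by (rule filterlim_tendsto_pos_mult_at_top[OF tendsto_const _ lam_at_top]) (use \<delta> in simp)
    from tendsto_mult_left[OF filterlim_compose[OF weyl_tendsto this], of "(1 + \<delta>) powr (d\<^sub>n / 2)"]
    have "(\<lambda>N. (1 + \<delta>) powr (d\<^sub>n / 2) * weyl ((1 + \<delta>) * lam (Suc N))) \<longlonglongrightarrow> W * (1 + \<delta>) powr (d\<^sub>n / 2)"
      by (simp add: mult.commute)
    from order_tendstoD(2)[OF this \<delta>(3)]
    show "\<forall>\<^sub>F N in sequentially. real N / lam (Suc N) powr (d\<^sub>n / 2) < a"
      by eventually_elim (use hi[OF \<delta>(1)] le_less_trans in blast)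
  }
qed

end

section \<open>The flux norm\<close>

context bounded_open begin

lemma gradient_closure_L2: "p \<in> gradient_closure \<Omega> \<Longrightarrow> p \<in> L2 \<Omega>"
  by (simp add: gradient_closure_def)

lemma gradient_closure_approx:
  "p \<in> gradient_closure \<Omega> \<Longrightarrow> 0 < \<epsilon> \<Longrightarrow> \<exists>g\<in>test_functions \<Omega>. L2norm \<Omega> (\<lambda>x. p x - grad g x) < \<epsilon>"
  by (simp add: gradient_closure_def)

text \<open>A closure is closed: the approximants may themselves be limits of gradients.\<close>

lemma gradient_closureI:
  assumes "p \<in> L2 \<Omega>" "\<And>\<epsilon>. 0 < \<epsilon> \<Longrightarrow> \<exists>q\<in>gradient_closure \<Omega>. L2norm \<Omega> (\<lambda>x. p x - q x) < \<epsilon>"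
  shows "p \<in> gradient_closure \<Omega>"
proof -
  have "\<exists>g\<in>test_functions \<Omega>. L2norm \<Omega> (\<lambda>x. p x - grad g x) < \<epsilon>" if e: "0 < \<epsilon>" for \<epsilon>
  proof -
    obtain q where q: "q \<in> gradient_closure \<Omega>" "L2norm \<Omega> (\<lambda>x. p x - q x) < \<epsilon> / 2" using assms(2)[of "\<epsilon>/2"] e by auto
    obtain g where g: "g \<in> test_functions \<Omega>" "L2norm \<Omega> (\<lambda>x. q x - grad g x) < \<epsilon> / 2"
      using gradient_closure_approx[OF q(1), of "\<epsilon>/2"] e by auto
    have "L2norm \<Omega> (\<lambda>x. p x - grad g x) < \<epsilon>"
      using L2.nrm_triangle3[OF assms(1) gradient_closure_L2[OF q(1)] test_L2(2)[OF g(1)]] q(2) g(2)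
      unfolding L2norm_eq by linarith
    then show ?thesis using g(1) by blast
  qed
  then show ?thesis using assms(1) by (simp add: gradient_closure_def)
qed

lemma grad_gradient_closure: "g \<in> test_functions \<Omega> \<Longrightarrow> grad g \<in> gradient_closure \<Omega>"
  using test_L2(2)[of g] by (auto simp: gradient_closure_def L2norm_def intro!: bexI[of _ g])

lemma weak_grad_gradient_closure:
  assumes "u \<in> H10 \<Omega>" shows "weak_grad \<Omega> u \<in> gradient_closure \<Omega>"
  using weak_grad_H10(3)[OF assms] H10_approx[OF assms] by (fastforce simp: gradient_closure_def)

sublocale P: semi_inner "gradient_closure \<Omega>" "L2inner \<Omega>"
proof
  show "(\<lambda>x. 0) \<in> gradient_closure \<Omega>"
  proof -
    have "grad (\<lambda>x. 0) = (\<lambda>x :: real^'n. 0)" by (simp add: fun_eq_iff grad_const)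
    then show ?thesis using grad_gradient_closure[OF test_function_zero] by simp
  qed
  fix f g h :: "real^'n \<Rightarrow> real^'n" and c :: real
  assume f: "f \<in> gradient_closure \<Omega>"
  note fL = gradient_closure_L2[OF f]
  show "0 \<le> L2inner \<Omega> f f" by (rule L2.B_nonneg[OF fL])
  show "(\<lambda>x. c *\<^sub>R f x) \<in> gradient_closure \<Omega>"
  proof (rule gradient_closureI[OF L2.scale_mem[OF fL]])
    fix \<epsilon> :: real assume e: "0 < \<epsilon>"
    obtain g where g: "g \<in> test_functions \<Omega>" "L2norm \<Omega> (\<lambda>x. f x - grad g x) < \<epsilon> / (\<bar>c\<bar> + 1)"
      using gradient_closure_approx[OF f, of "\<epsilon> / (\<bar>c\<bar> + 1)"] e by auto
    have gr: "grad (\<lambda>x. c * g x) x = c *\<^sub>R grad g x" for x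
      using test_function_differentiable[OF g(1)] by (simp add: grad_mult grad_const)
    have "L2norm \<Omega> (\<lambda>x. c *\<^sub>R f x - grad (\<lambda>x. c * g x) x) = \<bar>c\<bar> * L2norm \<Omega> (\<lambda>x. f x - grad g x)"
      using L2.nrm_scale[OF L2.diff_mem[OF fL test_L2(2)[OF g(1)]], of c] unfolding L2norm_eq gr
      by (simp add: scaleR_diff_right)
    also have "\<dots> \<le> \<bar>c\<bar> * (\<epsilon> / (\<bar>c\<bar> + 1))" using g(2) by (intro mult_left_mono) auto
    also have "\<dots> < \<epsilon>" using e by (simp add: field_simps)
    finally show "\<exists>q\<in>gradient_closure \<Omega>. L2norm \<Omega> (\<lambda>x. c *\<^sub>R f x - q x) < \<epsilon>"
      using grad_gradient_closure[OF test_function_scale[OF g(1), of c]] by blast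
  qed
  assume g: "g \<in> gradient_closure \<Omega>"
  note gL = gradient_closure_L2[OF g]
  show "L2inner \<Omega> f g = L2inner \<Omega> g f" by (rule L2.B_commute[OF fL gL])
  show "(\<lambda>x. f x + g x) \<in> gradient_closure \<Omega>"
  proof (rule gradient_closureI[OF L2.add_mem[OF fL gL]])
    fix \<epsilon> :: real assume e: "0 < \<epsilon>"
    obtain \<phi> where \<phi>: "\<phi> \<in> test_functions \<Omega>" "L2norm \<Omega> (\<lambda>x. f x - grad \<phi> x) < \<epsilon> / 2"
      using gradient_closure_approx[OF f, of "\<epsilon>/2"] e by auto
    obtain \<psi> where \<psi>: "\<psi> \<in> test_functions \<Omega>" "L2norm \<Omega> (\<lambda>x. g x - grad \<psi> x) < \<epsilon> / 2"
      using gradient_closure_approx[OF g, of "\<epsilon>/2"] e by auto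
    have gr: "grad (\<lambda>x. \<phi> x + \<psi> x) x = grad \<phi> x + grad \<psi> x" for x
      using test_function_differentiable \<phi>(1) \<psi>(1) by (intro grad_add) auto
    have "L2norm \<Omega> (\<lambda>x. f x + g x - grad (\<lambda>x. \<phi> x + \<psi> x) x) < \<epsilon>"
      using L2.nrm_triangle[OF L2.diff_mem[OF fL test_L2(2)[OF \<phi>(1)]] L2.diff_mem[OF gL test_L2(2)[OF \<psi>(1)]]] \<phi>(2) \<psi>(2)
      unfolding L2norm_eq gr by (simp add: algebra_simps)
    then show "\<exists>q\<in>gradient_closure \<Omega>. L2norm \<Omega> (\<lambda>x. f x + g x - q x) < \<epsilon>"
      using grad_gradient_closure[OF test_function_add[OF \<phi>(1) \<psi>(1)]] by blast
  qed
next
  fix f g h :: "real^'n \<Rightarrow> real^'n" and c :: real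
  assume "f \<in> gradient_closure \<Omega>" "g \<in> gradient_closure \<Omega>" "h \<in> gradient_closure \<Omega>"
  note L = this[THEN gradient_closure_L2]
  show "L2inner \<Omega> (\<lambda>x. f x + g x) h = L2inner \<Omega> f h + L2inner \<Omega> g h" by (rule L2.B_add_left[OF L])
next
  fix f h :: "real^'n \<Rightarrow> real^'n" and c :: real
  assume "f \<in> gradient_closure \<Omega>" "h \<in> gradient_closure \<Omega>"
  note L = this[THEN gradient_closure_L2]
  show "L2inner \<Omega> (\<lambda>x. c *\<^sub>R f x) h = c * L2inner \<Omega> f h" by (rule L2.B_scale_left[OF L])
qed

lemma P_nrm: "P.nrm f = L2norm \<Omega> f"
  by (simp add: P.nrm_def L2norm_eq[symmetric] L2.nrm_def)

text \<open>The projection is the Riesz representer of the pairing with \<open>k\<close> on the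
  closed space of gradient fields; its existence gives the choice in \<open>pot\<close> its
  meaning.\<close>

lemma pot_spec:
  assumes k: "k \<in> L2 \<Omega>"
  shows "pot \<Omega> k \<in> gradient_closure \<Omega>" "q \<in> gradient_closure \<Omega> \<Longrightarrow> L2inner \<Omega> (pot \<Omega> k) q = L2inner \<Omega> k q"
proof -
  have "\<exists>p\<in>gradient_closure \<Omega>. \<forall>q\<in>gradient_closure \<Omega>. L2inner \<Omega> p q = L2inner \<Omega> k q"
  proof (rule P.Riesz[where M = "L2norm \<Omega> k"])
    fix X :: "nat \<Rightarrow> real^'n \<Rightarrow> real^'n"
    assume X: "\<And>n. X n \<in> gradient_closure \<Omega>"
      and c: "\<And>\<epsilon>. \<epsilon> > 0 \<Longrightarrow> \<exists>N. \<forall>m\<ge>N. \<forall>n\<ge>N. P.nrm (\<lambda>x. X m x - X n x) < \<epsilon>"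
    from L2_complete[OF gradient_closure_L2[OF X] c[unfolded P_nrm]]
    obtain p where p: "p \<in> L2 \<Omega>" "(\<lambda>n. L2norm \<Omega> (\<lambda>x. X n x - p x)) \<longlonglongrightarrow> 0" by blast
    have "p \<in> gradient_closure \<Omega>"
    proof (rule gradient_closureI[OF p(1)])
      fix \<epsilon> :: real assume "0 < \<epsilon>"
      from order_tendstoD(2)[OF p(2) this] obtain n where "L2norm \<Omega> (\<lambda>x. X n x - p x) < \<epsilon>"
        by (auto simp: eventually_sequentially)
      then show "\<exists>q\<in>gradient_closure \<Omega>. L2norm \<Omega> (\<lambda>x. p x - q x) < \<epsilon>"
        using X[of n] L2norm_minus_commute[of p "X n"] by (intro bexI[of _ "X n"]) auto
    qed
    then show "\<exists>f\<in>gradient_closure \<Omega>. (\<lambda>n. P.nrm (\<lambda>x. X n x - f x)) \<longlonglongrightarrow> 0" using p(2) unfolding P_nrm by blast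
  next
    fix f g assume "f \<in> gradient_closure \<Omega>" "g \<in> gradient_closure \<Omega>"
    then show "L2inner \<Omega> k (\<lambda>x. f x + g x) = L2inner \<Omega> k f + L2inner \<Omega> k g"
      using gradient_closure_L2 k by (intro L2.B_add_right) auto
  next
    fix f c assume "f \<in> gradient_closure \<Omega>"
    then show "L2inner \<Omega> k (\<lambda>x. c *\<^sub>R f x) = c * L2inner \<Omega> k f"
      using gradient_closure_L2 k by (intro L2.B_scale_right) auto
  next
    fix f assume "f \<in> gradient_closure \<Omega>"
    then show "\<bar>L2inner \<Omega> k f\<bar> \<le> L2norm \<Omega> k * P.nrm f"
      unfolding P_nrm using L2.Cauchy_Schwarz[OF k gradient_closure_L2, of f] unfolding L2norm_eq by simp
  qed
  then obtain p where p: "p \<in> gradient_closure \<Omega>" "\<And>q. q \<in> gradient_closure \<Omega> \<Longrightarrow> L2inner \<Omega> p q = L2inner \<Omega> k q" by blast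
  have "p \<in> gradient_closure \<Omega> \<and> (\<forall>q\<in>gradient_closure \<Omega>. L2inner \<Omega> (\<lambda>x. k x - p x) q = 0)"
    using p gradient_closure_L2 k by (auto simp: L2.B_diff_left)
  then have "pot \<Omega> k \<in> gradient_closure \<Omega> \<and> (\<forall>q\<in>gradient_closure \<Omega>. L2inner \<Omega> (\<lambda>x. k x - pot \<Omega> k x) q = 0)"
    unfolding pot_def
    by (rule someI[where P = "\<lambda>p. p \<in> gradient_closure \<Omega> \<and> (\<forall>q\<in>gradient_closure \<Omega>. L2inner \<Omega> (\<lambda>x. k x - p x) q = 0)"])
  then show "pot \<Omega> k \<in> gradient_closure \<Omega>"
    "q \<in> gradient_closure \<Omega> \<Longrightarrow> L2inner \<Omega> (pot \<Omega> k) q = L2inner \<Omega> k q"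
    using gradient_closure_L2 k by (auto simp: L2.B_diff_left)
qed

end

section \<open>The elliptic equation, and the flux norm as a dual norm\<close>

locale elliptic = eigensystem \<Omega> \<tau> lam \<Psi> for \<Omega> :: "(real^'n) set" and \<tau> lam \<Psi> +
  fixes a :: "real^'n \<Rightarrow> real^'n^'n" and lmin lmax :: real and \<theta> :: "nat \<Rightarrow> real^'n \<Rightarrow> real"
  assumes elliptic: "elliptic_matrix \<Omega> a lmin lmax"
    and \<theta>: "\<And>k. k \<ge> 1 \<Longrightarrow> is_weak_sol \<Omega> a (\<lambda>x. lam k * \<Psi> k x) (\<theta> k)"
begin

definition A :: "(real^'n \<Rightarrow> real^'n) \<Rightarrow> real^'n \<Rightarrow> real^'n" where
  "A F x = a x *v F x"

lemma lmin_pos: "0 < lmin"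
  using elliptic by (simp add: elliptic_matrix_def)

lemma A_measurable: assumes "F \<in> borel_measurable M" shows "A F \<in> borel_measurable M"
proof -
  have [measurable]: "(\<lambda>x. a x $ i $ j) \<in> borel_measurable M" for i j
    using elliptic by (simp add: elliptic_matrix_def)
  have [measurable]: "(\<lambda>x. F x $ j) \<in> borel_measurable M" for j
    unfolding cart_eq_inner_axis using assms by measurable
  have "(\<lambda>x. A F x \<bullet> axis i 1) \<in> borel_measurable M" for i
    unfolding A_def inner_axis by (simp add: matrix_vector_mult_def)
  then show ?thesis by (subst borel_measurable_euclidean_space) (auto simp: Basis_vec_def)
qed

lemma A_L2: assumes "F \<in> L2 \<Omega>" shows "A F \<in> L2 \<Omega>"
proof -
  have "\<forall>i j. \<exists>K. AE x in M. \<bar>a x $ i $ j\<bar> \<le> K" using elliptic by (simp add: elliptic_matrix_def)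
  then obtain K where K: "\<And>i j. AE x in M. \<bar>a x $ i $ j\<bar> \<le> K i j" by metis
  then have "AE x in M. \<forall>k\<in>UNIV. \<bar>a x $ fst k $ snd k\<bar> \<le> K (fst k) (snd k)" by (intro AE_finite_allI) auto
  then have "AE x in M. norm (A F x) \<le> (\<Sum>i\<in>UNIV. \<Sum>j\<in>UNIV. K i j) * norm (F x)"
  proof eventually_elim
    case (elim x)
    have "norm (A F x) \<le> (\<Sum>i\<in>UNIV. \<bar>A F x $ i\<bar>)" by (rule norm_le_l1_cart)
    also have "\<dots> \<le> (\<Sum>i\<in>UNIV. \<Sum>j\<in>UNIV. K i j * norm (F x))"
    proof (rule sum_mono)
      fix i
      have "\<bar>A F x $ i\<bar> \<le> (\<Sum>j\<in>UNIV. \<bar>a x $ i $ j * F x $ j\<bar>)"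
        by (simp add: A_def matrix_vector_mult_def sum_abs)
      also have "\<dots> \<le> (\<Sum>j\<in>UNIV. K i j * norm (F x))"
      proof (rule sum_mono)
        fix j
        have "\<bar>a x $ i $ j\<bar> \<le> K i j" using elim by (metis UNIV_I fst_conv snd_conv)
        then show "\<bar>a x $ i $ j * F x $ j\<bar> \<le> K i j * norm (F x)"
          unfolding abs_mult by (intro mult_mono component_le_norm_cart) auto
      qed
      finally show "\<bar>A F x $ i\<bar> \<le> (\<Sum>j\<in>UNIV. K i j * norm (F x))" .
    qed
    finally show ?case by (simp add: sum_distrib_right)
  qed
  then show ?thesis by (rule L2_bound[OF assms A_measurable[OF L2_measurable[OF assms]]])
qed

lemma A_symmetric:
  assumes "F \<in> L2 \<Omega>" "G \<in> L2 \<Omega>" shows "L2inner \<Omega> (A F) G = L2inner \<Omega> (A G) F"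
  unfolding L2inner_def
proof (rule integral_cong_AE)
  have "AE x in M. transpose (a x) = a x" using elliptic by (simp add: elliptic_matrix_def)
  then show "AE x in M. A F x \<bullet> G x = A G x \<bullet> F x"
  proof eventually_elim
    case (elim x)
    have "A F x \<bullet> G x = (transpose (a x) *v F x) \<bullet> G x" using elim by (simp add: A_def)
    also have "\<dots> = F x \<bullet> (a x *v G x)" unfolding transpose_matrix_vector by (rule dot_lmul_matrix)
    finally show ?case by (simp add: A_def inner_commute)
  qed
qed (use assms A_L2 L2_measurable in \<open>auto intro!: borel_measurable_inner\<close>)

lemma A_bounds:
  assumes "F \<in> L2 \<Omega>"
  shows "lmin * L2inner \<Omega> F F \<le> L2inner \<Omega> (A F) F" "L2inner \<Omega> (A F) F \<le> lmax * L2inner \<Omega> F F"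
proof -
  have e: "AE x in M. \<forall>\<xi>. lmin * (norm \<xi>)\<^sup>2 \<le> \<xi> \<bullet> (a x *v \<xi>) \<and> \<xi> \<bullet> (a x *v \<xi>) \<le> lmax * (norm \<xi>)\<^sup>2"
    using elliptic by (simp add: elliptic_matrix_def)
  note i = L2_inner_integrable[OF assms assms] L2_inner_integrable[OF A_L2[OF assms] assms]
  have "(LINT x|M. lmin * (F x \<bullet> F x)) \<le> (LINT x|M. A F x \<bullet> F x)"
    by (rule integral_mono_AE) (use e i in \<open>auto simp: A_def power2_norm_eq_inner inner_commute elim!: eventually_mono\<close>)
  then show "lmin * L2inner \<Omega> F F \<le> L2inner \<Omega> (A F) F" by (simp add: L2inner_def)
  have "(LINT x|M. A F x \<bullet> F x) \<le> (LINT x|M. lmax * (F x \<bullet> F x))"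
    by (rule integral_mono_AE) (use e i in \<open>auto simp: A_def power2_norm_eq_inner inner_commute elim!: eventually_mono\<close>)
  then show "L2inner \<Omega> (A F) F \<le> lmax * L2inner \<Omega> F F" by (simp add: L2inner_def)
qed

definition E :: "(real^'n \<Rightarrow> real) \<Rightarrow> (real^'n \<Rightarrow> real) \<Rightarrow> real" where
  "E u v = L2inner \<Omega> (A (weak_grad \<Omega> u)) (weak_grad \<Omega> v)"

sublocale E: semi_inner "H10 \<Omega>" E
  unfolding E_def[abs_def]
proof (rule semi_inner_weak_grad)
  fix F :: "real^'n \<Rightarrow> real^'n" assume F: "F \<in> L2 \<Omega>"
  have "0 \<le> lmin * L2inner \<Omega> F F" using lmin_pos L2.B_nonneg[OF F] by simp
  then show "0 \<le> L2inner \<Omega> (A F) F" using A_bounds(1)[OF F] by linarith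
qed (auto simp: A_L2 A_symmetric)

lemma E_D_bounds:
  assumes "u \<in> H10 \<Omega>" shows "lmin * D u u \<le> E u u" "E u u \<le> lmax * D u u"
  using A_bounds[OF weak_grad_H10(3)[OF assms]] by (auto simp: E_def D_def)

lemma H_nrm_le_E: assumes "u \<in> H10 \<Omega>" shows "H.nrm u \<le> E.nrm u / sqrt lmin"
proof -
  have "D u u \<le> E u u / lmin" using E_D_bounds(1)[OF assms] lmin_pos by (simp add: field_simps)
  then have "sqrt (D u u) \<le> sqrt (E u u / lmin)" by (rule real_sqrt_le_mono)
  then show ?thesis by (simp add: H.nrm_def E.nrm_def real_sqrt_divide)
qed

lemma E_nrm_le_H: assumes "u \<in> H10 \<Omega>" shows "E.nrm u \<le> sqrt lmax * H.nrm u"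
  using E_D_bounds(2)[OF assms] by (simp add: H.nrm_def E.nrm_def flip: real_sqrt_mult)

lemma is_weak_sol_iff: "is_weak_sol \<Omega> a f u \<longleftrightarrow> u \<in> H10 \<Omega> \<and> (\<forall>\<phi>\<in>H10 \<Omega>. E u \<phi> = L2inner \<Omega> f \<phi>)"
  by (simp add: is_weak_sol_def E_def A_def[abs_def])

text \<open>Riesz representation in the energy form. Ellipticity makes its norm equivalent to the
  Dirichlet norm, which transfers completeness, and the Poincare inequality makes the right-hand
  side continuous.\<close>

lemma weak_sol:
  assumes f: "f \<in> L2 \<Omega>"
  shows "weak_sol \<Omega> a f \<in> H10 \<Omega>" "\<phi> \<in> H10 \<Omega> \<Longrightarrow> E (weak_sol \<Omega> a f) \<phi> = L2inner \<Omega> f \<phi>"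
proof -
  have "\<exists>u\<in>H10 \<Omega>. \<forall>\<phi>\<in>H10 \<Omega>. E u \<phi> = L2inner \<Omega> f \<phi>"
  proof (rule E.Riesz[where M = "L2.nrm f * (cP / sqrt lmin)"])
    fix X :: "nat \<Rightarrow> real^'n \<Rightarrow> real"
    assume X: "\<And>n. X n \<in> H10 \<Omega>"
      and c: "\<And>\<epsilon>. \<epsilon> > 0 \<Longrightarrow> \<exists>N. \<forall>m\<ge>N. \<forall>n\<ge>N. E.nrm (\<lambda>x. X m x - X n x) < \<epsilon>"
    have "\<exists>N. \<forall>m\<ge>N. \<forall>n\<ge>N. H.nrm (\<lambda>x. X m x - X n x) < \<epsilon>" if "\<epsilon> > 0" for \<epsilon>
    proof -
      have "0 < \<epsilon> * sqrt lmin" using that lmin_pos by simp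
      from c[OF this] obtain N where N: "\<And>m n. m \<ge> N \<Longrightarrow> n \<ge> N \<Longrightarrow> E.nrm (\<lambda>x. X m x - X n x) < \<epsilon> * sqrt lmin"
        by blast
      have "H.nrm (\<lambda>x. X m x - X n x) < \<epsilon>" if "m \<ge> N" "n \<ge> N" for m n
      proof -
        have "H.nrm (\<lambda>x. X m x - X n x) \<le> E.nrm (\<lambda>x. X m x - X n x) / sqrt lmin" by (intro H_nrm_le_E H.diff_mem X)
        also have "\<dots> < \<epsilon>" using N[OF that] lmin_pos by (simp add: field_simps)
        finally show ?thesis .
      qed
      then show ?thesis by blast
    qed
    from H10_complete[OF X this] obtain u where u: "u \<in> H10 \<Omega>" "(\<lambda>n. H.nrm (\<lambda>x. X n x - u x)) \<longlonglongrightarrow> 0" by blast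
    have "(\<lambda>n. E.nrm (\<lambda>x. X n x - u x)) \<longlonglongrightarrow> 0"
    proof (rule Lim_null_comparison)
      show "(\<lambda>n. sqrt lmax * H.nrm (\<lambda>x. X n x - u x)) \<longlonglongrightarrow> 0" using tendsto_mult_left[OF u(2), of "sqrt lmax"] by simp
      show "\<forall>\<^sub>F n in sequentially. norm (E.nrm (\<lambda>x. X n x - u x)) \<le> sqrt lmax * H.nrm (\<lambda>x. X n x - u x)"
        using E_nrm_le_H[OF H.diff_mem[OF X u(1)]] E.nrm_nonneg[OF H.diff_mem[OF X u(1)]] by simp
    qed
    then show "\<exists>f\<in>H10 \<Omega>. (\<lambda>n. E.nrm (\<lambda>x. X n x - f x)) \<longlonglongrightarrow> 0" using u(1) by blast
  next
    fix u assume u: "u \<in> H10 \<Omega>"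
    have "\<bar>L2inner \<Omega> f u\<bar> \<le> L2.nrm f * L2.nrm u" by (rule L2.Cauchy_Schwarz[OF f weak_grad_H10(1)[OF u]])
    also have "\<dots> \<le> L2.nrm f * (cP * (E.nrm u / sqrt lmin))"
    proof (rule mult_left_mono[OF _ L2.nrm_nonneg[OF f]])
      have "L2.nrm u \<le> cP * H.nrm u" by (rule Poincare_nrm[OF u])
      also have "\<dots> \<le> cP * (E.nrm u / sqrt lmin)" using cP_pos H_nrm_le_E[OF u] by (intro mult_left_mono) auto
      finally show "L2.nrm u \<le> cP * (E.nrm u / sqrt lmin)" .
    qed
    finally show "\<bar>L2inner \<Omega> f u\<bar> \<le> L2.nrm f * (cP / sqrt lmin) * E.nrm u" by simp
  qed (use weak_grad_H10(1) f in \<open>auto simp: L2.B_add_right L2.B_scale_right simp del: real_scaleR_def\<close>)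
  then have "\<exists>u. is_weak_sol \<Omega> a f u" unfolding is_weak_sol_iff by blast
  then have "is_weak_sol \<Omega> a f (weak_sol \<Omega> a f)" unfolding weak_sol_def by (rule someI_ex)
  then show "weak_sol \<Omega> a f \<in> H10 \<Omega>" "\<phi> \<in> H10 \<Omega> \<Longrightarrow> E (weak_sol \<Omega> a f) \<phi> = L2inner \<Omega> f \<phi>"
    by (auto simp: is_weak_sol_iff)
qed

lemma flux_norm_eq: "flux_norm \<Omega> a \<psi> = L2.nrm (pot \<Omega> (A (weak_grad \<Omega> \<psi>)))"
  by (simp add: flux_norm_def A_def[abs_def] L2norm_eq)

text \<open>One half of the identification of the flux norm with the dual norm of
  \<open>E \<psi>\<close>: against a gradient field the flux may be replaced by its projection, and
  Cauchy-Schwarz applies.\<close>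

lemma flux_norm_ge:
  assumes "\<psi> \<in> H10 \<Omega>" "w \<in> H10 \<Omega>"
  shows "\<bar>E \<psi> w\<bar> \<le> flux_norm \<Omega> a \<psi> * H.nrm w"
proof -
  have k: "A (weak_grad \<Omega> \<psi>) \<in> L2 \<Omega>" by (rule A_L2[OF weak_grad_H10(3)[OF assms(1)]])
  have "E \<psi> w = L2inner \<Omega> (pot \<Omega> (A (weak_grad \<Omega> \<psi>))) (weak_grad \<Omega> w)"
    unfolding E_def by (rule pot_spec(2)[OF k weak_grad_gradient_closure[OF assms(2)], symmetric])
  also have "\<bar>\<dots>\<bar> \<le> L2.nrm (pot \<Omega> (A (weak_grad \<Omega> \<psi>))) * L2.nrm (weak_grad \<Omega> w)"
    by (rule L2.Cauchy_Schwarz[OF gradient_closure_L2[OF pot_spec(1)[OF k]] weak_grad_H10(3)[OF assms(2)]])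
  also have "L2.nrm (weak_grad \<Omega> w) = H.nrm w" by (simp add: L2.nrm_def H.nrm_def D_def)
  finally show ?thesis unfolding flux_norm_eq .
qed

text \<open>The other half. The projection is itself a limit of gradients of test functions, so
  testing with these recovers its norm.\<close>

lemma flux_norm_le:
  assumes \<psi>: "\<psi> \<in> H10 \<Omega>" and bound: "\<And>\<phi>. \<phi> \<in> H10 \<Omega> \<Longrightarrow> E \<psi> \<phi> \<le> C * H.nrm \<phi>" and "0 \<le> C"
  shows "flux_norm \<Omega> a \<psi> \<le> C"
proof -
  have k: "A (weak_grad \<Omega> \<psi>) \<in> L2 \<Omega>" by (rule A_L2[OF weak_grad_H10(3)[OF \<psi>]])
  define p where "p = pot \<Omega> (A (weak_grad \<Omega> \<psi>))"
  have p: "p \<in> gradient_closure \<Omega>" unfolding p_def by (rule pot_spec(1)[OF k])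
  note pL = gradient_closure_L2[OF p]
  have "\<forall>n::nat. \<exists>g. g\<in>test_functions \<Omega> \<and> L2norm \<Omega> (\<lambda>x. p x - grad g x) < inverse (real (Suc n))" (is "\<forall>n. ?P n")
  proof
    fix n :: nat
    have "0 < inverse (real (Suc n))" by simp
    from gradient_closure_approx[OF p this] show "?P n" by blast
  qed
  from choice[OF this] obtain g where g: "\<And>n. g n \<in> test_functions \<Omega>"
    "\<And>n. L2norm \<Omega> (\<lambda>x. p x - grad (g n) x) < inverse (real (Suc n))" by blast
  note gL = test_L2(2)[OF g(1)]
  have lim: "(\<lambda>n. L2.nrm (\<lambda>x. grad (g n) x - p x)) \<longlonglongrightarrow> 0"
  proof (rule Lim_null_comparison[OF _ LIMSEQ_inverse_real_of_nat])
    show "\<forall>\<^sub>F n in sequentially. norm (L2.nrm (\<lambda>x. grad (g n) x - p x)) \<le> inverse (real (Suc n))"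
      using g(2) L2.nrm_diff_commute[OF gL pL] L2.nrm_nonneg[OF L2.diff_mem[OF pL gL]]
      by (auto simp: L2norm_eq L2norm_nonneg intro!: always_eventually less_imp_le)
  qed
  have "L2inner \<Omega> p p \<le> C * L2.nrm p"
  proof (rule LIMSEQ_le)
    show "(\<lambda>n. L2inner \<Omega> (grad (g n)) p) \<longlonglongrightarrow> L2inner \<Omega> p p" by (rule L2.B_tendsto[OF gL pL lim pL])
    show "(\<lambda>n. C * L2.nrm (grad (g n))) \<longlonglongrightarrow> C * L2.nrm p"
      by (intro tendsto_mult_left L2.nrm_tendsto[OF gL pL lim])
    have "L2inner \<Omega> (grad (g n)) p \<le> C * L2.nrm (grad (g n))" for n
    proof -
      note gH = test_H10[OF g(1)[of n]]
      have "L2inner \<Omega> (grad (g n)) p = L2inner \<Omega> p (grad (g n))" by (rule L2.B_commute[OF gL pL])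
      also have "\<dots> = L2inner \<Omega> (A (weak_grad \<Omega> \<psi>)) (grad (g n))"
        unfolding p_def by (rule pot_spec(2)[OF k grad_gradient_closure[OF g(1)]])
      also have "\<dots> = E \<psi> (g n)" unfolding E_def
      proof (rule L2inner_cong_AE)
        show "AE x in M. grad (g n) x = weak_grad \<Omega> (g n) x" using weak_grad_test_AE[OF g(1)[of n]] by eventually_elim simp
      qed (use L2_measurable k gL weak_grad_H10(3)[OF gH] in auto)
      also have "\<dots> \<le> C * H.nrm (g n)" by (rule bound[OF gH])
      also have "H.nrm (g n) = L2.nrm (grad (g n))" by (simp add: H.nrm_def L2.nrm_def D_test[OF g(1)])
      finally show ?thesis .
    qed
    then show "\<exists>N. \<forall>n\<ge>N. L2inner \<Omega> (grad (g n)) p \<le> C * L2.nrm (grad (g n))" by blast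
  qed
  then have "L2.nrm p * L2.nrm p \<le> C * L2.nrm p" using L2.nrm_sq[OF pL] by (simp add: power2_eq_square)
  then have "L2.nrm p \<le> C"
    using L2.nrm_nonneg[OF pL] assms(3) by (cases "L2.nrm p = 0") (auto simp: mult_le_cancel_right)
  then show ?thesis unfolding flux_norm_eq p_def .
qed

lemma \<theta>_H10: "k \<ge> 1 \<Longrightarrow> \<theta> k \<in> H10 \<Omega>"
  using \<theta> by (simp add: is_weak_sol_iff)

lemma E_\<theta>: "k \<ge> 1 \<Longrightarrow> \<phi> \<in> H10 \<Omega> \<Longrightarrow> E (\<theta> k) \<phi> = lam k * L2inner \<Omega> (\<Psi> k) \<phi>"
  using \<theta>[of k] L2.B_scale_left[OF \<Psi>_L2 weak_grad_H10(1), of k \<phi> "lam k"] by (simp add: is_weak_sol_iff)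

section \<open>The Kolmogorov width\<close>

text \<open>Members of \<open>L2_span\<close> equal combinations of the basis only almost
  everywhere; this lets the energy form see the combination.\<close>

lemma E_cong_AE:
  assumes "u \<in> H10 \<Omega>" "v \<in> H10 \<Omega>" "w \<in> H10 \<Omega>" "AE x in M. u x = v x"
  shows "E w u = E w v"
  unfolding E_def
proof (rule L2inner_cong_AE)
  show "AE x in M. weak_grad \<Omega> u x = weak_grad \<Omega> v x"
    by (rule is_weak_grad_unique[OF weak_grad_H10(2)[OF assms(1)] weak_grad_H10(2)[OF assms(2)]])
      (use weak_grad_H10(1) assms in auto)
qed (use L2_measurable A_L2 weak_grad_H10(3) assms in auto)

lemma basis_mem_L2_span:
  assumes "\<And>k. k \<in> {1..N} \<Longrightarrow> v k \<in> L2 \<Omega>" "j \<in> {1..N}"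
  shows "v j \<in> L2_span \<Omega> v N"
proof -
  have "(\<Sum>k=1..N. (if k = j then 1 else 0) * v k x) = v j x" for x
    using assms(2) by (simp add: if_distrib[of "\<lambda>c. c * _"] cong: if_cong)
  then show ?thesis using assms unfolding L2_span_def ae_zero_def
    by (auto intro!: exI[of _ "\<lambda>k. if k = j then 1 else 0"])
qed

text \<open>A combination \<open>f\<close> of \<open>\<Psi>\<^sub>1, \<dots>, \<Psi>\<^bsub>N+1\<^esub>\<close> is chosen such that the solution \<open>w\<close> of
  \<open>-\<Delta>w = f\<close> is \<open>E\<close>-orthogonal to \<open>V\<close>.\<close>

theorem width_lower:
  assumes V: "V \<in> H10_subspaces \<Omega> N"
  shows "\<exists>f\<in>L2 \<Omega>. \<not> ae_zero \<Omega> f \<and> (\<forall>v\<in>V. L2norm \<Omega> f / sqrt (lam (Suc N)) \<le> flux_norm \<Omega> a (\<lambda>x. weak_sol \<Omega> a f x - v x))"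
proof -
  obtain v where v: "\<And>k. k \<in> {1..N} \<Longrightarrow> v k \<in> L2 \<Omega>" "V = L2_span \<Omega> v N" and VH: "V \<subseteq> H10 \<Omega>"
    using V unfolding H10_subspaces_def has_dim_def by blast
  have vH: "v k \<in> H10 \<Omega>" if "k \<in> {1..N}" for k using basis_mem_L2_span[of N v k] v VH that by auto
  let ?I = "{1..Suc N}"
  \<comment> \<open>N conditions on N+1 coefficients; they state that the combination of the
    \<open>\<Psi> i\<close> with coefficients \<open>c i / lam i\<close> is energy-orthogonal to a
    basis of \<open>V\<close>.\<close>
  have "\<exists>c. (\<exists>i\<in>?I. c i \<noteq> 0) \<and> (\<forall>j\<in>{1..N}. (\<Sum>i\<in>?I. (E (\<Psi> i) (v j) / lam i) * c i) = 0)"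
    by (rule homogeneous_system_nontrivial) auto
  then obtain c where c: "\<exists>i\<in>?I. c i \<noteq> 0" "\<And>j. j \<in> {1..N} \<Longrightarrow> (\<Sum>i\<in>?I. (E (\<Psi> i) (v j) / lam i) * c i) = 0"
    by blast
  define f where "f x = (\<Sum>i\<in>?I. c i *\<^sub>R \<Psi> i x)" for x
  define w where "w x = (\<Sum>i\<in>?I. (c i / lam i) *\<^sub>R \<Psi> i x)" for x
  have lp: "0 < lam i" if "i \<in> ?I" for i using that lam_pos by auto
  have fH: "f \<in> H10 \<Omega>" unfolding f_def[abs_def] by (rule H.lincomb_mem) (auto intro: \<Psi>_H10)
  have wH: "w \<in> H10 \<Omega>" unfolding w_def[abs_def] by (rule H.lincomb_mem) (auto intro: \<Psi>_H10)
  note fL = weak_grad_H10(1)[OF fH] and wL = weak_grad_H10(1)[OF wH]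
  have Ewv: "E w (v j) = 0" if "j \<in> {1..N}" for j
  proof -
    have "E w (v j) = (\<Sum>i\<in>?I. c i / lam i * E (\<Psi> i) (v j))"
      unfolding w_def[abs_def] by (rule E.B_lincomb_left) (auto intro: \<Psi>_H10 vH that)
    also have "\<dots> = (\<Sum>i\<in>?I. (E (\<Psi> i) (v j) / lam i) * c i)" by (intro sum.cong refl) simp
    finally show ?thesis using c(2)[OF that] by simp
  qed
  have EwV: "E u w = 0" if u: "u \<in> V" for u
  proof -
    obtain b where b: "AE x in M. u x = (\<Sum>k=1..N. b k *\<^sub>R v k x)" using L2_spanD(2) u unfolding v(2) by fastforce
    have sH: "(\<lambda>x. \<Sum>k=1..N. b k *\<^sub>R v k x) \<in> H10 \<Omega>" by (rule H.lincomb_mem[OF vH])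
    have uH: "u \<in> H10 \<Omega>" using u VH by blast
    have "E u w = E w u" by (rule E.B_commute[OF uH wH])
    also have "\<dots> = E w (\<lambda>x. \<Sum>k=1..N. b k *\<^sub>R v k x)" by (rule E_cong_AE[OF uH sH wH b])
    also have "\<dots> = (\<Sum>k=1..N. b k * E w (v k))" by (rule E.B_lincomb_right[OF vH wH])
    also have "\<dots> = 0" using Ewv by (intro sum.neutral) auto
    finally show ?thesis .
  qed
  have ff: "L2inner \<Omega> f f = (\<Sum>i\<in>?I. (c i)\<^sup>2)"
    unfolding f_def[abs_def] using L2.lincomb_orthonormal_self[of ?I \<Psi> "\<lambda>_. 1" c c]
    by (simp add: \<Psi>_L2 \<Psi>_orthonormal power2_eq_square)
  have fw: "L2inner \<Omega> f w = (\<Sum>i\<in>?I. (c i)\<^sup>2 / lam i)"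
    unfolding f_def[abs_def] w_def[abs_def] using L2.lincomb_orthonormal_self[of ?I \<Psi> "\<lambda>_. 1" c "\<lambda>i. c i / lam i"]
    by (simp add: \<Psi>_L2 \<Psi>_orthonormal power2_eq_square)
  have Dww: "D w w = (\<Sum>i\<in>?I. (c i)\<^sup>2 / lam i)"
  proof -
    have "D w w = (\<Sum>i\<in>?I. c i / lam i * (c i / lam i) * lam i)"
      unfolding w_def[abs_def] by (rule H.lincomb_orthonormal_self) (auto simp: \<Psi>_H10 D_\<Psi> \<Psi>_orthonormal)
    also have "\<dots> = (\<Sum>i\<in>?I. (c i)\<^sup>2 / lam i)"
      using lp by (intro sum.cong refl) (auto simp: power2_eq_square field_simps)
    finally show ?thesis .
  qed
  \<comment> \<open>The indices stop at N+1, so every weight \<open>1 / lam i\<close> is at least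
    \<open>1 / lam (Suc N)\<close>.\<close>
  have ge: "L2inner \<Omega> f f / lam (Suc N) \<le> D w w"
    unfolding ff Dww sum_divide_distrib
  proof (rule sum_mono)
    fix i assume i: "i \<in> ?I"
    then have "lam i \<le> lam (Suc N)" by (intro lam_mono) auto
    then show "(c i)\<^sup>2 / lam (Suc N) \<le> (c i)\<^sup>2 / lam i" using lp[OF i] by (intro divide_left_mono) auto
  qed
  have fpos: "0 < L2inner \<Omega> f f"
  proof -
    obtain i where "i \<in> ?I" "c i \<noteq> 0" using c(1) by blast
    then show ?thesis unfolding ff by (intro sum_pos2[of ?I i]) auto
  qed
  have "\<not> ae_zero \<Omega> f"
  proof
    assume "ae_zero \<Omega> f"
    then have "L2inner \<Omega> f f = 0" unfolding ae_zero_def by (rule L2_eq_zero_of_AE[OF fL fL])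
    then show False using fpos by simp
  qed
  moreover have "L2norm \<Omega> f / sqrt (lam (Suc N)) \<le> flux_norm \<Omega> a (\<lambda>x. weak_sol \<Omega> a f x - u x)" if u: "u \<in> V" for u
  proof -
    have uH: "u \<in> H10 \<Omega>" using u VH by blast
    \<comment> \<open>The element of \<open>V\<close> drops out by orthogonality. What remains
      equals the Dirichlet energy of \<open>w\<close>, so dividing by the norm of \<open>w\<close>
      bounds the flux norm from below.\<close>
    have "E (\<lambda>x. weak_sol \<Omega> a f x - u x) w = L2inner \<Omega> f w"
      using EwV[OF u] by (simp add: E.B_diff_left weak_sol[OF fL] uH wH)
    then have "D w w \<le> flux_norm \<Omega> a (\<lambda>x. weak_sol \<Omega> a f x - u x) * H.nrm w"
      using flux_norm_ge[OF H.diff_mem[OF weak_sol(1)[OF fL] uH] wH] by (simp add: fw Dww)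
    moreover have "D w w = H.nrm w * H.nrm w" using H.nrm_sq[OF wH] by (simp add: power2_eq_square)
    moreover have "0 < H.nrm w"
    proof -
      have "0 < L2inner \<Omega> f f / lam (Suc N)" using fpos lp[of "Suc N"] by simp
      then have "0 < D w w" using ge by linarith
      then show ?thesis by (simp add: H.nrm_def)
    qed
    ultimately have "H.nrm w \<le> flux_norm \<Omega> a (\<lambda>x. weak_sol \<Omega> a f x - u x)"
      by (metis mult_right_le_imp_le)
    moreover have "L2norm \<Omega> f / sqrt (lam (Suc N)) \<le> H.nrm w"
      using real_sqrt_le_mono[OF ge] by (simp add: L2norm_eq[symmetric] L2.nrm_def H.nrm_def real_sqrt_divide)
    ultimately show ?thesis by linarith
  qed
  ultimately show ?thesis using fL by blast
qed

text \<open>With these coefficients \<open>v\<close> solves the equation for the projected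
  right-hand side, so the error is driven by \<open>g\<close>, orthogonal to the first N
  eigenfunctions. Pairing with \<open>g\<close> sees only the remainder \<open>r\<close> of a test
  element, and the Rayleigh bound controls \<open>r\<close> by its gradient.\<close>

theorem width_upper:
  assumes f: "f \<in> L2 \<Omega>"
  shows "\<exists>v\<in>L2_span \<Omega> \<theta> N. flux_norm \<Omega> a (\<lambda>x. weak_sol \<Omega> a f x - v x) \<le> L2norm \<Omega> f / sqrt (lam (Suc N))"
proof -
  define v where "v x = (\<Sum>k=1..N. (L2inner \<Omega> f (\<Psi> k) / lam k) *\<^sub>R \<theta> k x)" for x
  have vH: "v \<in> H10 \<Omega>" unfolding v_def[abs_def] by (rule H.lincomb_mem) (auto intro: \<theta>_H10)
  have vs: "v \<in> L2_span \<Omega> \<theta> N"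
    unfolding L2_span_def ae_zero_def using weak_grad_H10(1)[OF vH]
    by (auto simp: v_def intro!: exI[of _ "\<lambda>k. L2inner \<Omega> f (\<Psi> k) / lam k"])
  define g where "g x = f x - proj N f x" for x
  have gL: "g \<in> L2 \<Omega>" unfolding g_def[abs_def] by (intro L2.diff_mem f proj_L2)
  have go: "L2inner \<Omega> g (\<Psi> k) = 0" if "k \<in> {1..N}" for k unfolding g_def[abs_def] by (rule diff_proj_orthogonal[OF f that])
  have gp: "L2inner \<Omega> g (proj N h) = 0" for h
  proof -
    have "L2inner \<Omega> g (proj N h) = (\<Sum>k=1..N. L2inner \<Omega> h (\<Psi> k) * L2inner \<Omega> g (\<Psi> k))"
      unfolding proj_def[abs_def] by (rule L2.B_lincomb_right) (auto intro: \<Psi>_L2 gL)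
    then show ?thesis using go by simp
  qed
  have g_le: "L2.nrm g \<le> L2.nrm f"
  proof -
    have fg: "f = (\<lambda>x. g x + proj N f x)" by (simp add: g_def fun_eq_iff)
    have "L2inner \<Omega> f f = L2inner \<Omega> g g + L2inner \<Omega> (proj N f) (proj N f)"
      using L2.B_add_self[OF gL proj_L2, of N f] gp[of f] by (simp flip: fg)
    then show ?thesis using L2.B_nonneg[OF proj_L2[of N f]] by (simp add: L2.nrm_def)
  qed
  have lp: "0 < lam (Suc N)" by (rule lam_pos) simp
  let ?\<psi> = "\<lambda>x. weak_sol \<Omega> a f x - v x"
  have "flux_norm \<Omega> a ?\<psi> \<le> L2.nrm f / sqrt (lam (Suc N))"
  proof (rule flux_norm_le)
    show "?\<psi> \<in> H10 \<Omega>" by (intro H.diff_mem weak_sol f vH)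
    show "0 \<le> L2.nrm f / sqrt (lam (Suc N))" using lp L2.nrm_nonneg[OF f] by simp
    fix \<phi> assume \<phi>: "\<phi> \<in> H10 \<Omega>"
    note \<phi>L = weak_grad_H10(1)[OF \<phi>]
    define r where "r x = \<phi> x - proj N \<phi> x" for x
    have rH: "r \<in> H10 \<Omega>" unfolding r_def[abs_def] by (intro H.diff_mem \<phi> proj_H10)
    note rL = weak_grad_H10(1)[OF rH]
    have ro: "L2inner \<Omega> r (\<Psi> k) = 0" if "k \<in> {1..N}" for k unfolding r_def[abs_def] by (rule diff_proj_orthogonal[OF \<phi>L that])
    have "E v \<phi> = (\<Sum>k=1..N. L2inner \<Omega> f (\<Psi> k) / lam k * E (\<theta> k) \<phi>)"
      unfolding v_def[abs_def] by (rule E.B_lincomb_left) (auto intro: \<theta>_H10 \<phi>)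
    also have "\<dots> = (\<Sum>k=1..N. L2inner \<Omega> f (\<Psi> k) * L2inner \<Omega> (\<Psi> k) \<phi>)"
      using lam_pos by (intro sum.cong refl) (auto simp: E_\<theta> \<phi> less_imp_neq[symmetric])
    also have "\<dots> = L2inner \<Omega> (proj N f) \<phi>"
      unfolding proj_def[abs_def] by (rule L2.B_lincomb_left[symmetric]) (auto intro: \<Psi>_L2 \<phi>L)
    finally have "E ?\<psi> \<phi> = L2inner \<Omega> g \<phi>"
      unfolding g_def[abs_def] by (simp add: E.B_diff_left L2.B_diff_left weak_sol[OF f] vH \<phi> \<phi>L f proj_L2)
    also have "\<dots> = L2inner \<Omega> g r"
      unfolding r_def[abs_def] by (simp add: L2.B_diff_right gL \<phi>L proj_L2 gp)
    also have "\<dots> \<le> L2.nrm g * L2.nrm r" using L2.Cauchy_Schwarz[OF gL rL] by linarith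
    also have "\<dots> \<le> L2.nrm f * (H.nrm \<phi> / sqrt (lam (Suc N)))"
    proof (rule mult_mono[OF g_le])
      have "L2inner \<Omega> r r \<le> D r r / lam (Suc N)" using Rayleigh[OF rH ro] lp by (simp add: field_simps)
      from real_sqrt_le_mono[OF this] have "L2.nrm r \<le> H.nrm r / sqrt (lam (Suc N))"
        by (simp add: L2.nrm_def H.nrm_def real_sqrt_divide)
      also have "H.nrm r \<le> H.nrm \<phi>"
      proof -
        have s: "\<phi> = (\<lambda>x. r x + proj N \<phi> x)" by (simp add: r_def fun_eq_iff)
        have "D \<phi> \<phi> = D r r + D (proj N \<phi>) (proj N \<phi>)"
          using H.B_add_self[OF rH proj_H10, of N \<phi>] D_orthogonal_proj(1)[OF rH ro, where f = \<phi>] by (simp flip: s)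
        then show ?thesis using H.B_nonneg[OF proj_H10[of N \<phi>]] by (simp add: H.nrm_def)
      qed
      finally show "L2.nrm r \<le> H.nrm \<phi> / sqrt (lam (Suc N))" using lp by (simp add: divide_right_mono)
    qed (use L2.nrm_nonneg rL f in auto)
    finally show "E ?\<psi> \<phi> \<le> L2.nrm f / sqrt (lam (Suc N)) * H.nrm \<phi>" by simp
  qed
  then show ?thesis using vs by (auto simp: L2norm_eq)
qed

text \<open>The energy form pairs \<open>\<theta> k\<close> with \<open>\<Psi> j\<close> diagonally
  with the positive weights \<open>lam k\<close>, which gives linear independence.\<close>

lemma span_\<theta>_subspace: "L2_span \<Omega> \<theta> N \<in> H10_subspaces \<Omega> N"
proof -
  have L: "\<theta> k \<in> L2 \<Omega>" if "k \<in> {1..N}" for k using that weak_grad_H10(1)[OF \<theta>_H10] by simp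
  have comb: "(\<lambda>x. \<Sum>k=1..N. c k *\<^sub>R \<theta> k x) \<in> H10 \<Omega>" for c
    by (rule H.lincomb_mem) (auto intro: \<theta>_H10)
  have "w \<in> H10 \<Omega>" if w: "w \<in> L2_span \<Omega> \<theta> N" for w
  proof -
    obtain c where "AE x in M. w x = (\<Sum>k=1..N. c k * \<theta> k x)" using L2_spanD(2)[OF w] by blast
    then have "AE x in M. (\<Sum>k=1..N. c k *\<^sub>R \<theta> k x) = w x" by eventually_elim simp
    then show ?thesis by (rule H10_cong_AE[OF comb L2_measurable[OF L2_spanD(1)[OF w]]])
  qed
  moreover have "c j = 0" if z: "ae_zero \<Omega> (\<lambda>x. \<Sum>k=1..N. c k * \<theta> k x)" and j: "j \<in> {1..N}" for c j
  proof -
    have j1: "j \<ge> 1" using j by simp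
    have "E (\<Psi> j) (\<lambda>x. \<Sum>k=1..N. c k *\<^sub>R \<theta> k x) = E (\<Psi> j) (\<lambda>x. 0)"
      by (rule E_cong_AE[OF comb zero_H10 \<Psi>_H10[OF j1]]) (use z in \<open>simp add: ae_zero_def\<close>)
    also have "\<dots> = 0" using E.B_commute[OF \<Psi>_H10[OF j1] zero_H10] E.B_zero_left[OF \<Psi>_H10[OF j1]] by simp
    also have "E (\<Psi> j) (\<lambda>x. \<Sum>k=1..N. c k *\<^sub>R \<theta> k x) = E (\<lambda>x. \<Sum>k=1..N. c k *\<^sub>R \<theta> k x) (\<Psi> j)"
      by (rule E.B_commute[OF \<Psi>_H10[OF j1] comb])
    also have "\<dots> = (\<Sum>k=1..N. c k * E (\<theta> k) (\<Psi> j))"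
      by (rule E.B_lincomb_left) (auto intro: \<theta>_H10 \<Psi>_H10[OF j1])
    also have "\<dots> = (\<Sum>k=1..N. if k = j then c j * lam j else 0)"
      using j1 by (intro sum.cong refl) (auto simp: E_\<theta> \<Psi>_H10 \<Psi>_orthonormal)
    also have "\<dots> = c j * lam j" using j by simp
    finally show ?thesis using lam_pos[OF j1] by simp
  qed
  ultimately show ?thesis unfolding H10_subspaces_def has_dim_def using L by blast
qed

text \<open>The factor \<open>s\<close> covers both normalisations of the width:
  \<open>s = h\<close> for the limit in h and \<open>s = 1\<close> for the infimum over
  subspaces.\<close>

lemma SUP_INF_lower:
  assumes "V \<in> H10_subspaces \<Omega> N" "0 < s"
  shows "ereal (1 / (s * sqrt (lam (Suc N)))) \<le> (SUP f\<in>{f \<in> L2 \<Omega>. \<not> ae_zero \<Omega> f}. INF v\<in>V.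
    ereal (flux_norm \<Omega> a (\<lambda>x. weak_sol \<Omega> a f x - v x) / (s * L2norm \<Omega> f)))"
proof -
  obtain f where f: "f \<in> L2 \<Omega>" "\<not> ae_zero \<Omega> f"
    "\<And>v. v \<in> V \<Longrightarrow> L2norm \<Omega> f / sqrt (lam (Suc N)) \<le> flux_norm \<Omega> a (\<lambda>x. weak_sol \<Omega> a f x - v x)"
    using width_lower[OF assms(1)] by blast
  have pos: "0 < L2norm \<Omega> f" using f(1,2) L2norm_eq_0_iff[OF f(1)] L2norm_nonneg[of f] by (simp add: ae_zero_def)
  have "ereal (1 / (s * sqrt (lam (Suc N)))) \<le> (INF v\<in>V. ereal (flux_norm \<Omega> a (\<lambda>x. weak_sol \<Omega> a f x - v x) / (s * L2norm \<Omega> f)))"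
  proof (rule INF_greatest)
    fix v assume v: "v \<in> V"
    have "1 / (s * sqrt (lam (Suc N))) = L2norm \<Omega> f / sqrt (lam (Suc N)) / (s * L2norm \<Omega> f)" using pos by simp
    also have "\<dots> \<le> flux_norm \<Omega> a (\<lambda>x. weak_sol \<Omega> a f x - v x) / (s * L2norm \<Omega> f)"
      using f(3)[OF v] pos assms(2) by (intro divide_right_mono) auto
    finally show "ereal (1 / (s * sqrt (lam (Suc N)))) \<le> ereal (flux_norm \<Omega> a (\<lambda>x. weak_sol \<Omega> a f x - v x) / (s * L2norm \<Omega> f))" by simp
  qed
  also have "\<dots> \<le> (SUP f\<in>{f \<in> L2 \<Omega>. \<not> ae_zero \<Omega> f}. INF v\<in>V. ereal (flux_norm \<Omega> a (\<lambda>x. weak_sol \<Omega> a f x - v x) / (s * L2norm \<Omega> f)))"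
    by (rule SUP_upper) (use f in simp)
  finally show ?thesis .
qed

lemma SUP_INF_\<theta>:
  assumes "0 < s"
  shows "(SUP f\<in>{f \<in> L2 \<Omega>. \<not> ae_zero \<Omega> f}. INF v\<in>L2_span \<Omega> \<theta> N.
    ereal (flux_norm \<Omega> a (\<lambda>x. weak_sol \<Omega> a f x - v x) / (s * L2norm \<Omega> f))) = ereal (1 / (s * sqrt (lam (Suc N))))"
proof (rule antisym)
  show "(SUP f\<in>{f \<in> L2 \<Omega>. \<not> ae_zero \<Omega> f}. INF v\<in>L2_span \<Omega> \<theta> N.
    ereal (flux_norm \<Omega> a (\<lambda>x. weak_sol \<Omega> a f x - v x) / (s * L2norm \<Omega> f))) \<le> ereal (1 / (s * sqrt (lam (Suc N))))"
  proof (rule SUP_least)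
    fix f assume "f \<in> {f \<in> L2 \<Omega>. \<not> ae_zero \<Omega> f}"
    then have f: "f \<in> L2 \<Omega>" "\<not> ae_zero \<Omega> f" by auto
    have pos: "0 < L2norm \<Omega> f" using f L2norm_eq_0_iff[OF f(1)] L2norm_nonneg[of f] by (simp add: ae_zero_def)
    obtain v where v: "v \<in> L2_span \<Omega> \<theta> N" "flux_norm \<Omega> a (\<lambda>x. weak_sol \<Omega> a f x - v x) \<le> L2norm \<Omega> f / sqrt (lam (Suc N))"
      using width_upper[OF f(1)] by blast
    have "(INF v\<in>L2_span \<Omega> \<theta> N. ereal (flux_norm \<Omega> a (\<lambda>x. weak_sol \<Omega> a f x - v x) / (s * L2norm \<Omega> f)))
      \<le> ereal (flux_norm \<Omega> a (\<lambda>x. weak_sol \<Omega> a f x - v x) / (s * L2norm \<Omega> f))" by (rule INF_lower[OF v(1)])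
    also have "flux_norm \<Omega> a (\<lambda>x. weak_sol \<Omega> a f x - v x) / (s * L2norm \<Omega> f) \<le> L2norm \<Omega> f / sqrt (lam (Suc N)) / (s * L2norm \<Omega> f)"
      using v(2) pos assms by (intro divide_right_mono) auto
    also have "\<dots> = 1 / (s * sqrt (lam (Suc N)))" using pos by simp
    finally show "(INF v\<in>L2_span \<Omega> \<theta> N. ereal (flux_norm \<Omega> a (\<lambda>x. weak_sol \<Omega> a f x - v x) / (s * L2norm \<Omega> f)))
      \<le> ereal (1 / (s * sqrt (lam (Suc N))))" by simp
  qed
qed (rule SUP_INF_lower[OF span_\<theta>_subspace assms])

end

section \<open>Asymptotics\<close>

context eigensystem begin

text \<open>The unit ball contributes the root sqrt pi, and sqrt pi / (2 pi) = 1 / (2 sqrt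
  pi).\<close>

lemma W_root:
  "W powr (1 / d\<^sub>n) = 1 / (2 * sqrt pi) * (measure lebesgue \<Omega> / Gamma (1 + d\<^sub>n / 2)) powr (1 / d\<^sub>n)"
proof -
  have d: "0 < d\<^sub>n" by (simp add: d\<^sub>n_def)
  have G: "0 < Gamma (1 + d\<^sub>n / 2)" using d by (intro Gamma_real_pos) simp
  have "W = (measure lebesgue \<Omega> / Gamma (1 + d\<^sub>n / 2)) * (pi powr (d\<^sub>n / 2) / (2 * pi) powr d\<^sub>n)"
    by (simp add: W_def unit_ball_vol_def d\<^sub>n_def powr_realpow add.commute)
  then have "W powr (1 / d\<^sub>n) = (measure lebesgue \<Omega> / Gamma (1 + d\<^sub>n / 2)) powr (1 / d\<^sub>n) * (pi powr (1 / 2) / (2 * pi))"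
    using G d by (simp add: powr_mult powr_divide powr_powr)
  also have "pi powr (1 / 2) / (2 * pi) = 1 / (2 * sqrt pi)"
    by (simp add: powr_half_sqrt field_simps)
  finally show ?thesis by (simp add: mult.commute)
qed

lemma measure_\<Omega>_pos: "\<Omega> \<noteq> {} \<Longrightarrow> 0 < measure lebesgue \<Omega>"
  using open_not_negligible[OF open_\<Omega>] \<Omega>_lmeasurable measure_nonneg[of lebesgue \<Omega>]
  by (simp add: negligible_iff_measure0 less_le)

text \<open>The d-th root of Weyl's law; it can be taken in the limit because \<open>W\<close> is
  positive for a non-empty set.\<close>

lemma sqrt_lam_asymptotics:
  assumes "\<Omega> \<noteq> {}"
  shows "(\<lambda>N. real N powr (1 / d\<^sub>n) / sqrt (lam (Suc N))) \<longlonglongrightarrow> W powr (1 / d\<^sub>n)"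
proof -
  have d: "0 < d\<^sub>n" by (simp add: d\<^sub>n_def)
  have "W > 0" using measure_\<Omega>_pos[OF assms] d by (simp add: W_def)
  then have "(\<lambda>N. (real N / lam (Suc N) powr (d\<^sub>n / 2)) powr (1 / d\<^sub>n)) \<longlonglongrightarrow> W powr (1 / d\<^sub>n)"
    by (intro tendsto_powr Weyl_law tendsto_const) simp
  moreover have "(real N / lam (Suc N) powr (d\<^sub>n / 2)) powr (1 / d\<^sub>n) = real N powr (1 / d\<^sub>n) / sqrt (lam (Suc N))" for N
    using lam_pos[of "Suc N"] d by (simp add: powr_divide powr_powr powr_half_sqrt)
  ultimately show ?thesis by simp
qed

text \<open>The expression is the quotient of the previous asymptotics along \<open>Nh h\<close> by
  the d-th root of \<open>Nh h\<close> times h to the power d. Rounding down changes that product by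
  at most h to the power d, so it tends to the volume.\<close>

lemma width_ratio_tendsto:
  fixes Nh :: "real \<Rightarrow> nat"
  assumes "\<Omega> \<noteq> {}"
  defines "Nh \<equiv> \<lambda>h. nat \<lfloor>measure lebesgue \<Omega> / h ^ CARD('n)\<rfloor>"
  shows "((\<lambda>h. 1 / (h * sqrt (lam (Suc (Nh h)))))
    \<longlongrightarrow> 1 / (2 * sqrt pi) * (1 / Gamma (1 + d\<^sub>n / 2)) powr (1 / d\<^sub>n)) (at_right 0)"
proof -
  define V where "V = measure lebesgue \<Omega>"
  have V: "0 < V" unfolding V_def by (rule measure_\<Omega>_pos[OF assms(1)])
  have d: "0 < d\<^sub>n" by (simp add: d\<^sub>n_def)
  have hn0: "((\<lambda>h::real. h ^ CARD('n)) \<longlongrightarrow> 0) (at_right 0)"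
    by (auto intro!: tendsto_eq_intros simp: power_0_left)
  have hn: "filterlim (\<lambda>h::real. h ^ CARD('n)) (at_right 0) (at_right 0)"
    unfolding filterlim_at using hn0 by (auto simp: eventually_at_right_field intro!: exI[of _ 1])
  have "filterlim (\<lambda>h. V * inverse (h ^ CARD('n))) at_top (at_right 0)"
    by (rule filterlim_tendsto_pos_mult_at_top[OF tendsto_const V filterlim_compose[OF filterlim_inverse_at_top_right hn]])
  then have Vh: "filterlim (\<lambda>h. V / h ^ CARD('n)) at_top (at_right 0)" by (simp add: divide_inverse)
  have Nh_top: "filterlim Nh sequentially (at_right 0)"
    unfolding filterlim_at_top
  proof
    fix Z :: nat
    have "\<forall>\<^sub>F h in at_right 0. real Z \<le> V / h ^ CARD('n)" using Vh by (simp add: filterlim_at_top)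
    then show "\<forall>\<^sub>F h in at_right 0. Z \<le> Nh h"
      by eventually_elim (simp add: Nh_def V_def le_nat_floor)
  qed
  have ev: "\<forall>\<^sub>F h in at_right 0. 0 < (h::real)" by (simp add: eventually_at_right_less)
  have prod: "((\<lambda>h. real (Nh h) * h ^ CARD('n)) \<longlongrightarrow> V) (at_right 0)"
  proof (rule tendsto_sandwich[OF _ _ _ tendsto_const])
    show "((\<lambda>h. V - h ^ CARD('n)) \<longlongrightarrow> V) (at_right 0)" using tendsto_diff[OF tendsto_const hn0, of V] by simp
    have b: "V / h ^ CARD('n) - 1 \<le> real (Nh h) \<and> real (Nh h) \<le> V / h ^ CARD('n)" if "0 < h" for h
    proof -
      have "0 \<le> V / h ^ CARD('n)" using V that by simp
      then show ?thesis unfolding Nh_def V_def[symmetric] by linarith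
    qed
    show "\<forall>\<^sub>F h in at_right 0. V - h ^ CARD('n) \<le> real (Nh h) * h ^ CARD('n)"
      using ev
    proof eventually_elim
      case (elim h)
      then show ?case using mult_right_mono[OF conjunct1[OF b[OF elim]], of "h ^ CARD('n)"] by (simp add: left_diff_distrib)
    qed
    show "\<forall>\<^sub>F h in at_right 0. real (Nh h) * h ^ CARD('n) \<le> V"
      using ev
    proof eventually_elim
      case (elim h)
      then show ?case using mult_right_mono[OF conjunct2[OF b[OF elim]], of "h ^ CARD('n)"] by simp
    qed
  qed
  have prod_root: "((\<lambda>h. (real (Nh h) * h ^ CARD('n)) powr (1 / d\<^sub>n)) \<longlongrightarrow> V powr (1 / d\<^sub>n)) (at_right 0)"
    using V by (intro tendsto_powr prod tendsto_const) simp
  have "((\<lambda>h. (real (Nh h) powr (1 / d\<^sub>n) / sqrt (lam (Suc (Nh h)))) / (real (Nh h) * h ^ CARD('n)) powr (1 / d\<^sub>n))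
    \<longlongrightarrow> W powr (1 / d\<^sub>n) / V powr (1 / d\<^sub>n)) (at_right 0)"
    using V by (intro tendsto_divide filterlim_compose[OF sqrt_lam_asymptotics[OF assms(1)] Nh_top] prod_root) simp
  moreover have "W powr (1 / d\<^sub>n) / V powr (1 / d\<^sub>n) = 1 / (2 * sqrt pi) * (1 / Gamma (1 + d\<^sub>n / 2)) powr (1 / d\<^sub>n)"
  proof -
    have "0 < Gamma (1 + d\<^sub>n / 2)" using d by (intro Gamma_real_pos) simp
    then show ?thesis unfolding W_root V_def[symmetric] using V by (simp add: powr_divide)
  qed
  \<comment> \<open>\<open>Nh h\<close> must be at least 1 for its root to cancel, hence an identity
    for small h only.\<close>
  moreover have "\<forall>\<^sub>F h in at_right 0. (real (Nh h) powr (1 / d\<^sub>n) / sqrt (lam (Suc (Nh h)))) / (real (Nh h) * h ^ CARD('n)) powr (1 / d\<^sub>n)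
      = 1 / (h * sqrt (lam (Suc (Nh h))))"
    using ev Nh_top[unfolded filterlim_at_top, rule_format, of 1]
  proof eventually_elim
    case (elim h)
    have "(h ^ CARD('n)) powr (1 / d\<^sub>n) = h"
      using elim by (simp add: d\<^sub>n_def powr_powr flip: powr_realpow)
    then show ?case using elim by (simp add: powr_mult field_simps)
  qed
  ultimately show ?thesis by (simp add: tendsto_cong)
qed

end

lemma small_torus_exists:
  fixes \<Omega> :: "(real^'n) set"
  assumes "open \<Omega>" "bounded \<Omega>"
  shows "\<exists>\<tau>. small_boxed_open \<Omega> \<tau>"
proof -
  obtain R where R: "0 < R" "\<And>x. x \<in> \<Omega> \<Longrightarrow> norm x \<le> R" using assms(2) by (auto simp: bounded_pos)
  define V where "V = measure lebesgue \<Omega>"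
  have V: "0 \<le> V" by (simp add: V_def)
  \<comment> \<open>The first bound puts \<Omega> inside the cube. The second makes \<kappa> at most
    1 / (2V + 1), hence \<kappa>V at most 1/2.\<close>
  define \<tau> where "\<tau> = min (pi / (R + 1)) (2 * pi / (2 * V + 1))"
  have \<tau>: "0 < \<tau>" using R V by (simp add: \<tau>_def)
  have R\<tau>: "R < pi / \<tau>"
  proof -
    have "\<tau> \<le> pi / (R + 1)" by (simp add: \<tau>_def)
    then have "\<tau> * (R + 1) \<le> pi" using R(1) by (simp add: field_simps)
    then have "R + 1 \<le> pi / \<tau>" using \<tau> by (simp add: field_simps)
    then show ?thesis by simp
  qed
  interpret boxed_open \<Omega> \<tau>
  proof
    show "\<Omega> \<subseteq> tbox \<tau>"
    proof
      fix x assume "x \<in> \<Omega>"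
      then have "\<bar>x $ i\<bar> < pi / \<tau>" for i using R(2) R\<tau> component_le_norm_cart[of x i] by fastforce
      then show "x \<in> tbox \<tau>" unfolding mem_tbox by (auto simp: abs_less_iff) (metis minus_less_iff)
    qed
  qed (use assms \<tau> in auto)
  have t: "\<tau> / (2 * pi) \<le> 1 / (2 * V + 1)"
  proof -
    have "\<tau> \<le> 2 * pi / (2 * V + 1)" by (simp add: \<tau>_def)
    then show ?thesis using V by (simp add: field_simps)
  qed
  have "\<kappa> \<le> \<tau> / (2 * pi)"
  proof -
    have "\<tau> / (2 * pi) \<le> 1" 
    proof (rule order_trans[OF t])
      show "1 / (2 * V + 1) \<le> 1" using V by (simp add: divide_le_eq_1)
    qed
    then have "(\<tau> / (2 * pi)) ^ CARD('n) \<le> (\<tau> / (2 * pi)) ^ 1"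
      using \<tau> by (intro power_decreasing) (auto simp: Suc_leI)
    then show ?thesis by (simp add: \<kappa>_def)
  qed
  then have "\<kappa> \<le> 1 / (2 * V + 1)" using t by linarith
  then have "\<kappa> * V \<le> 1 / (2 * V + 1) * V" using V by (rule mult_right_mono)
  also have "\<dots> \<le> 1 / 2" using V by (simp add: field_simps)
  finally have "small_boxed_open \<Omega> \<tau>" by unfold_locales (simp add: V_def)
  then show ?thesis by blast
qed

theorem theorem3p3:
  fixes \<Omega> :: "(real^'n) set"
    and a :: "real^'n \<Rightarrow> real^'n^'n"
    and lmin lmax :: real
    and lam :: "nat \<Rightarrow> real"
    and \<Psi> \<theta> :: "nat \<Rightarrow> real^'n \<Rightarrow> real"
    and vol d C :: real
    and Nh :: "real \<Rightarrow> nat"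
  defines "vol \<equiv> measure lebesgue \<Omega>"
    and "d \<equiv> real CARD('n)"
    and "C \<equiv> 1 / (2 * sqrt pi) * (1 / Gamma (1 + d / 2)) powr (1 / d)"
    and "Nh \<equiv> (\<lambda>h. nat \<lfloor>vol / h ^ CARD('n)\<rfloor>)"
  assumes "CARD('n) \<ge> 2"
    and "bounded_C2_domain \<Omega>"
    and "elliptic_matrix \<Omega> a lmin lmax"
    and "dirichlet_eigensystem \<Omega> lam \<Psi>"
    and "\<And>k. k \<ge> 1 \<Longrightarrow> is_weak_sol \<Omega> a (\<lambda>x. lam k * \<Psi> k x) (\<theta> k)"
  shows
    "((\<lambda>h. SUP f\<in>{f \<in> L2 \<Omega>. \<not> ae_zero \<Omega> f}. INF v\<in>L2_span \<Omega> \<theta> (Nh h).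
        ereal (flux_norm \<Omega> a (\<lambda>x. weak_sol \<Omega> a f x - v x) / (h * L2norm \<Omega> f)))
      \<longlongrightarrow> ereal C) (at_right 0)
    \<and>
    (\<forall>V :: real \<Rightarrow> (real^'n \<Rightarrow> real) set. (\<forall>h>0. V h \<in> H10_subspaces \<Omega> (Nh h)) \<longrightarrow>
      Liminf (at_right 0) (\<lambda>h. SUP f\<in>{f \<in> L2 \<Omega>. \<not> ae_zero \<Omega> f}. INF v\<in>V h.
        ereal (flux_norm \<Omega> a (\<lambda>x. weak_sol \<Omega> a f x - v x) / (h * L2norm \<Omega> f)))
      \<ge> ereal C)
    \<and>
    (\<exists>\<epsilon> :: nat \<Rightarrow> real. \<epsilon> \<longlonglongrightarrow> 0 \<and>
      (\<forall>N\<ge>1. (INF V\<in>H10_subspaces \<Omega> N. SUP f\<in>{f \<in> L2 \<Omega>. \<not> ae_zero \<Omega> f}. INF v\<in>V.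
          ereal (flux_norm \<Omega> a (\<lambda>x. weak_sol \<Omega> a f x - v x) / L2norm \<Omega> f))
        = ereal (1 / (2 * sqrt pi) * (vol / (Gamma (1 + d / 2) * real N)) powr (1 / d) * (1 + \<epsilon> N))))"
proof -
  have \<Omega>: "open \<Omega>" "bounded \<Omega>" "\<Omega> \<noteq> {}" using assms(6) by (auto simp: bounded_C2_domain_def)
  obtain \<tau> where "small_boxed_open \<Omega> \<tau>" using small_torus_exists[OF \<Omega>(1,2)] by blast
  then interpret small_boxed_open \<Omega> \<tau> .
  interpret elliptic \<Omega> \<tau> lam \<Psi> a lmin lmax \<theta> by unfold_locales (use assms in auto)
  have d: "d = d\<^sub>n" "0 < d" by (simp_all add: d_def d\<^sub>n_def)
  have V: "0 < vol" unfolding vol_def by (rule measure_\<Omega>_pos[OF \<Omega>(3)])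
  have G: "0 < Gamma (1 + d / 2)" using d by (intro Gamma_real_pos) simp
  let ?w = "\<lambda>h. 1 / (h * sqrt (lam (Suc (Nh h))))"
  let ?F = "{f \<in> L2 \<Omega>. \<not> ae_zero \<Omega> f}"
  let ?q = "\<lambda>f v. flux_norm \<Omega> a (\<lambda>x. weak_sol \<Omega> a f x - v x)"
  have w: "((\<lambda>h. ereal (?w h)) \<longlongrightarrow> ereal C) (at_right 0)"
    using width_ratio_tendsto[OF \<Omega>(3)] unfolding C_def Nh_def vol_def d(1) by (intro tendsto_ereal)
  have ev: "\<forall>\<^sub>F h in at_right 0. 0 < (h::real)" by (simp add: eventually_at_right_less)
  have 1: "((\<lambda>h. SUP f\<in>?F. INF v\<in>L2_span \<Omega> \<theta> (Nh h). ereal (?q f v / (h * L2norm \<Omega> f))) \<longlongrightarrow> ereal C) (at_right 0)"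
    by (rule Lim_transform_eventually[OF w]) (use ev in eventually_elim, simp add: SUP_INF_\<theta>)
  have 2: "Liminf (at_right 0) (\<lambda>h. SUP f\<in>?F. INF v\<in>V h. ereal (?q f v / (h * L2norm \<Omega> f))) \<ge> ereal C"
    if "\<forall>h>0. V h \<in> H10_subspaces \<Omega> (Nh h)" for V
  proof -
    have "ereal C = Liminf (at_right 0) (\<lambda>h. ereal (?w h))"
      using lim_imp_Liminf[OF _ w] by (simp add: trivial_limit_at_right_real)
    also have "\<dots> \<le> Liminf (at_right 0) (\<lambda>h. SUP f\<in>?F. INF v\<in>V h. ereal (?q f v / (h * L2norm \<Omega> f)))"
      by (rule Liminf_mono) (use ev in eventually_elim, rule SUP_INF_lower, use that in auto)
    finally show ?thesis .
  qed
  define b where "b N = 1 / (2 * sqrt pi) * (vol / (Gamma (1 + d / 2) * real N)) powr (1 / d)" for N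
  \<comment> \<open>Defined as the relative error, so that the formula is exact for N at least 1,
    where \<open>b N\<close> is positive; what has to be shown is that the ratio tends to 1.\<close>
  define \<epsilon> where "\<epsilon> N = 1 / sqrt (lam (Suc N)) / b N - 1" for N
  define c where "c = W powr (1 / d)"
  have c: "c = 1 / (2 * sqrt pi) * (vol / Gamma (1 + d / 2)) powr (1 / d)" "0 < c"
    unfolding c_def d(1) W_root vol_def using V G by (simp_all add: vol_def d(1))
  have b: "b N = c / real N powr (1 / d)" for N
    unfolding b_def c(1) using V G by (simp add: powr_divide powr_mult)
  have "(\<lambda>N. real N powr (1 / d) / sqrt (lam (Suc N)) / c) \<longlonglongrightarrow> c / c"
    using c(2) sqrt_lam_asymptotics[OF \<Omega>(3)] by (intro tendsto_divide tendsto_const) (auto simp: c_def d(1))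
  then have "(\<lambda>N. real N powr (1 / d) / sqrt (lam (Suc N)) / c - 1) \<longlonglongrightarrow> 1 - 1"
    using c(2) by (intro tendsto_diff tendsto_const) simp
  then have \<epsilon>: "\<epsilon> \<longlonglongrightarrow> 0" by (simp add: \<epsilon>_def[abs_def] b mult.commute)
  have 3: "(INF V\<in>H10_subspaces \<Omega> N. SUP f\<in>?F. INF v\<in>V. ereal (?q f v / L2norm \<Omega> f)) = ereal (b N * (1 + \<epsilon> N))"
    if "N \<ge> 1" for N
  proof -
    have "b N * (1 + \<epsilon> N) = 1 / sqrt (lam (Suc N))" using that c(2) by (simp add: \<epsilon>_def b)
    moreover have "(INF V\<in>H10_subspaces \<Omega> N. SUP f\<in>?F. INF v\<in>V. ereal (?q f v / L2norm \<Omega> f)) = ereal (1 / sqrt (lam (Suc N)))"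
    proof (rule antisym)
      show "(INF V\<in>H10_subspaces \<Omega> N. SUP f\<in>?F. INF v\<in>V. ereal (?q f v / L2norm \<Omega> f)) \<le> ereal (1 / sqrt (lam (Suc N)))"
        using INF_lower[OF span_\<theta>_subspace, of "\<lambda>V. SUP f\<in>?F. INF v\<in>V. ereal (?q f v / L2norm \<Omega> f)" N] SUP_INF_\<theta>[of 1 N] by simp
      show "ereal (1 / sqrt (lam (Suc N))) \<le> (INF V\<in>H10_subspaces \<Omega> N. SUP f\<in>?F. INF v\<in>V. ereal (?q f v / L2norm \<Omega> f))"
        by (rule INF_greatest) (use SUP_INF_lower[of _ N 1] in simp)
    qed
    ultimately show ?thesis by simp
  qed
  show ?thesis
    using 1 2 \<epsilon> 3 unfolding b_def by blast
qed

end
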